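(* Let $u$ be a K41-function on $[T_0,T_1]\times\mathbb{T}^3$, with parameters $(K_\pm,\Re,\gamma)$, and a Leray solution of (NS) on $\mathbb{T}^3$ with $\int_{\mathbb{T}^3}\rho u_0(x)\,dx=0$. Then the following holds for numerical factors $C_j(\Re,\gamma)\to1$ in the asymptotic regime $\Re\to\infty$, $\Re^\gamma\to1$: $$\frac{3375}{2048}\,C_1(\Re,\gamma)\,\Re\,\mathcal{T}(u_0;\omega)\le T_1-T_0\le\frac{128\,C_2(\Re,\gamma)}{3375\,\pi^4}\,\frac{1}{\Re\,\mathcal{T}(u_0;\omega)}\times\frac{\operatorname{Vol}(\mathbb{T}^3)^{4/3}}{\nu^2}.$$ Moreover, if $C(n_-)=\dfrac{\operatorname{Card}\{z\in\mathbb{Z}^3:|z|^2=n_-\}}{8\pi^3\sqrt{n_-}}<1$ where $n_-=\left(\dfrac{LK_-}{2\pi}\right)^2$, then $$\frac{3375}{2048}\,C_3(\Re,\gamma)\le\left(\frac{\bar E}{E_0}\right)^2\frac{T_1-T_0}{\Re\,\mathcal{T}(u_0;\omega)}\le\frac{864\,C_4(\Re,\gamma)}{(1-C(n_-))^2}.$$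
   Context: **Equation.** $\mathbb{T}^3=\mathbb{R}^3/(L\mathbb{Z})^3$, $\operatorname{Vol}(\mathbb{T}^3)=L^3$. (NS) is $\partial_tu-\nu\Delta u+(u\cdot\nabla)u=-\nabla\Pi$, $\operatorname{div}u=0$, $\nu>0$, with data $u_0=u(T_0)$. The Leray space is $\mathcal{L}=L^\infty(\mathbb{R}_+;L^2)\cap L^2(\mathbb{R}_+;\dot H^1)$. A Leray solution is a weak solution $u\in\mathcal{L}$ with $E(t)\le E(t')-\int_{t'}^t\varepsilon(\tau)d\tau$ for a.e. $t>t'$. **Energy.** $\rho=L^{-3}$; $E(t)=\rho\|u(t)\|_{L^2}^2$, $E_0=E(T_0)$, $\varepsilon(t)=2\rho\nu\|\nabla u(t)\|_{L^2}^2$. Time averages: $\bar f=\langle f\rangle=\frac1{T_1-T_0}\int_{T_0}^{T_1}f\,dt$. $\omega=(\partial_iu_j-\partial_ju_i)_{1\le i,j\le3}$ is the vorticity, with $\|\omega\|_{L^2}^2=2\|\nabla u\|_{L^2}^2$. **Spectrum.** $\hat u(t,\mathbf{k})=\int_{\mathbb{T}^3}e^{-i\mathbf{k}\cdot x}u(t,x)dx$; $\Sigma=\{|\mathbf{k}|:\mathbf{k}\in(2\pi L^{-1}\mathbb{Z})^3\}=\{K_j\}$ (increasing), $\Sigma^\ast=\Sigma\setminus\{0\}$, $\mu=\frac{2\pi}{L}\sum_{K\in\Sigma^\ast}\frac{2\pi}{KL}\delta_K$, $E^\dagger(K,t)=(2\pi)^{-2}\rho\frac KL\sum_{|\mathbf{k}|=K}|\hat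 u(t,\mathbf{k})|^2$ for $K\in\Sigma^\ast$. $\operatorname{Vol}(u;[T_0,T_1])=\langle\|u\|_{L^1}^2\rangle/\langle\|u\|_{L^2}^2\rangle$. **K41-functions.** $u\in\mathcal{L}$ is a K41-function on $[T_0,T_1]$ if there is a constant $c\in]1,2[$ with $\int K^2\bar E^\dagger d\mu\le c\int_{\{K\ge\operatorname{Vol}(u;[T_0,T_1])^{-1/3}\}}K^2\bar E^\dagger d\mu$. An inertial range of $u$ is any interval $[K_-,K_+]$ with $K_\pm\in\Sigma^\ast$, $K_-<K_+$, for which: (i) $K_-=2\pi L^{-1}$ if $\operatorname{Vol}(u;[T_0,T_1])/\operatorname{Vol}(\mathbb{T}^3)\ge(2\pi)^{-3}$ and $2\pi L^{-1}\le K_-\le\operatorname{Vol}(u;[T_0,T_1])^{-1/3}$ otherwise; (ii) $\int K^2\bar E^\dagger d\mu\le(1+c)\int_{[K_-,K_+]}K^2\bar E^\dagger d\mu$. The attached parameters are $K_\pm$, $\Re=(K_+/K_-)^{4/3}$ and $\gamma=\max_{K_-\le K_j<K_{j+1}\le K_+}\left|\frac{\log(\bar E^\dagger(K_{j+1})/\bar E^\dagger(K_j))}{\log(K_{j+1}/K_j)}+\frac53\right|$. **Constants.** $\alpha=\bar E^\dagger(K_+)/(\bar\varepsilon^{2/3}K_+^{-5/3})$; $\displaystyle\mathcal{T}(u_0;\omega)=\frac{\alpha^3\nu^2}{\rho}\times\frac{\int_{T_0}^{T_1}\|\omega(t)\|_{L^2}^2dt}{\|u_0\|_{L^2}^4}$.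 *)

theory Defs
  imports "HOL-Analysis.Analysis"
begin

(* The torus R^3/(LZ)^3: fields on it are L-periodic maps on R^3, integrated over the cell [0,L]^3. *)

definition cell :: "real \<Rightarrow> (real^3) set" where
  "cell L = cbox 0 (\<chi> i. L)"

definition torus :: "real \<Rightarrow> (real^3) measure" where
  "torus L = restrict_space lborel (cell L)"

definition space_periodic :: "real \<Rightarrow> (real^3 \<Rightarrow> 'b) \<Rightarrow> bool" where
  "space_periodic L f \<longleftrightarrow> (\<forall>x i. f (x + axis i L) = f x)"

definition vol_torus :: "real \<Rightarrow> real" where
  "vol_torus L = L ^ 3"

definition dirderiv :: "'a \<Rightarrow> ('a::real_normed_vector \<Rightarrow> 'b::real_normed_vector) \<Rightarrow> 'a \<Rightarrow> 'b" where
  "dirderiv v f p = frechet_derivative f (at p) v"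

primrec times_differentiable ::
  "nat \<Rightarrow> ('a::real_normed_vector \<Rightarrow> 'b::real_normed_vector) \<Rightarrow> bool" where
  "times_differentiable 0 f \<longleftrightarrow> continuous_on UNIV f"
| "times_differentiable (Suc n) f \<longleftrightarrow>
     f differentiable_on UNIV \<and> (\<forall>v. times_differentiable n (dirderiv v f))"

definition smooth :: "('a::real_normed_vector \<Rightarrow> 'b::real_normed_vector) \<Rightarrow> bool" where
  "smooth f \<longleftrightarrow> (\<forall>n. times_differentiable n f)"

definition square_integrable :: "real \<Rightarrow> (real^3 \<Rightarrow> 'b::euclidean_space) \<Rightarrow> bool" where
  "square_integrable L f \<longleftrightarrow>
     f \<in> borel_measurable (torus L) \<and> integrable (torus L) (\<lambda>x. (norm (f x))\<^sup>2)"

definition L1_norm :: "real \<Rightarrow> (real^3 \<Rightarrow> 'b::euclidean_space) \<Rightarrow> real" where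
  "L1_norm L f = (LINT x|torus L. norm (f x))"

definition L2_norm :: "real \<Rightarrow> (real^3 \<Rightarrow> 'b::euclidean_space) \<Rightarrow> real" where
  "L2_norm L f = sqrt (LINT x|torus L. (norm (f x))\<^sup>2)"

(* Entry (i,j) of the gradient is the weak derivative of the j-th component in direction i.
   The norm of real^3^3 is the Frobenius norm. *)

definition is_weak_grad :: "real \<Rightarrow> (real^3 \<Rightarrow> real^3) \<Rightarrow> (real^3 \<Rightarrow> real^3^3) \<Rightarrow> bool" where
  "is_weak_grad L f G \<longleftrightarrow>
     square_integrable L G \<and>
     (\<forall>\<phi> :: real^3 \<Rightarrow> real. smooth \<phi> \<and> space_periodic L \<phi> \<longrightarrow>
       (\<forall>i j. (LINT x|torus L. f x $ j * dirderiv (axis i 1) \<phi> x)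
               = - (LINT x|torus L. G x $ i $ j * \<phi> x)))"

(* Determined almost everywhere whenever a square integrable weak gradient exists. *)
definition weak_grad :: "real \<Rightarrow> (real^3 \<Rightarrow> real^3) \<Rightarrow> real^3 \<Rightarrow> real^3^3" where
  "weak_grad L f = (SOME G. is_weak_grad L f G)"

definition vorticity :: "real \<Rightarrow> (real^3 \<Rightarrow> real^3) \<Rightarrow> real^3 \<Rightarrow> real^3^3" where
  "vorticity L f x = (\<chi> i j. weak_grad L f x $ i $ j - weak_grad L f x $ j $ i)"

definition weakly_div_free :: "real \<Rightarrow> (real^3 \<Rightarrow> real^3) \<Rightarrow> bool" where
  "weakly_div_free L f \<longleftrightarrow>
     (\<forall>\<psi> :: real^3 \<Rightarrow> real. smooth \<psi> \<and> space_periodic L \<psi> \<longrightarrow>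
       (LINT x|torus L. (\<Sum>i\<in>UNIV. f x $ i * dirderiv (axis i 1) \<psi> x)) = 0)"

definition leray_space :: "real \<Rightarrow> (real \<Rightarrow> real^3 \<Rightarrow> real^3) \<Rightarrow> bool" where
  "leray_space L u \<longleftrightarrow>
     (\<lambda>(t, x). u t x) \<in> borel_measurable (restrict_space borel ({0..} \<times> UNIV)) \<and>
     (\<forall>t\<ge>0. space_periodic L (u t)) \<and>
     (\<exists>M. AE t in lborel. t \<ge> 0 \<longrightarrow> square_integrable L (u t) \<and> L2_norm L (u t) \<le> M) \<and>
     (\<exists>G. (\<lambda>(t, x). G t x) \<in> borel_measurable (restrict_space borel ({0..} \<times> cell L)) \<and>
          (AE t in lborel. t \<ge> 0 \<longrightarrow> is_weak_grad L (u t) (G t)) \<and>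
          set_integrable lborel ({0..} \<times> cell L) (\<lambda>(t, x). (norm (G t x))\<^sup>2))"

definition rho :: "real \<Rightarrow> real" where
  "rho L = 1 / L ^ 3"

definition energy :: "real \<Rightarrow> (real \<Rightarrow> real^3 \<Rightarrow> real^3) \<Rightarrow> real \<Rightarrow> real" where
  "energy L u t = rho L * (L2_norm L (u t))\<^sup>2"

definition dissipation :: "real \<Rightarrow> real \<Rightarrow> (real \<Rightarrow> real^3 \<Rightarrow> real^3) \<Rightarrow> real \<Rightarrow> real" where
  "dissipation L \<nu> u t = 2 * rho L * \<nu> * (L2_norm L (weak_grad L (u t)))\<^sup>2"

(* The test fields are divergence free, which eliminates the pressure.  By linearity of the
   derivative, the term u . dirderiv (0,u) phi is the sum of u_i u_j (d_i phi_j). *)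

definition ns_test_field :: "real \<Rightarrow> (real \<times> (real^3) \<Rightarrow> real^3) \<Rightarrow> bool" where
  "ns_test_field L \<phi> \<longleftrightarrow>
     smooth \<phi> \<and> (\<forall>t. space_periodic L (\<lambda>x. \<phi> (t, x))) \<and>
     (\<exists>b. \<forall>t x. \<bar>t\<bar> \<ge> b \<longrightarrow> \<phi> (t, x) = 0) \<and>
     (\<forall>p. (\<Sum>i\<in>UNIV. dirderiv (0, axis i 1) \<phi> p $ i) = 0)"

definition ns_weak_form ::
  "real \<Rightarrow> real \<Rightarrow> real \<Rightarrow> (real \<Rightarrow> real^3 \<Rightarrow> real^3) \<Rightarrow> bool" where
  "ns_weak_form L \<nu> T0 u \<longleftrightarrow>
     (\<forall>\<phi>. ns_test_field L \<phi> \<longrightarrow>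
       (LINT p:({T0..} \<times> cell L)|lborel. (case p of (t, x) \<Rightarrow>
            u t x \<bullet> dirderiv (1, 0) \<phi> (t, x)
          + \<nu> * (u t x \<bullet> (\<Sum>i\<in>UNIV. dirderiv (0, axis i 1) (dirderiv (0, axis i 1) \<phi>) (t, x)))
          + u t x \<bullet> dirderiv (0, u t x) \<phi> (t, x)))
       + (LINT x|torus L. u T0 x \<bullet> \<phi> (T0, x)) = 0)"

(* Leray solution with data u T0 at time T0; the energy inequality starts from T0 itself and from
   almost every later time. *)
definition leray_solution ::
  "real \<Rightarrow> real \<Rightarrow> real \<Rightarrow> (real \<Rightarrow> real^3 \<Rightarrow> real^3) \<Rightarrow> bool" where
  "leray_solution L \<nu> T0 u \<longleftrightarrow>
     leray_space L u \<and>
     square_integrable L (u T0) \<and> weakly_div_free L (u T0) \<and>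
     (AE t in lborel. t > T0 \<longrightarrow> weakly_div_free L (u t)) \<and>
     ns_weak_form L \<nu> T0 u \<and>
     (let ineq_from = (\<lambda>t'. AE t in lborel. t > t' \<longrightarrow>
            energy L u t \<le> energy L u t' - (LINT \<tau>:{t'..t}|lborel. dissipation L \<nu> u \<tau>))
      in ineq_from T0 \<and> (AE t' in lborel. t' > T0 \<longrightarrow> ineq_from t'))"

definition time_avg :: "real \<Rightarrow> real \<Rightarrow> (real \<Rightarrow> real) \<Rightarrow> real" where
  "time_avg T0 T1 f = (LINT t:{T0..T1}|lborel. f t) / (T1 - T0)"

definition fourier :: "real \<Rightarrow> (real^3 \<Rightarrow> real^3) \<Rightarrow> real^3 \<Rightarrow> complex^3" where
  "fourier L f k =
     (\<chi> j. LINT x|torus L. exp (- \<i> * complex_of_real (k \<bullet> x)) * complex_of_real (f x $ j))"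

definition wave_vectors :: "real \<Rightarrow> (real^3) set" where
  "wave_vectors L = {k. \<forall>i. k $ i / (2 * pi / L) \<in> \<int>}"

definition Sigma_set :: "real \<Rightarrow> real set" where
  "Sigma_set L = norm ` wave_vectors L"

definition Sigma_star :: "real \<Rightarrow> real set" where
  "Sigma_star L = Sigma_set L - {0}"

definition spectral_measure :: "real \<Rightarrow> real measure" where
  "spectral_measure L =
     point_measure (Sigma_star L) (\<lambda>K. ennreal ((2 * pi / L) * (2 * pi / (K * L))))"

definition spectrum :: "real \<Rightarrow> (real \<Rightarrow> real^3 \<Rightarrow> real^3) \<Rightarrow> real \<Rightarrow> real \<Rightarrow> real" where
  "spectrum L u K t = (1 / (2 * pi)\<^sup>2) * rho L * (K / L) *
     (\<Sum>k | k \<in> wave_vectors L \<and> norm k = K. (norm (fourier L (u t) k))\<^sup>2)"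

definition mean_spectrum ::
  "real \<Rightarrow> real \<Rightarrow> real \<Rightarrow> (real \<Rightarrow> real^3 \<Rightarrow> real^3) \<Rightarrow> real \<Rightarrow> real" where
  "mean_spectrum L T0 T1 u K = time_avg T0 T1 (spectrum L u K)"

definition Vol :: "real \<Rightarrow> real \<Rightarrow> real \<Rightarrow> (real \<Rightarrow> real^3 \<Rightarrow> real^3) \<Rightarrow> real" where
  "Vol L T0 T1 u = time_avg T0 T1 (\<lambda>t. (L1_norm L (u t))\<^sup>2) / time_avg T0 T1 (\<lambda>t. (L2_norm L (u t))\<^sup>2)"

definition enstrophy_on ::
  "real \<Rightarrow> real \<Rightarrow> real \<Rightarrow> (real \<Rightarrow> real^3 \<Rightarrow> real^3) \<Rightarrow> real set \<Rightarrow> real" where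
  "enstrophy_on L T0 T1 u A = (LINT K:A|spectral_measure L. K\<^sup>2 * mean_spectrum L T0 T1 u K)"

(* K41-function with constant c; the same c enters the definition of an inertial range. *)
definition K41_function ::
  "real \<Rightarrow> real \<Rightarrow> real \<Rightarrow> real \<Rightarrow> (real \<Rightarrow> real^3 \<Rightarrow> real^3) \<Rightarrow> bool" where
  "K41_function L T0 T1 c u \<longleftrightarrow>
     leray_space L u \<and> 1 < c \<and> c < 2 \<and>
     enstrophy_on L T0 T1 u UNIV \<le> c * enstrophy_on L T0 T1 u {Vol L T0 T1 u powr (-1/3)..}"

definition inertial_range ::
  "real \<Rightarrow> real \<Rightarrow> real \<Rightarrow> real \<Rightarrow> (real \<Rightarrow> real^3 \<Rightarrow> real^3) \<Rightarrow> real \<Rightarrow> real \<Rightarrow> bool" where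
  "inertial_range L T0 T1 c u Km Kp \<longleftrightarrow>
     Km \<in> Sigma_star L \<and> Kp \<in> Sigma_star L \<and> Km < Kp \<and>
     (if Vol L T0 T1 u / vol_torus L \<ge> 1 / (2 * pi) ^ 3 then Km = 2 * pi / L
      else 2 * pi / L \<le> Km \<and> Km \<le> Vol L T0 T1 u powr (-1/3)) \<and>
     enstrophy_on L T0 T1 u UNIV \<le> (1 + c) * enstrophy_on L T0 T1 u {Km..Kp}"

definition reynolds :: "real \<Rightarrow> real \<Rightarrow> real" where
  "reynolds Km Kp = (Kp / Km) powr (4/3)"

definition consecutive :: "real \<Rightarrow> real \<Rightarrow> real \<Rightarrow> bool" where
  "consecutive L K K' \<longleftrightarrow>
     K \<in> Sigma_set L \<and> K' \<in> Sigma_set L \<and> K < K' \<and> Sigma_set L \<inter> {K<..<K'} = {}"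

(* Meaningful when the mean spectrum is positive on the frequencies of [Km,Kp]. *)
definition slope_defect ::
  "real \<Rightarrow> real \<Rightarrow> real \<Rightarrow> (real \<Rightarrow> real^3 \<Rightarrow> real^3) \<Rightarrow> real \<Rightarrow> real \<Rightarrow> real" where
  "slope_defect L T0 T1 u Km Kp =
     Max {\<bar>ln (mean_spectrum L T0 T1 u K' / mean_spectrum L T0 T1 u K) / ln (K' / K) + 5/3\<bar> | K K'.
            consecutive L K K' \<and> Km \<le> K \<and> K' \<le> Kp}"

definition K41_alpha ::
  "real \<Rightarrow> real \<Rightarrow> real \<Rightarrow> real \<Rightarrow> (real \<Rightarrow> real^3 \<Rightarrow> real^3) \<Rightarrow> real \<Rightarrow> real" where
  "K41_alpha L \<nu> T0 T1 u Kp = mean_spectrum L T0 T1 u Kp /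
     (time_avg T0 T1 (dissipation L \<nu> u) powr (2/3) * Kp powr (-5/3))"

definition time_scale ::
  "real \<Rightarrow> real \<Rightarrow> real \<Rightarrow> real \<Rightarrow> (real \<Rightarrow> real^3 \<Rightarrow> real^3) \<Rightarrow> real \<Rightarrow> real" where
  "time_scale L \<nu> T0 T1 u Kp =
     (K41_alpha L \<nu> T0 T1 u Kp) ^ 3 * \<nu>\<^sup>2 / rho L *
     ((LINT t:{T0..T1}|lborel. (L2_norm L (vorticity L (u t)))\<^sup>2) / (L2_norm L (u T0)) ^ 4)"

definition shell_ratio :: "real \<Rightarrow> real" where
  "shell_ratio n =
     real (card {z :: int^3. of_int (\<Sum>i\<in>UNIV. (z $ i)\<^sup>2) = n}) / (8 * pi ^ 3 * sqrt n)"

definition asymptotic_regime :: "(real \<times> real) filter" where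
  "asymptotic_regime =
     inf (filtercomap fst at_top) (filtercomap (\<lambda>(R, g). R powr g) (nhds 1))"

end

theory Submission
 imports Defs "HOL-Number_Theory.Number_Theory" "HOL-Computational_Algebra.Squarefree"
  "HOL-Computational_Algebra.Polynomial"
begin

text \<open>On the inertial range the slope defect pins the mean spectrum to \<open>K\<close> to the power \<open>-5/3\<close>, up to factors tending
to 1. By Parseval, mean energy and mean dissipation thus become sums of the powers \<open>-4/3\<close> and \<open>-1/3\<close> over the
integers that are sums of three squares, which Legendre's theorem describes. The mean flow stays zero, so no mode
is missed by \<open>Sigma_star\<close>; the modes below \<open>Km\<close> are controlled by the \<open>L1\<close> norm, that is, by the volume in the K41
condition. The energy inequality bounds the mean energy by the initial energy, and the mean dissipation by its
quotient by the duration.\<close>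

text \<open>Means over time are Bochner integrals, with value 0 on non-integrable integrands, so
  measurability in time has to be proved. \<open>weak_grad\<close> is a choice made separately at
  each time; its norm is read off the Fourier coefficients, and the times at which a weak gradient
  exists must form a Borel set. At exceptional times \<open>u t\<close> may fail to be integrable,
  and then the weak identity speaks about integrals with default value 0. Hence the part on box
  averages, which turns existence of a weak derivative into countably many measurable conditions.
  The residues 1 and 2 modulo 4 supply half of all integers, and this density is enough: the lower
  constant 3375/2048 is 2 (15/16)^3, while the sums over these residues give 2 (7/10) (11/10)^2 up
  to factors near 1. The lower bounds may be trivial outside of the asymptotic regime, whereas the
  upper bound on the duration is needed at every Reynolds number, which calls for a second, cruder
  lower bound on the dissipation sum. Nonvanishing of real L-series at 1 provides the auxiliary
  prime in the three-squares theorem.\<close>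

abbreviation (input) seq_limit (infixr "~>" 60) where "X ~> l \<equiv> X \<longlonglongrightarrow> l"

abbreviation (input) cx where "cx f \<equiv> (\<lambda>x. complex_of_real (f x))"

abbreviation (input) tint where "tint L \<equiv> integrable (torus L)"

abbreviation (input) shells where "shells L n \<equiv> {K \<in> Sigma_star L. K \<le> real n}"

section \<open>Summation by parts and Dirichlet convolution\<close>

lemma abel_sum_bound:
 fixes c a :: "nat => real"
 assumes C: "!!n. \<bar>\<Sum>k<n. c k\<bar> <= M"
  and dec: "!!n. N <= n ==> a (Suc n) <= a n" and nn: "!!n. 0 <= a n"
 shows "\<bar>SUM k:{N..<N'}. c k * a k\<bar> <= 2 * M * a N"
proof -
 define C' where "C' n = (\<Sum>k<n. c k)" for n
 \<comment> \<open>Summation by parts moves the differences onto \<open>a\<close>, where they have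
   one sign and telescope; the telescoped sum and the two boundary terms add up to the factor
   2.\<close>
 have eq: "(SUM k:{N..<N+j}. c k * a k)
  = C' (N+j) * a (N+j) - C' N * a N + (SUM k:{N..<N+j}. C' (Suc k) * (a k - a (Suc k)))" for j
 proof (induction j)
  case (Suc j)
  have "C' (Suc (N+j)) = C' (N+j) + c (N+j)" by (simp add: C'_def)
  with Suc show ?case by (simp add: algebra_simps)
 qed simp
 have M0: "0 <= M" using C[of 0] by simp
 have bd: "\<bar>SUM k:{N..<N+j}. c k * a k\<bar> <= 2 * M * a N" for j
 proof -
  have t: "(SUM k:{N..<N+j}. a k - a (Suc k)) = a N - a (N+j)"
  by (induction j) auto
  have "\<bar>SUM k:{N..<N+j}. C' (Suc k) * (a k - a (Suc k))\<bar>
  <= (SUM k:{N..<N+j}. M * (a k - a (Suc k)))"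
  proof (intro order.trans[OF sum_abs] sum_mono)
  fix k assume "k : {N..<N+j}"
  thus "\<bar>C' (Suc k) * (a k - a (Suc k))\<bar> <= M * (a k - a (Suc k))"
  using C[of "Suc k"] dec[of k] M0 unfolding C'_def abs_mult by (intro mult_mono) auto
  qed
  also have "... = M * (a N - a (N+j))" by (simp add: sum_distrib_left[symmetric] t)
  finally have 1: "\<bar>SUM k:{N..<N+j}. C' (Suc k) * (a k - a (Suc k))\<bar> <= M * (a N - a (N+j))" .
  have 2: "\<bar>C' (N+j) * a (N+j)\<bar> <= M * a (N+j)" "\<bar>C' N * a N\<bar> <= M * a N"
  using C nn unfolding C'_def by (auto simp: abs_mult intro!: mult_right_mono)
  show ?thesis unfolding eq using 1 2 by (simp add: algebra_simps)
 qed
 show ?thesis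
 proof (cases "N <= N'")
  case True thus ?thesis using bd[of "N' - N"] by simp
 next
  case False thus ?thesis using M0 nn[of N] by simp
 qed
qed

text \<open>Dirichlet's test with an explicit tail. Monotonicity is asked only from
  \<open>N0\<close> on, because one of the later applications is to
  \<open>ln n * n powr (-s)\<close>, which is decreasing only for large n.\<close>

lemma abel_summable:
 fixes c a :: "nat => real"
 assumes C: "!!n. \<bar>\<Sum>k<n. c k\<bar> <= M"
  and dec: "!!n. N0 <= n ==> a (Suc n) <= a n" and nn: "!!n. 0 <= a n" and lim: "a ~> 0"
 shows "summable (%k. c k * a k)"
  and "N0 <= N ==> \<bar>(\<Sum>k. c k * a k) - (\<Sum>k<N. c k * a k)\<bar> <= 2 * M * a N"
proof -
 have M0: "0 <= M" using C[of 0] by simp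
 have b: "\<bar>SUM k:{N..<N'}. c k * a k\<bar> <= 2 * M * a N" if "N0 <= N" for N N'
  by (rule abel_sum_bound[OF C]) (use dec nn that in auto)
 show s: "summable (%k. c k * a k)"
  unfolding summable_Cauchy
 proof (intro allI impI)
  fix e :: real assume "0 < e"
  have "(%n. 2 * M * a n) ~> 2 * M * 0" by (intro tendsto_intros lim)
  hence "eventually (%n. 2 * M * a n < e) sequentially"
  using \<open>0 < e\<close> by (simp add: order_tendstoD)
  then obtain K where K: "!!n. K <= n ==> 2 * M * a n < e" by (auto simp: eventually_sequentially)
  show "EX N. ALL m>=N. ALL n. norm (\<Sum>k=m..<n. c k * a k) < e"
  proof (intro exI allI impI)
  fix m n assume "max K N0 <= m"
  thus "norm (\<Sum>k=m..<n. c k * a k) < e" using b[of m n] K[of m] by auto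
  qed
 qed
 assume "N0 <= N"
 have "(%n. \<bar>(\<Sum>k<n. c k * a k) - (\<Sum>k<N. c k * a k)\<bar>)
  ~> \<bar>(\<Sum>k. c k * a k) - (\<Sum>k<N. c k * a k)\<bar>"
  by (intro tendsto_intros summable_LIMSEQ s)
 moreover have "eventually (%n. \<bar>(\<Sum>k<n. c k * a k) - (\<Sum>k<N. c k * a k)\<bar> <= 2 * M * a N) sequentially"
  using eventually_ge_at_top[of N]
 proof eventually_elim
  case (elim n)
  have "(\<Sum>k<n. c k * a k) - (\<Sum>k<N. c k * a k) = (SUM k:{N..<n}. c k * a k)"
  using elim sum.atLeastLessThan_concat[of 0 N n "%k. c k * a k"] by (simp add: lessThan_atLeast0)
  thus ?case using b[OF \<open>N0 <= N\<close>, of n] by simp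
 qed
 ultimately show "\<bar>(\<Sum>k. c k * a k) - (\<Sum>k<N. c k * a k)\<bar> <= 2 * M * a N"
  by (rule tendsto_upperbound) simp
qed

text \<open>Pairs (d, e) of positive integers correspond to pairs of n = d e and a divisor d of n.
  The convergence of \<open>has_sum\<close> is unconditional, so the terms may be summed fibre by
  fibre, and each fibre is finite.\<close>

lemma has_sum_divisors:
 fixes g :: "nat => nat => real"
 assumes "((%(d,e). g d e) has_sum S) ({1..} \<times> {1..})"
 shows "((%n. \<Sum>d | d dvd n. g d (n div d)) has_sum S) {1..}"
proof -
 have "((%(n,d). g d (n div d)) has_sum S) (SIGMA n:{1..}. {d. d dvd n})
  \<longleftrightarrow> ((%(d,e). g d e) has_sum S) ({1..} \<times> {1..})"
 proof (rule has_sum_reindex_bij_witness[where i = "%(d,e). (d*e, d)" and j = "%(n,d). (d, n div d)"], goal_cases)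
  case (2 a)
  then obtain n d where a: "a = (n, d)" "n >= 1" "d dvd n" by auto
  hence "n div d >= 1" "d >= 1" by (auto elim!: dvdE simp: Suc_le_eq)
  thus ?case using a by auto
 next
  case (4 b)
  then obtain d e where b: "b = (d, e)" "d >= 1" "e >= 1" by auto
  hence "1 * 1 <= d * e" by (intro mult_mono) auto
  thus ?case using b by auto
 qed auto
 with assms have "((%(n,d). g d (n div d)) has_sum S) (SIGMA n:{1..}. {d. d dvd n})" by simp
 thus ?thesis
  by (rule has_sum_SigmaD) (auto intro!: has_sum_finiteI finite_divisors_nat)
qed

lemma has_sum_dirichlet_product:
 fixes f g :: "nat => real"
 assumes "(%n. f n) summable_on {1..}" "(%n. g n) summable_on {1..}"
 shows "((%n. \<Sum>d | d dvd n. f d * g (n div d)) has_sum (infsum f {1..} * infsum g {1..})) {1..}"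
proof -
 have fs: "(%n. norm (f n)) summable_on {1..}" and gs: "(%n. norm (g n)) summable_on {1..}"
  using assms summable_on_iff_abs_summable_on_real by blast+
 have "(%x. norm (case x of (d,e) => f d * g e)) summable_on Sigma {1..} (%_. {1..})"
 proof (rule iffD2[OF Infinite_Sum.abs_summable_on_Sigma_iff], intro conjI ballI)
  show "(%y. norm (case (x, y) of (d, e) => f d * g e)) summable_on {1..}" for x
  using summable_on_cmult_right[OF gs, of "\<bar>f x\<bar>"] by (simp add: abs_mult)
  show "(%x. norm (\<Sum>\<^sub>\<infinity>y\<in>{1..}. norm (case (x, y) of (d, e) => f d * g e))) summable_on {1..}"
  using summable_on_cmult_left[OF fs, of "\<bar>\<Sum>\<^sub>\<infinity>y\<in>{1..}. \<bar>g y\<bar>\<bar>"]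
  by (simp add: abs_mult infsum_cmult_right')
 qed
 hence s: "(%(d,e). f d * g e) summable_on {1..} \<times> {1..}"
  by (rule Infinite_Sum.abs_summable_summable)
 have "infsum (%(d,e). f d * g e) ({1..} \<times> {1..}) = (\<Sum>\<^sub>\<infinity>d\<in>{1..}. \<Sum>\<^sub>\<infinity>e\<in>{1..}. f d * g e)"
  using infsum_Sigma'_banach[OF s] by simp
 also have "... = infsum f {1..} * infsum g {1..}"
  by (simp add: infsum_cmult_left' infsum_cmult_right')
 finally have "((%(d,e). f d * g e) has_sum (infsum f {1..} * infsum g {1..})) ({1..} \<times> {1..})"
  using s by (simp add: has_sum_iff)
 from has_sum_divisors[OF this] show ?thesis .
qed

lemma gcd_mult_coprime:
 fixes a b d :: nat
 assumes "coprime a b"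
 shows "gcd d (a * b) = gcd d a * gcd d b"
proof (rule dvd_antisym)
 show "gcd d (a * b) dvd gcd d a * gcd d b"
 proof -
  obtain x y where xy: "gcd d (a * b) = x * y" "x dvd a" "y dvd b"
  using division_decomp[of "gcd d (a * b)" a b] by auto
  hence "x dvd d" "y dvd d" by (metis dvd_mult_left dvd_mult_right gcd_dvd1)+
  with xy show ?thesis by (simp add: mult_dvd_mono)
 qed
 have "coprime (gcd d a) (gcd d b)" using assms by (meson coprime_divisors gcd_dvd2)
 thus "gcd d a * gcd d b dvd gcd d (a * b)"
  by (simp add: divides_mult mult_dvd_mono)
qed

text \<open>A divisor d of a product of coprime a and b splits uniquely, as \<open>gcd d a\<close>
  times \<open>gcd d b\<close>.\<close>

lemma sum_divisors_coprime_mult: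
 fixes f :: "nat => real"
 assumes "coprime a b" "a > 0" "b > 0" "!!x y. f (x * y) = f x * f y"
 shows "(\<Sum>d | d dvd a * b. f d) = (\<Sum>d | d dvd a. f d) * (\<Sum>d | d dvd b. f d)"
proof -
 have "(\<Sum>d | d dvd a. f d) * (\<Sum>d | d dvd b. f d) = (SUM (x,y):{d. d dvd a} \<times> {d. d dvd b}. f (x * y))"
  by (simp add: sum_product sum.cartesian_product assms(4))
 also have "... = (\<Sum>d | d dvd a * b. f d)"
 proof (rule sum.reindex_bij_witness[where i = "%d. (gcd d a, gcd d b)" and j = "%(x,y). x * y"], goal_cases)
  case (1 z)
  then obtain x y where z: "z = (x,y)" "x dvd a" "y dvd b" by auto
  have "coprime a y" "coprime b x" using z assms(1) by (meson coprime_commute coprime_divisors dvd_refl)+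
  hence "gcd (x*y) a = gcd x a" "gcd (x*y) b = gcd y b"
  by (simp_all add: gcd_mult_right_right_cancel gcd.commute gcd_mult_right_left_cancel)
  thus ?case using z by (simp add: gcd_nat.absorb1)
 next
  case (4 d)
  hence "gcd d (a*b) = d" by (simp add: gcd_nat.absorb1)
  thus ?case by auto
 qed (auto intro: mult_dvd_mono simp: gcd_mult_coprime[OF assms(1), symmetric] gcd_nat.absorb1)
 finally show ?thesis ..
qed

section \<open>Real characters, their L-series at 1, and primes with prescribed signs\<close>

locale real_character =
 fixes m :: nat and chi :: "nat => real"
 assumes m_pos: "m > 0" and mult: "chi (a * b) = chi a * chi b" and one: "chi 1 = 1"
  and per: "chi (a + m) = chi a" and vals: "chi a : {-1, 0, 1}" and sum0: "(\<Sum>r<m. chi r) = 0"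
begin

lemma abs_le: "\<bar>chi a\<bar> <= 1"
 using vals[of a] by auto

text \<open>Whole periods cancel by \<open>sum0\<close>, the form in which nonprincipality enters,
  and fewer than m terms remain.\<close>

lemma partial_sum_bound: "\<bar>\<Sum>k<n. chi k\<bar> <= real m"
proof (induction n rule: less_induct)
 case (less n)
 show ?case
 proof (cases "n < m")
  case True
  have "\<bar>\<Sum>k<n. chi k\<bar> <= (\<Sum>k<n. 1)"
  by (intro order.trans[OF sum_abs] sum_mono abs_le)
  with True show ?thesis by simp
 next
  case False
  then obtain j where n: "n = m + j" using le_Suc_ex[of m n] by auto
  have "(\<Sum>k<m + j. chi k) = (\<Sum>k<m. chi k) + (\<Sum>k<j. chi k)" for j
  by (induction j) (auto simp: per add.commute)
  thus ?thesis using less[of j] m_pos n by (simp add: sum0)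
 qed
qed

text \<open>The divisor sum of chi is multiplicative. At a prime power it is a geometric sum in
  \<open>chi p\<close>, which is -1, 0 or 1: never negative, and at least 1 when the exponent is
  even. In a square every exponent is even.\<close>

lemma sum_divisors_nonneg:
 assumes "n > 0"
 shows "(\<Sum>d | d dvd n. chi d) >= 0 & (ALL k. n = k^2 --> (\<Sum>d | d dvd n. chi d) >= 1)"
 using assms
proof (induction n rule: less_induct)
 case (less n)
 show ?case
 proof (cases "n = 1")
  case True
  moreover have "k = 1" if "1 = k^2" for k :: nat using that by (simp add: power2_eq_square)
  ultimately show ?thesis using one by auto
 next
  case False
  then obtain p where p: "prime p" "p dvd n" using prime_factor_nat by blast
  obtain b where b: "n = p ^ multiplicity p n * b" "~ p dvd b"
  by (rule multiplicity_decompose'[of n p]) (use less.prems p in auto)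
  define e where "e = multiplicity p n"
  have e0: "e > 0" using p less.prems by (auto simp: e_def prime_multiplicity_gt_zero_iff)
  have b0: "b > 0" using less.prems b by (cases b) auto
  have "1 < p ^ e" using e0 prime_gt_1_nat[OF p(1)] by (intro one_less_power)
  hence bn: "b < n" using b(1) b0 unfolding e_def[symmetric] by simp
  have cop: "coprime (p ^ e) b" using b p by (simp add: prime_imp_coprime)
  have pe: "(\<Sum>d | d dvd p ^ e. chi d) = (SUM j<=e. chi p ^ j)"
  proof -
  have "{d. d dvd p ^ e} = (%j. p ^ j) ` {..e}"
  using p by (auto simp: divides_primepow_nat)
  moreover have "inj_on (%j. p ^ j) {..e}"
  using prime_gt_1_nat[OF p(1)] by (auto simp: inj_on_def)
  moreover have "chi (p ^ j) = chi p ^ j" for j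
  using one by (induction j) (auto simp: mult)
  ultimately show ?thesis by (simp add: sum.reindex)
  qed
  have E: "(\<Sum>d | d dvd n. chi d) = (SUM j<=e. chi p ^ j) * (\<Sum>d | d dvd b. chi d)"
  using sum_divisors_coprime_mult[OF cop _ b0 mult] p b prime_gt_0_nat[OF p(1)]
  by (simp add: pe[symmetric] e_def[symmetric])
  have geo: "(SUM j<=e. chi p ^ j) >= 0 & (even e --> (SUM j<=e. chi p ^ j) >= 1)"
  proof -
  have "chi p = -1 \<or> chi p = 0 \<or> chi p = 1" using vals by auto
  moreover have "(SUM j<=e. (-1::real) ^ j) = (if even e then 1 else 0)"
  by (induction e) auto
  moreover have "(SUM j<=e. (0::real) ^ j) = 1"
  by (induction e) auto
  ultimately show ?thesis by auto
  qed
  have IH: "(\<Sum>d | d dvd b. chi d) >= 0" "ALL k. b = k^2 --> (\<Sum>d | d dvd b. chi d) >= 1"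
  using less.IH[OF bn b0] by auto
  have "(\<Sum>d | d dvd n. chi d) >= 1" if nk: "n = k^2" for k
  proof -
  have k0: "k > 0" using nk less.prems by (cases k) auto
  have ev: "even e" using nk p k0 by (simp add: e_def prime_elem_multiplicity_power_distrib)
  obtain f where f: "e = 2 * f" using ev by auto
  have "p ^ e dvd k\<^sup>2" unfolding nk[symmetric] e_def by (rule multiplicity_dvd)
  hence "(p ^ f)^2 dvd k\<^sup>2" by (simp add: f power_mult[symmetric] mult.commute)
  hence "p ^ f dvd k" by simp
  then obtain l where "k = p ^ f * l" by auto
  hence "p ^ e * b = p ^ e * l^2" using nk b(1) unfolding e_def[symmetric] f
  by (simp add: power_mult_distrib power_mult[symmetric] mult.commute)
  hence "b = l^2" using p prime_gt_0_nat[OF p(1)] by simp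
  hence "1 * 1 <= (SUM j<=e. chi p ^ j) * (\<Sum>d | d dvd b. chi d)" using IH geo ev by (intro mult_mono) auto
  thus ?thesis unfolding E by simp
  qed
  thus ?thesis using E geo IH by auto
 qed
qed

end

lemma has_sum_UNIV_imp_from_1:
 fixes f :: "nat => real"
 assumes "summable (%n. norm (f n))" "f 0 = 0"
 shows "(f has_sum (\<Sum>n. f n)) {1..}"
proof -
 have "(f has_sum (\<Sum>n. f n)) UNIV"
  by (rule norm_summable_imp_has_sum[OF assms(1) summable_sums[OF summable_norm_cancel[OF assms(1)]]])
 moreover have "(f has_sum (\<Sum>n. f n)) UNIV \<longleftrightarrow> (f has_sum (\<Sum>n. f n)) {1..}"
  by (rule has_sum_cong_neutral) (use assms(2) in \<open>auto simp: not_le\<close>)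
 ultimately show ?thesis by simp
qed

text \<open>Half of the excess s - 1 is spent on dominating ln n by a power, the other half keeps
  the series convergent.\<close>

lemma summable_ln_powr:
 assumes "s > 1"
 shows "summable (%n. ln (real n) * real n powr (-s))" "summable (%n. real n powr (-s))"
proof -
 show "summable (%n. real n powr (-s))" using assms by (simp add: summable_real_powr_iff)
 define a where "a = (s - 1) / 2"
 have a: "a > 0" using assms by (simp add: a_def)
 have "summable (%n. (1 / a) * real n powr (-(1 + a)))"
  using a by (intro summable_mult) (simp add: summable_real_powr_iff)
 thus "summable (%n. ln (real n) * real n powr (-s))"
 proof (rule summable_comparison_test'[where N = 1])
  fix n :: nat assume n: "1 <= n"
  have "ln (real n) * real n powr (-s) <= (real n powr a / a) * real n powr (-s)"
  using n a by (intro mult_right_mono ln_powr_bound) auto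
  also have "... = (1 / a) * real n powr (-(1 + a))"
  proof -
  have "a + - s = - (1 + a)" by (simp add: a_def field_simps)
  hence "real n powr a * real n powr (-s) = real n powr (-(1 + a))"
  by (simp only: powr_add[symmetric])
  thus ?thesis by (simp add: field_simps)
  qed
  finally show "norm (ln (real n) * real n powr (-s)) <= (1 / a) * real n powr (-(1 + a))"
  using n by simp
 qed
qed

lemma mangoldt_le_ln: "n >= 1 ==> (mangoldt n :: real) <= ln (real n)"
proof -
 assume n: "n >= 1"
 have "(mangoldt n :: real) <= (\<Sum>d | d dvd n. mangoldt d)"
  using n by (intro member_le_sum) (auto simp: mangoldt_nonneg finite_divisors_nat)
 also have "... = ln (real n)" using n by (subst mangoldt_sum) auto
 finally show ?thesis .
qed

text \<open>This is -L' = (-L'/L) L: the convolution of \<open>mangoldt\<close> with 1 is ln, and a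
  completely multiplicative chi passes through the convolution.\<close>

lemma dirichlet_log_derivative:
 fixes chi :: "nat => real"
 assumes mult: "!!a b. chi (a * b) = chi a * chi b" and ab: "!!a. \<bar>chi a\<bar> <= 1" and s: "s > 1"
 shows "summable (%n. chi n * real n powr (-s))"
  "summable (%n. chi n * mangoldt n * real n powr (-s))"
  "summable (%n. chi n * (ln (real n) * real n powr (-s)))"
  "(\<Sum>n. chi n * (ln (real n) * real n powr (-s))) =
  (\<Sum>n. chi n * mangoldt n * real n powr (-s)) * (\<Sum>n. chi n * real n powr (-s))"
proof -
 have 1: "summable (%n. norm (chi n * real n powr (-s)))"
  by (rule summable_comparison_test'[OF summable_ln_powr(2)[OF s], where N = 0])
  (use ab in \<open>auto simp: abs_mult intro!: mult_left_le_one_le\<close>)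
 have 2: "summable (%n. norm (chi n * mangoldt n * real n powr (-s)))"
 proof (rule summable_comparison_test'[OF summable_ln_powr(1)[OF s], where N = 1])
  fix n :: nat assume n: "1 <= n"
  have "\<bar>chi n\<bar> * mangoldt n <= 1 * ln (real n)"
  using n ab mangoldt_le_ln[of n] by (intro mult_mono) (auto simp: mangoldt_nonneg)
  hence "(\<bar>chi n\<bar> * mangoldt n) * real n powr (-s) <= ln (real n) * real n powr (-s)"
  by (intro mult_right_mono) auto
  thus "norm (norm (chi n * mangoldt n * real n powr (-s))) <= ln (real n) * real n powr (-s)"
  by (simp add: abs_mult)
 qed
 have 3: "summable (%n. norm (chi n * (ln (real n) * real n powr (-s))))"
 proof (rule summable_comparison_test'[OF summable_ln_powr(1)[OF s], where N = 1])
  fix n :: nat assume n: "1 <= n"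
  have "\<bar>chi n\<bar> * (ln (real n) * real n powr (-s)) <= 1 * (ln (real n) * real n powr (-s))"
  using n ab by (intro mult_right_mono) auto
  thus "norm (norm (chi n * (ln (real n) * real n powr (-s)))) <= ln (real n) * real n powr (-s)"
  using n by (simp add: abs_mult)
 qed
 show "summable (%n. chi n * real n powr (-s))"
  "summable (%n. chi n * mangoldt n * real n powr (-s))"
  "summable (%n. chi n * (ln (real n) * real n powr (-s)))"
  by (rule summable_norm_cancel[OF 1] summable_norm_cancel[OF 2] summable_norm_cancel[OF 3])+
 have h1: "((%n. chi n * real n powr (-s)) has_sum (\<Sum>n. chi n * real n powr (-s))) {1..}"
  by (rule has_sum_UNIV_imp_from_1[OF 1]) simp
 have h2: "((%n. chi n * mangoldt n * real n powr (-s)) has_sum (\<Sum>n. chi n * mangoldt n * real n powr (-s))) {1..}"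
  by (rule has_sum_UNIV_imp_from_1[OF 2]) simp
 have h3: "((%n. chi n * (ln (real n) * real n powr (-s))) has_sum (\<Sum>n. chi n * (ln (real n) * real n powr (-s)))) {1..}"
  by (rule has_sum_UNIV_imp_from_1[OF 3]) simp
 have "((%n. \<Sum>d | d dvd n. (chi d * mangoldt d * real d powr (-s)) * (chi (n div d) * real (n div d) powr (-s)))
  has_sum (infsum (%n. chi n * mangoldt n * real n powr (-s)) {1..} * infsum (%n. chi n * real n powr (-s)) {1..})) {1..}"
  by (rule has_sum_dirichlet_product) (use h1 h2 in \<open>auto simp only: summable_on_def\<close>)
 moreover have "(\<Sum>d | d dvd n. (chi d * mangoldt d * real d powr (-s)) * (chi (n div d) * real (n div d) powr (-s)))
  = chi n * (ln (real n) * real n powr (-s))" if "n : {1..}" for n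
 proof -
  have n: "n ~= 0" using that by auto
  have "(chi d * mangoldt d * real d powr (-s)) * (chi (n div d) * real (n div d) powr (-s))
  = mangoldt d * (chi n * real n powr (-s))" if dn: "d dvd n" for d
  proof -
  obtain e where e: "n = d * e" using dn by auto
  thus ?thesis using n by (simp add: mult powr_mult)
  qed
  hence "(\<Sum>d | d dvd n. (chi d * mangoldt d * real d powr (-s)) * (chi (n div d) * real (n div d) powr (-s)))
  = (\<Sum>d | d dvd n. mangoldt d) * (chi n * real n powr (-s))"
  unfolding sum_distrib_right by (intro sum.cong) auto
  thus ?thesis using mangoldt_sum[OF n, where ?'a = real] by simp
 qed
 ultimately have "((%n. chi n * (ln (real n) * real n powr (-s)))
  has_sum (infsum (%n. chi n * mangoldt n * real n powr (-s)) {1..} * infsum (%n. chi n * real n powr (-s)) {1..})) {1..}"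
  by (rule iffD1[OF has_sum_cong, rotated])
 thus "(\<Sum>n. chi n * (ln (real n) * real n powr (-s))) =
  (\<Sum>n. chi n * mangoldt n * real n powr (-s)) * (\<Sum>n. chi n * real n powr (-s))"
  unfolding infsumI[OF h1] infsumI[OF h2] by (rule has_sum_unique[OF h3])
qed

context real_character
begin

text \<open>Lambert series argument. If the sum were 0, subtracting the multiple chi n / (n (1 - t))
  would not change the Lambert series, and the corrected weights \<open>b n\<close> decrease from
  \<open>b 1 = 1\<close>; so the series would stay below 2 m for every t < 1. Expanded in powers of
  t it has the nonnegative divisor sums as coefficients, at least 1 on squares, and exceeds 2 m for
  t close to 1.\<close>

lemma L1_nonzero: "(\<Sum>n. chi n * (1 / real n)) ~= 0"
proof
 assume L0: "(\<Sum>n. chi n * (1 / real n)) = 0"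
 have sL: "summable (%n. chi n * (1 / real n))"
  by (rule abel_summable(1)[OF partial_sum_bound, of 1])
  (auto simp: frac_le lim_1_over_n)
 \<comment> \<open>K squares, each contributing at least t ^ (K^2) = 1/2, give K / 2 = 2 m + 1, just
   above the upper bound 2 m.\<close>
 define K where "K = 4 * m + 2"
 have K0: "K > 0" by (simp add: K_def)
 define t where "t = root (K^2) (1/2)"
 have t0: "0 < t" unfolding t_def using K0 by simp
 have tK: "t ^ (K^2) = 1/2" unfolding t_def using K0 by (intro real_root_pow_pos2) auto
 have t1: "t < 1"
 proof (rule ccontr)
  assume "~ t < 1" hence "1 <= t ^ (K^2)" by (intro one_le_power) auto
  thus False using tK by simp
 qed
 define S where "S n = (\<Sum>k<n. t ^ k)" for n
 have S: "1 - t ^ n = (1 - t) * S n" for n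
  unfolding S_def using one_diff_power_eq[of t n] by simp
 have Spos: "S n > 0" if "n >= 1" for n
  using that t0 unfolding S_def by (intro sum_pos) (auto simp: lessThan_empty_iff)
 have tn: "t ^ n < 1" if "n >= 1" for n :: nat
  using power_decreasing[OF that, of t] t0 t1 by simp
 have Slow: "real n * t ^ n <= S n" for n
 proof -
  have "(\<Sum>k<n. t ^ n) <= S n" unfolding S_def using t0 t1
  by (intro sum_mono power_decreasing) auto
  thus ?thesis by simp
 qed
 define b where "b n = 1 / (real n * (1 - t)) - t ^ n / (1 - t ^ n)" for n
 have b_eq: "b n = (1 / real n - t ^ n / S n) / (1 - t)" if "n >= 1" for n
  unfolding b_def S by (simp add: diff_divide_distrib mult.commute)
 have b_nn: "0 <= b n" for n
 proof (cases "n = 0")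
  case False
  hence "t ^ n / S n <= 1 / real n" using Slow[of n] Spos[of n] by (simp add: field_simps)
  thus ?thesis using False t1 by (simp add: b_eq)
 qed (simp add: b_def)
 \<comment> \<open>Arithmetic-geometric mean inequality: in the square of \<open>S n\<close> the
   terms are paired so that the two members of a pair multiply to the square of t ^ (n - 1).\<close>
 have AM: "(real n)^2 * t ^ (n - 1) <= (S n)^2" for n
 proof -
  have "S n * S n = (\<Sum>k<n. t ^ k) * (\<Sum>k<n. t ^ (n - Suc k))"
  unfolding S_def by (simp add: sum.nat_diff_reindex)
  also have "... = (\<Sum>k<n. \<Sum>l<n. t ^ k * t ^ (n - Suc l))" by (rule sum_product)
  finally have e: "S n * S n = (\<Sum>k<n. \<Sum>l<n. t ^ k * t ^ (n - Suc l))" .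
  have e2: "S n * S n = (\<Sum>k<n. \<Sum>l<n. t ^ l * t ^ (n - Suc k))"
  unfolding e by (rule sum.swap)
  have ge: "2 * t ^ (n - 1) <= t ^ k * t ^ (n - Suc l) + t ^ l * t ^ (n - Suc k)" if "k < n" "l < n" for k l
  proof -
  have "(t ^ k * t ^ (n - Suc l)) * (t ^ l * t ^ (n - Suc k)) = (t ^ (n - 1))^2"
  proof -
  have "k + (n - Suc l) + (l + (n - Suc k)) = (n - 1) * 2" using that by simp
  thus ?thesis by (simp only: power_add[symmetric] power_mult[symmetric])
  qed
  moreover have "(2::real) * z <= x + y" if "x * y = z^2" "0 <= x" "0 <= y" "0 <= z" for x y z
  proof -
  have "(2 * z)^2 <= (x + y)^2" using that sum_squares_bound[of x y] by (simp add: power2_eq_square algebra_simps)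
  thus ?thesis by (rule power2_le_imp_le) (use that in simp)
  qed
  ultimately show ?thesis using t0 by simp
  qed
  have "(\<Sum>k<n. \<Sum>l<n. 2 * t ^ (n - 1)) <= 2 * (S n * S n)"
  proof -
  have E2: "2 * (S n * S n) = (\<Sum>k<n. \<Sum>l<n. t ^ k * t ^ (n - Suc l) + t ^ l * t ^ (n - Suc k))"
  using e e2 by (simp add: sum.distrib)
  show ?thesis unfolding E2 by (intro sum_mono ge) simp_all
  qed
  thus ?thesis by (simp add: power2_eq_square)
 qed
 \<comment> \<open>From n to n + 1 the quotient t ^ n / S n drops by exactly t ^ n / (S n * S (n +
   1)), and 1/n drops by 1 / (n (n + 1)); \<open>AM\<close> at n and n + 1 compares the two
   drops.\<close>
 have dec: "b (Suc n) <= b n" if n: "1 <= n" for n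
 proof -
  have SS: "S (Suc n) = S n + t ^ n" by (simp add: S_def)
  have "(real n * real (Suc n) * t ^ n)^2 <= (real n)^2 * t ^ (n - 1) * ((real (Suc n))^2 * t ^ n)"
  proof -
  have "t ^ n * t ^ n <= t ^ (n - 1) * t ^ n"
  using t0 t1 by (intro mult_right_mono power_decreasing) auto
  thus ?thesis using mult_left_mono[of "t ^ n * t ^ n" "t ^ (n - 1) * t ^ n" "(real n)^2 * (real (Suc n))^2"]
  by (simp add: power2_eq_square algebra_simps)
  qed
  also have "... <= (S n)^2 * (S (Suc n))^2"
  using AM[of n] AM[of "Suc n"] t0 by (intro mult_mono) auto
  also have "... = (S n * S (Suc n))^2" by (simp add: power_mult_distrib)
  finally have key: "real n * real (Suc n) * t ^ n <= S n * S (Suc n)"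
  by (rule power2_le_imp_le) (use Spos[of n] Spos[of "Suc n"] n in simp)
  have "t ^ n / S n - t ^ Suc n / S (Suc n) = t ^ n / (S n * S (Suc n))"
  proof -
  have "t ^ n * S (Suc n) - t ^ Suc n * S n = t ^ n * ((1 - t) * S n + t ^ n)"
  unfolding SS by (simp add: algebra_simps)
  also have "... = t ^ n" unfolding S[symmetric] by simp
  finally show ?thesis using Spos[of n] Spos[of "Suc n"] n by (simp add: field_simps)
  qed
  also have "... <= 1 / (real n * real (Suc n))"
  using key n Spos[of n] Spos[of "Suc n"] by (simp add: divide_simps) (simp add: algebra_simps)
  also have "... = 1 / real n - 1 / real (Suc n)" using n by (simp add: field_simps)
  finally have "1 / real (Suc n) - t ^ Suc n / S (Suc n) <= 1 / real n - t ^ n / S n" by simp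
  thus ?thesis unfolding b_eq[OF n] b_eq[of "Suc n", simplified] using t1
  by (simp add: divide_right_mono)
 qed
 have tlim: "(%n. t ^ n) ~> 0" using t0 t1 by (intro LIMSEQ_realpow_zero) auto
 have "b ~> 0 * (1 / (1 - t)) - 0 / (1 - 0)"
 proof -
  have "(%n. (1 / real n) * (1 / (1 - t)) - t ^ n / (1 - t ^ n)) ~> 0 * (1 / (1 - t)) - 0 / (1 - 0)"
  by (intro tendsto_intros tlim lim_1_over_n) auto
  thus ?thesis by (simp add: b_def[abs_def])
 qed
 hence blim: "b ~> 0" by simp
 note ab = abel_summable[where ?N0.0 = 1, OF partial_sum_bound dec b_nn blim]
 have sb: "summable (%n. chi n * b n)" by (rule ab(1))
 have "\<bar>(\<Sum>n. chi n * b n) - (\<Sum>n<1. chi n * b n)\<bar> <= 2 * real m * b 1"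
 proof -
  show ?thesis by (rule ab(2)) simp_all
 qed
 moreover have "b 1 = 1" unfolding b_def using t1 by (simp add: field_simps)
 ultimately have bound: "\<bar>\<Sum>n. chi n * b n\<bar> <= 2 * real m" by (simp add: b_def)
 have lam: "chi n * (t ^ n / (1 - t ^ n)) = (1 / (1 - t)) * (chi n * (1 / real n)) - chi n * b n" for n
  by (simp add: b_def field_simps)
 have "(%n. chi n * (t ^ n / (1 - t ^ n))) sums ((1 / (1 - t)) * 0 - (\<Sum>n. chi n * b n))"
  unfolding lam by (intro sums_diff sums_mult summable_sums sb) (use sL L0 summable_sums in force)
 hence f_sums: "(%n. chi n * (t ^ n / (1 - t ^ n))) sums (- (\<Sum>n. chi n * b n))" by simp
 define T where "T = - (\<Sum>n. chi n * b n)"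
 have geo: "((%e. x ^ e) has_sum (x / (1 - x))) {1..}" if "0 < x" "x < 1" for x :: real
 proof -
  have "(%e. x ^ Suc e) sums (x * (1 / (1 - x)))"
  unfolding power_Suc using that by (intro sums_mult geometric_sums) auto
  hence "((%e. x ^ Suc e) has_sum (x / (1 - x))) UNIV"
  using that by (intro sums_nonneg_imp_has_sum) auto
  hence "((%e. x ^ e) has_sum (x / (1 - x))) (Suc ` UNIV)"
  by (subst has_sum_reindex) (auto simp: o_def)
  also have "Suc ` UNIV = {1..}" by (auto simp: image_iff Suc_le_eq gr0_conv_Suc)
  finally show ?thesis .
 qed
 have tdn: "norm (t ^ d / (1 - t ^ d)) <= t ^ d / (1 - t)" if "d >= 1" for d
 proof -
  have "t ^ d <= t" using that t0 t1 power_decreasing[of 1 d t] by simp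
  thus ?thesis using t0 t1 tn[OF that] by (simp add: frac_le)
 qed
 have sumt: "summable (%d. norm (chi d * (t ^ d / (1 - t ^ d))))"
 proof (rule summable_comparison_test'[where N = 1])
  show "summable (%d. t ^ d / (1 - t))" using t0 t1 by (intro summable_divide summable_geometric) auto
  fix d :: nat assume "1 <= d"
  have "\<bar>chi d\<bar> * norm (t ^ d / (1 - t ^ d)) <= 1 * (t ^ d / (1 - t))"
  using abs_le tdn[OF \<open>1 <= d\<close>] by (intro mult_mono) auto
  thus "norm (norm (chi d * (t ^ d / (1 - t ^ d)))) <= t ^ d / (1 - t)" by (simp add: abs_mult)
 qed
 have "((%d. chi d * (t ^ d / (1 - t ^ d))) has_sum T) {1..}"
  using has_sum_UNIV_imp_from_1[OF sumt] f_sums by (simp add: T_def sums_iff)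
 moreover have inner: "((%e. chi d * t ^ (d * e)) has_sum (chi d * (t ^ d / (1 - t ^ d)))) {1..}" if "d : {1..}" for d
  unfolding power_mult using that tn[of d] t0 by (intro has_sum_cmult_right geo) auto
 moreover have "(%(d,e). chi d * t ^ (d * e)) summable_on {1..} \<times> {1..}"
 proof -
  have "(%x. norm (case x of (d,e) => t ^ (d * e))) summable_on Sigma {1..} (%_. {1..})"
  proof (rule iffD2[OF Infinite_Sum.abs_summable_on_Sigma_iff], intro conjI ballI)
  fix d :: nat assume d: "d : {1..}"
  show "(%y. norm (case (d, y) of (d, e) => t ^ (d * e))) summable_on {1..}"
  using geo[of "t ^ d"] tn[of d] t0 d by (auto simp: power_mult summable_on_def)
  next
  have "(%x. norm (t ^ x / (1 - t ^ x))) summable_on {1..}"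
  proof (rule summable_on_comparison_test)
  show "(%d. t ^ d * (1 / (1 - t))) summable_on {1..}"
  using geo[OF t0 t1] by (intro summable_on_cmult_left) (auto simp: summable_on_def)
  qed (use tdn in auto)
  thus "(%x. norm (\<Sum>\<^sub>\<infinity>y\<in>{1..}. norm (case (x, y) of (d, e) => t ^ (d * e)))) summable_on {1..}"
  proof (rule iffD1[OF summable_on_cong, rotated])
  fix x :: nat assume x: "x : {1..}"
  have "(\<Sum>\<^sub>\<infinity>y\<in>{1..}. norm (t ^ (x * y))) = t ^ x / (1 - t ^ x)"
  using geo[of "t ^ x"] tn[of x] t0 x by (intro infsumI) (auto simp: power_mult)
  thus "norm (t ^ x / (1 - t ^ x)) = norm (\<Sum>\<^sub>\<infinity>y\<in>{1..}. norm (case (x, y) of (d, e) => t ^ (d * e)))"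
  by simp
  qed
  qed
  hence "(%x. norm (case x of (d,e) => chi d * t ^ (d * e))) summable_on {1..} \<times> {1..}"
  proof (rule summable_on_comparison_test)
  fix x :: "nat \<times> nat"
  obtain d e where x: "x = (d, e)" by (cases x)
  show "norm (case x of (d,e) => chi d * t ^ (d * e)) <= norm (case x of (d,e) => t ^ (d * e))"
  using abs_le[of d] t0 unfolding x by (simp add: abs_mult mult_left_le_one_le)
  qed auto
  thus ?thesis by (rule Infinite_Sum.abs_summable_summable)
 qed
 ultimately have "((%(d,e). chi d * t ^ (d * e)) has_sum T) ({1..} \<times> {1..})"
  by (intro has_sum_SigmaI[where g = "%d. chi d * (t ^ d / (1 - t ^ d))"]) auto
 from has_sum_divisors[OF this]
 have hs: "((%n. \<Sum>d | d dvd n. chi d * t ^ (d * (n div d))) has_sum T) {1..}" .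
 have co: "(\<Sum>d | d dvd n. chi d * t ^ (d * (n div d))) = (\<Sum>d | d dvd n. chi d) * t ^ n" for n
  by (simp add: sum_distrib_right)
 have "(SUM n:(%k. k^2) ` {1..K}. (\<Sum>d | d dvd n. chi d) * t ^ n) <= T"
  using hs unfolding co by (rule finite_sum_le_has_sum)
  (use sum_divisors_nonneg t0 in \<open>auto intro!: mult_nonneg_nonneg\<close>)
 moreover have "(SUM n:(%k. k^2) ` {1..K}. (\<Sum>d | d dvd n. chi d) * t ^ n) >= (SUM n:(%k. k^2) ` {1..K}. 1/2)"
 proof (rule sum_mono)
  fix n assume "n : (%k. k^2) ` {1..K}"
  then obtain k where k: "n = k^2" "1 <= k" "k <= K" by auto
  have "t ^ (K^2) <= t ^ n" using k t0 t1 by (intro power_decreasing power_mono) auto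
  moreover have "(\<Sum>d | d dvd n. chi d) >= 1" using sum_divisors_nonneg[of n] k by auto
  ultimately have "1 * (1/2) <= (\<Sum>d | d dvd n. chi d) * t ^ n" using tK by (intro mult_mono) auto
  thus "1/2 <= (\<Sum>d | d dvd n. chi d) * t ^ n" by simp
 qed
 moreover have "card ((%k. k^2) ` {1..K}) = K" by (subst card_image) (auto simp: inj_on_def)
 ultimately have "real K / 2 <= T" by simp
 moreover have "T <= 2 * real m" using bound unfolding T_def by linarith
 ultimately show False by (simp add: K_def)
qed

definition L :: "real => real" where "L s = (\<Sum>n. chi n * real n powr (-s))"

text \<open>The tail bound is uniform in s >= 1, so continuity from the right at 1 passes from the
  finite sums to \<open>L\<close>.\<close>

lemma L_approx:
 assumes "s >= 1" "N >= 1"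
 shows "\<bar>L s - (\<Sum>n<N. chi n * real n powr (-s))\<bar> <= 2 * real m / real N"
proof -
 have "\<bar>L s - (\<Sum>n<N. chi n * real n powr (-s))\<bar> <= 2 * real m * real N powr (-s)"
  unfolding L_def
 proof (rule abel_summable(2)[OF partial_sum_bound])
  show "1 <= n ==> real (Suc n) powr (-s) <= real n powr (-s)" for n
  using assms by (intro powr_mono2') auto
  show "(%n. real n powr (-s)) ~> 0"
  using assms by (intro tendsto_neg_powr filterlim_real_sequentially) auto
 qed (use assms in auto)
 also have "real N powr (-s) <= real N powr (-1)"
  using assms by (intro powr_mono) auto
 hence "2 * real m * real N powr (-s) <= 2 * real m * (1 / real N)"
  using assms by (intro mult_left_mono) (auto simp: powr_minus_divide)
 finally show ?thesis by simp
qed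

lemma L_tendsto: "(L \<longlongrightarrow> L 1) (at_right 1)"
proof (rule tendstoI)
 fix e :: real assume e: "0 < e"
 obtain N where N: "real N > 6 * real m / e + 1" using reals_Archimedean2 by blast
 have N1: "N >= 1"
 proof (rule ccontr)
  assume "~ N >= 1"
  hence "6 * real m / e + 1 < 0" using N by simp
  moreover have "6 * real m / e >= 0" using e by simp
  ultimately show False by linarith
 qed
 have "6 * real m / e < real N" using N by linarith
 hence Nb: "2 * real m / real N < e / 3" using e N1 by (simp add: field_simps)
 define P where "P s = (\<Sum>n<N. chi n * real n powr (-s))" for s
 have "(P \<longlongrightarrow> P 1) (at_right 1)"
  unfolding P_def
 proof (rule tendsto_sum, rule tendsto_mult[OF tendsto_const])
  fix n
  show "((%s. real n powr (-s)) \<longlongrightarrow> real n powr (-1)) (at_right 1)"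
  proof (cases "n = 0")
  case False
  thus ?thesis by (intro tendsto_intros) auto
  qed simp
 qed
 hence "eventually (%s. dist (P s) (P 1) < e / 3) (at_right 1)" using e by (intro tendstoD) auto
 moreover have "eventually (%s::real. s > 1) (at_right 1)" by (simp add: eventually_at_right_less)
 ultimately show "eventually (%s. dist (L s) (L 1) < e) (at_right 1)"
 proof eventually_elim
  case (elim s)
  have "\<bar>L s - P s\<bar> < e / 3" using L_approx[of s N] Nb N1 elim unfolding P_def by linarith
  moreover have "\<bar>L 1 - P 1\<bar> < e / 3" using L_approx[of 1 N] Nb N1 unfolding P_def by linarith
  ultimately show ?case using elim unfolding dist_real_def by linarith
 qed
qed

text \<open>ln x / x decreases beyond e < 3, hence the tail estimate from n = 3 on; the term n = 2
  accounts for ln 2. The point is that the bound is free of s.\<close>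

lemma log_sum_bounded:
 assumes s: "s > 1"
 shows "\<bar>\<Sum>n. chi n * (ln (real n) * real n powr (-s))\<bar> <= ln 2 + 2 * real m * ln 3"
proof -
 let ?a = "%n. ln (real n) * real n powr (-s)"
 have "\<bar>(\<Sum>n. chi n * ?a n) - (\<Sum>n<3. chi n * ?a n)\<bar> <= 2 * real m * ?a 3"
 proof (rule abel_summable(2)[OF partial_sum_bound, where ?N0.0 = 3])
  fix n :: nat assume n: "3 <= n"
  have l: "1 <= ln (real n)"
  proof -
  have "exp 1 <= real n" using exp_le n by linarith
  thus ?thesis using n by (simp add: ln_ge_iff)
  qed
  have "real (Suc n) = real n * (1 + 1 / real n)" using n by (simp add: field_simps)
  hence "ln (real (Suc n)) = ln (real n) + ln (1 + 1 / real n)"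
  using n ln_mult_pos[of "real n" "1 + 1 / real n"] by (simp add: add_pos_pos)
  also have "ln (1 + 1 / real n) <= 1 / real n" by (rule ln_add_one_self_le_self) simp
  finally have "real n * ln (real (Suc n)) <= real n * (ln (real n) + 1 / real n)"
  by (intro mult_left_mono) auto
  also have "... <= (real n + 1) * ln (real n)" using l n by (simp add: algebra_simps)
  finally have q: "ln (real (Suc n)) / real (Suc n) <= ln (real n) / real n"
  using n by (simp add: field_simps)
  have e: "ln x * x powr (-s) = ln x / x * x powr (1 - s)" if "x > 0" for x :: real
  using that by (simp add: powr_diff powr_minus_divide)
  have "ln (real (Suc n)) / real (Suc n) * real (Suc n) powr (1 - s) <= ln (real n) / real n * real n powr (1 - s)"
  using q n s l by (intro mult_mono powr_mono2') auto
  thus "?a (Suc n) <= ?a n" using n e[of "real (Suc n)"] e[of "real n"] by simp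
 next
  show "0 <= ?a n" for n by (cases n) auto
  show "?a ~> 0" by (rule summable_LIMSEQ_zero[OF summable_ln_powr(1)[OF s]])
  show "(3::nat) <= 3" by simp
 qed
 moreover have "?a 3 <= ln 3 * 1"
  using s powr_mono[of "-s" 0 3] by (simp add: mult_left_le)
 hence "2 * real m * ?a 3 <= 2 * real m * ln 3" by (intro mult_left_mono) auto
 moreover have "\<bar>\<Sum>n<3. chi n * ?a n\<bar> <= ln 2"
 proof -
  have "(\<Sum>n<3. chi n * ?a n) = chi 2 * ?a 2" by (simp add: numeral_3_eq_3 numeral_2_eq_2)
  moreover have "\<bar>chi 2\<bar> * \<bar>?a 2\<bar> <= 1 * (ln 2 * 1)"
  using s powr_mono[of "-s" 0 2] abs_le by (intro mult_mono) (auto simp: abs_mult)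
  ultimately show ?thesis by (simp add: abs_mult)
 qed
 ultimately show ?thesis by linarith
qed

text \<open>The sum is -L'/L: as s tends to 1 the numerator stays bounded and the denominator tends
  to a nonzero value.\<close>

lemma mangoldt_sum_bounded:
 "EX B. eventually (%s. \<bar>\<Sum>n. chi n * mangoldt n * real n powr (-s)\<bar> <= B) (at_right 1)"
proof -
 have L1: "L 1 ~= 0"
 proof -
  have "real n powr (-1) = 1 / real n" for n by (cases "n = 0") (auto simp: powr_minus_divide)
  thus ?thesis using L1_nonzero unfolding L_def by simp
 qed
 let ?B = "(ln 2 + 2 * real m * ln 3) / (\<bar>L 1\<bar> / 2)"
 have "eventually (%s. \<bar>L s\<bar> > \<bar>L 1\<bar> / 2) (at_right 1)"
  using L1 by (intro order_tendstoD(1)[OF tendsto_rabs[OF L_tendsto]]) auto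
 moreover have "eventually (%s::real. s > 1) (at_right 1)" by (simp add: eventually_at_right_less)
 ultimately have "eventually (%s. \<bar>\<Sum>n. chi n * mangoldt n * real n powr (-s)\<bar> <= ?B) (at_right 1)"
 proof eventually_elim
  case (elim s)
  let ?V = "\<Sum>n. chi n * mangoldt n * real n powr (-s)"
  have "\<bar>?V\<bar> * \<bar>L s\<bar> <= ln 2 + 2 * real m * ln 3"
  using log_sum_bounded[of s] elim dirichlet_log_derivative(4)[OF mult abs_le, of s]
  by (simp add: L_def abs_mult)
  moreover have "\<bar>?V\<bar> * (\<bar>L 1\<bar> / 2) <= \<bar>?V\<bar> * \<bar>L s\<bar>" using elim by (intro mult_left_mono) auto
  ultimately show ?case using L1 by (simp add: field_simps)
 qed
 thus ?thesis by blast
qed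

end

text \<open>The principal series \<open>Z s\<close> tends to infinity, already along the progression
  k m + 1. Since ln n >= M' from N on, the series weighted by ln is at least M' (Z - N), and
  dividing it by Z > M' N loses at most 1.\<close>

lemma principal_mangoldt_sum_unbounded:
 fixes m :: nat and M :: real
 assumes m: "m > 0"
 defines "chi0 \<equiv> %n. of_bool (coprime n m) :: real"
 shows "eventually (%s. M <= (\<Sum>n. chi0 n * mangoldt n * real n powr (-s))) (at_right 1)"
proof -
 define M' where "M' = max 1 (M + 1)"
 have M': "M' >= 1" "M <= M' - 1" by (auto simp: M'_def)
 have mult: "chi0 (a * b) = chi0 a * chi0 b" for a b by (auto simp: chi0_def)
 have ab: "\<bar>chi0 a\<bar> <= 1" for a by (simp add: chi0_def)
 have nn: "0 <= chi0 a" for a by (simp add: chi0_def)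
 obtain N0 where N0: "exp M' <= real N0" using real_arch_simple by blast
 define N where "N = max 1 N0"
 have N: "real N >= exp M'" "N >= 1" using N0 by (auto simp: N_def)
 define Z where "Z s = (\<Sum>n. chi0 n * real n powr (-s))" for s
 have Zinf: "eventually (%s. C < Z s) (at_right 1)" for C
 proof -
  have "~ summable (%k. 1 / real (k * m + 1))"
  proof
  assume "summable (%k. 1 / real (k * m + 1))"
  hence "summable (%k. (1 / real m) * inverse (real (Suc k)))"
  proof (rule summable_comparison_test'[where N = 0])
  fix k :: nat
  have "real (k * m + 1) <= real m * real (Suc k)" using m by (simp add: algebra_simps)
  thus "norm ((1 / real m) * inverse (real (Suc k))) <= 1 / real (k * m + 1)"
  using m by (simp add: divide_simps del: of_nat_Suc of_nat_add of_nat_mult)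
  qed
  hence "summable (%k. real m * ((1 / real m) * inverse (real (Suc k))))" by (rule summable_mult)
  hence "summable (%k. inverse (real (Suc k)))" using m by simp
  thus False using not_summable_harmonic[where 'a = real] by (simp only: summable_Suc_iff[of "%k. inverse (real k)"])
  qed
  then obtain K where K: "(\<Sum>k<K. 1 / real (k * m + 1)) > C"
  using summableI_nonneg_bounded[of "%k. 1 / real (k * m + 1)" C] by (auto simp: not_le intro: leI)
  have "((%s. \<Sum>k<K. real (k * m + 1) powr (-s)) \<longlongrightarrow> (\<Sum>k<K. real (k * m + 1) powr (-1))) (at_right 1)"
  by (intro tendsto_intros) (auto simp del: of_nat_add of_nat_mult)
  moreover have "(\<Sum>k<K. real (k * m + 1) powr (-1)) > C"
  using K by (simp add: powr_minus_divide del: of_nat_add of_nat_mult)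
  ultimately have "eventually (%s. (\<Sum>k<K. real (k * m + 1) powr (-s)) > C) (at_right 1)"
  by (rule order_tendstoD(1))
  moreover have "eventually (%s::real. s > 1) (at_right 1)" by (simp add: eventually_at_right_less)
  ultimately show ?thesis
  proof eventually_elim
  case (elim s)
  have inj: "inj_on (%k. k * m + 1) {..<K}" using m by (auto simp: inj_on_def)
  have c1: "chi0 (k * m + 1) = 1" for k
  proof -
  have "gcd m (k * m + 1) = 1" unfolding gcd_add_mult by simp
  hence "coprime (k * m + 1) m" by (simp only: coprime_iff_gcd_eq_1 gcd.commute)
  thus ?thesis by (simp only: chi0_def of_bool_eq)
  qed
  have "(\<Sum>k<K. real (k * m + 1) powr (-s)) = (SUM n:(%k. k * m + 1) ` {..<K}. chi0 n * real n powr (-s))"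
  by (subst sum.reindex[OF inj]) (simp only: o_def c1 mult_1_left)
  also have "... <= Z s"
  unfolding Z_def by (intro sum_le_suminf dirichlet_log_derivative(1)[OF mult ab]) (use elim nn in auto)
  finally show ?case using elim by linarith
  qed
 qed
 have "eventually (%s. M' * real N < Z s) (at_right 1)" by (rule Zinf)
 moreover have "eventually (%s::real. s > 1) (at_right 1)" by (simp add: eventually_at_right_less)
 ultimately show ?thesis
 proof eventually_elim
  case (elim s)
  note D = dirichlet_log_derivative[OF mult ab elim(2)]
  let ?V = "\<Sum>n. chi0 n * mangoldt n * real n powr (-s)"
  have fin: "(%n. if n : {..<N} then M' else 0) sums (SUM n:{..<N}. M')" by (rule sums_If_finite_set) simp
  have "(\<Sum>n. M' * (chi0 n * real n powr (-s)) - (if n : {..<N} then M' else 0))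
  <= (\<Sum>n. chi0 n * (ln (real n) * real n powr (-s)))"
  proof (rule suminf_le)
  fix n
  have p1: "real n powr (-s) <= 1" if "n > 0"
  using that elim powr_mono[of "-s" 0 "real n"] by simp
  show "M' * (chi0 n * real n powr (-s)) - (if n : {..<N} then M' else 0) <= chi0 n * (ln (real n) * real n powr (-s))"
  proof (cases "n < N")
  case True
  have "chi0 n * real n powr (-s) <= 1"
  proof (cases "n = 0")
  case False
  hence "chi0 n * real n powr (-s) <= 1 * 1"
  using p1 ab[of n] nn[of n] by (intro mult_mono) auto
  thus ?thesis by simp
  qed simp
  hence "M' * (chi0 n * real n powr (-s)) <= M' * 1"
  using M' by (intro mult_left_mono) auto
  moreover have "0 <= chi0 n * (ln (real n) * real n powr (-s))"
  using nn by (cases n) auto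
  ultimately show ?thesis using True by simp
  next
  case False
  have "exp M' <= real n" using N False by linarith
  hence "M' <= ln (real n)" using False N by (simp add: ln_ge_iff)
  hence "(chi0 n * real n powr (-s)) * M' <= (chi0 n * real n powr (-s)) * ln (real n)"
  using nn by (intro mult_left_mono) auto
  thus ?thesis using False by (simp add: mult_ac)
  qed
  qed (intro summable_diff summable_mult D sums_summable[OF fin])+
  also have "(\<Sum>n. M' * (chi0 n * real n powr (-s)) - (if n : {..<N} then M' else 0)) = M' * Z s - real N * M'"
  proof -
  have "(%n. M' * (chi0 n * real n powr (-s))) sums (M' * Z s)"
  unfolding Z_def by (intro sums_mult summable_sums D(1))
  from sums_unique[OF sums_diff[OF this fin]] show ?thesis by simp
  qed
  finally have "M' * Z s - real N * M' <= ?V * Z s" using D(4) by (simp add: Z_def)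
  moreover have "M' * Z s - Z s <= M' * Z s - real N * M'" using elim by (simp add: mult.commute)
  ultimately have "(M' - 1) * Z s <= ?V * Z s" by (simp add: algebra_simps)
  moreover have "Z s > 0" using elim M' by (smt (verit) mult_nonneg_nonneg of_nat_0_le_iff)
  ultimately show ?case using M' by simp
 qed
qed

lemma prime_or_one_with_signs:
 fixes ch :: "'i => nat => real" and eps :: "'i => real"
 assumes fin: "finite I" and m: "m > 0"
  and mult: "!!i a b. i : I ==> ch i (a * b) = ch i a * ch i b"
  and one: "!!i. i : I ==> ch i 1 = 1"
  and per: "!!i a. i : I ==> ch i (a + m) = ch i a"
  and vals: "!!i a. i : I ==> ch i a : {-1, 0, 1}"
  and nz: "!!i a. i : I ==> coprime a m ==> ch i a ~= 0"
  and eps: "!!i. i : I ==> eps i : {-1, 1}"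
  and nonprincipal: "!!A. A <= I ==> A ~= {} ==> EX a. coprime a m & (PROD i:A. ch i a) = -1"
 shows "EX q. (q = 1 \<or> prime q) & coprime q m & (ALL i:I. ch i q = eps i)"
proof -
 define X where "X A n = of_bool (coprime n m) * (PROD i:A. ch i n)" for A n
 have finA: "finite A" if "A <= I" for A using fin that by (rule rev_finite_subset)
 have X_mult: "X A (a * b) = X A a * X A b" if "A <= I" for A a b
  using that mult by (auto simp: X_def prod.distrib[symmetric] intro!: prod.cong)
 have X_abs: "\<bar>X A a\<bar> <= 1" if "A <= I" for A a
 proof -
  have "\<bar>ch i a\<bar> <= 1" if "i : A" for i
  proof -
  have "i : I" using that \<open>A <= I\<close> by blast
  from vals[OF this, of a] show ?thesis by auto
  qed
  hence "(PROD i:A. \<bar>ch i a\<bar>) <= 1" by (intro prod_le_1) auto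
  thus ?thesis by (simp add: X_def abs_mult abs_prod)
 qed
 have rc: "real_character m (X A)" if A: "A <= I" "A ~= {}" for A
 proof
  show "X A (a * b) = X A a * X A b" for a b by (rule X_mult[OF A(1)])
  show "X A 1 = 1" using one A by (auto simp: X_def intro!: prod.neutral)
  show pX: "X A (a + m) = X A a" for a
  proof -
  have "coprime (a + m) m \<longleftrightarrow> coprime a m" by (simp only: coprime_iff_gcd_eq_1 gcd_add1)
  thus ?thesis using per A by (auto simp: X_def intro!: prod.cong)
  qed
  show "X A a : {-1, 0, 1}" for a
  proof -
  have "(PROD i:A. ch i a) : {-1, 0, 1}"
  using finA[OF A(1)] A(1) vals by (induction A rule: finite_induct) fastforce+
  thus ?thesis by (auto simp: X_def)
  qed
  have pm: "X A (a mod m) = X A a" for a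
  proof -
  have "X A (b + k * m) = X A b" for b k
  by (induction k) (auto simp: pX add.assoc[symmetric] add.commute[of m] pX[of "b + _", simplified add.assoc])
  from this[of "a mod m" "a div m"] show ?thesis by (simp add: mod_div_mult_eq)
  qed
  obtain a where a: "coprime a m" "(PROD i:A. ch i a) = -1" using nonprincipal[OF A] by blast
  \<comment> \<open>Multiplication by a permutes the residues and changes the sign of their
    character sum, which is therefore 0.\<close>
  have bij: "bij_betw (%r. (a * r) mod m) {..<m} {..<m}"
  proof (rule bij_betwI')
  show "(a * x mod m = a * y mod m) = (x = y)" if "x : {..<m}" "y : {..<m}" for x y
  using cong_mult_lcancel_nat[OF a(1), of x y] that by (auto simp: cong_def)
  show "(a * x) mod m : {..<m}" for x using m by simp
  fix y assume y: "y : {..<m}"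
  obtain b where b: "[a * b = 1] (mod m)" using cong_solve_coprime_nat[OF a(1)] by auto
  have "[a * (b * y) = 1 * y] (mod m)" using cong_mult[OF b cong_refl[of y]] by (simp add: mult_ac)
  hence "(a * ((b * y) mod m)) mod m = y" using y by (simp add: cong_def mod_mult_right_eq)
  thus "EX x:{..<m}. y = a * x mod m" using m by (intro bexI[of _ "(b * y) mod m"]) auto
  qed
  have "(\<Sum>r<m. X A r) = (\<Sum>r<m. X A ((a * r) mod m))"
  by (rule sum.reindex_bij_betw[OF bij, symmetric])
  also have "... = X A a * (\<Sum>r<m. X A r)"
  by (simp add: pm X_mult[OF A(1)] sum_distrib_left)
  also have "X A a = -1" using a by (simp add: X_def)
  finally show "(\<Sum>r<m. X A r) = 0" by simp
 qed (rule m)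
 define V where "V A s = (\<Sum>n. X A n * mangoldt n * real n powr (-s))" for A and s :: real
 have "ALL A:Pow I - {{}}. EX B. eventually (%s. \<bar>V A s\<bar> <= B) (at_right 1)"
  using real_character.mangoldt_sum_bounded[OF rc] unfolding V_def by blast
 then obtain B where B: "!!A. A : Pow I - {{}} ==> eventually (%s. \<bar>V A s\<bar> <= B A) (at_right 1)"
  by metis
 define Bs where "Bs = (SUM A:Pow I - {{}}. B A)"
 have finP: "finite (Pow I - {{}})" using fin by simp
 have "eventually (%s. ALL A:Pow I - {{}}. \<bar>V A s\<bar> <= B A) (at_right 1)"
  using B finP by (simp add: eventually_ball_finite)
 moreover have "eventually (%s. Bs + 1 <= V {} s) (at_right 1)"
  using principal_mangoldt_sum_unbounded[OF m, of "Bs + 1"] by (simp add: V_def X_def)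
 moreover have "eventually (%s::real. s > 1) (at_right 1)" by (simp add: eventually_at_right_less)
 ultimately have "eventually (%s. (ALL A:Pow I - {{}}. \<bar>V A s\<bar> <= B A) & Bs + 1 <= V {} s & s > 1) (at_right 1)"
  by eventually_elim auto
 hence "EX s. (ALL A:Pow I - {{}}. \<bar>V A s\<bar> <= B A) & Bs + 1 <= V {} s & s > 1"
  by (rule eventually_happens'[rotated]) simp
 then obtain s where s: "!!A. A\<in>Pow I - {{}} ==> \<bar>V A s\<bar> <= B A" "Bs + 1 <= V {} s" "s > 1"
  by blast
 define W where "W n = X {} n * mangoldt n * real n powr (-s) * (PROD i:I. 1 + eps i * ch i n)" for n
 have We: "W n = (SUM A:Pow I. (PROD i:A. eps i) * (X A n * mangoldt n * real n powr (-s)))" for n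
 proof -
  have "(PROD i:I. 1 + eps i * ch i n) = (SUM A:Pow I. PROD i:A. eps i * ch i n)"
  using prod_add[OF fin, of "%i. eps i * ch i n" "%_. 1"] by (simp add: add.commute)
  thus ?thesis by (simp add: W_def X_def sum_distrib_left prod.distrib mult_ac)
 qed
 have "W sums (SUM A:Pow I. (PROD i:A. eps i) * V A s)"
  unfolding We[abs_def] V_def
  by (intro sums_sum sums_mult summable_sums dirichlet_log_derivative(2)[OF X_mult X_abs s(3)]) auto
 moreover have "(SUM A:Pow I. (PROD i:A. eps i) * V A s) = V {} s + (SUM A:Pow I - {{}}. (PROD i:A. eps i) * V A s)"
  using fin by (subst sum.remove[where x = "{}"]) auto
 moreover have "\<bar>SUM A:Pow I - {{}}. (PROD i:A. eps i) * V A s\<bar> <= Bs"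
  unfolding Bs_def
 proof (intro order.trans[OF sum_abs] sum_mono)
  fix A assume A: "A : Pow I - {{}}"
  have "\<bar>PROD i:A. eps i\<bar> = 1" unfolding abs_prod using A eps by (intro prod.neutral) fastforce
  thus "\<bar>(PROD i:A. eps i) * V A s\<bar> <= B A" using s(1)[OF A] by (simp add: abs_mult)
 qed
 ultimately have "~ W sums 0" using s(2) sums_unique2[of W 0] by force
 then obtain n where n: "W n ~= 0" by (metis sums_0)
 have cop: "coprime n m" and lam: "mangoldt n ~= (0::real)" using n by (auto simp: W_def X_def)
 have chn: "ch i n = eps i" if i: "i : I" for i
 proof -
  have "1 + eps i * ch i n ~= 0" using n fin i by (auto simp: W_def)
  thus ?thesis using eps[OF i] vals[OF i, of n] nz[OF i cop] by auto
 qed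
 have "primepow n" using lam by (auto simp: mangoldt_def split: if_splits)
 then obtain p k where pk: "prime p" "k > 0" "n = p ^ k" by (auto simp: primepow_def)
 have chpow: "ch i (p ^ j) = ch i p ^ j" if "i : I" for i j
  using that by (induction j) (auto simp: mult one[simplified])
 have copp: "coprime p m" using cop pk by simp
 show ?thesis
 proof (cases "even k")
  case True
  have "eps i = 1" if i: "i : I" for i
  proof -
  have "eps i = ch i p ^ k" using chn[OF i] chpow[OF i] pk by simp
  thus ?thesis using True vals[OF i, of p] nz[OF i copp] by auto
  qed
  thus ?thesis using one by (intro exI[of _ 1]) auto
 next
  case False
  have "ch i p = eps i" if i: "i : I" for i
  proof -
  have "eps i = ch i p ^ k" using chn[OF i] chpow[OF i] pk by simp
  thus ?thesis using False vals[OF i, of p] nz[OF i copp] by auto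
  qed
  thus ?thesis using pk copp by auto
 qed
qed

section \<open>Sums of three squares\<close>

lemma davenport_cassels:
 fixes n :: int
 assumes "n * (int w)^2 = x^2 + y^2 + z^2" "w > 0"
 shows "EX a b c. n = a^2 + b^2 + c^2"
 using assms
proof (induction w arbitrary: x y z rule: less_induct)
 case (less w)
 define W where "W = int w"
 have W: "W > 0" "n * W^2 = x^2 + y^2 + z^2" using less.prems by (auto simp: W_def)
 have near: "EX t. (2 * (s - W * t))^2 <= W^2" for s
 proof -
  define t where "t = (2 * s + W) div (2 * W)"
  have e: "2 * s + W = (2 * W) * t + (2 * s + W) mod (2 * W)" by (simp add: t_def)
  have b: "0 <= (2 * s + W) mod (2 * W)" "(2 * s + W) mod (2 * W) < 2 * W" using W by auto
  have "2 * (s - W * t) = (2 * s + W) mod (2 * W) - W" using e by (simp add: algebra_simps)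
  hence "\<bar>2 * (s - W * t)\<bar> <= \<bar>W\<bar>" using b W by linarith
  thus ?thesis using abs_le_square_iff by blast
 qed
 obtain x' y' z' where near': "(2 * (x - W * x'))^2 <= W^2" "(2 * (y - W * y'))^2 <= W^2" "(2 * (z - W * z'))^2 <= W^2"
  using near by meson
 \<comment> \<open>The rational point (x, y, z) / W lies on the sphere of squared radius n. The line
   through it and a nearest integer point meets the sphere again in a point with denominator w' = N
   / W. Each coordinate is off by at most W / 2 before division, so N <= 3/4 W^2 and w' < W.\<close>
 define N where "N = (x - W * x')^2 + (y - W * y')^2 + (z - W * z')^2"
 have N4: "4 * N <= 3 * W^2" using near' by (simp add: N_def power2_eq_square algebra_simps)
 define a where "a = x'^2 + y'^2 + z'^2 - n"
 define b where "b = 2 * (n * W - (x * x' + y * y' + z * z'))"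
 define w' where "w' = a * W + b"
 have wN: "W * w' = N"
 proof -
  have "W * w' = W^2 * (x'^2 + y'^2 + z'^2) + n * W^2 - 2 * W * (x * x' + y * y' + z * z')"
  by (simp add: w'_def a_def b_def power2_eq_square algebra_simps)
  also have "... = N" unfolding W(2) N_def by (simp add: power2_eq_square algebra_simps)
  finally show ?thesis .
 qed
 show ?case
 proof (cases "N = 0")
  case True
  hence z0: "x - W * x' = 0" "y - W * y' = 0" "z - W * z' = 0"
  unfolding N_def by (smt (verit) zero_le_power2 power_eq_0_iff)+
  hence "n * W^2 = (x'^2 + y'^2 + z'^2) * W^2"
  using W(2) by (simp add: power2_eq_square algebra_simps)
  hence "n = x'^2 + y'^2 + z'^2" using W by simp
  thus ?thesis by blast
 next
  case False
  moreover have "N >= 0" by (simp add: N_def)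
  ultimately have "N > 0" by simp
  hence w'0: "w' > 0" using wN W by (metis zero_less_mult_pos)
  have "N < W^2" using N4 W by (smt (verit) zero_less_power)
  hence "W * w' < W * W" unfolding wN by (simp only: power2_eq_square)
  hence w'W: "w' < W" using W by simp
  define u where "u = x * x' + y * y' + z * z'"
  define p where "p = x'^2 + y'^2 + z'^2"
  have "(a * x + b * x')^2 + (a * y + b * y')^2 + (a * z + b * z')^2
  = a^2 * (x^2 + y^2 + z^2) + 2 * a * b * u + b^2 * p"
  unfolding u_def p_def by (simp add: power2_eq_square algebra_simps)
  also have "... = a^2 * (n * W^2) + a * b * (2 * u) + b^2 * p" unfolding W(2) by simp
  also have "2 * u = 2 * n * W - b" unfolding u_def b_def by simp
  also have "p = a + n" unfolding p_def a_def by simp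
  also have "a^2 * (n * W^2) + a * b * (2 * n * W - b) + b^2 * (a + n) = n * w'^2"
  unfolding w'_def by (simp add: power2_eq_square algebra_simps)
  finally have "n * (int (nat w'))^2 = (a * x + b * x')^2 + (a * y + b * y')^2 + (a * z + b * z')^2"
  using w'0 by simp
  moreover have "nat w' < w" "nat w' > 0" using w'W w'0 by (auto simp: W_def)
  ultimately show ?thesis using less.IH by blast
 qed
qed

lemma ceil_sqrt_ex: "EX k. (x::nat) <= k^2 & (ALL j<k. j^2 < x)"
proof -
 have "x <= x^2" by (simp add: power2_eq_square)
 hence "x <= (LEAST k. x <= k^2)^2" by (rule LeastI)
 moreover have "j^2 < x" if "j < (LEAST k. x <= k^2)" for j
  using not_less_Least[OF that] by simp
 ultimately show ?thesis by blast
qed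

lemma diff_sq_less:
 fixes i j k x :: nat
 assumes "i < k" "j < k" "!!j. j < k ==> j\<^sup>2 < x"
 shows "(int i - int j)^2 < int x"
proof -
 have "(int i - int j)^2 <= (int (max i j))^2"
  by (subst abs_le_square_iff[symmetric]) auto
 also have "... < int x" using assms(3)[of "max i j"] assms(1,2) by (simp flip: of_nat_power)
 finally show ?thesis .
qed

text \<open>Pigeonhole on a box with more than n q points: two of them agree in one linear form
  modulo n and in another modulo q. Their difference makes the quadratic form divisible by n q,
  while its size keeps it strictly between - n q and 2 n q.\<close>

lemma conic_solvable:
 fixes n q :: nat and lam mu :: int
 assumes n: "n > 1" "squarefree n" and q: "q > 0" and cop: "coprime n q"
  and lam: "[lam\<^sup>2 = - int q] (mod int n)" and mu: "[mu\<^sup>2 = int n] (mod int q)"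
 shows "EX z v w :: int. z^2 + int q * v^2 = int n * w^2 & w ~= 0"
proof -
 obtain kz where kz: "n * q <= kz^2" "!!j. j < kz ==> j\<^sup>2 < n * q" using ceil_sqrt_ex by blast
 obtain kv where kv: "n <= kv^2" "!!j. j < kv ==> j\<^sup>2 < n" using ceil_sqrt_ex by blast
 obtain kw where kw: "q <= kw^2" "!!j. j < kw ==> j\<^sup>2 < q" using ceil_sqrt_ex by blast
 \<comment> \<open>A squarefree n > 1 is not a square; this makes the box strictly larger than n
   q.\<close>
 have "kv^2 ~= n"
 proof
  assume "kv^2 = n"
  hence "kv dvd 1" using squarefreeD[OF n(2), of kv] by simp
  thus False using \<open>kv\<^sup>2 = n\<close> n(1) by simp
 qed
 hence kv': "n < kv^2" using kv(1) by simp
 have "(n * q)^2 < (kz * kv * kw)^2"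
 proof -
  have "n * q * (n * q) < kz^2 * (kv^2 * kw^2)"
  proof (rule mult_le_less_imp_less)
  show "n * q < kv^2 * kw^2" using kv' kw(1) q by (intro mult_less_le_imp_less) auto
  qed (use kz n q in auto)
  thus ?thesis by (simp add: power2_eq_square mult_ac)
 qed
 hence big: "n * q < kz * kv * kw" by (simp add: power2_nat_le_imp_le power_less_imp_less_base)
 define Bx where "Bx = {..<kz} \<times> {..<kv} \<times> {..<kw}"
 define f where "f = (%(z,v,w). ((int z - lam * int v) mod int n, (int z - mu * int w) mod int q))"
 have "f ` Bx <= {0..<int n} \<times> {0..<int q}" using n q by (auto simp: f_def)
 hence "card (f ` Bx) <= card ({0..<int n} \<times> {0..<int q})" by (intro card_mono) auto
 also have "... = n * q" by (simp add: card_cartesian_product)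
 also have "... < card Bx" using big by (simp add: Bx_def card_cartesian_product mult.assoc)
 finally have "~ inj_on f Bx" by (rule pigeonhole)
 then obtain a b where ab: "a : Bx" "b : Bx" "f a = f b" "a ~= b" unfolding inj_on_def by blast
 obtain z1 v1 w1 where a: "a = (z1, v1, w1)" by (metis prod_cases3)
 obtain z2 v2 w2 where b: "b = (z2, v2, w2)" by (metis prod_cases3)
 define z where "z = int z1 - int z2"
 define v where "v = int v1 - int v2"
 define w where "w = int w1 - int w2"
 have nz: "z ~= 0 \<or> v ~= 0 \<or> w ~= 0" using ab a b by (auto simp: z_def v_def w_def)
 have bz: "z^2 < int (n * q)" unfolding z_def using ab a b kz(2) by (intro diff_sq_less[of _ kz]) (auto simp: Bx_def)
 have bv: "v^2 < int n" unfolding v_def using ab a b kv(2) by (intro diff_sq_less[of _ kv]) (auto simp: Bx_def)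
 have bw: "w^2 < int q" unfolding w_def using ab a b kw(2) by (intro diff_sq_less[of _ kw]) (auto simp: Bx_def)
 have d1: "int n dvd z - lam * v"
 proof -
  have "int n dvd (int z1 - lam * int v1) - (int z2 - lam * int v2)"
  using ab(3) unfolding a b f_def by (auto simp: mod_eq_dvd_iff)
  thus ?thesis by (simp add: z_def v_def algebra_simps)
 qed
 have d2: "int q dvd z - mu * w"
 proof -
  have "int q dvd (int z1 - mu * int w1) - (int z2 - mu * int w2)"
  using ab(3) unfolding a b f_def by (auto simp: mod_eq_dvd_iff)
  thus ?thesis by (simp add: z_def w_def algebra_simps)
 qed
 define F where "F = z^2 + int q * v^2 - int n * w^2"
 have "int n dvd F"
 proof -
  have "int n dvd (lam^2 - (- int q))" using lam by (simp add: cong_iff_dvd_diff)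
  hence "int n dvd (z - lam * v) * (z + lam * v) + (lam^2 - (- int q)) * v^2 - int n * w^2"
  using d1 by (intro dvd_diff dvd_add) auto
  also have "... = F" by (simp add: F_def power2_eq_square algebra_simps)
  finally show ?thesis .
 qed
 moreover have "int q dvd F"
 proof -
  have "int q dvd (mu^2 - int n)" using mu by (simp add: cong_iff_dvd_diff)
  hence "int q dvd (z - mu * w) * (z + mu * w) + (mu^2 - int n) * w^2 + int q * v^2"
  using d2 by (intro dvd_add) auto
  also have "... = F" by (simp add: F_def power2_eq_square algebra_simps)
  finally show ?thesis .
 qed
 ultimately have "int n * int q dvd F" using cop by (intro divides_mult) auto
 then obtain k where k: "F = (int n * int q) * k" by auto
 have nq: "int n * int q > 0" using n q by simp
 have "int q * v^2 < int q * int n" using bv q by (intro mult_strict_left_mono) auto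
 moreover have "int n * w^2 < int n * int q" using bw n by (intro mult_strict_left_mono) auto
 moreover have "int q * v^2 >= 0" "int n * w^2 >= 0" "z^2 >= 0" by auto
 moreover have "z^2 < int n * int q" using bz by simp
 ultimately have "F < (int n * int q) * 2" "(int n * int q) * (-1) < F"
  unfolding F_def mult.commute[of "int q" "int n"] by linarith+
 hence "k < 2" "-1 < k" unfolding k using mult_less_cancel_left_pos[OF nq] by blast+
 then consider "k = 0" | "k = 1" by linarith
 thus ?thesis
 proof cases
  case 1
  hence e: "z^2 + int q * v^2 = int n * w^2" using k by (simp add: F_def)
  have "w ~= 0"
  proof
  assume "w = 0"
  hence "z^2 + int q * v^2 = 0" using e by simp
  moreover have "z^2 >= 0" "int q * v^2 >= 0" by auto
  ultimately have "z^2 = 0" "int q * v^2 = 0" by linarith+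
  thus False using nz \<open>w = 0\<close> q by simp
  qed
  thus ?thesis using e by blast
 next
  case 2
  hence e: "z^2 + int q * v^2 = int n * (w^2 + int q)" using k by (simp add: F_def algebra_simps)
  \<comment> \<open>Here the form equals n q. Multiplicativity of the norm, for z + v sqrt(-q) and w
    + sqrt(-q), turns this into a solution of the homogeneous equation with last coordinate w^2 +
    q.\<close>
  have "(z * w + int q * v)^2 + int q * (z - v * w)^2 = (z^2 + int q * v^2) * (w^2 + int q)"
  by (simp add: power2_eq_square algebra_simps)
  also have "... = int n * (w^2 + int q)^2" unfolding e by (simp add: power2_eq_square)
  finally show ?thesis using q
  by (metis add_nonneg_pos less_irrefl of_nat_0_less_iff zero_le_power2)
 qed
qed

text \<open>Thue's argument: two points of a small square agree in x - i y modulo q, and for their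
  difference x^2 + y^2 is divisible by q, positive and below 2 q.\<close>

lemma sum_two_squares_if_minus_one_square:
 fixes q :: nat and i :: int
 assumes q: "prime q" and i: "[i\<^sup>2 = -1] (mod int q)"
 shows "EX e f :: int. int q = e^2 + f^2"
proof -
 obtain k where k: "q <= k^2" "!!j. j < k ==> j\<^sup>2 < q" using ceil_sqrt_ex by blast
 have "k^2 ~= q" using q by (metis prime_power_iff[of k 2] one_eq_numeral_iff semiring_norm(85) prime_power_iff)
 hence big: "q < k * k" using k(1) by (simp add: power2_eq_square)
 define f where "f = (%(x,y). (int x - i * int y) mod int q)"
 have q0: "q > 0" using q prime_gt_0_nat by blast
 have "f ` ({..<k} \<times> {..<k}) <= {0..<int q}" using q0 by (auto simp: f_def)
 hence "card (f ` ({..<k} \<times> {..<k})) <= card {0..<int q}" by (intro card_mono) auto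
 also have "... < card ({..<k} \<times> {..<k})" using big by (simp add: card_cartesian_product)
 finally have "~ inj_on f ({..<k} \<times> {..<k})" by (rule pigeonhole)
 then obtain a b where ab: "a : {..<k} \<times> {..<k}" "b : {..<k} \<times> {..<k}" "f a = f b" "a ~= b" unfolding inj_on_def by blast
 obtain x1 y1 where a: "a = (x1, y1)" by (cases a)
 obtain x2 y2 where b: "b = (x2, y2)" by (cases b)
 define x where "x = int x1 - int x2"
 define y where "y = int y1 - int y2"
 have nz: "x ~= 0 \<or> y ~= 0" using ab a b by (auto simp: x_def y_def)
 have bx: "x^2 < int q" unfolding x_def using ab a b k(2) by (intro diff_sq_less[of _ k]) auto
 have by': "y^2 < int q" unfolding y_def using ab a b k(2) by (intro diff_sq_less[of _ k]) auto
 have d1: "int q dvd x - i * y"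
 proof -
  have "int q dvd (int x1 - i * int y1) - (int x2 - i * int y2)"
  using ab(3) unfolding a b f_def by (auto simp: mod_eq_dvd_iff)
  thus ?thesis by (simp add: x_def y_def algebra_simps)
 qed
 have "int q dvd (i^2 - (-1))" using i by (simp add: cong_iff_dvd_diff)
 hence "int q dvd (x - i * y) * (x + i * y) + (i^2 - (-1)) * y^2"
  using d1 by (intro dvd_add) auto
 also have "... = x^2 + y^2" by (simp add: power2_eq_square algebra_simps)
 finally obtain l where l: "x^2 + y^2 = int q * l" by auto
 have "x^2 + y^2 > 0" using nz by (simp add: sum_power2_gt_zero_iff)
 hence "l > 0" using l q0 by (simp add: zero_less_mult_iff)
 moreover have "int q * l < int q * 2" using l bx by' by linarith
 hence "l < 2" using q0 by simp
 ultimately have "l = 1" by simp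
 thus ?thesis using l by (metis mult.right_neutral)
qed

lemma int_dvd_small_imp_zero: "m dvd x ==> \<bar>x\<bar> < m ==> x = (0::int)"
 using dvd_imp_le_int[of x m] by (cases "x = 0") auto

lemma Legendre_vals: "Legendre a p : {-1, 0, 1}"
 by (auto simp: Legendre_def)

text \<open>Euler's criterion gives a congruence modulo p between numbers in {-1, 0, 1}, and p > 2
  turns it into an equality.\<close>

lemma Legendre_mult:
 assumes "prime p" "2 < p"
 shows "Legendre (a * b) (int p) = Legendre a (int p) * Legendre b (int p)"
proof -
 have "[Legendre (a * b) (int p) = Legendre a (int p) * Legendre b (int p)] (mod int p)"
  using euler_criterion[OF assms, of "a * b"] cong_mult[OF euler_criterion[OF assms, of a] euler_criterion[OF assms, of b]]
  by (metis cong_sym cong_trans power_mult_distrib)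
 hence "int p dvd Legendre (a * b) (int p) - Legendre a (int p) * Legendre b (int p)"
  by (simp add: cong_iff_dvd_diff)
 moreover have "\<bar>Legendre (a * b) (int p) - Legendre a (int p) * Legendre b (int p)\<bar> < int p"
  using Legendre_vals[of "a * b" p] Legendre_vals[of a p] Legendre_vals[of b p] assms by auto
 ultimately have "Legendre (a * b) (int p) - Legendre a (int p) * Legendre b (int p) = 0"
  by (rule int_dvd_small_imp_zero)
 thus ?thesis by simp
qed

lemma Legendre_cong:
 assumes "[a = b] (mod p)"
 shows "Legendre a p = Legendre b p"
proof -
 have "QuadRes p a \<longleftrightarrow> QuadRes p b" using assms unfolding QuadRes_def by (meson cong_sym cong_trans)
 moreover have "[a = 0] (mod p) \<longleftrightarrow> [b = 0] (mod p)" using assms by (meson cong_sym cong_trans)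
 ultimately show ?thesis by (simp add: Legendre_def)
qed

text \<open>Otherwise every residue would be a square and squaring would permute the residues, yet 1
  and p - 1 have the same square.\<close>

lemma ex_nonresidue:
 assumes p: "prime p" "2 < p"
 shows "EX a::nat. Legendre (int a) (int p) = -1"
proof (rule ccontr)
 assume no: "~ ?thesis"
 have sq: "EX y:{0..<p}. a = y^2 mod p" if a: "a : {0..<p}" for a
 proof (cases "a = 0")
  case False
  hence "~ [int a = 0] (mod int p)" using a by (auto simp: cong_def)
  moreover have "Legendre (int a) (int p) ~= -1" using no by blast
  ultimately have "QuadRes (int p) (int a)" by (auto simp: Legendre_def split: if_splits)
  then obtain y where y: "[y\<^sup>2 = int a] (mod int p)" by (auto simp: QuadRes_def)
  define z where "z = nat (y mod int p)"
  have z: "int z = y mod int p" using p by (simp add: z_def)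
  have "[(int z)\<^sup>2 = int a] (mod int p)" using y unfolding z by (simp add: cong_def power_mod)
  hence "[z\<^sup>2 = a] (mod p)" by (simp flip: of_nat_power add: cong_int_iff)
  hence "a = z^2 mod p" using a by (simp add: cong_def)
  moreover have "z < p" using p by (simp add: z_def nat_less_iff)
  ultimately show ?thesis by auto
 next
  case True
  thus ?thesis using p by (intro bexI[of _ 0]) auto
 qed
 hence "{0..<p} <= (%y. y^2 mod p) ` {0..<p}" by blast
 hence "card {0..<p} <= card ((%y. y^2 mod p) ` {0..<p})" by (intro card_mono) auto
 moreover have "card ((%y. y^2 mod p) ` {0..<p}) <= card {0..<p}" by (rule card_image_le) simp
 ultimately have inj: "inj_on (%y. y^2 mod p) {0..<p}" by (intro eq_card_imp_inj_on) simp_all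
 have eq: "1^2 mod p = (p - 1)^2 mod p"
 proof -
  have "(p - 1)^2 = 1 + p * (p - 2)"
  proof -
  obtain r where "p = r + 2" using p(2) by (metis add.commute le_iff_add less_imp_le)
  thus ?thesis by (simp add: power2_eq_square algebra_simps)
  qed
  thus ?thesis by (simp only: power_one mod_mult_self2)
 qed
 have "1 = p - 1" by (rule inj_onD[OF inj eq]) (use p in auto)
 thus False using p by simp
qed

text \<open>With i a square root of -1, (1 + i)^2 = 2 i. Raised to the power (q - 1) / 2 = 2 r, the
  left side becomes 1 and the right side the symbol of 2 times (-1)^r.\<close>

lemma Legendre_two:
 fixes i :: int
 assumes q: "prime q" "2 < q" and q4: "q mod 4 = 1" and i: "[i\<^sup>2 = -1] (mod int q)"
 shows "Legendre 2 (int q) = (if q mod 8 = 1 then 1 else -1)"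
proof -
 define r where "r = q div 4"
 have r: "q = 4 * r + 1" using q4 unfolding r_def by presburger
 hence h: "(q - 1) div 2 = 2 * r" by simp
 have odd2: "~ [2 = 0] (mod int q)"
 proof
  assume "[2 = 0] (mod int q)"
  hence "int q dvd 2" by (simp add: cong_0_iff)
  hence "int q <= 2" by (rule zdvd_imp_le) simp
  thus False using q by simp
 qed
 have sq: "[(1 + i)\<^sup>2 = 2 * i] (mod int q)"
 proof -
  have "(1 + i)^2 = (1 + 2 * i) + i^2" by (simp add: power2_eq_square algebra_simps)
  moreover have "[(1 + 2 * i) + i^2 = (1 + 2 * i) + -1] (mod int q)" using i by (intro cong_add cong_refl)
  ultimately show ?thesis by simp
 qed
 have i0: "~ int q dvd i"
 proof
  assume "int q dvd i"
  hence "int q dvd i\<^sup>2" by (simp add: power2_eq_square)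
  moreover have "int q dvd i\<^sup>2 + 1" using i by (simp add: cong_iff_dvd_diff)
  ultimately have "int q dvd 1" by (simp add: dvd_add_right_iff)
  thus False using q by simp
 qed
 have pq: "prime (int q)" using q by simp
 have nz: "~ [1 + i = 0] (mod int q)"
 proof
  assume "[1 + i = 0] (mod int q)"
  hence "int q dvd (1 + i)\<^sup>2" by (simp add: cong_0_iff power2_eq_square)
  hence "int q dvd 2 * i" using sq cong_dvd_iff by blast
  hence "int q dvd 2 \<or> int q dvd i" using pq by (simp add: prime_dvd_mult_iff)
  thus False using i0 odd2 by (simp add: cong_0_iff)
 qed
 have "(Legendre (1 + i) (int q))^2 = 1" using nz by (auto simp: Legendre_def)
 moreover have "[(Legendre (1 + i) (int q))\<^sup>2 = ((1 + i) ^ (2 * r))^2] (mod int q)"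
  using euler_criterion[OF q, of "1 + i"] unfolding h by (rule cong_pow)
 ultimately have e1: "[1 = ((1 + i)^2) ^ (2 * r)] (mod int q)"
  by (simp add: power_mult[symmetric] mult.commute)
 have e2: "[((1 + i)^2) ^ (2 * r) = (2 * i) ^ (2 * r)] (mod int q)"
  by (rule cong_pow[OF sq])
 have e3: "(2 * i) ^ (2 * r) = 2 ^ (2 * r) * (i^2) ^ r" by (simp add: power_mult_distrib power_mult[symmetric])
 have e4: "[2 ^ (2 * r) * (i^2) ^ r = Legendre 2 (int q) * (-1) ^ r] (mod int q)"
  using euler_criterion[OF q, of 2] i unfolding h by (intro cong_mult cong_pow) (auto simp: cong_sym_eq)
 have "[1 = Legendre 2 (int q) * (-1) ^ r] (mod int q)"
  using cong_trans[OF cong_trans[OF e1 e2]] e4 unfolding e3 by blast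
 hence d: "int q dvd 1 - Legendre 2 (int q) * (-1) ^ r" by (simp add: cong_iff_dvd_diff)
 have "Legendre 2 (int q) * (-1) ^ r = 1"
 proof (rule ccontr)
  assume ne: "Legendre 2 (int q) * (-1) ^ r ~= 1"
  have "Legendre 2 (int q) : {-1, 1}" using odd2 by (auto simp: Legendre_def)
  moreover have "(-1::int) ^ r : {-1, 1}" by (cases "even r") auto
  ultimately have "Legendre 2 (int q) * (-1) ^ r = -1" using ne by auto
  hence "int q dvd 2" using d by simp
  thus False using odd2 by (simp add: cong_0_iff)
 qed
 moreover have "q mod 8 = 1 \<longleftrightarrow> even r" unfolding r by presburger
 ultimately show ?thesis by (cases "even r") auto
qed

text \<open>The index 4 stands for the character modulo 4, the index 8 for the character that
 evaluates the symbol of 2, and an odd prime for its Legendre symbol.\<close>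

definition quadratic_symbol :: "nat => nat => int" where
 "quadratic_symbol i n =
  (if i = 4 then (if even n then 0 else if n mod 4 = 1 then 1 else -1)
  else if i = 8 then (if even n then 0 else if n mod 8 = 1 \<or> n mod 8 = 7 then 1 else -1)
  else Legendre (int n) (int i))"

lemma quadratic_symbol_mult:
 assumes "i = 4 \<or> i = 8 \<or> prime i & 2 < i"
 shows "quadratic_symbol i (a * b) = quadratic_symbol i a * quadratic_symbol i b"
proof -
 have m4: "(a * b) mod 4 = ((a mod 4) * (b mod 4)) mod 4" by (simp add: mod_mult_eq)
 have m8: "(a * b) mod 8 = ((a mod 8) * (b mod 8)) mod 8" by (simp add: mod_mult_eq)
 consider "i = 4" | "i = 8" | "prime i" "2 < i" "i ~= 4" "i ~= 8" using assms by blast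
 thus ?thesis
 proof cases
  case 1
  show ?thesis
  proof (cases "even a \<or> even b")
  case False
  hence "a mod 4 = 1 \<or> a mod 4 = 3" "b mod 4 = 1 \<or> b mod 4 = 3" by presburger+
  thus ?thesis using 1 False m4 by (auto simp: quadratic_symbol_def)
  qed (use 1 in \<open>auto simp: quadratic_symbol_def\<close>)
 next
  case 2
  show ?thesis
  proof (cases "even a \<or> even b")
  case False
  hence "a mod 8 = 1 \<or> a mod 8 = 3 \<or> a mod 8 = 5 \<or> a mod 8 = 7"
  "b mod 8 = 1 \<or> b mod 8 = 3 \<or> b mod 8 = 5 \<or> b mod 8 = 7" by presburger+
  thus ?thesis
  using False by (elim disjE; simp only: quadratic_symbol_def 2 even_mult_iff m8; simp)
  qed (use 2 in \<open>auto simp: quadratic_symbol_def\<close>)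
 next
  case 3
  thus ?thesis using Legendre_mult[of i "int a" "int b"] by (simp add: quadratic_symbol_def)
 qed
qed

lemma quadratic_symbol_cong:
 assumes "[a = b] (mod m)" "i dvd m" "i = 4 \<or> i = 8 \<or> prime i"
 shows "quadratic_symbol i a = quadratic_symbol i b"
proof -
 have c: "[a = b] (mod i)" using assms by (meson cong_dvd_modulus_nat)
 have "[int a = int b] (mod int i)" using c by (simp add: cong_int_iff)
 hence L: "Legendre (int a) (int i) = Legendre (int b) (int i)" by (rule Legendre_cong)
 have "even a \<longleftrightarrow> even b" if "i = 4 \<or> i = 8"
 proof -
  have "2 dvd i" using that by auto
  hence "[a = b] (mod 2)" using c by (rule cong_dvd_modulus_nat[rotated])
  thus ?thesis by (simp add: cong_def even_iff_mod_2_eq_zero)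
 qed
 thus ?thesis using c L by (auto simp: quadratic_symbol_def cong_def)
qed

lemma quadratic_symbol_prod:
 assumes "finite P" "i = 4 \<or> i = 8 \<or> prime i & 2 < i"
 shows "quadratic_symbol i (\<Prod>P) = (PROD p:P. quadratic_symbol i p)"
 using assms(1)
proof (induction P rule: finite_induct)
 case empty
 have "Legendre 1 (int i) = 1" if "prime i"
 proof -
  have "QuadRes (int i) 1" unfolding QuadRes_def by (rule exI[of _ 1]) simp
  moreover have "~ [1 = 0] (mod int i)" using that by (auto simp: cong_0_iff)
  ultimately show ?thesis by (simp add: Legendre_def)
 qed
 thus ?case using assms(2) by (auto simp: quadratic_symbol_def)
qed (simp add: quadratic_symbol_mult[OF assms(2)])

lemma Legendre_minus_one:
 assumes "prime p" "2 < p"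
 shows "Legendre (-1) (int p) = quadratic_symbol 4 p"
proof -
 have odd: "odd p" using assms prime_odd_nat by blast
 have "[Legendre (-1) (int p) = (-1) ^ ((p - 1) div 2)] (mod int p)" by (rule euler_criterion[OF assms])
 moreover have "(-1::int) ^ ((p - 1) div 2) = quadratic_symbol 4 p"
 proof -
  have "p mod 4 = 1 \<or> p mod 4 = 3" using odd by presburger
  hence "p mod 4 = 1 & even ((p - 1) div 2) \<or> p mod 4 = 3 & odd ((p - 1) div 2)" by presburger
  thus ?thesis using odd by (auto simp: quadratic_symbol_def)
 qed
 ultimately have "int p dvd Legendre (-1) (int p) - quadratic_symbol 4 p" by (simp add: cong_iff_dvd_diff)
 moreover have "\<bar>Legendre (-1) (int p) - quadratic_symbol 4 p\<bar> < int p"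
  using Legendre_vals[of "-1" "int p"] assms by (auto simp: quadratic_symbol_def)
 ultimately have "Legendre (-1) (int p) - quadratic_symbol 4 p = 0"
  by (rule int_dvd_small_imp_zero)
 thus ?thesis by simp
qed

text \<open>The characters are independent. If A contains an odd prime p, the residue is a
  nonresidue modulo p and 1 modulo all other factors. Otherwise 3 modulo 8 serves for A = {4}, and 5
  modulo 8 for the sets containing 8.\<close>

lemma ex_with_quadratic_symbols:
 assumes fin: "finite P" and P: "!!p. p : P ==> prime p & 2 < p"
  and A: "A <= P \<union> {4, 8}" "A ~= {}"
 shows "EX a. coprime a (8 * \<Prod>P) & (PROD i:A. real_of_int (quadratic_symbol i a)) = -1"
proof -
 have nP: "4 ~: P" "8 ~: P"
  using P[of 4] P[of 8] prime_odd_nat[of 4] prime_odd_nat[of 8] by auto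
 define B where "B = insert 8 P"
 have finB: "finite B" using fin by (simp add: B_def)
 have copB: "ALL i:B. ALL j:B. i ~= j --> coprime i j"
 proof (intro ballI impI)
  fix i j assume ij: "i : B" "j : B" "i ~= j"
  have c8: "coprime 8 p" "coprime p 8" if "p : P" for p
  proof -
  have "odd p" using P[OF that] prime_odd_nat by blast
  thus "coprime 8 p" using coprime_power_left_iff[of 2 3 p] by simp
  thus "coprime p 8" by (simp only: coprime_commute)
  qed
  show "coprime i j"
  using ij c8 P by (auto simp: B_def intro: primes_coprime)
 qed
 have "EX u. (ALL i:B. coprime (u i) i) & (ALL a. (ALL i:B. [a = u i] (mod i)) --> (PROD i:A. real_of_int (quadratic_symbol i a)) = -1)"
 proof (cases "A \<inter> P = {}")
  case True
  define e where "e = (if A = {4} then 3 else 5 :: nat)"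
  have A48: "A = {4} \<or> A = {8} \<or> A = {4, 8}" using A True by auto
  show ?thesis
  proof (intro exI[of _ "%i. if i = 8 then e else 1"] conjI allI impI)
  show "ALL i:B. coprime (if i = 8 then e else 1) i" by (auto simp: e_def coprime_iff_gcd_eq_1 gcd_non_0_nat)
  fix a assume "ALL i:B. [a = (if i = 8 then e else 1)] (mod i)"
  hence "[a = e] (mod 8)" by (auto simp: B_def)
  hence "quadratic_symbol 4 a = quadratic_symbol 4 e" "quadratic_symbol 8 a = quadratic_symbol 8 e"
  by (intro quadratic_symbol_cong[of _ _ 8]; simp)+
  thus "(PROD i:A. real_of_int (quadratic_symbol i a)) = -1"
  using A48 by (auto simp: e_def quadratic_symbol_def)
  qed
 next
  case False
  then obtain p where p: "p : A" "p : P" by blast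
  obtain r where r: "Legendre (int r) (int p) = -1" using ex_nonresidue P[OF p(2)] by blast
  show ?thesis
  proof (intro exI[of _ "%i. if i = p then r else 1"] conjI allI impI)
  have "~ p dvd r" using r by (auto simp: Legendre_def cong_0_iff split: if_splits)
  hence "coprime r p" using P[OF p(2)] by (metis coprime_commute prime_imp_coprime)
  thus "ALL i:B. coprime (if i = p then r else 1) i" by auto
  fix a assume a: "ALL i:B. [a = (if i = p then r else 1)] (mod i)"
  have qs: "quadratic_symbol i a = (if i = p then -1 else 1)" if i: "i : A" for i
  proof (cases "i : P")
  case True
  hence "[a = (if i = p then r else 1)] (mod i)" using a by (auto simp: B_def)
  hence "quadratic_symbol i a = quadratic_symbol i (if i = p then r else 1)"
  using P[OF True] by (intro quadratic_symbol_cong) auto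
  moreover have "quadratic_symbol i 1 = 1"
  using quadratic_symbol_prod[of "{}" i] P[OF True] by simp
  ultimately show ?thesis using r True nP by (auto simp: quadratic_symbol_def)
  next
  case False
  hence i48: "i = 4 \<or> i = 8" "i ~= p" using i A p by auto
  have "p ~= 8" using p nP by auto
  hence "[a = 1] (mod 8)" using a by (auto simp: B_def)
  hence "quadratic_symbol i a = quadratic_symbol i 1"
  using i48 by (intro quadratic_symbol_cong[of _ _ 8]) auto
  thus ?thesis using i48 by (auto simp: quadratic_symbol_def)
  qed
  have finA: "finite A" using A fin by (meson finite.intros finite_Un finite_subset)
  have "(PROD i:A. real_of_int (quadratic_symbol i a)) = (PROD i:A. if i = p then -1 else 1)"
  by (intro prod.cong) (auto simp: qs)
  also have "... = -1" using finA p by (simp add: prod.delta)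
  finally show "(PROD i:A. real_of_int (quadratic_symbol i a)) = -1" .
  qed
 qed
 then obtain u where u: "ALL i:B. coprime (u i) i"
  "!!a. ALL i:B. [a = u i] (mod i) ==> (PROD i:A. real_of_int (quadratic_symbol i a)) = -1" by blast
 obtain a where a: "ALL i:B. [a = u i] (mod i)"
  using chinese_remainder_nat[of B "%i. i" u] finB copB by auto
 have copa: "coprime a i" if "i : B" for i
  using u(1) a that by (meson cong_imp_coprime cong_sym)
 have "coprime a 8" using copa by (simp add: B_def)
 moreover have "coprime a (\<Prod>P)" using copa by (intro prod_coprime_right) (auto simp: B_def)
 ultimately show ?thesis using u(2)[OF a] by (intro exI[of _ a]) auto
qed

lemma square_mod_squarefree:
 fixes c :: int
 assumes "finite P" "!!p. p : P ==> prime p" "!!p. p : P ==> EX y. [y\<^sup>2 = c] (mod int p)"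
 shows "EX y. [y\<^sup>2 = c] (mod int (\<Prod>P))"
 using assms
proof (induction P rule: finite_induct)
 case empty
 thus ?case by simp
next
 case (insert p P)
 have "EX y. [y\<^sup>2 = c] (mod int (\<Prod>P))" using insert.prems by (intro insert.IH) auto
 then obtain y where y: "[y\<^sup>2 = c] (mod int (\<Prod>P))" by blast
 obtain z where z: "[z\<^sup>2 = c] (mod int p)" using insert.prems by blast
 have "coprime p (\<Prod>P)"
  using insert by (intro prod_coprime_right primes_coprime) auto
 hence cop: "coprime (int p) (int (\<Prod>P))" by (simp only: coprime_int_iff)
 obtain x where x: "[x = z] (mod int p)" "[x = y] (mod int (\<Prod>P))"
  using binary_chinese_remainder_int[OF cop] by blast
 have "[x\<^sup>2 = c] (mod int p)" "[x\<^sup>2 = c] (mod int (\<Prod>P))"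
  using x y z by (meson cong_pow cong_trans)+
 hence "[x\<^sup>2 = c] (mod int p * int (\<Prod>P))" using cop by (simp add: coprime_cong_mult)
 thus ?case using insert by (intro exI[of _ x]) simp
qed

text \<open>The auxiliary q is 1 modulo 4 and, at each odd prime dividing n, has the same symbol as
  -1, so -q is a square modulo n. Reciprocity and the condition on the symbol of 2 make n a square
  modulo q. Then z^2 + q v^2 = n w^2 is solvable, and q = e^2 + f^2 makes n w^2 a sum of three
  squares, from which \<open>davenport_cassels\<close> removes w.\<close>

lemma three_squares_squarefree:
 assumes n: "squarefree n" "n mod 4 = 1 \<or> n mod 4 = 2"
 shows "EX x y z :: int. int n = x^2 + y^2 + z^2"
proof (cases "n = 1")
 case True
 hence "int n = 1^2 + 0^2 + 0^2" by simp
 thus ?thesis by blast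
next
 case False
 hence n1: "n > 1" using n(2) by (cases n) auto
 define P where "P = prime_factors n - {2}"
 define delta where "delta = (if even n then 2 else 1 :: nat)"
 have P: "prime p & 2 < p" if "p : P" for p
  using that prime_ge_2_nat[of p] by (auto simp: P_def in_prime_factors_iff)
 have finP: "finite P" by (simp add: P_def)
 have n_eq: "n = delta * \<Prod>P"
 proof -
  have "n = \<Prod>(prime_factors n)"
  proof -
  have "(PROD p:prime_factors n. p ^ multiplicity p n) = (PROD p:prime_factors n. p)"
  proof (intro prod.cong refl)
  fix p assume p: "p : prime_factors n"
  hence "prime p" by auto
  have "multiplicity p n > 0" using p n1 by (simp add: prime_factors_multiplicity)
  moreover have "multiplicity p n <= 1"
  using n(1) \<open>prime p\<close> n1 by (simp add: squarefree_factorial_semiring'')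
  ultimately have "multiplicity p n = 1" by linarith
  thus "p ^ multiplicity p n = p" by simp
  qed
  thus ?thesis using prime_factorization_nat[of n] n1 by simp
  qed
  also have "... = delta * \<Prod>P"
  proof (cases "even n")
  case True
  hence "2 : prime_factors n" using n1 by (simp add: in_prime_factors_iff)
  hence "\<Prod>(prime_factors n) = 2 * \<Prod>(prime_factors n - {2})"
  by (subst prod.remove) auto
  thus ?thesis using True by (simp add: delta_def P_def)
  next
  case False
  hence "prime_factors n - {2} = prime_factors n" by (auto simp: in_prime_factors_iff)
  thus ?thesis using False by (simp add: delta_def P_def)
  qed
  finally show ?thesis .
 qed
 have n_odd: "n = \<Prod>P" if "odd n" using that n_eq unfolding delta_def by presburger
 have n_even: "n = 2 * \<Prod>P" if "even n" using that n_eq unfolding delta_def by presburger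
 define E where "E = (PROD p:P. quadratic_symbol 4 p)"
 have q4P: "quadratic_symbol 4 p : {-1, 1}" if "p : P" for p
  using P[OF that] prime_odd_nat[of p] by (auto simp: quadratic_symbol_def)
 have E: "E : {-1, 1}"
 proof -
  have "\<bar>E\<bar> = 1" unfolding E_def abs_prod using q4P by (intro prod.neutral) fastforce
  thus ?thesis by auto
 qed
 \<comment> \<open>For odd n the product of the symbols is the symbol of n itself, and n is 1 modulo
   4.\<close>
 have E1: "E = 1" if "odd n"
 proof -
  have "n mod 4 = 1" using n(2) that by presburger
  hence "quadratic_symbol 4 (\<Prod>P) = 1"
  unfolding n_odd[OF that, symmetric] using that by (simp add: quadratic_symbol_def)
  thus ?thesis unfolding E_def using quadratic_symbol_prod[OF finP, of 4] by simp
 qed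
 \<comment> \<open>The sign at 8 will be the symbol of 2 modulo q. It has to equal \<open>E\<close>,
   so that for even n the factor 2 compensates the odd part.\<close>
 define eps where "eps i = (if i = 4 then 1 else if i = 8 then real_of_int E else real_of_int (quadratic_symbol 4 i))" for i :: nat
 have nP: "4 ~: P" "8 ~: P"
  using P[of 4] P[of 8] prime_odd_nat[of 4] prime_odd_nat[of 8] by auto
 have idx: "i = 4 \<or> i = 8 \<or> prime i & 2 < i" if "i : P \<union> {4, 8}" for i using that P by auto
 have "EX q. (q = 1 \<or> prime q) & coprime q (8 * \<Prod>P) & (ALL i:P \<union> {4, 8}. real_of_int (quadratic_symbol i q) = eps i)"
 proof (rule prime_or_one_with_signs)
  show "finite (P \<union> {4, 8})" using finP by simp
  have "0 < p" if "p : P" for p using P[OF that] by simp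
  thus "8 * \<Prod>P > 0" by (simp add: prod_pos)
  fix i a b assume i: "i : P \<union> {4, 8}"
  show "real_of_int (quadratic_symbol i (a * b)) = real_of_int (quadratic_symbol i a) * real_of_int (quadratic_symbol i b)"
  using quadratic_symbol_mult[OF idx[OF i]] by simp
  show "real_of_int (quadratic_symbol i 1) = 1"
  using quadratic_symbol_prod[OF finite.emptyI idx[OF i]] by simp
  have id: "i dvd 8 * \<Prod>P" using i finP by (auto intro: dvd_mult dvd_prodI)
  show "real_of_int (quadratic_symbol i (a + 8 * \<Prod>P)) = real_of_int (quadratic_symbol i a)"
  using quadratic_symbol_cong[OF _ id, of "a + 8 * \<Prod>P" a] idx[OF i] by (auto simp: cong_def)
  show "real_of_int (quadratic_symbol i a) : {-1, 0, 1}"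
  using Legendre_vals[of "int a" "int i"] by (auto simp: quadratic_symbol_def)
  show "coprime a (8 * \<Prod>P) ==> real_of_int (quadratic_symbol i a) ~= 0"
  proof -
  assume c: "coprime a (8 * \<Prod>P)"
  hence "coprime a 8" by simp
  hence "odd a" by (metis coprime_common_divisor dvd_refl even_numeral odd_one coprime_divisors)
  moreover have "~ i dvd a" if "prime i"
  using c id that coprime_common_divisor not_prime_unit by blast
  ultimately show ?thesis using idx[OF i] by (auto simp: quadratic_symbol_def Legendre_def cong_0_iff)
  qed
  show "eps i : {-1, 1}" using i E q4P[of i] by (auto simp: eps_def)
 next
  fix A assume "A <= P \<union> {4, 8}" "A ~= {}"
  thus "EX a. coprime a (8 * \<Prod>P) & (PROD i:A. real_of_int (quadratic_symbol i a)) = -1"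
  using ex_with_quadratic_symbols[OF finP P] by blast
 qed
 then obtain q where q: "q = 1 \<or> prime q" "coprime q (8 * \<Prod>P)"
  "!!i. i : P \<union> {4, 8} ==> real_of_int (quadratic_symbol i q) = eps i" by blast
 have q0: "q > 0" using q(1) prime_gt_0_nat by auto
 have qP: "quadratic_symbol p q = quadratic_symbol 4 p" if "p : P" for p
 proof -
  have "p ~= 4" "p ~= 8" using nP that by auto
  thus ?thesis using q(3)[of p] that by (simp add: eps_def)
 qed
 have q8: "quadratic_symbol 8 q = E" using q(3)[of 8] by (simp add: eps_def)
 have "quadratic_symbol 4 q = 1" using q(3)[of 4] by (simp add: eps_def)
 hence q4: "q mod 4 = 1" by (auto simp: quadratic_symbol_def split: if_splits)
 have copq: "coprime n q"
 proof -
  have "coprime q (\<Prod>P)" "coprime q 8" using q(2) by auto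
  moreover have "coprime q delta" using \<open>coprime q 8\<close>
  by (auto simp: delta_def intro: coprime_divisors[of q q 2 8])
  ultimately show ?thesis unfolding n_eq by (simp add: coprime_commute)
 qed
 have "EX lam. [lam\<^sup>2 = - int q] (mod int (\<Prod>P))"
 proof (rule square_mod_squarefree[OF finP])
  fix p assume p: "p : P"
  show "prime p" using P[OF p] by simp
  have "p ~= 4" "p ~= 8" using p nP by auto
  hence "Legendre (int q) (int p) = Legendre (-1) (int p)"
  using qP[OF p] Legendre_minus_one P[OF p] by (simp add: quadratic_symbol_def[of p])
  hence "Legendre (-1 * int q) (int p) = 1"
  using Legendre_mult[of p "-1" "int q"] P[OF p] q4P[OF p] Legendre_minus_one by auto
  thus "EX y. [y\<^sup>2 = - int q] (mod int p)"
  by (auto simp: Legendre_def QuadRes_def split: if_splits)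
 qed
 then obtain l0 where l0: "[l0\<^sup>2 = - int q] (mod int (\<Prod>P))" by blast
 have "EX lam. [lam\<^sup>2 = - int q] (mod int n)"
 proof (cases "even n")
  case True
  have oddP: "odd (\<Prod>P)" using finP P prime_odd_nat by (induction P rule: finite_induct) auto
  have oddP': "odd (prod int P)"
  proof -
  have "odd (int (\<Prod>P))" using oddP by (simp only: even_of_nat not_False_eq_True)
  thus ?thesis by simp
  qed
  \<comment> \<open>Adding the odd modulus if necessary makes the root odd, hence a root modulo 2 as
    well.\<close>
  have "EX l. [l = l0] (mod int (\<Prod>P)) & odd l"
  proof (cases "odd l0")
  case False
  thus ?thesis using oddP' by (intro exI[of _ "l0 + int (\<Prod>P)"]) (auto simp: cong_def)
  next
  case True
  thus ?thesis by (intro exI[of _ l0]) (auto simp: cong_def)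
  qed
  then obtain l where l: "[l = l0] (mod int (\<Prod>P))" "odd l" by blast
  have "[l\<^sup>2 = - int q] (mod int (\<Prod>P))" using l(1) l0 by (meson cong_pow cong_trans)
  moreover have "[l\<^sup>2 = - int q] (mod 2)"
  proof -
  have "odd q" using q4 by presburger
  thus ?thesis using l(2) by (simp add: cong_iff_dvd_diff)
  qed
  moreover have "coprime (2::int) (int (\<Prod>P))" using oddP' by simp
  ultimately have "[l\<^sup>2 = - int q] (mod 2 * int (\<Prod>P))" by (simp add: coprime_cong_mult)
  moreover have "int n = 2 * int (\<Prod>P)" using n_even[OF True] by (metis of_nat_mult of_nat_numeral)
  ultimately show ?thesis by metis
 next
  case False
  thus ?thesis using l0 n_odd by metis
 qed
 then obtain lam where lam: "[lam\<^sup>2 = - int q] (mod int n)" by blast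
 have q_split: "(EX mu. [mu\<^sup>2 = int n] (mod int q)) & (EX e f :: int. int q = e^2 + f^2)"
 proof (cases "q = 1")
  case True
  hence "int q = 1^2 + 0^2" by simp
  moreover have "[0\<^sup>2 = int n] (mod int q)" using True by simp
  ultimately show ?thesis by blast
 next
  case False
  hence pq: "prime q" using q(1) by blast
  have q2: "2 < q" using pq q4 prime_ge_2_nat[OF pq] by (cases "q = 2") auto
  have "Legendre (-1) (int q) = 1" using Legendre_minus_one[OF pq q2] q4 by (auto simp: quadratic_symbol_def) presburger
  then obtain i where i: "[i\<^sup>2 = -1] (mod int q)"
  by (auto simp: Legendre_def QuadRes_def split: if_splits)
  have ef: "EX e f :: int. int q = e^2 + f^2" by (rule sum_two_squares_if_minus_one_square[OF pq i])
  have L2: "Legendre 2 (int q) = E"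
  proof -
  have "q mod 8 = 1 \<or> q mod 8 = 5" "odd q" using q4 by presburger+
  thus ?thesis using Legendre_two[OF pq q2 q4 i] q8 by (auto simp: quadratic_symbol_def split: if_splits)
  qed
  have Lp: "Legendre (int p) (int q) = quadratic_symbol 4 p" if p: "p : P" for p
  proof -
  have "p dvd n" unfolding n_eq using dvd_prodI[OF finP p, of "%x. x"] by simp
  hence pn: "p ~= q" using copq pq coprime_common_divisor[of n q q] by (auto simp: not_prime_unit)
  have "even ((q - 1) div 2)" using q4 by presburger
  hence "Legendre (int p) (int q) * Legendre (int q) (int p) = 1"
  using Quadratic_Reciprocity[of p q] P[OF p] pq q2 pn by simp
  moreover have "Legendre (int q) (int p) = quadratic_symbol 4 p"
  
  proof -
  have "p ~= 4" "p ~= 8" using p nP by auto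
  thus ?thesis using qP[OF p] by (simp add: quadratic_symbol_def[of p])
  qed
  ultimately show ?thesis using q4P[OF p] by auto
  qed
  have "quadratic_symbol q (\<Prod>P) = (PROD p:P. quadratic_symbol q p)"
  using pq q2 by (intro quadratic_symbol_prod finP) auto
  moreover have "q ~= 4" "q ~= 8" using q4 by auto
  ultimately have LP: "Legendre (int (\<Prod>P)) (int q) = E"
  unfolding E_def by (simp add: quadratic_symbol_def[of q] Lp del: of_nat_prod)
  have "Legendre (int n) (int q) = 1"
  proof (cases "even n")
  case True
  hence "int n = 2 * int (\<Prod>P)" using n_even by (metis of_nat_mult of_nat_numeral)
  hence "Legendre (int n) (int q) = E * E" using Legendre_mult[OF pq q2, of 2 "int (\<Prod>P)"] L2 LP by simp
  thus ?thesis using E by auto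
  next
  case False
  thus ?thesis using n_odd LP E1 by metis
  qed
  hence "EX mu. [mu\<^sup>2 = int n] (mod int q)" by (auto simp: Legendre_def QuadRes_def split: if_splits)
  thus ?thesis using ef by blast
 qed
 then obtain mu e f where mu: "[mu\<^sup>2 = int n] (mod int q)" and ef: "int q = e^2 + f^2" by blast
 obtain z v w where zvw: "z^2 + int q * v^2 = int n * w^2" "w ~= 0"
  using conic_solvable[OF n1 n(1) q0 copq lam mu] by blast
 have "int n * (int (nat \<bar>w\<bar>))^2 = z^2 + (e * v)^2 + (f * v)^2"
  using zvw(1) ef by (simp add: power_mult_distrib algebra_simps)
 thus ?thesis using davenport_cassels[of "int n" "nat \<bar>w\<bar>" z "e * v" "f * v"] zvw(2) by auto
qed

text \<open>An odd square is 1 modulo 4, so dividing it out preserves the residue of n; an even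
  square factor is excluded by that residue.\<close>

lemma three_squares:
 assumes "n mod 4 = 1 \<or> n mod 4 = 2"
 shows "EX x y z :: int. int n = x^2 + y^2 + z^2"
 using assms
proof (induction n rule: less_induct)
 case (less n)
 show ?case
 proof (cases "squarefree n")
  case True
  thus ?thesis using three_squares_squarefree less.prems by blast
 next
  case False
  then obtain d where d: "d^2 dvd n" "~ d dvd 1" by (auto simp: squarefree_def)
  then obtain k where k: "n = d^2 * k" by auto
  have n0: "n > 0" using less.prems by (cases n) auto
  have d1: "d > 1" using d n0 k by (cases "d = 0") auto
  have "odd d"
  proof
  assume "even d"
  then obtain c where "d = 2 * c" by auto
  hence "4 dvd n" using k by (simp add: power_mult_distrib)
  thus False using less.prems by auto
  qed
  hence "d^2 mod 4 = 1"
  proof -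
  obtain c where "d = 2 * c + 1" using \<open>odd d\<close> oddE by blast
  hence "d^2 = 4 * (c^2 + c) + 1" by (simp add: power2_eq_square algebra_simps)
  thus ?thesis by simp
  qed
  hence "n mod 4 = k mod 4" unfolding k by (metis mod_mult_left_eq mult_1)
  moreover have "1 * k < d^2 * k" using n0 k d1 by (intro mult_strict_right_mono one_less_power) auto
  hence "k < n" using k by simp
  ultimately obtain x y z :: int where "int k = x^2 + y^2 + z^2" using less by metis
  hence "int n = (int d * x)^2 + (int d * y)^2 + (int d * z)^2"
  unfolding k by (simp add: power_mult_distrib algebra_simps)
  thus ?thesis by blast
 qed
qed

section \<open>Smooth functions\<close>

lemma dirderiv_eqI: "(f has_derivative D) (at p) ==> dirderiv v f p = D v"
 unfolding dirderiv_def using frechet_derivative_at by metis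

lemma times_differentiable_mono: "times_differentiable (Suc n) f ==> times_differentiable n f"
proof (induction n arbitrary: f)
 case 0
 thus ?case by (simp add: differentiable_imp_continuous_on)
next
 case (Suc n)
 thus ?case by (metis times_differentiable.simps(2))
qed

lemma differentiable_has_derivative:
 assumes "f differentiable_on UNIV"
 shows "(f has_derivative (%v. dirderiv v f p)) (at p)"
proof -
 have "f differentiable (at p)" using assms by (auto simp: differentiable_on_def)
 thus ?thesis unfolding dirderiv_def by (simp add: frechet_derivative_works[symmetric])
qed

lemma times_differentiable_const:
 "times_differentiable n (%_ :: 'a::real_normed_vector. c :: 'b::real_normed_vector)"
proof (induction n arbitrary: c)
 case (Suc n)
 have "dirderiv v (%_ :: 'a. c) = (%_. 0)" for v
  by (rule ext, rule dirderiv_eqI[of _ "%_. 0"]) (rule has_derivative_const)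
 thus ?case using Suc by simp
qed simp

lemma times_differentiable_add:
 "times_differentiable n f ==> times_differentiable n g ==> times_differentiable n (%p. f p + g p)"
proof (induction n arbitrary: f g)
 case 0
 thus ?case by (simp add: continuous_on_add)
next
 case (Suc n)
 hence d: "f differentiable_on UNIV" "g differentiable_on UNIV" by auto
 have "dirderiv v (%p. f p + g p) = (%p. dirderiv v f p + dirderiv v g p)" for v
  by (rule ext, rule dirderiv_eqI) (intro has_derivative_add differentiable_has_derivative d)
 thus ?case using Suc d by (auto intro: differentiable_on_add)
qed

lemma times_differentiable_mult:
 fixes f g :: "'a::real_normed_vector => real"
 shows "times_differentiable n f ==> times_differentiable n g ==> times_differentiable n (%p. f p * g p)"
proof (induction n arbitrary: f g)
 case 0
 thus ?case by (simp add: continuous_on_mult)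
next
 case (Suc n)
 hence d: "f differentiable_on UNIV" "g differentiable_on UNIV" by auto
 have e: "dirderiv v (%p. f p * g p) = (%p. f p * dirderiv v g p + dirderiv v f p * g p)" for v
  by (rule ext, rule dirderiv_eqI) (intro has_derivative_mult differentiable_has_derivative d)
 have "times_differentiable n f" "times_differentiable n g"
  using Suc.prems times_differentiable_mono by blast+
 hence "times_differentiable n (dirderiv v (%p. f p * g p))" for v
  unfolding e using Suc by (intro times_differentiable_add Suc.IH) auto
 moreover have "(%p. f p * g p) differentiable_on UNIV" using d by (intro differentiable_on_mult)
 ultimately show ?case by simp
qed

lemma times_differentiable_scaleR:
 fixes f :: "'a::real_normed_vector => real" and c :: "'b::real_normed_vector"
 shows "times_differentiable n f ==> times_differentiable n (%p. f p *\<^sub>R c)"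
proof (induction n arbitrary: f)
 case 0
 thus ?case by (simp add: continuous_on_scaleR)
next
 case (Suc n)
 hence d: "f differentiable_on UNIV" by auto
 have der: "((%p. f p *\<^sub>R c) has_derivative (%v. dirderiv v f p *\<^sub>R c)) (at p)" for p
  using has_derivative_scaleR_left[OF differentiable_has_derivative[OF d]] .
 have "dirderiv v (%p. f p *\<^sub>R c) = (%p. dirderiv v f p *\<^sub>R c)" for v
  by (rule ext, rule dirderiv_eqI, rule der)
 moreover have "(%p. f p *\<^sub>R c) differentiable_on UNIV"
  using der by (auto simp: differentiable_on_def differentiable_def)
 ultimately show ?case using Suc by simp
qed

lemma smooth_scaleR: "smooth f ==> smooth (%p. (f p :: real) *\<^sub>R c)"
 by (simp add: smooth_def times_differentiable_scaleR)

lemma smooth_mult: "smooth f ==> smooth g ==> smooth (%p. f p * g p :: real)"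
 by (simp add: smooth_def times_differentiable_mult)

lemma smooth_const: "smooth (%_. c)"
 by (simp add: smooth_def times_differentiable_const)

lemma smooth_prod:
 fixes f :: "'i => 'a::real_normed_vector => real"
 assumes "finite I" "!!i. i : I ==> smooth (f i)"
 shows "smooth (%p. PROD i:I. f i p)"
 using assms by (induction I rule: finite_induct) (simp_all add: smooth_mult smooth_const)

lemma smooth_differentiable: "smooth f ==> f differentiable_on UNIV"
 unfolding smooth_def by (metis times_differentiable.simps(2))

lemma smooth_dirderiv: "smooth f ==> smooth (dirderiv v f)"
 unfolding smooth_def by (metis times_differentiable.simps(2))

lemma smooth_continuous: "smooth f ==> continuous_on UNIV f"
 unfolding smooth_def by (metis times_differentiable.simps(1))

lemma dirderiv_along_line:
 assumes "smooth f"
 shows "((%s. f (x + s *\<^sub>R v)) has_vector_derivative dirderiv v f (x + s *\<^sub>R v)) (at s within A)"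
proof -
 have "((%s. x + s *\<^sub>R v) has_derivative (%h. h *\<^sub>R v)) (at s within A)"
  by (auto intro!: derivative_eq_intros)
 from diff_chain_within[OF this has_derivative_at_withinI[OF differentiable_has_derivative[OF smooth_differentiable[OF assms]]]]
 have "((f \<circ> (%s. x + s *\<^sub>R v)) has_derivative ((%w. dirderiv w f (x + s *\<^sub>R v)) \<circ> (%h. h *\<^sub>R v))) (at s within A)" .
 moreover have "dirderiv (h *\<^sub>R v) f (x + s *\<^sub>R v) = h *\<^sub>R dirderiv v f (x + s *\<^sub>R v)" for h
  using differentiable_has_derivative[OF smooth_differentiable[OF assms], of "x + s *\<^sub>R v"]
  by (rule linear_scale[OF has_derivative_linear])
 ultimately show ?thesis by (simp add: has_vector_derivative_def o_def)
qed

text \<open>Smoothness in one variable by naming successive derivatives, which is easily closed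
  under products and composition. Level 0 asks nothing, not even continuity, so the transfer to
  \<open>times_differentiable n\<close> starts from level n + 1.\<close>

primrec diffn :: "nat => (real => real) => bool" where
 "diffn 0 f \<longleftrightarrow> True"
| "diffn (Suc n) f \<longleftrightarrow> (EX f'. (ALL x. (f has_real_derivative f' x) (at x)) & diffn n f')"

definition smooth1 :: "(real => real) => bool" where
 "smooth1 f \<longleftrightarrow> (ALL n. diffn n f)"

lemma diffn_mono: "diffn (Suc n) f ==> diffn n f"
proof (induction n arbitrary: f)
 case (Suc n)
 thus ?case by (metis diffn.simps(2))
qed simp

lemma diffn_const: "diffn n (%_. c)"
 by (induction n arbitrary: c) (auto intro!: exI[of _ "%_. 0"] derivative_eq_intros)

lemma diffn_add: "diffn n f ==> diffn n g ==> diffn n (%x. f x + g x)"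
proof (induction n arbitrary: f g)
 case (Suc n)
 then obtain f' g' where "ALL x. (f has_real_derivative f' x) (at x)" "diffn n f'"
  "ALL x. (g has_real_derivative g' x) (at x)" "diffn n g'" by auto
 thus ?case using Suc.IH[of f' g'] by (auto intro!: exI[of _ "%x. f' x + g' x"] derivative_eq_intros)
qed simp

lemma diffn_mult: "diffn n f ==> diffn n g ==> diffn n (%x. f x * g x)"
proof (induction n arbitrary: f g)
 case (Suc n)
 then obtain f' g' where fg: "ALL x. (f has_real_derivative f' x) (at x)" "diffn n f'"
  "ALL x. (g has_real_derivative g' x) (at x)" "diffn n g'" by auto
 have "diffn n f" "diffn n g" using Suc.prems diffn_mono by blast+
 hence "diffn n (%x. f' x * g x + f x * g' x)" using fg by (intro diffn_add Suc.IH)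
 moreover have "ALL x. ((%x. f x * g x) has_real_derivative f' x * g x + f x * g' x) (at x)"
  using fg by (auto intro!: derivative_eq_intros)
 ultimately show ?case by auto
qed simp

lemma diffn_compose: "diffn n f ==> diffn n g ==> diffn n (%x. f (g x))"
proof (induction n arbitrary: f g)
 case (Suc n)
 then obtain f' g' where fg: "ALL x. (f has_real_derivative f' x) (at x)" "diffn n f'"
  "ALL x. (g has_real_derivative g' x) (at x)" "diffn n g'" by auto
 have "diffn n g" using Suc.prems diffn_mono by blast
 hence "diffn n (%x. f' (g x) * g' x)" by (rule diffn_mult[OF Suc.IH[OF fg(2)] fg(4)])
 moreover have "ALL x. ((%x. f (g x)) has_real_derivative f' (g x) * g' x) (at x)"
  using DERIV_chain2[of f _ g] fg by blast
 ultimately show ?case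
  unfolding diffn.simps by (intro exI[of _ "%x. f' (g x) * g' x"] conjI)
qed simp

lemma smooth1_const: "smooth1 (%_. c)" by (simp add: smooth1_def diffn_const)
lemma smooth1_add: "smooth1 f ==> smooth1 g ==> smooth1 (%x. f x + g x)" by (simp add: smooth1_def diffn_add)
lemma smooth1_mult: "smooth1 f ==> smooth1 g ==> smooth1 (%x. f x * g x)" by (simp add: smooth1_def diffn_mult)
lemma smooth1_compose: "smooth1 f ==> smooth1 g ==> smooth1 (%x. f (g x))"
 unfolding smooth1_def using diffn_compose[of _ f g] by blast

lemma smooth1_diff: "smooth1 f ==> smooth1 g ==> smooth1 (%x. f x - g x)"
 using smooth1_add[OF _ smooth1_mult[OF smooth1_const[of "-1"]], of f g] by simp

lemma smooth1_id: "smooth1 (%x. x)"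
 unfolding smooth1_def
proof
 show "diffn n (%x. x)" for n
  by (cases n) (auto intro!: exI[of _ "%_. 1"] derivative_eq_intros diffn_const)
qed

lemma smooth1_antiderivative:
 assumes "!!x. (B has_real_derivative b x) (at x)" "smooth1 b"
 shows "smooth1 B"
 unfolding smooth1_def
proof
 show "diffn n B" for n using assms by (cases n) (auto simp: smooth1_def)
qed

text \<open>Differentiation shifts cos by pi / 2, so the family of all shifts is closed under
  it.\<close>

lemma smooth1_cos: "smooth1 cos"
proof -
 have "diffn n (%x. cos (x + c))" for n c
 proof (induction n arbitrary: c)
  case (Suc n)
  have "((%x. cos (x + c)) has_real_derivative cos (x + (c + pi / 2))) (at x)" for x
  by (auto intro!: derivative_eq_intros simp: minus_sin_cos_eq add.assoc)
  thus ?case using Suc by (auto intro!: exI[of _ "%x. cos (x + (c + pi / 2))"])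
 qed simp
 from this[of _ 0] show ?thesis by (simp add: smooth1_def)
qed

lemma smooth1_sin: "smooth1 sin"
proof -
 have "smooth1 (%x. cos (x + - (pi / 2)))"
  by (rule smooth1_compose[OF smooth1_cos smooth1_add[OF smooth1_id smooth1_const]])
 also have "(%x. cos (x + - (pi / 2))) = sin" by (auto simp: cos_diff)
 finally show ?thesis .
qed

lemma smooth_linear_compose:
 fixes l :: "'a::real_normed_vector => real"
 assumes l: "bounded_linear l" and h: "smooth1 h"
 shows "smooth (%p. h (l p))"
proof -
 have "times_differentiable n (%p. h (l p))" if "diffn (Suc n) h" for n h
  using that
 proof (induction n arbitrary: h)
  case 0
  then obtain h' where "!!x. (h has_real_derivative h' x) (at x)" by auto
  hence "continuous_on UNIV h" by (meson DERIV_isCont continuous_at_imp_continuous_on)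
  thus ?case using continuous_on_compose2[of UNIV h UNIV l] linear_continuous_on[OF l] by simp
 next
  case (Suc n)
  then obtain h' where h': "!!x. (h has_real_derivative h' x) (at x)" "diffn (Suc n) h'" by auto
  have der: "((%p. h (l p)) has_derivative (%v. l v * h' (l p))) (at p)" for p
  proof -
  have "(h has_derivative (%y. y * h' (l p))) (at (l p))"
  proof -
  have "(*) (h' (l p)) = (%y. y * h' (l p))" by (rule ext) (rule mult.commute)
  thus ?thesis using h'(1)[of "l p"] by (simp only: has_field_derivative_def)
  qed
  from has_derivative_compose[OF bounded_linear_imp_has_derivative[OF l] this] show ?thesis .
  qed
  have "dirderiv v (%p. h (l p)) = (%p. l v * h' (l p))" for v
  by (rule ext, rule dirderiv_eqI, rule der)
  hence "times_differentiable n (dirderiv v (%p. h (l p)))" for v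
  by (simp only: times_differentiable_mult[OF times_differentiable_const Suc.IH[OF h'(2)]])
  moreover have "(%p. h (l p)) differentiable_on UNIV"
  using der by (auto simp: differentiable_on_def differentiable_def)
  ultimately show ?case by simp
 qed
 thus ?thesis using h unfolding smooth_def smooth1_def by blast
qed

subsection \<open>Bump functions\<close>

text \<open>A family closed under differentiation: for s > 0 the derivative of P(1/s) exp(-1/s) has
  the same form with X^2 (P - P') in place of P, and at 0 the exponential beats every
  polynomial.\<close>

definition flat :: "real poly => real => real" where
 "flat P s = (if s > 0 then poly P (1 / s) * exp (- 1 / s) else 0)"

lemma poly_exp_tendsto_0: "((%y. poly P y * exp (- y)) \<longlongrightarrow> (0::real)) at_top"
proof -
 have "((%y. SUM i<=degree P. Polynomial.coeff P i * (y ^ i / exp y)) \<longlongrightarrow> (SUM i<=degree P. Polynomial.coeff P i * 0)) at_top"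
  by (intro tendsto_intros tendsto_power_div_exp_0)
 thus ?thesis by (simp add: poly_altdef exp_minus divide_inverse sum_distrib_right mult.assoc)
qed

lemma flat_derivative:
 "(flat P has_real_derivative flat (Polynomial.monom 1 2 * (P - pderiv P)) s) (at s)"
proof -
 consider "s > 0" | "s < 0" | "s = 0" by linarith
 thus ?thesis
 proof cases
  case 1
  have "((%s. poly P (1 / s) * exp (- 1 / s)) has_real_derivative flat (Polynomial.monom 1 2 * (P - pderiv P)) s) (at s)"
  using 1 by (auto intro!: derivative_eq_intros DERIV_chain2[OF poly_DERIV] simp: flat_def poly_monom field_simps power2_eq_square)
  thus ?thesis
  proof (rule DERIV_cong_ev[OF refl _ refl, THEN iffD1, rotated])
  show "eventually (%x. poly P (1 / x) * exp (- 1 / x) = flat P x) (nhds s)"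
  using eventually_nhds_in_open[of "{0<..}" s] 1 by (auto elim!: eventually_mono simp: flat_def)
  qed
 next
  case 2
  have "((%_. 0) has_real_derivative flat (Polynomial.monom 1 2 * (P - pderiv P)) s) (at s)"
  using 2 by (simp add: flat_def)
  thus ?thesis
  proof (rule DERIV_cong_ev[OF refl _ refl, THEN iffD1, rotated])
  show "eventually (%x. 0 = flat P x) (nhds s)"
  using eventually_nhds_in_open[of "{..<0}" s] 2 by (auto elim!: eventually_mono simp: flat_def)
  qed
 next
  case 3
  have r: "((%h. flat P h / h) \<longlongrightarrow> 0) (at_right 0)"
  proof -
  have "((%h. poly (pCons 0 P) (inverse h) * exp (- inverse h)) \<longlongrightarrow> 0) (at_right 0)"
  by (rule filterlim_compose[OF poly_exp_tendsto_0 filterlim_inverse_at_top_right])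
  thus ?thesis
  proof (rule tendsto_cong[THEN iffD1, rotated])
  show "eventually (%h. poly (pCons 0 P) (inverse h) * exp (- inverse h) = flat P h / h) (at_right 0)"
  by (auto simp: eventually_at_right_field flat_def field_simps intro!: exI[of _ 1])
  qed
  qed
  have l: "((%h. flat P h / h) \<longlongrightarrow> 0) (at_left 0)"
  proof (rule tendsto_eventually)
  show "eventually (%h. flat P h / h = 0) (at_left 0)"
  by (auto simp: eventually_at_left_field flat_def intro!: exI[of _ "-1"])
  qed
  have "((%h. flat P h / h) \<longlongrightarrow> 0) (at 0)" using l r by (rule filterlim_split_at)
  thus ?thesis using 3 by (simp add: DERIV_def flat_def)
 qed
qed

lemma smooth1_flat: "smooth1 (flat P)"
proof -
 have "diffn n (flat P)" for n
  by (induction n arbitrary: P) (auto intro!: flat_derivative exI)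
 thus ?thesis by (simp add: smooth1_def)
qed

definition bump :: "real => real" where "bump = flat 1"

lemma bump_eq: "bump s = (if s > 0 then exp (- 1 / s) else 0)"
 by (simp add: bump_def flat_def)

lemma smooth1_bump: "smooth1 bump"
 unfolding bump_def by (rule smooth1_flat)

lemma bump_nonneg: "0 <= bump s" and bump_le_1: "bump s <= 1"
 by (auto simp: bump_eq)

text \<open>Stretching the argument sharpens the bump into the indicator of the positive axis; the
  cut-offs in space and in time are built from this.\<close>

lemma bump_limit: "(%n. bump (real n * s)) ~> (if s > 0 then 1 else 0)"
proof (cases "s > 0")
 case True
 have "(%n. exp (- (1 / s) * (1 / real n))) ~> exp (- (1 / s) * 0)"
  by (intro tendsto_intros lim_1_over_n)
 moreover have "eventually (%n. exp (- (1 / s) * (1 / real n)) = bump (real n * s)) sequentially"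
  using eventually_gt_at_top[of 0] by eventually_elim (use True in \<open>auto simp: bump_eq field_simps\<close>)
 ultimately have "(%n. bump (real n * s)) ~> exp (- (1 / s) * 0)"
  by (rule Lim_transform_eventually)
 thus ?thesis using True by simp
next
 case False
 hence "~ real n * s > 0" for n by (simp add: not_less mult_nonneg_nonpos)
 thus ?thesis using False by (simp add: bump_eq)
qed

lemma ex_antiderivative:
 assumes "continuous_on UNIV (b :: real => real)"
 obtains B where "!!x. (B has_real_derivative b x) (at x)"
proof -
 define B where "B x = (if x >= 0 then integral {0..x} b else - integral {x..0} b)" for x
 have "(B has_real_derivative b x) (at x)" for x
 proof -
  define a where "a = - \<bar>x\<bar> - 1"
  define c where "c = \<bar>x\<bar> + 1"
  have cont: "continuous_on {a..c} b" using assms continuous_on_subset by blast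
  have "((%y. integral {a..y} b) has_real_derivative b x) (at x within {a..c})"
  by (rule integral_has_real_derivative[OF cont]) (auto simp: a_def c_def)
  hence d: "((%y. integral {a..y} b - integral {a..0} b) has_real_derivative b x) (at x)"
  by (subst (asm) at_within_Icc_at) (auto simp: a_def c_def intro!: derivative_eq_intros)
  show ?thesis
  proof (rule DERIV_cong_ev[OF refl _ refl, THEN iffD1, OF _ d])
  show "eventually (%y. integral {a..y} b - integral {a..0} b = B y) (nhds x)"
  proof (rule eventually_mono[OF eventually_nhds_in_open[of "{a<..<c}"]])
  fix y assume y: "y : {a<..<c}"
  have io: "b integrable_on {u..v}" for u v
  using assms by (intro integrable_continuous_real) (auto intro: continuous_on_subset)
  have a0: "a <= 0" by (simp add: a_def)
  show "integral {a..y} b - integral {a..0} b = B y"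
  proof (cases "y >= 0")
  case True
  hence "integral {a..0} b + integral {0..y} b = integral {a..y} b"
  using a0 by (intro Henstock_Kurzweil_Integration.integral_combine io) auto
  thus ?thesis using True by (simp add: B_def)
  next
  case False
  hence "integral {a..y} b + integral {y..0} b = integral {a..0} b"
  using y by (intro Henstock_Kurzweil_Integration.integral_combine io) auto
  thus ?thesis using False by (simp add: B_def)
  qed
  qed (auto simp: a_def c_def)
  qed
 qed
 thus thesis by (rule that)
qed

lemma smooth1_imp_continuous: "smooth1 f ==> continuous_on UNIV f"
proof -
 assume "smooth1 f"
 hence "diffn (Suc 0) f" by (simp only: smooth1_def)
 then obtain f' where "!!x. (f has_real_derivative f' x) (at x)" by auto
 thus ?thesis by (meson DERIV_isCont continuous_at_imp_continuous_on)
qed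

section \<open>Integration over the torus\<close>

lemma cell_borel [measurable]: "cell L : sets borel"
 by (simp add: cell_def)

lemma mem_cell: "x : cell L \<longleftrightarrow> (ALL i. 0 <= x $ i & x $ i <= L)"
 by (simp add: cell_def mem_box_cart)

lemma space_torus [simp]: "space (torus L) = cell L"
 by (simp add: torus_def space_restrict_space)

lemma integral_torus:
 fixes f :: "real^3 => 'b::{banach, second_countable_topology}"
 shows "(LINT x|torus L. f x) = (LINT x|lborel. indicator (cell L) x *\<^sub>R f x)"
 unfolding torus_def by (rule integral_restrict_space) simp

lemma integrable_torus:
 fixes f :: "real^3 => 'b::{banach, second_countable_topology}"
 shows "tint L f \<longleftrightarrow> integrable lborel (%x. indicator (cell L) x *\<^sub>R f x)"
 unfolding torus_def by (rule integrable_restrict_space) simp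

lemma measurable_torus [measurable_dest]: "f : borel_measurable borel ==> f : borel_measurable (torus L)"
 unfolding torus_def by (rule measurable_restrict_space1) simp

lemma AE_torus: "(AE x in torus L. P x) \<longleftrightarrow> (AE x in lborel. x : cell L --> P x)"
 unfolding torus_def by (rule AE_restrict_space_iff) simp

lemma prod_Basis_vec: "(PROD b:(Basis :: (real^'n) set). f b) = (PROD j:UNIV. f (axis j 1))"
proof -
 have "bij_betw (%j. axis j (1::real)) (UNIV :: 'n set) (Basis :: (real^'n) set)"
  by (auto simp: bij_betw_def inj_on_def axis_eq_axis Basis_vec_def)
 from prod.reindex_bij_betw[OF this, of f] show ?thesis by simp
qed

lemma emeasure_torus: "0 <= L ==> emeasure (torus L) (cell L) = ennreal (L ^ 3)"
proof -
 assume L: "0 <= L"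
 have "emeasure (torus L) (cell L) = emeasure lborel (cell L)"
  unfolding torus_def by (subst emeasure_restrict_space) auto
 also have "... = ennreal (PROD b:Basis. ((\<chi> i. L) - (0 :: real^3)) \<bullet> b)"
  unfolding cell_def using L by (intro emeasure_lborel_cbox) (auto simp: Basis_vec_def inner_axis)
 also have "(PROD b:Basis. ((\<chi> i. L) - (0 :: real^3)) \<bullet> b) = L ^ 3"
  by (simp add: prod_Basis_vec inner_axis)
 finally show ?thesis .
qed

lemma finite_measure_torus [simp]: "finite_measure (torus L)"
 by (rule finite_measureI)
  (auto simp: torus_def emeasure_restrict_space cell_def space_restrict_space emeasure_lborel_cbox_eq)

lemma measure_torus: "0 <= L ==> measure (torus L) (cell L) = L ^ 3"
 by (simp add: measure_def emeasure_torus)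

definition upd :: "real^3 => 3 => real => real^3" where
 "upd x i s = (\<chi> j. if j = i then s else x $ j)"

lemma upd_nth [simp]: "upd x i s $ j = (if j = i then s else x $ j)"
 by (simp add: upd_def)

lemma upd_measurable [measurable]: "(%p. upd (fst p) i (snd p)) : borel_measurable (borel \<Otimes>\<^sub>M borel)"
proof -
 have "continuous_on UNIV (%p :: (real^3) \<times> real. upd (fst p) i (snd p))"
  unfolding upd_def
 proof (rule continuous_on_vec_lambda)
  fix j
  show "continuous_on UNIV (%p :: (real^3) \<times> real. if j = i then snd p else fst p $ j)"
  by (cases "j = i") (auto intro!: continuous_intros)
 qed
 hence "(%p :: (real^3) \<times> real. upd (fst p) i (snd p)) : borel_measurable borel"
  by (rule borel_measurable_continuous_onI)
 thus ?thesis by (simp add: borel_prod)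
qed

lemma nth_measurable [measurable]: "(%x :: real^3. x $ i) : borel_measurable borel"
 by (intro borel_measurable_continuous_onI continuous_intros)

text \<open>Exchanging coordinate i of x with an extra real variable is a measure-preserving
  involution. It does the work of Fubini's theorem in direction i, as \<open>real^3\<close> is not a
  product type.\<close>

definition coord_swap :: "3 => (real^3) \<times> real => (real^3) \<times> real" where
 "coord_swap i p = (upd (fst p) i (snd p), fst p $ i)"

lemma coord_swap_measurable [measurable]: "coord_swap i : borel \<rightarrow>\<^sub>M borel"
 unfolding coord_swap_def[abs_def] borel_prod[symmetric] by measurable

lemma box_prod_eq: "box l u = box (fst l) (fst u) \<times> box (snd l) (snd u)"
 for l u :: "('a::euclidean_space) \<times> ('b::euclidean_space)"
 by (cases l; cases u) (auto simp: box_def Basis_prod_def ball_Un)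

lemma emeasure_box_prod:
 fixes l u :: "('a::euclidean_space) \<times> ('b::euclidean_space)"
 shows "emeasure lborel (box l u) = emeasure lborel (box (fst l) (fst u)) * emeasure lborel (box (snd l) (snd u))"
 unfolding box_prod_eq[of l u] lborel_prod[symmetric]
 by (rule lborel.emeasure_pair_measure_Times) auto

text \<open>The preimage of a box is again a box, with two side lengths exchanged, and Lebesgue
  measure is determined by its values on boxes.\<close>

lemma distr_coord_swap: "distr lborel borel (coord_swap i) = (lborel :: ((real^3) \<times> real) measure)"
proof (rule lborel_eqI[symmetric])
 fix l u :: "(real^3) \<times> real"
 assume le: "!!b. b : Basis ==> l \<bullet> b <= u \<bullet> b"
 have le1: "fst l $ j <= fst u $ j" for j
  using le[of "(axis j 1, 0)"] by (auto simp: Basis_prod_def inner_prod_def inner_axis axis_in_Basis_iff)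
 have le2: "snd l <= snd u"
  using le[of "(0, 1)"] by (auto simp: Basis_prod_def inner_prod_def)
 have e3: "emeasure lborel (box a b) = ennreal (PROD j:UNIV. b $ j - a $ j)" if "!!j. a $ j <= b $ j" for a b :: "real^3"
 proof -
  have "emeasure lborel (box a b) = ennreal (PROD c:Basis. (b - a) \<bullet> c)"
  by (rule emeasure_lborel_box) (use that in \<open>auto simp: Basis_vec_def inner_axis\<close>)
  thus ?thesis by (simp add: prod_Basis_vec inner_axis)
 qed
 have e1: "emeasure lborel (box a b) = ennreal (b - a)" if "a <= b" for a b :: real
  using that by (subst emeasure_lborel_box) auto
 have pr: "(PROD j:UNIV. g j) = g i * (PROD j:UNIV - {i}. g j)" for g :: "3 => real"
  by (rule prod.remove) auto
 have nnp: "(PROD j:UNIV. fst u $ j - fst l $ j) >= 0" using le1 by (intro prod_nonneg) auto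
 have "coord_swap i -` box l u \<inter> space lborel = box (coord_swap i l) (coord_swap i u)"
 proof -
  have "p : coord_swap i -` box l u \<inter> space lborel \<longleftrightarrow> p : box (coord_swap i l) (coord_swap i u)" for p
  unfolding box_prod_eq by (cases p) (auto simp: coord_swap_def mem_box_cart split: if_splits)
  thus ?thesis by (simp only: set_eq_iff simp_thms)
 qed
 hence "emeasure (distr lborel borel (coord_swap i)) (box l u) = emeasure lborel (box (coord_swap i l) (coord_swap i u))"
  by (subst emeasure_distr) auto
 also have "... = ennreal (PROD j:UNIV. (if j = i then snd u else fst u $ j) - (if j = i then snd l else fst l $ j)) * ennreal (fst u $ i - fst l $ i)"
  using le1 le2 by (subst emeasure_box_prod, subst e3) (auto simp: coord_swap_def e1)
 also have "... = ennreal ((PROD j:UNIV. (if j = i then snd u else fst u $ j) - (if j = i then snd l else fst l $ j)) * (fst u $ i - fst l $ i))"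
  using le1 le2 by (subst ennreal_mult) (auto intro!: prod_nonneg)
 also have "(PROD j:UNIV. (if j = i then snd u else fst u $ j) - (if j = i then snd l else fst l $ j)) * (fst u $ i - fst l $ i)
  = (PROD j:UNIV. fst u $ j - fst l $ j) * (snd u - snd l)"
 proof -
  have "(PROD j:UNIV - {i}. (if j = i then snd u else fst u $ j) - (if j = i then snd l else fst l $ j))
  = (PROD j:UNIV - {i}. fst u $ j - fst l $ j)" by (intro prod.cong) auto
  thus ?thesis unfolding pr by simp
 qed
 also have "... = (PROD b:Basis. (u - l) \<bullet> b)"
 proof -
  have "(PROD b:(Basis :: ((real^3) \<times> real) set). (u - l) \<bullet> b)
  = (PROD b:(%v. (v, 0)) ` (Basis :: (real^3) set). (u - l) \<bullet> b) * (PROD b:(%v. (0, v)) ` (Basis :: real set). (u - l) \<bullet> b)"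
  unfolding Basis_prod_def by (rule prod.union_disjoint) auto
  also have "(PROD b:(%v. (v, 0)) ` (Basis :: (real^3) set). (u - l) \<bullet> b) = (PROD b:(Basis :: (real^3) set). (fst u - fst l) \<bullet> b)"
  by (subst prod.reindex) (auto simp: inj_on_def inner_prod_def)
  also have "... = (PROD j:UNIV. fst u $ j - fst l $ j)" by (simp add: prod_Basis_vec inner_axis)
  finally show ?thesis by (simp add: inner_prod_def)
 qed
 finally show "emeasure (distr lborel borel (coord_swap i)) (box l u) = ennreal (PROD b:Basis. (u - l) \<bullet> b)" .
qed simp

lemma integral_coord_swap:
 fixes F :: "(real^3) \<times> real => 'b::{banach, second_countable_topology}"
 assumes "F : borel_measurable borel"
 shows "(LINT p|lborel. F (coord_swap i p)) = (LINT p|lborel. F p)"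
  "integrable lborel (%p. F (coord_swap i p)) \<longleftrightarrow> integrable lborel F"
proof -
 have "(LINT p|distr lborel borel (coord_swap i). F p) = (LINT p|lborel. F (coord_swap i p))"
  using assms by (intro integral_distr) auto
 thus "(LINT p|lborel. F (coord_swap i p)) = (LINT p|lborel. F p)" by (simp add: distr_coord_swap)
 have "integrable (distr lborel borel (coord_swap i)) F \<longleftrightarrow> integrable lborel (%p. F (coord_swap i p))"
  using assms by (intro integrable_distr_eq) auto
 thus "integrable lborel (%p. F (coord_swap i p)) \<longleftrightarrow> integrable lborel F" by (simp add: distr_coord_swap)
qed

lemma integrable_lborel_prod_mult:
 fixes f :: "real^3 => 'b::{banach, second_countable_topology, real_normed_algebra}" and h :: "real => 'b"
 assumes "integrable lborel f" "integrable lborel h"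
 shows "integrable lborel (%p. f (fst p) * h (snd p))"
  "(LINT p|lborel. f (fst p) * h (snd p)) = (LINT x|lborel. f x) * (LINT s|lborel. h s)"
proof -
 have [measurable]: "f : borel_measurable borel" "h : borel_measurable borel" using assms by auto
 have i: "integrable (lborel \<Otimes>\<^sub>M lborel) (%(x, s). f x * h s)"
 proof (rule lborel_pair.Fubini_integrable)
  show "(%(x, s). f x * h s) : borel_measurable (lborel \<Otimes>\<^sub>M lborel)" by measurable
  show "AE x in lborel. integrable lborel (%y. case (x, y) of (x, s) => f x * h s)"
  using assms by auto
  show "integrable lborel (%x. LINT y|lborel. norm (case (x, y) of (x, s) => f x * h s))"
  proof (rule Bochner_Integration.integrable_bound)
  show "integrable lborel (%x. norm (f x) * (LINT y|lborel. norm (h y)))" using assms by auto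
  show "(%x. LINT y|lborel. norm (case (x, y) of (x, s) => f x * h s)) : borel_measurable lborel" by measurable
  show "AE x in lborel. norm (LINT y|lborel. norm (case (x, y) of (x, s) => f x * h s)) <= norm (norm (f x) * (LINT y|lborel. norm (h y)))"
  proof (rule AE_I2)
  fix x
  have "(LINT y|lborel. norm (f x * h y)) <= (LINT y|lborel. norm (f x) * norm (h y))"
  using assms by (intro integral_mono integrable_norm integrable_mult_right) (auto simp: norm_mult_ineq)
  thus "norm (LINT y|lborel. norm (case (x, y) of (x, s) => f x * h s)) <= norm (norm (f x) * (LINT y|lborel. norm (h y)))"
  by simp
  qed
  qed
 qed
 thus "integrable lborel (%p. f (fst p) * h (snd p))" by (simp add: lborel_prod case_prod_unfold)
 have "(LINT p|(lborel \<Otimes>\<^sub>M lborel). f (fst p) * h (snd p)) = (LINT x|lborel. LINT s|lborel. f x * h s)"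
  using lborel_pair.integral_fst[OF i] by (simp add: case_prod_unfold)
 thus "(LINT p|lborel. f (fst p) * h (snd p)) = (LINT x|lborel. f x) * (LINT s|lborel. h s)"
  using assms by (simp add: lborel_prod)
qed

text \<open>The integral over the cell times [0, L] is invariant under swapping the i-th coordinate
  with the extra one, because both range over [0, L].\<close>

lemma line_average:
 fixes g :: "real^3 => 'b::{banach, second_countable_topology, real_normed_field}"
 assumes L: "L > 0" and [measurable]: "g : borel_measurable borel" and g: "tint L g"
 shows "of_real L * (LINT x|torus L. g x) = (LINT x|torus L. (LINT s:{0..L}|lborel. g (upd x i s)))"
proof -
 define F where "F p = (indicator (cell L) (fst p) *\<^sub>R g (fst p)) * (indicator {0..L} (snd p) *\<^sub>R 1)" for p :: "(real^3) \<times> real"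
 have ih: "integrable lborel (%s::real. indicator {0..L} s *\<^sub>R (1::'b))"
  by (intro integrable_scaleR_left integrable_real_indicator) (auto simp: emeasure_lborel_Icc_eq)
 have iF: "integrable lborel F"
  unfolding F_def using integrable_lborel_prod_mult(1)[OF g[unfolded integrable_torus] ih] .
 have F_int: "(LINT p|lborel. F p) = (LINT x|torus L. g x) * of_real L"
  unfolding F_def using integrable_lborel_prod_mult(2)[OF g[unfolded integrable_torus] ih] L
  by (simp add: integral_torus of_real_def)
 have Fm: "F : borel_measurable borel" using iF by auto
 have sw: "F (coord_swap i (x, s)) = indicator (cell L) x *\<^sub>R (indicator {0..L} s *\<^sub>R g (upd x i s))" for x :: "real^3" and s :: real
  by (auto simp: F_def coord_swap_def mem_cell indicator_def split: if_splits)
 have i2: "integrable (lborel \<Otimes>\<^sub>M lborel) (%p. F (coord_swap i p))"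
  using integral_coord_swap(2)[OF Fm, of i] iF by (simp add: lborel_prod)
 have "(LINT p|lborel. F p) = (LINT p|(lborel \<Otimes>\<^sub>M lborel). F (coord_swap i p))"
  using integral_coord_swap(1)[OF Fm, of i] by (simp add: lborel_prod)
 also have "... = (LINT x|lborel. LINT s|lborel. F (coord_swap i (x, s)))"
  by (rule lborel_pair.integral_fst'[OF i2, symmetric])
 also have "(%x. LINT s|lborel. F (coord_swap i (x, s))) = (%x. indicator (cell L) x *\<^sub>R (LINT s:{0..L}|lborel. g (upd x i s)))"
  unfolding sw set_lebesgue_integral_def by (rule ext) (simp add: indicator_def)
 also have "(LINT x|lborel. indicator (cell L) x *\<^sub>R (LINT s:{0..L}|lborel. g (upd x i s))) = (LINT x|torus L. (LINT s:{0..L}|lborel. g (upd x i s)))"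
  by (rule integral_torus[symmetric])
 finally show ?thesis using F_int by (simp add: mult.commute)
qed

section \<open>Fourier coefficients\<close>

definition mode :: "real^3 => real^3 => complex" where
 "mode k x = exp (- \<i> * complex_of_real (k \<bullet> x))"

lemma mode_borel [measurable]: "mode k : borel_measurable borel"
 unfolding mode_def by (intro borel_measurable_continuous_onI continuous_intros)

lemma norm_mode [simp]: "norm (mode k x) = 1"
 by (simp add: mode_def norm_exp_eq_Re)

lemma cnj_mode: "cnj (mode k x) = mode (- k) x"
 by (simp add: mode_def exp_cnj)

lemma mode_add: "mode (k + l) x = mode k x * mode l x"
 by (simp add: mode_def exp_add[symmetric] inner_add_left algebra_simps)

lemma mode_zero [simp]: "mode 0 x = 1"
 by (simp add: mode_def)

lemma wave_vectors_add: "k : wave_vectors L ==> l : wave_vectors L ==> k + l : wave_vectors L"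
 unfolding wave_vectors_def by (auto simp only: mem_Collect_eq vector_add_component add_divide_distrib intro: Ints_add)

lemma wave_vectors_uminus: "k : wave_vectors L ==> - k : wave_vectors L"
 by (auto simp: wave_vectors_def)

lemma wave_vectors_diff: "k : wave_vectors L ==> l : wave_vectors L ==> k - l : wave_vectors L"
 using wave_vectors_add[of k L "- l"] wave_vectors_uminus[of l L] by simp

lemma integrable_mode [simp]: "tint L (mode k)"
 by (rule finite_measure.integrable_const_bound[where B = 1]) auto

lemma integral_exp_period:
 assumes "L > 0" "a ~= 0" "a / (2 * pi / L) : \<int>"
 shows "(LINT s:{0..L}|lborel. exp (- \<i> * complex_of_real (a * s))) = 0"
proof -
 obtain z where z: "a / (2 * pi / L) = of_int z" using assms(3) by (auto elim: Ints_cases)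
 have az: "a * L = 2 * pi * of_int z" using z assms(1) by (simp add: field_simps)
 define G where "G s = exp (- \<i> * complex_of_real (a * s)) / (- \<i> * complex_of_real a)" for s
 have "(LINT s:{0..L}|lborel. exp (- \<i> * complex_of_real (a * s))) = G L - G 0"
  unfolding set_lebesgue_integral_def
 proof (rule integral_FTC_Icc)
  show "0 <= L" using assms by simp
  show "(G has_vector_derivative exp (- \<i> * complex_of_real (a * s))) (at s within {0..L})" for s
  proof -
  have "((%z. exp (- \<i> * (complex_of_real a * z)) / (- \<i> * complex_of_real a)) has_field_derivative
  exp (- \<i> * (complex_of_real a * complex_of_real s))) (at (complex_of_real s))"
  using assms(2) by (auto intro!: derivative_eq_intros simp: mult.left_commute[of "\<i>" "exp _" "\<i>"])
  from has_vector_derivative_real_field[OF this] show ?thesis by (simp add: G_def[abs_def])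
  qed
  show "continuous_on {0..L} (%s. exp (- \<i> * complex_of_real (a * s)))"
  by (intro continuous_intros)
 qed
 also have "G L = G 0"
 proof -
  have "exp (- \<i> * complex_of_real (a * L)) = exp (2 * pi * of_int (- z) * \<i>)"
  unfolding az by (simp add: algebra_simps)
  also have "... = 1" using exp_integer_2pi[of "of_int (- z)"] by (simp add: mult_ac)
  finally show ?thesis by (simp add: G_def)
 qed
 finally show ?thesis by simp
qed

text \<open>A nonzero k has a nonzero component \<open>k $ i\<close>, and the mode integrates to 0
  over a period in direction i.\<close>

lemma integral_mode:
 assumes L: "L > 0" and k: "k : wave_vectors L"
 shows "(LINT x|torus L. mode k x) = (if k = 0 then of_real (L ^ 3) else 0)"
proof (cases "k = 0")
 case True
 thus ?thesis using L measure_torus[of L] by (simp add: scaleR_conv_of_real)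
next
 case False
 then obtain i where i: "k $ i ~= 0" by (metis vec_eq_iff zero_index)
 have "of_real L * (LINT x|torus L. mode k x) = (LINT x|torus L. (LINT s:{0..L}|lborel. mode k (upd x i s)))"
  by (rule line_average[OF L]) auto
 also have "... = (LINT x|torus L. 0)"
 proof (rule Bochner_Integration.integral_cong[OF refl])
  fix x :: "real^3"
  have kx: "k \<bullet> upd x i s = k \<bullet> upd x i 0 + k $ i * s" for s
  proof -
  have "k \<bullet> upd x i s = (SUM j:UNIV. k $ j * upd x i s $ j)" by (simp add: inner_vec_def)
  also have "... = (SUM j:UNIV. k $ j * upd x i 0 $ j + (if j = i then k $ i * s else 0))"
  by (intro sum.cong) auto
  also have "... = (SUM j:UNIV. k $ j * upd x i 0 $ j) + k $ i * s" by (simp add: sum.distrib)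
  finally show ?thesis by (simp add: inner_vec_def)
  qed
  define c where "c = mode k (upd x i 0)"
  have "mode k (upd x i s) = c * exp (- \<i> * complex_of_real (k $ i * s))" for s
  unfolding c_def mode_def kx[of s] exp_add[symmetric] of_real_add distrib_left ..
  moreover have "k $ i / (2 * pi / L) : \<int>" using k unfolding wave_vectors_def by blast
  ultimately show "(LINT s:{0..L}|lborel. mode k (upd x i s)) = 0"
  using integral_exp_period[OF L i] by simp
 qed
 finally show ?thesis using L False by simp
qed

definition fc :: "real => (real^3 => complex) => real^3 => complex" where
 "fc L f k = (LINT x|torus L. mode k x * f x)"

lemma integrable_mode_mult:
 assumes f: "tint L f"
 shows "tint L (%x. mode k x * f x)"
proof (rule Bochner_Integration.integrable_bound[OF f])
 have "mode k : borel_measurable (torus L)" by (rule measurable_torus[OF mode_borel])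
 thus "(%x. mode k x * f x) : borel_measurable (torus L)"
  using borel_measurable_integrable[OF f] by (rule borel_measurable_times)
qed (simp add: norm_mult)

lemma fourier_nth: "fourier L f k $ j = fc L (%x. complex_of_real (f x $ j)) k"
 by (simp add: fourier_def fc_def mode_def)

section \<open>Completeness of the trigonometric system\<close>

text \<open>The positive and the negative part of f are densities of two measures that agree on
  boxes with rational corners, a generator stable under intersection. Rational corners are chosen so
  that later only countably many conditions have to be imposed.\<close>

lemma AE_zero_if_box_integrals_zero:
 fixes f :: "'a::euclidean_space => real"
 assumes f: "integrable lborel f"
  and zero: "!!a b. (!!i. i : Basis ==> a \<bullet> i : \<rat> & b \<bullet> i : \<rat>) ==> (LINT x|lborel. indicator (box a b) x * f x) = 0"
 shows "AE x in lborel. f x = 0"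
proof -
 have [measurable]: "f : borel_measurable borel" using f by auto
 define fp where "fp x = ennreal (max 0 (f x))" for x
 define fn where "fn x = ennreal (max 0 (- f x))" for x
 have [measurable]: "fp : borel_measurable borel" "fn : borel_measurable borel"
  unfolding fp_def fn_def by measurable
 define E where "E = {box a b |a b :: 'a. ALL i:Basis. a \<bullet> i : \<rat> & b \<bullet> i : \<rat>}"
 have ip: "integrable lborel (%x. indicator A x * max 0 (f x))"
  and inn: "integrable lborel (%x. indicator A x * max 0 (- f x))" if "A : sets borel" for A
  using that f by (auto intro!: Bochner_Integration.integrable_bound[OF f] AE_I2 simp: indicator_def)
 have val: "emeasure (density lborel fp) A = ennreal (LINT x|lborel. indicator A x * max 0 (f x))"
  "emeasure (density lborel fn) A = ennreal (LINT x|lborel. indicator A x * max 0 (- f x))" if A: "A : sets borel" for A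
 proof -
  have "emeasure (density lborel fp) A = (\<integral>\<^sup>+x. ennreal (indicator A x * max 0 (f x)) \<partial>lborel)"
  using A by (subst emeasure_density) (auto intro!: nn_integral_cong simp: fp_def indicator_def)
  thus "emeasure (density lborel fp) A = ennreal (LINT x|lborel. indicator A x * max 0 (f x))"
  using nn_integral_eq_integral[OF ip[OF A]] by (simp add: indicator_def)
  have "emeasure (density lborel fn) A = (\<integral>\<^sup>+x. ennreal (indicator A x * max 0 (- f x)) \<partial>lborel)"
  using A by (subst emeasure_density) (auto intro!: nn_integral_cong simp: fn_def indicator_def)
  thus "emeasure (density lborel fn) A = ennreal (LINT x|lborel. indicator A x * max 0 (- f x))"
  using nn_integral_eq_integral[OF inn[OF A]] by (simp add: indicator_def)
 qed
 have "density lborel fp = density lborel fn"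
 proof (rule measure_eqI_generator_eq[where E = E and \<Omega> = UNIV and A = "%n. box (SUM i:Basis. (- real n) *\<^sub>R i) (SUM i:Basis. real n *\<^sub>R i)"])
  show "Int_stable E"
  proof (rule Int_stableI)
  fix A B assume "A : E" "B : E"
  then obtain a b c d where AB: "A = box a b" "B = box c d" "ALL i:Basis. a \<bullet> i : \<rat> & b \<bullet> i : \<rat>" "ALL i:Basis. c \<bullet> i : \<rat> & d \<bullet> i : \<rat>"
  by (auto simp: E_def)
  define p q where "p = (SUM i:Basis. max (a \<bullet> i) (c \<bullet> i) *\<^sub>R i)" and "q = (SUM i:Basis. min (b \<bullet> i) (d \<bullet> i) *\<^sub>R i)"
  have "A \<inter> B = box p q" unfolding AB p_def q_def by (rule box_Int_box)
  moreover have "ALL i:Basis. p \<bullet> i : \<rat> & q \<bullet> i : \<rat>"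
  using AB(3,4) by (auto simp: p_def q_def max_def min_def)
  ultimately show "A \<inter> B : E" unfolding E_def by blast
  qed
  show "E <= Pow UNIV" by simp
  fix X assume "X : E"
  then obtain a b where X: "X = box a b" "!!i. i : Basis ==> a \<bullet> i : \<rat> & b \<bullet> i : \<rat>" by (auto simp: E_def)
  have "(LINT x|lborel. indicator X x * max 0 (f x)) - (LINT x|lborel. indicator X x * max 0 (- f x))
  = (LINT x|lborel. indicator X x * max 0 (f x) - indicator X x * max 0 (- f x))"
  by (rule Bochner_Integration.integral_diff[symmetric]) (auto intro!: ip inn simp: X)
  also have "... = (LINT x|lborel. indicator X x * f x)"
  by (intro Bochner_Integration.integral_cong) (auto simp: max_def algebra_simps)
  also have "... = 0" unfolding X by (rule zero[OF X(2)])
  finally show "emeasure (density lborel fp) X = emeasure (density lborel fn) X"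
  using val[of X] X by simp
 next
  have gen: "sets borel = sigma_sets UNIV E"
  proof -
  have "borel = sigma UNIV E"
  proof (rule borel_eq_sigmaI1[OF borel_def, where F = "%x. x" and A = E, simplified])
  fix M :: "'a set" assume "open M"
  define I where "I = {f : Basis \<rightarrow>\<^sub>E \<rat> \<times> \<rat>. box (SUM (i::'a):Basis. fst (f i :: real \<times> real) *\<^sub>R i) (SUM i:Basis. snd (f i) *\<^sub>R i) <= M}"
  have M: "M = (\<Union>f\<in>I. box (SUM i:Basis. fst (f i) *\<^sub>R i) (SUM i:Basis. snd (f i) *\<^sub>R i))"
  unfolding I_def by (rule open_UNION_box[OF \<open>open M\<close>])
  have "I <= Basis \<rightarrow>\<^sub>E \<rat> \<times> \<rat>" unfolding I_def by blast
  moreover have "countable ((Basis :: 'a set) \<rightarrow>\<^sub>E (\<rat> \<times> \<rat> :: (real \<times> real) set))"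
  by (intro countable_PiE countable_SIGMA countable_rat finite_Basis)
  ultimately have "countable I" by (rule countable_subset)
  moreover have "box (SUM i:Basis. fst (f i) *\<^sub>R i) (SUM i:Basis. snd (f i) *\<^sub>R i) : sigma_sets UNIV E" if "f : I" for f
  proof (rule sigma_sets.Basic)
  have "fst (f i) : \<rat> & snd (f i) : \<rat>" if "i : Basis" for i
  using \<open>f : I\<close> that unfolding I_def by (auto dest!: PiE_mem[where x = i] simp: mem_Times_iff)
  hence "ALL j:Basis. (SUM i:Basis. fst (f i) *\<^sub>R i) \<bullet> j : \<rat> & (SUM i:Basis. snd (f i) *\<^sub>R i) \<bullet> j : \<rat>"
  by simp
  thus "box (SUM i:Basis. fst (f i) *\<^sub>R i) (SUM i:Basis. snd (f i) *\<^sub>R i) : E"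
  unfolding E_def by blast
  qed
  ultimately show "M : sigma_sets UNIV E"
  by (subst M) (auto intro!: sigma_sets_UNION)
  next
  fix B assume "B : E" thus "B : sets borel" by (auto simp: E_def)
  qed
  thus ?thesis by (metis Pow_UNIV sets_measure_of top_greatest)
  qed
  show "sets (density lborel fp) = sigma_sets UNIV E" "sets (density lborel fn) = sigma_sets UNIV E"
  using gen by auto
  have "ALL j:Basis. (SUM i:(Basis :: 'a set). (- real n) *\<^sub>R i) \<bullet> j : \<rat> & (SUM i:Basis. real n *\<^sub>R i) \<bullet> j : \<rat>" for n
  by (simp del: scaleR_minus_left)
  thus "range (%n. box (SUM i:Basis. (- real n) *\<^sub>R i) (SUM i:Basis. real n *\<^sub>R i)) <= E"
  unfolding E_def by blast
  show "(\<Union>n. box (SUM i:Basis. (- real n) *\<^sub>R i) (SUM i:Basis. real n *\<^sub>R i)) = (UNIV :: 'a set)"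
  using UN_box_eq_UNIV by (simp add: scaleR_sum_right[symmetric] sum_negf)
  show "emeasure (density lborel fp) (box (SUM i:Basis. (- real n) *\<^sub>R i) (SUM i:Basis. real n *\<^sub>R i)) ~= \<infinity>" for n
  by (subst val) auto
 qed
 hence "AE x in lborel. fp x = fn x"
  by (intro sigma_finite_measure.density_unique[OF lborel.sigma_finite_measure_axioms]) auto
 thus ?thesis
  by eventually_elim (auto simp: fp_def fn_def max_def split: if_splits)
qed

text \<open>Trigonometric polynomials, generated inductively so that orthogonality to the modes
  extends to all of them by rule induction.\<close>

inductive trigp :: "real => (real^3 => complex) => bool" for L where
 mode: "k : wave_vectors L ==> trigp L (mode k)"
| add: "trigp L f ==> trigp L g ==> trigp L (%x. f x + g x)"
| scale: "trigp L f ==> trigp L (%x. c * f x)"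

lemma trigp_mult:
 assumes "trigp L f" "trigp L g"
 shows "trigp L (%x. f x * g x)"
 using assms(1)
proof (induction rule: trigp.induct)
 case (mode k)
 show ?case using assms(2)
 proof (induction rule: trigp.induct)
  case (mode l)
  have "trigp L (mode (k + l))" using wave_vectors_add \<open>k : wave_vectors L\<close> mode by (intro trigp.mode)
  moreover have "(%x. mode k x * mode l x) = mode (k + l)" by (rule ext) (simp add: mode_add)
  ultimately show ?case by simp
 next
  case (add f g)
  thus ?case using trigp.add[OF add.IH] by (simp add: algebra_simps)
 next
  case (scale f c)
  thus ?case using trigp.scale[OF scale.IH, of c] by (simp add: mult_ac)
 qed
next
 case (add f1 f2)
 thus ?case using trigp.add[OF add.IH] by (simp add: algebra_simps)
next
 case (scale f c)
 thus ?case using trigp.scale[OF scale.IH, of c] by (simp add: mult_ac)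
qed

lemma trigp_const: "trigp L (%x. c)"
proof -
 have "0 : wave_vectors L" by (simp add: wave_vectors_def)
 from trigp.scale[OF trigp.mode[OF this], of c] show ?thesis by simp
qed

lemma trigp_cos:
 assumes "L > 0"
 shows "trigp L (%x. complex_of_real (cos (2 * pi * (x $ i - c) / L)))"
proof -
 define k :: "real^3" where "k = axis i (2 * pi / L)"
 have k: "k : wave_vectors L" unfolding wave_vectors_def k_def using assms by (auto simp: axis_def)
 have kx: "k \<bullet> x = 2 * pi / L * x $ i" for x by (simp add: k_def inner_axis' mult.commute)
 define b where "b = 2 * pi * c / L"
 have e: "2 * pi * (x $ i - c) / L = k \<bullet> x - b" for x
  unfolding kx b_def by (simp add: algebra_simps diff_divide_distrib)
 have "complex_of_real (cos (2 * pi * (x $ i - c) / L))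
  = exp (\<i> * b) / 2 * mode k x + exp (- \<i> * b) / 2 * mode (- k) x" for x
 proof -
  have "complex_of_real (cos (k \<bullet> x - b)) = (exp (\<i> * complex_of_real (k \<bullet> x - b)) + exp (- (\<i> * complex_of_real (k \<bullet> x - b)))) / 2"
  by (simp add: cos_of_real[symmetric] cos_exp_eq)
  also have "... = exp (\<i> * b) / 2 * mode k x + exp (- \<i> * b) / 2 * mode (- k) x"
  by (simp add: mode_def exp_diff exp_add[symmetric] exp_minus field_simps)
  finally show ?thesis unfolding e .
 qed
 thus ?thesis
  by (simp only:) (intro trigp.intros k wave_vectors_uminus)
qed

lemma trigp_polynomial:
 fixes g :: "real^3 => real"
 assumes L: "L > 0" and "real_polynomial_function g"
 shows "trigp L (%x. complex_of_real (g (\<chi> i. cos (2 * pi * (x $ i - c $ i) / L))))"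
 using assms(2)
proof (induction rule: real_polynomial_function.induct)
 case (linear f)
 interpret bounded_linear f by fact
 have fw: "f w = (SUM i:UNIV. w $ i * f (axis i 1))" for w
 proof -
  have "f w = f (SUM i:UNIV. w $ i *\<^sub>R axis i 1)" using basis_expansion[of w] by (simp add: scalar_mult_eq_scaleR)
  thus ?thesis by (simp add: sum scaleR)
 qed
 have e: "complex_of_real (f (\<chi> i. cos (2 * pi * (x $ i - c $ i) / L)))
  = complex_of_real (f (axis 1 1)) * complex_of_real (cos (2 * pi * (x $ 1 - c $ 1) / L))
  + (complex_of_real (f (axis 2 1)) * complex_of_real (cos (2 * pi * (x $ 2 - c $ 2) / L))
  + complex_of_real (f (axis 3 1)) * complex_of_real (cos (2 * pi * (x $ 3 - c $ 3) / L)))" for x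
  unfolding fw[of "\<chi> i. cos (2 * pi * (x $ i - c $ i) / L)"] sum_3
  by (simp only: vec_lambda_beta of_real_add of_real_mult mult.commute add.assoc)
 show ?case unfolding e by (intro trigp.add trigp.scale trigp_cos L)
next
 case (const c)
 show ?case by (rule trigp_const)
next
 case (add f g)
 thus ?case using trigp.add[OF add.IH] by simp
next
 case (mult f g)
 thus ?case using trigp_mult[OF mult.IH] by simp
qed

lemma trigp_integral_zero:
 assumes "trigp L g" "tint L (f :: real^3 => complex)" "!!k. k : wave_vectors L ==> fc L f k = 0"
 shows "tint L (%x. g x * f x) & (LINT x|torus L. g x * f x) = 0"
 using assms(1)
proof (induction rule: trigp.induct)
 case (mode k)
 have "tint L (%x. mode k x * f x)" by (rule integrable_mode_mult[OF assms(2)])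
 thus ?case using assms(3)[OF mode] by (simp add: fc_def)
next
 case (add f1 f2)
 thus ?case by (simp add: distrib_right)
next
 case (scale f1 c)
 thus ?case by (simp add: mult.assoc)
qed

lemma AE_nth_neq: "AE x in lborel. (x :: real^3) $ i ~= y"
proof -
 have "negligible {x :: real^3. x \<bullet> axis i 1 = y}"
  by (rule negligible_standard_hyperplane) (simp add: axis_in_Basis_iff)
 hence "{x :: real^3. x $ i = y} : null_sets lebesgue"
  by (simp add: negligible_iff_null_sets inner_axis)
 moreover have "{x :: real^3. x $ i = y} : sets borel" by measurable
 ultimately have "{x :: real^3. x $ i = y} : null_sets lborel" by (auto simp: null_sets_def)
 thus ?thesis by (intro AE_I'[of "{x :: real^3. x $ i = y}"]) auto
qed

lemma AE_interior: "AE x in lborel. ALL i::3. (x :: real^3) $ i ~= 0 & x $ i ~= L"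
proof -
 have "AE x in lborel. (x :: real^3) $ i ~= 0 & x $ i ~= L" for i :: 3
  using AE_nth_neq[of i 0] AE_nth_neq[of i L] by eventually_elim simp
 hence "AE x in lborel. ALL i:(UNIV :: 3 set). (x :: real^3) $ i ~= 0 & x $ i ~= L"
  by (intro AE_finite_allI) auto
 thus ?thesis by simp
qed

text \<open>Over one period, an interval is the set where a cosine centred at its midpoint exceeds
  its value at the endpoints. This describes boxes by smooth periodic functions.\<close>

lemma cos_arc:
 fixes a b x L :: real
 assumes L: "L > 0" and ab: "0 <= a" "a < b" "b <= L" and x: "0 < x & x < L"
 shows "cos (pi * (b - a) / L) < cos (2 * pi * (x - (a + b) / 2) / L) \<longleftrightarrow> a < x & x < b"
proof -
 define c where "c = (a + b) / 2"
 define r where "r = pi * (b - a) / L"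
 define t where "t = 2 * pi * (x - c) / L"
 have r: "0 <= r" "r <= pi" unfolding r_def using L ab
  by (auto simp: divide_le_eq zero_le_mult_iff)
 have t: "\<bar>t\<bar> <= 2 * pi - r"
 proof -
  have "\<bar>x - c\<bar> <= L - (b - a) / 2"
  proof (rule abs_leI)
  have ci: "c = (a + b) / 2" by (simp add: c_def)
  show "x - c <= L - (b - a) / 2" "- (x - c) <= L - (b - a) / 2"
  unfolding ci using x ab(1) ab(2) ab(3) by (simp_all add: field_simps)
  qed
  hence "2 * pi * \<bar>x - c\<bar> / L <= 2 * pi * (L - (b - a) / 2) / L"
  using L by (intro divide_right_mono mult_left_mono) auto
  moreover have "\<bar>t\<bar> = 2 * pi * \<bar>x - c\<bar> / L" using L by (simp add: t_def abs_mult)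
  moreover have "2 * pi * (L - (b - a) / 2) / L = 2 * pi - r" using L by (simp add: r_def field_simps)
  ultimately show ?thesis by linarith
 qed
 have "cos r < cos t \<longleftrightarrow> \<bar>t\<bar> < r"
 proof
  assume "\<bar>t\<bar> < r"
  thus "cos r < cos t" using r cos_monotone_0_pi[of "\<bar>t\<bar>" r] by simp
 next
  assume *: "cos r < cos t"
  show "\<bar>t\<bar> < r"
  proof (rule ccontr)
  assume "~ \<bar>t\<bar> < r"
  hence ge: "r <= \<bar>t\<bar>" by simp
  show False
  proof (cases "\<bar>t\<bar> <= pi")
  case True
  hence "cos \<bar>t\<bar> <= cos r" using ge r by (intro cos_monotone_0_pi_le) auto
  thus False using * by simp
  next
  case False
  have "cos (2 * pi - \<bar>t\<bar>) <= cos r" using False t r by (intro cos_monotone_0_pi_le) auto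
  moreover have "cos (2 * pi - \<bar>t\<bar>) = cos t" by (simp add: cos_diff)
  ultimately show False using * by simp
  qed
  qed
 qed
 moreover have "\<bar>t\<bar> < r \<longleftrightarrow> a < x & x < b"
 proof -
  have "\<bar>t\<bar> < r \<longleftrightarrow> 2 * pi / L * \<bar>x - c\<bar> < 2 * pi / L * ((b - a) / 2)"
  using L by (simp add: t_def r_def abs_mult)
  also have "... \<longleftrightarrow> \<bar>x - c\<bar> < (b - a) / 2" using L by (subst mult_less_cancel_left_pos) auto
  also have "... \<longleftrightarrow> a < x & x < b" by (auto simp: c_def abs_less_iff field_simps)
  finally show ?thesis .
 qed
 ultimately show ?thesis by (simp add: r_def t_def c_def)
qed

text \<open>Completeness through boxes: membership in a box is a condition on shifted cosines of the
  coordinates, its indicator is a limit of continuous ramps in these cosines, and Stone-Weierstrass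
  replaces the ramps by polynomials, against which f integrates to 0.\<close>

lemma fc_unique_real:
 fixes f :: "real^3 => real"
 assumes L: "L > 0" and [measurable]: "f : borel_measurable borel" and f: "tint L f"
  and zero: "!!k. k : wave_vectors L ==> fc L (cx f) k = 0"
 shows "AE x in torus L. f x = 0"
proof -
 have fC: "tint L (cx f)" using f by simp
 have box0: "(LINT x|torus L. indicator (box a b) x * f x) = 0" if ab: "!!i. 0 <= a $ i" "!!i. a $ i < b $ i" "!!i. b $ i <= L" for a b :: "real^3"
 proof -
  define c :: "real^3" where "c = (\<chi> i. (a $ i + b $ i) / 2)"
  define s where "s i = cos (pi * (b $ i - a $ i) / L)" for i
  define w where "w x = (\<chi> i. cos (2 * pi * (x $ i - c $ i) / L))" for x :: "real^3"
  have [measurable]: "w : borel_measurable borel"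
  unfolding w_def using L by (intro borel_measurable_continuous_onI continuous_on_vec_lambda continuous_intros) auto
  have w_range: "w x : cbox (-1) 1" for x by (auto simp: w_def mem_box_cart)
  have inbox: "x : box a b \<longleftrightarrow> (ALL i. s i < w x $ i)" if x: "!!i. 0 < x $ i & x $ i < L" for x
  proof -
  have "a $ i < x $ i & x $ i < b $ i \<longleftrightarrow> s i < w x $ i" for i
  using cos_arc[OF L ab(1)[of i] ab(2)[of i] ab(3)[of i] x[of i]] by (simp add: s_def w_def c_def)
  thus ?thesis by (auto simp: mem_box_cart)
  qed
  define ramp where "ramp n y = (PROD i:UNIV. max 0 (min 1 (real n * (y $ i - s i))))" for n and y :: "real^3"
  have ramp_cont: "continuous_on (cbox (-1) 1) (ramp n)" for n
  unfolding ramp_def by (intro continuous_intros)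
  have "EX g. real_polynomial_function g & (ALL y:cbox (-1) 1. \<bar>ramp n y - g y\<bar> < 1 / (real n + 1))" for n
  by (rule Stone_Weierstrass_real_polynomial_function[OF compact_cbox ramp_cont, of "1 / (real n + 1)" n]) auto
  then obtain g where g: "!!n. real_polynomial_function (g n)"
  "!!n y. y : cbox (-1) 1 ==> \<bar>ramp n y - g n y\<bar> < 1 / (real n + 1)" by metis
  have ramp01: "0 <= ramp n y" "ramp n y <= 1" for n y
  unfolding ramp_def by (auto intro!: prod_nonneg prod_le_1)
  have gz: "(LINT x|torus L. g n (w x) * f x) = 0" for n
  proof -
  have "(LINT x|torus L. complex_of_real (g n (w x)) * complex_of_real (f x)) = 0"
  using trigp_integral_zero[OF trigp_polynomial[OF L g(1), of n c] fC zero] by (simp add: w_def)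
  hence "complex_of_real (LINT x|torus L. g n (w x) * f x) = 0"
  by (subst integral_complex_of_real[symmetric]) simp
  thus ?thesis by simp
  qed
  have lim: "(%n. g n (w x)) ~> indicator (box a b) x" if x: "!!i. 0 < x $ i & x $ i < L" for x
  proof -
  have "(%n. max 0 (min 1 (real n * (w x $ i - s i)))) ~> (if s i < w x $ i then 1 else 0)" for i
  proof (cases "s i < w x $ i")
  case True
  have "filterlim (%n. real n * (w x $ i - s i)) at_top sequentially"
  using True by (intro filterlim_tendsto_pos_mult_at_top[where c = "w x $ i - s i", THEN filterlim_compose[OF _ filterlim_ident]] filterlim_at_top_mult_tendsto_pos[OF tendsto_const _ filterlim_real_sequentially]) auto
  hence "eventually (%n. 1 <= real n * (w x $ i - s i)) sequentially"
  by (simp add: filterlim_at_top)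
  hence "eventually (%n. max 0 (min 1 (real n * (w x $ i - s i))) = 1) sequentially"
  by eventually_elim auto
  thus ?thesis using True by (simp add: tendsto_eventually)
  next
  case False
  hence "max 0 (min 1 (real n * (w x $ i - s i))) = 0" for n
  using mult_nonneg_nonpos[of "real n" "w x $ i - s i"] by auto
  thus ?thesis using False by simp
  qed
  hence "(%n. ramp n (w x)) ~> (PROD i:UNIV. if s i < w x $ i then 1 else 0)"
  unfolding ramp_def by (intro tendsto_prod)
  also have "(PROD i:UNIV. if s i < w x $ i then 1 else 0) = (indicator (box a b) x :: real)"
  using inbox[OF x] by (auto simp: indicator_def intro: prod.neutral)
  finally have r: "(%n. ramp n (w x)) ~> indicator (box a b) x" .
  have "(%n. g n (w x) - ramp n (w x)) ~> 0"
  proof (rule Lim_null_comparison)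
  show "eventually (%n. norm (g n (w x) - ramp n (w x)) <= 1 / (real n + 1)) sequentially"
  using g(2)[OF w_range] by (intro always_eventually allI) (simp add: abs_minus_commute less_imp_le)
  show "(%n. 1 / (real n + 1)) ~> 0" using LIMSEQ_inverse_real_of_nat by (simp add: inverse_eq_divide add.commute)
  qed
  from tendsto_add[OF this r] show ?thesis by simp
  qed
  have open_cell: "AE x in torus L. ALL i. 0 < x $ i & x $ i < L"
  proof -
  have "AE x in lborel. ALL i::3. x $ i ~= 0 & x $ i ~= L" by (rule AE_interior)
  thus ?thesis unfolding AE_torus
  proof eventually_elim
  case (elim x)
  thus ?case by (auto simp: mem_cell order_less_le)
  qed
  qed
  have "(%n. LINT x|torus L. g n (w x) * f x) ~> (LINT x|torus L. indicator (box a b) x * f x)"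
  proof (rule integral_dominated_convergence[where w = "%x. 2 * norm (f x)"])
  have gm: "g n : borel_measurable borel" for n
  using g(1) by (intro borel_measurable_continuous_onI continuous_on_polymonial_function) (simp add: real_polynomial_function_eq)
  have "(%x. g n (w x)) : borel_measurable borel" for n
  by (rule measurable_compose[OF \<open>w : borel_measurable borel\<close> gm])
  thus "(%x. g n (w x) * f x) : borel_measurable (torus L)" for n
  using \<open>f : borel_measurable borel\<close> by (intro measurable_torus borel_measurable_times)
  show "AE x in torus L. (%n. g n (w x) * f x) ~> indicator (box a b) x * f x"
  using open_cell by eventually_elim (intro tendsto_intros lim, auto)
  show "AE x in torus L. norm (g n (w x) * f x) <= 2 * norm (f x)" for n
  proof (rule AE_I2)
  fix x
  have "1 / (real n + 1) <= 1" by simp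
  hence "\<bar>g n (w x)\<bar> <= 2" using g(2)[OF w_range, of n x] ramp01[of n "w x"] by linarith
  thus "norm (g n (w x) * f x) <= 2 * norm (f x)" by (simp add: abs_mult mult_right_mono)
  qed
  show "(%x. indicator (box a b) x * f x) : borel_measurable (torus L)"
  using \<open>f : borel_measurable borel\<close> by (intro measurable_torus borel_measurable_times) auto
  qed (use f in auto)
  thus ?thesis unfolding gz by (simp add: LIMSEQ_const_iff)
 qed
 have "AE x in lborel. indicator (cell L) x * f x = 0"
 proof (rule AE_zero_if_box_integrals_zero)
  show "integrable lborel (%x. indicator (cell L) x * f x)" using f by (simp add: integrable_torus)
  fix a b :: "real^3"
  \<comment> \<open>An arbitrary box is clipped to the cell, up to the boundary of the cell, a null
    set; when the clipped box is degenerate, the integrand lives on a hyperplane.\<close>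
  define a' b' :: "real^3" where "a' = (\<chi> i. max 0 (a $ i))" and "b' = (\<chi> i. min L (b $ i))"
  show "(LINT x|lborel. indicator (box a b) x * (indicator (cell L) x * f x)) = 0"
  proof (cases "ALL i. a' $ i < b' $ i")
  case True
  have "(LINT x|lborel. indicator (box a b) x * (indicator (cell L) x * f x)) = (LINT x|lborel. indicator (cell L) x *\<^sub>R (indicator (box a' b') x * f x))"
  proof (rule integral_cong_AE)
  show "AE x in lborel. indicator (box a b) x * (indicator (cell L) x * f x) = indicator (cell L) x *\<^sub>R (indicator (box a' b') x * f x)"
  using AE_interior[of L]
  proof eventually_elim
  case (elim x)
  have "x : box a b \<longleftrightarrow> x : box a' b'" if "x : cell L"
  proof -
  have "0 < x $ i" "x $ i < L" for i using elim that by (auto simp: mem_cell order_less_le)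
  thus ?thesis by (simp add: mem_box_cart a'_def b'_def)
  qed
  thus ?case by (auto simp: indicator_def)
  qed
  qed measurable
  also have "... = 0"
  unfolding integral_torus[symmetric] by (rule box0) (use True in \<open>auto simp: a'_def b'_def\<close>)
  finally show ?thesis .
  next
  case False
  then obtain i where i: "~ a' $ i < b' $ i" by blast
  have eq: "indicator (box a b) x * (indicator (cell L) x * f x) = (if x $ i = a' $ i then indicator (box a b) x * (indicator (cell L) x * f x) else 0)" for x
  using i by (auto simp: mem_box_cart a'_def b'_def mem_cell indicator_def split: if_splits) (smt (verit))+
  have "AE x in lborel. indicator (box a b) x * (indicator (cell L) x * f x) = 0"
  using AE_nth_neq[of i "a' $ i"]
  proof eventually_elim
  case (elim x)
  show ?case by (rule trans[OF eq[of x] if_not_P[OF elim]])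
  qed
  thus ?thesis by (rule integral_eq_zero_AE)
  qed
 qed
 thus ?thesis unfolding AE_torus by eventually_elim auto
qed

section \<open>Riesz--Fischer and Parseval\<close>

lemma integral_cnj_complex: "(LINT x|M. cnj (f x)) = cnj (LINT x|M. f x)"
proof (cases "integrable M f")
 case True
 thus ?thesis by (rule integral_bounded_linear[OF bounded_linear_cnj])
next
 case False
 hence "~ integrable M (%x. cnj (f x))"
  using integrable_bounded_linear[OF bounded_linear_cnj, of M "%x. cnj (f x)"] by auto
 thus ?thesis using False by (simp add: not_integrable_integral_eq)
qed

lemma integrable_sq_diff:
 fixes f g :: "'a => 'b::{second_countable_topology, real_normed_vector}"
 assumes [measurable]: "f : borel_measurable M" "g : borel_measurable M"
  and "integrable M (%x. (norm (f x))^2)" "integrable M (%x. (norm (g x))^2)"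
 shows "integrable M (%x. (norm (f x - g x))^2)"
  and "(LINT x|M. (norm (f x - g x))^2) <= 2 * (LINT x|M. (norm (f x))^2) + 2 * (LINT x|M. (norm (g x))^2)"
proof -
 have b: "(norm (f x - g x))^2 <= 2 * (norm (f x))^2 + 2 * (norm (g x))^2" for x
 proof -
  have "(norm (f x - g x))^2 <= (norm (f x) + norm (g x))^2"
  by (intro power_mono norm_triangle_ineq4) auto
  also have "... <= 2 * (norm (f x))^2 + 2 * (norm (g x))^2"
  using sum_squares_bound[of "norm (f x)" "norm (g x)"] by (simp add: power2_sum)
  finally show ?thesis .
 qed
 have i: "integrable M (%x. 2 * (norm (f x))^2 + 2 * (norm (g x))^2)" using assms by auto
 show 1: "integrable M (%x. (norm (f x - g x))^2)"
  by (rule Bochner_Integration.integrable_bound[OF i]) (use b in \<open>auto intro!: AE_I2\<close>)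
 have "(LINT x|M. (norm (f x - g x))^2) <= (LINT x|M. 2 * (norm (f x))^2 + 2 * (norm (g x))^2)"
  by (intro integral_mono 1 i b)
 thus "(LINT x|M. (norm (f x - g x))^2) <= 2 * (LINT x|M. (norm (f x))^2) + 2 * (LINT x|M. (norm (g x))^2)"
  using assms by simp
qed

context finite_measure
begin

lemma integrable_if_square_integrable:
 fixes f :: "'a => 'b::{banach, second_countable_topology}"
 assumes [measurable]: "f : borel_measurable M" and "integrable M (%x. (norm (f x))^2)"
 shows "integrable M f"
proof (rule Bochner_Integration.integrable_bound)
 show "integrable M (%x. 1 + (norm (f x))^2)" using assms by auto
 show "AE x in M. norm (f x) <= norm (1 + (norm (f x))^2)"
 proof (rule AE_I2)
  fix x
  have "0 <= (norm (f x) - 1)^2" by simp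
  hence "2 * norm (f x) <= 1 + (norm (f x))^2" by (simp add: power2_diff)
  moreover have "0 <= (norm (f x))^2" "0 <= norm (f x)" by auto
  ultimately have "norm (f x) <= 1 + (norm (f x))^2" by linarith
  thus "norm (f x) <= norm (1 + (norm (f x))^2)" by simp
 qed
qed simp

text \<open>Cauchy-Schwarz from 0 <= integral of (m |f| - I)^2, with m the total mass and I the L1
  norm.\<close>

lemma L1_le_L2:
 fixes f :: "'a => 'b::{banach, second_countable_topology}"
 assumes [measurable]: "f : borel_measurable M" and f: "integrable M (%x. (norm (f x))^2)"
 shows "(LINT x|M. norm (f x))^2 <= measure M (space M) * (LINT x|M. (norm (f x))^2)"
proof -
 define I where "I = (LINT x|M. norm (f x))"
 define m where "m = measure M (space M)"
 have n: "integrable M (%x. norm (f x))" using integrable_if_square_integrable[OF assms] by simp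
 have m0: "m >= 0" by (simp add: m_def)
 have "0 <= (LINT x|M. (m * norm (f x) - I)^2)" by simp
 also have "(%x. (m * norm (f x) - I)^2) = (%x. m^2 * (norm (f x))^2 - 2 * m * I * norm (f x) + I^2)"
  by (intro ext) (simp add: power2_diff power_mult_distrib)
 also have "(LINT x|M. m^2 * (norm (f x))^2 - 2 * m * I * norm (f x) + I^2)
  = m^2 * (LINT x|M. (norm (f x))^2) - 2 * m * I * I + m * I^2"
  using f n by (simp add: I_def[symmetric] m_def[symmetric])
 finally have "m * I^2 <= m * (m * (LINT x|M. (norm (f x))^2))"
  by (simp add: power2_eq_square algebra_simps)
 show ?thesis
 proof (cases "m = 0")
  case True
  hence "emeasure M (space M) = 0" by (simp add: m_def emeasure_eq_measure)
  hence "AE x in M. False" by (intro AE_I[where N = "space M"]) auto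
  hence "I = 0" unfolding I_def by (intro integral_eq_zero_AE) (auto elim: eventually_mono)
  thus ?thesis using True by (simp add: I_def m_def)
 next
  case False
  hence "m > 0" using m0 by simp
  from mult_left_le_imp_le[OF \<open>m * I^2 <= _\<close> this] show ?thesis by (simp only: I_def m_def)
 qed
qed

text \<open>The rate 4^-j makes the L1 norms of the increments summable, which gives a limit almost
  everywhere; Fatou's lemma upgrades it to a limit in L2.\<close>

lemma L2_complete:
 fixes f :: "nat => 'a => complex"
 assumes [measurable]: "!!j. f j : borel_measurable M"
  and sq: "!!j. integrable M (%x. (norm (f j x))^2)"
  and cau: "!!j. (LINT x|M. (norm (f (Suc j) x - f j x))^2) <= (1/4) ^ j"
 obtains h where "h : borel_measurable M" "integrable M (%x. (norm (h x))^2)"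
  "(%j. LINT x|M. (norm (h x - f j x))^2) ~> 0"
proof -
 define d where "d j x = f (Suc j) x - f j x" for j x
 have [measurable]: "d j : borel_measurable M" for j unfolding d_def by measurable
 have dsq: "integrable M (%x. (norm (d j x))^2)" for j unfolding d_def by (intro integrable_sq_diff sq) auto
 have di: "integrable M (%x. norm (d j x))" for j
  using integrable_if_square_integrable[OF _ dsq] by simp
 define V where "V = measure M (space M)"
 have dL1: "(LINT x|M. norm (d j x)) <= (V + 1) * (1/2) ^ j" for j
 proof -
  have "(LINT x|M. norm (d j x))^2 <= V * (LINT x|M. (norm (d j x))^2)"
  unfolding V_def by (rule L1_le_L2[OF _ dsq]) simp
  also have "... <= V * (1/4) ^ j" using cau[of j] unfolding d_def V_def by (intro mult_left_mono) auto
  also have "... <= (V + 1)^2 * (1/4) ^ j"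
  by (intro mult_right_mono) (auto simp: V_def power2_eq_square algebra_simps)
  also have "... = ((V + 1) * (1/2) ^ j)^2"
  proof -
  have "(1/4 :: real) ^ j = ((1/2) ^ j)^2"
  by (simp add: power_mult[symmetric] mult.commute[of j]) (simp add: power_mult power_one_over[symmetric] power2_eq_square)
  thus ?thesis by (simp only: power_mult_distrib)
  qed
  finally show ?thesis by (rule power2_le_imp_le) (auto simp: V_def)
 qed
 have "AE x in M. summable (%j. norm (d j x))"
 proof -
  have "(\<integral>\<^sup>+x. (\<Sum>j. ennreal (norm (d j x))) \<partial>M) = (\<Sum>j. \<integral>\<^sup>+x. ennreal (norm (d j x)) \<partial>M)"
  by (rule nn_integral_suminf) simp
  also have "... = (\<Sum>j. ennreal (LINT x|M. norm (d j x)))"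
  using di by (intro suminf_cong nn_integral_eq_integral) auto
  also have "... <= (\<Sum>j. ennreal ((V + 1) * (1/2) ^ j))"
  by (intro suminf_le ennreal_leI dL1) auto
  also have "... = ennreal (\<Sum>j. (V + 1) * (1/2) ^ j)"
  by (intro suminf_ennreal2 summable_mult summable_geometric) (auto simp: V_def)
  also have "... < \<infinity>" by simp
  finally have "(\<integral>\<^sup>+x. (\<Sum>j. ennreal (norm (d j x))) \<partial>M) ~= \<infinity>" by simp
  hence "AE x in M. (\<Sum>j. ennreal (norm (d j x))) ~= \<infinity>"
  by (intro nn_integral_PInf_AE) auto
  thus ?thesis by eventually_elim (auto intro: summable_suminf_not_top)
 qed
 hence conv: "AE x in M. convergent (%n. f n x)"
 proof eventually_elim
  case (elim x)
  hence "summable (%j. d j x)" by (rule summable_norm_cancel)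
  hence "convergent (%n. \<Sum>j<n. d j x)" by (simp add: summable_iff_convergent)
  hence "convergent (%n. (\<Sum>j<n. d j x) + f 0 x)" by (intro convergent_add convergent_const)
  moreover have "(\<Sum>j<n. d j x) + f 0 x = f n x" for n
  using sum_lessThan_telescope[of "%n. f n x" n] by (simp add: d_def)
  ultimately show ?case by simp
 qed
 define h where "h x = lim (%n. f n x)" for x
 have hm [measurable]: "h : borel_measurable M" unfolding h_def by measurable
 have hl: "AE x in M. (%n. f n x) ~> h x"
  using conv unfolding h_def by eventually_elim (simp add: convergent_LIMSEQ_iff)
 define A where "A n j = (LINT x|M. (norm (f n x - f j x))^2)" for n j
 have Ai: "integrable M (%x. (norm (f n x - f j x))^2)" for n j by (intro integrable_sq_diff sq) auto
 \<comment> \<open>The inequality |u - v|^2 <= 2 |u|^2 + 2 |v|^2 costs a factor 2 per step, which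
   the rate 1/4 absorbs: 2 * 4 / 4 + 2 = 4.\<close>
 have Ab: "A (j + k) j <= 4 * (1/4) ^ j" for k j
 proof (induction k arbitrary: j)
  case 0
  thus ?case by (simp add: A_def)
 next
  case (Suc k)
  have "A (j + Suc k) j = (LINT x|M. (norm ((f (Suc j + k) x - f (Suc j) x) - (f j x - f (Suc j) x)))^2)"
  unfolding A_def by simp
  also have "... <= 2 * A (Suc j + k) (Suc j) + 2 * A j (Suc j)"
  unfolding A_def by (rule integrable_sq_diff(2)) (auto intro: Ai)
  also have "A j (Suc j) <= (1/4) ^ j" using cau[of j] by (simp add: A_def norm_minus_commute)
  also have "A (Suc j + k) (Suc j) <= 4 * (1/4) ^ Suc j" by (rule Suc.IH)
  finally show ?case by simp
 qed
 have fatou: "(\<integral>\<^sup>+x. ennreal ((norm (h x - f j x))^2) \<partial>M) <= ennreal (4 * (1/4) ^ j)" for j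
 proof -
  have "(\<integral>\<^sup>+x. ennreal ((norm (h x - f j x))^2) \<partial>M) = (\<integral>\<^sup>+x. liminf (%n. ennreal ((norm (f n x - f j x))^2)) \<partial>M)"
  proof (rule nn_integral_cong_AE, use hl in eventually_elim)
  case (elim x)
  have "(%n. ennreal ((norm (f n x - f j x))^2)) ~> ennreal ((norm (h x - f j x))^2)"
  by (intro tendsto_ennrealI tendsto_intros elim)
  thus ?case by (rule lim_imp_Liminf[OF trivial_limit_sequentially, symmetric])
  qed
  also have "... <= liminf (%n. \<integral>\<^sup>+x. ennreal ((norm (f n x - f j x))^2) \<partial>M)"
  by (rule nn_integral_liminf) measurable
  also have "... = liminf (%n. ennreal (A n j))"
  unfolding A_def using Ai by (subst nn_integral_eq_integral) auto
  also have "... <= ennreal (4 * (1/4) ^ j)"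
  proof (rule Liminf_le)
  show "eventually (%n. ennreal (A n j) <= ennreal (4 * (1/4) ^ j)) sequentially"
  using eventually_ge_at_top[of j]
  proof eventually_elim
  case (elim n)
  thus ?case using Ab[of j "n - j"] by (intro ennreal_leI) simp
  qed
  qed simp
  finally show ?thesis .
 qed
 have hi: "integrable M (%x. (norm (h x - f j x))^2)" for j
  by (rule integrableI_bounded) (use fatou[of j] in \<open>auto simp: le_less_trans\<close>)
 have hb: "(LINT x|M. (norm (h x - f j x))^2) <= 4 * (1/4) ^ j" for j
  using fatou[of j] nn_integral_eq_integral[OF hi, of j] by simp
 have "integrable M (%x. (norm ((h x - f 0 x) - (- f 0 x)))^2)"
  by (intro integrable_sq_diff hi) (use sq in auto)
 hence hsq: "integrable M (%x. (norm (h x))^2)" by simp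
 have "(%j. LINT x|M. (norm (h x - f j x))^2) ~> 0"
 proof (rule Lim_null_comparison)
  show "eventually (%j. norm (LINT x|M. (norm (h x - f j x))^2) <= 4 * (1/4) ^ j) sequentially"
  using hb by (intro always_eventually allI) simp
  have "(%j. 4 * (1/4 :: real) ^ j) ~> 4 * 0" by (intro tendsto_mult tendsto_const LIMSEQ_realpow_zero) auto
  thus "(%j. 4 * (1/4 :: real) ^ j) ~> 0" by simp
 qed
 with hm hsq show thesis by (rule that)
qed

end

definition ball_modes :: "real => real => (real^3) set" where
 "ball_modes L R = {k : wave_vectors L. norm k <= R}"

lemma finite_int_box: "finite {z :: int^3. ALL i. \<bar>z $ i\<bar> <= N}"
proof -
 have "{z :: int^3. ALL i. \<bar>z $ i\<bar> <= N} <= (%f. \<chi> i. f i) ` (PiE UNIV (%_. {-N..N}))"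
 proof
  fix z :: "int^3" assume z: "z : {z. ALL i. \<bar>z $ i\<bar> <= N}"
  hence "(%i. z $ i) : PiE UNIV (%_. {-N..N})" by (auto simp: abs_le_iff) (metis minus_le_iff)
  moreover have "z = (\<chi> i. z $ i)" by (simp add: vec_eq_iff)
  ultimately show "z : (%f. \<chi> i. f i) ` (PiE UNIV (%_. {-N..N}))" by blast
 qed
 thus ?thesis by (rule finite_subset) (intro finite_imageI finite_PiE, auto)
qed

definition wave :: "real => int^3 => real^3" where
 "wave L z = (\<chi> i. 2 * pi / L * of_int (z $ i))"

lemma wave_vectors_eq: "L > 0 ==> wave_vectors L = range (wave L)"
proof (intro equalityI subsetI)
 fix k assume L: "L > 0" and "k : wave_vectors L"
 hence "ALL i. EX z. k $ i / (2 * pi / L) = of_int z" by (auto simp: wave_vectors_def elim: Ints_cases)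
 then obtain z where z: "!!i. k $ i / (2 * pi / L) = of_int (z i)" by metis
 have "k = wave L (\<chi> i. z i)" using z L by (simp add: wave_def vec_eq_iff field_simps)
 thus "k : range (wave L)" by blast
qed (auto simp: wave_def wave_vectors_def)

lemma norm_wave: "L > 0 ==> norm (wave L z) = 2 * pi / L * sqrt (of_int (SUM i:UNIV. (z $ i)^2))"
proof -
 assume L: "L > 0"
 have "norm (wave L z) = sqrt ((2 * pi / L)^2 * (SUM i:UNIV. (of_int (z $ i))^2))"
  unfolding norm_vec_def L2_set_def wave_def sum_distrib_left real_norm_def power2_abs
  by (simp only: vec_lambda_beta power_mult_distrib)
 also have "... = 2 * pi / L * sqrt (SUM i:UNIV. (of_int (z $ i))^2)"
  using L by (simp add: real_sqrt_mult)
 finally show ?thesis by simp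
qed

lemma inj_wave: "L > 0 ==> inj (wave L)"
 by (auto simp: inj_def wave_def vec_eq_iff)

lemma finite_ball_modes [simp]: "L > 0 ==> finite (ball_modes L R)"
proof -
 assume L: "L > 0"
 define N where "N = \<lceil>R * L / (2 * pi)\<rceil>"
 have "ball_modes L R <= wave L ` {z. ALL i. \<bar>z $ i\<bar> <= N}"
 proof
  fix k assume k: "k : ball_modes L R"
  then obtain z where z: "k = wave L z" using wave_vectors_eq[OF L] by (auto simp: ball_modes_def)
  have "\<bar>z $ i\<bar> <= N" for i
  proof -
  have "\<bar>k $ i\<bar> <= R" using k component_le_norm_cart[of k i] by (auto simp: ball_modes_def)
  hence "\<bar>of_int (z $ i)\<bar> <= R * L / (2 * pi)" using L by (simp add: z wave_def abs_mult field_simps)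
  hence "of_int \<bar>z $ i\<bar> <= R * L / (2 * pi)" by simp
  thus ?thesis unfolding N_def by linarith
  qed
  thus "k : wave L ` {z. ALL i. \<bar>z $ i\<bar> <= N}" using z by blast
 qed
 thus ?thesis by (rule finite_subset) (intro finite_imageI finite_int_box)
qed

text \<open>Fourier synthesis: as \<open>mode k\<close> is exp(-i k x), the coefficients c are
  realised with \<open>mode (- k)\<close> and the factor 1 / L^3.\<close>

definition trig_sum :: "real => (real^3 => complex) => (real^3) set => real^3 => complex" where
 "trig_sum L c B x = (SUM k:B. c k * mode (- k) x) / of_real (L ^ 3)"

lemma trig_sum_measurable [measurable]: "trig_sum L c B : borel_measurable borel"
 unfolding trig_sum_def by measurable

lemma trig_sum_bounded: "norm (trig_sum L c B x) <= (SUM k:B. norm (c k)) / \<bar>L ^ 3\<bar>"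
 unfolding trig_sum_def norm_divide norm_of_real
 by (intro divide_right_mono order.trans[OF norm_sum] sum_mono) (auto simp: norm_mult)

lemma trig_sum_sq_integrable: "tint L (%x. (norm (trig_sum L c B x))^2)"
 by (rule finite_measure.integrable_const_bound[where B = "((SUM k:B. norm (c k)) / \<bar>L ^ 3\<bar>)^2"])
  (auto intro!: AE_I2 power_mono trig_sum_bounded measurable_torus)

lemma fc_trig_sum:
 assumes L: "L > 0" and B: "finite B" "B <= wave_vectors L" and l: "l : wave_vectors L"
 shows "fc L (trig_sum L c B) l = (if l : B then c l else 0)"
proof -
 have "fc L (trig_sum L c B) l = (LINT x|torus L. (SUM k:B. c k / of_real (L ^ 3) * mode (l - k) x))"
  unfolding fc_def trig_sum_def
  by (intro Bochner_Integration.integral_cong refl) (auto simp: sum_distrib_left sum_divide_distrib mode_add[of l "- _", simplified] mult_ac)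
 also have "... = (SUM k:B. c k / of_real (L ^ 3) * (LINT x|torus L. mode (l - k) x))"
  by (subst Bochner_Integration.integral_sum) auto
 also have "... = (SUM k:B. if k = l then c l else 0)"
 proof (rule sum.cong[OF refl])
  fix k assume k: "k : B"
  hence "l - k : wave_vectors L" using B l wave_vectors_diff by blast
  thus "c k / of_real (L ^ 3) * (LINT x|torus L. mode (l - k) x) = (if k = l then c l else 0)"
  using integral_mode[OF L] L by auto
 qed
 also have "... = (if l : B then c l else 0)" using B(1) by simp
 finally show ?thesis .
qed

lemma integral_trig_sum_inner:
 assumes L: "L > 0" and B: "finite B" "B <= wave_vectors L"
  and f: "tint L f"
 shows "tint L (%x. f x * cnj (trig_sum L c B x))"
  "(LINT x|torus L. f x * cnj (trig_sum L c B x)) = (SUM k:B. fc L f k * cnj (c k)) / of_real (L ^ 3)"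
proof -
 have fm: "tint L (%x. mode k x * f x)" for k
  by (rule integrable_mode_mult[OF f])
 have e: "f x * cnj (trig_sum L c B x) = (SUM k:B. cnj (c k) / of_real (L ^ 3) * (mode k x * f x))" for x
  by (simp add: trig_sum_def cnj_mode sum_distrib_left sum_divide_distrib mult_ac)
 have fi: "tint L (%x. cnj (c k) / of_real (L ^ 3) * (mode k x * f x))" for k
  by (rule integrable_mult_right[OF fm])
 show "tint L (%x. f x * cnj (trig_sum L c B x))"
  unfolding e by (rule Bochner_Integration.integrable_sum[OF fi])
 show "(LINT x|torus L. f x * cnj (trig_sum L c B x)) = (SUM k:B. fc L f k * cnj (c k)) / of_real (L ^ 3)"
  unfolding e Bochner_Integration.integral_sum[OF fi] integral_mult_right_zero fc_def sum_divide_distrib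
  by (intro sum.cong refl) simp
qed

lemma trig_sum_norm:
 assumes L: "L > 0" and B: "finite B" "B <= wave_vectors L"
 shows "(LINT x|torus L. (norm (trig_sum L c B x))^2) = (SUM k:B. (norm (c k))^2) / L ^ 3"
proof -
 interpret finite_measure "torus L" by simp
 have i: "tint L (trig_sum L c B)"
  by (rule integrable_if_square_integrable[OF measurable_torus trig_sum_sq_integrable]) simp
 have "complex_of_real (LINT x|torus L. (norm (trig_sum L c B x))^2) = (LINT x|torus L. trig_sum L c B x * cnj (trig_sum L c B x))"
  unfolding integral_complex_of_real[symmetric] complex_norm_square ..
 also have "... = (SUM k:B. fc L (trig_sum L c B) k * cnj (c k)) / of_real (L ^ 3)"
  by (rule integral_trig_sum_inner[OF L B i])
 also have "(SUM k:B. fc L (trig_sum L c B) k * cnj (c k)) = (SUM k:B. complex_of_real ((norm (c k))^2))"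
  using B by (intro sum.cong refl) (auto simp: fc_trig_sum[OF L B] complex_norm_square simp del: of_real_power)
 also have "... / of_real (L ^ 3) = complex_of_real ((SUM k:B. (norm (c k))^2) / L ^ 3)" by simp
 finally show ?thesis by (simp only: of_real_eq_iff)
qed

lemma bessel_identity:
 assumes L: "L > 0" and B: "finite B" "B <= wave_vectors L"
  and fm [measurable]: "f : borel_measurable (torus L)" and f: "tint L (%x. (norm (f x))^2)"
 shows "(LINT x|torus L. (norm (f x - trig_sum L (fc L f) B x))^2)
  = (LINT x|torus L. (norm (f x))^2) - (SUM k:B. (norm (fc L f k))^2) / L ^ 3"
proof -
 interpret finite_measure "torus L" by simp
 define P where "P = trig_sum L (fc L f) B"
 have fi: "tint L f" by (rule integrable_if_square_integrable[OF fm f])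
 have Psq: "tint L (%x. (norm (P x))^2)" unfolding P_def by (rule trig_sum_sq_integrable)
 have inn: "tint L (%x. f x * cnj (P x))"
  and inv: "(LINT x|torus L. f x * cnj (P x)) = complex_of_real ((SUM k:B. (norm (fc L f k))^2) / L ^ 3)"
  unfolding P_def using integral_trig_sum_inner[OF L B fi, of "fc L f"] by (auto simp: complex_norm_square simp del: of_real_power)
 have Re_int: "tint L (%x. Re (f x * cnj (P x)))" by (rule integrable_Re[OF inn])
 have Re_val: "(LINT x|torus L. Re (f x * cnj (P x))) = (SUM k:B. (norm (fc L f k))^2) / L ^ 3"
  using integral_Re[OF inn] inv by simp
 define R where "R x = Re (f x * cnj (P x))" for x
 have e: "(norm (f x - P x))^2 = (norm (f x))^2 - 2 * R x + (norm (P x))^2" for x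
  unfolding cmod_power2 R_def by (simp add: power2_eq_square algebra_simps)
 have "(LINT x|torus L. (norm (f x - P x))^2) = (LINT x|torus L. (norm (f x))^2)
  - 2 * (LINT x|torus L. R x) + (LINT x|torus L. (norm (P x))^2)"
  unfolding e using f Psq Re_int[folded R_def] by simp
 also have "(LINT x|torus L. (norm (P x))^2) = (SUM k:B. (norm (fc L f k))^2) / L ^ 3"
  unfolding P_def by (rule trig_sum_norm[OF L B])
 finally show ?thesis unfolding Re_val[folded R_def] P_def by simp
qed

lemma bessel:
 assumes "L > 0" "finite B" "B <= wave_vectors L"
  and "f : borel_measurable (torus L)" "tint L (%x. (norm (f x))^2)"
 shows "(SUM k:B. (norm (fc L f k))^2) <= L ^ 3 * (LINT x|torus L. (norm (f x))^2)"
proof -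
 have "0 <= (LINT x|torus L. (norm (f x - trig_sum L (fc L f) B x))^2)" by simp
 thus ?thesis unfolding bessel_identity[OF assms] using assms(1) by (simp add: field_simps)
qed

text \<open>The square sums are Cauchy, so a sparse sequence of radii brings the partial sums under
  \<open>L2_complete\<close>. The limit has the coefficients c because every k eventually lies
  inside the balls.\<close>

lemma riesz_fischer:
 assumes L: "L > 0" and bdd: "!!n. (SUM k:ball_modes L (real n). (norm (c k))^2) <= C"
 obtains h r where "h : borel_measurable (torus L)" "tint L (%x. (norm (h x))^2)"
  "!!k. k : wave_vectors L ==> fc L h k = c k"
  "(%j. LINT x|torus L. (norm (h x - trig_sum L c (ball_modes L (real (r j))) x))^2) ~> 0"
  "!!j. j <= r j"
proof -
 interpret finite_measure "torus L" by simp
 define s where "s n = (SUM k:ball_modes L (real n). (norm (c k))^2)" for n :: nat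
 have sub: "ball_modes L (real m) <= ball_modes L (real n)" if "m <= n" for m n using that by (auto simp: ball_modes_def)
 have Bw: "ball_modes L (real n) <= wave_vectors L" for n by (auto simp: ball_modes_def)
 have "incseq s" unfolding s_def by (intro monoI sum_mono2) (use sub L in auto)
 moreover have "bdd_above (range s)" using bdd by (auto simp: s_def bdd_above_def)
 ultimately have "Cauchy s" by (intro convergent_Cauchy) (meson incseq_bounded convergentI LIMSEQ_incseq_SUP)
 hence "EX N. ALL m>=N. ALL n>=N. dist (s m) (s n) < L ^ 3 * (1/4) ^ j" for j :: nat
  using L by (intro metric_CauchyD) auto
 then obtain N where N: "!!j m n. m >= N j ==> n >= N j ==> dist (s m) (s n) < L ^ 3 * (1/4) ^ j" by metis
 \<comment> \<open>Summing the thresholds makes r increasing, at least \<open>N j\<close> at j, and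
   at least the identity.\<close>
 define r where "r j = j + (SUM i<=j. N i)" for j
 have rN: "N j <= r j" "N j <= r (Suc j)" "r j <= r (Suc j)" "j <= r j" for j
 proof -
  have "N j <= (SUM i<=j. N i)" by (rule member_le_sum) auto
  thus "N j <= r j" "N j <= r (Suc j)" "r j <= r (Suc j)" "j <= r j" by (auto simp: r_def)
 qed
 define f where "f j = trig_sum L c (ball_modes L (real (r j)))" for j
 have fm: "f j : borel_measurable (torus L)" for j unfolding f_def by (intro measurable_torus) simp
 have fsq: "tint L (%x. (norm (f j x))^2)" for j unfolding f_def by (rule trig_sum_sq_integrable)
 have "(LINT x|torus L. (norm (f (Suc j) x - f j x))^2) <= (1/4) ^ j" for j
 proof -
  let ?D = "ball_modes L (real (r (Suc j))) - ball_modes L (real (r j))"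
  have "f (Suc j) x - f j x = trig_sum L c ?D x" for x
  unfolding f_def trig_sum_def using sum_diff[OF finite_ball_modes[OF L] sub[OF rN(3)], of "%k. c k * mode (- k) x"]
  by (simp add: diff_divide_distrib)
  hence "(LINT x|torus L. (norm (f (Suc j) x - f j x))^2) = (SUM k:?D. (norm (c k))^2) / L ^ 3"
  using trig_sum_norm[OF L, of ?D c] L Bw by auto
  also have "(SUM k:?D. (norm (c k))^2) = s (r (Suc j)) - s (r j)"
  unfolding s_def by (rule sum_diff[OF finite_ball_modes[OF L] sub[OF rN(3)]])
  also have "... <= L ^ 3 * (1/4) ^ j" using N[OF rN(2) rN(1), of j] by (simp add: dist_real_def)
  finally show ?thesis using L by (simp add: field_simps divide_right_mono)
 qed
 then obtain h where h: "h : borel_measurable (torus L)" "tint L (%x. (norm (h x))^2)"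
  "(%j. LINT x|torus L. (norm (h x - f j x))^2) ~> 0"
  using L2_complete[of f, OF fm fsq] by blast
 have "fc L h k = c k" if k: "k : wave_vectors L" for k
 proof -
  have hi: "tint L h" by (rule integrable_if_square_integrable[OF h(1,2)])
  have fi: "tint L (f j)" for j by (rule integrable_if_square_integrable[OF fm fsq])
  have mi: "tint L (%x. mode k x * g x)" if "tint L g" for g
  using that by (rule integrable_mode_mult)
  have "(%j. fc L h k - fc L (f j) k) ~> 0"
  proof (rule Lim_null_comparison)
  show "eventually (%j. norm (fc L h k - fc L (f j) k) <= sqrt (measure (torus L) (space (torus L)) * (LINT x|torus L. (norm (h x - f j x))^2))) sequentially"
  proof (intro always_eventually allI)
  fix j
  have "fc L h k - fc L (f j) k = (LINT x|torus L. mode k x * (h x - f j x))"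
  unfolding fc_def right_diff_distrib by (rule Bochner_Integration.integral_diff[OF mi[OF hi] mi[OF fi], symmetric])
  also have "norm ... <= (LINT x|torus L. norm (mode k x * (h x - f j x)))" by (rule integral_norm_bound)
  also have "... = (LINT x|torus L. norm (h x - f j x))" by (simp add: norm_mult)
  also have "... <= sqrt (measure (torus L) (space (torus L)) * (LINT x|torus L. (norm (h x - f j x))^2))"
  using h(1,2) fm fsq by (intro real_le_rsqrt L1_le_L2 integrable_sq_diff) auto
  finally show "norm (fc L h k - fc L (f j) k) <= sqrt (measure (torus L) (space (torus L)) * (LINT x|torus L. (norm (h x - f j x))^2))" .
  qed
  have "(%j. sqrt (measure (torus L) (space (torus L)) * (LINT x|torus L. (norm (h x - f j x))^2))) ~> sqrt (measure (torus L) (space (torus L)) * 0)"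
  by (intro tendsto_intros h(3))
  thus "(%j. sqrt (measure (torus L) (space (torus L)) * (LINT x|torus L. (norm (h x - f j x))^2))) ~> 0" by simp
  qed
  moreover have "eventually (%j. fc L (f j) k = c k) sequentially"
  proof -
  obtain n :: nat where n: "norm k <= real n" using real_arch_simple by blast
  show ?thesis using eventually_ge_at_top[of n]
  proof eventually_elim
  case (elim j)
  have "norm k <= real (r j)" using n elim rN(4)[of j] by linarith
  hence "k : ball_modes L (real (r j))" using k by (simp add: ball_modes_def)
  thus ?case unfolding f_def using fc_trig_sum[OF L finite_ball_modes[OF L] Bw k] by simp
  qed
  qed
  hence "eventually (%j. fc L h k - fc L (f j) k = fc L h k - c k) sequentially"
  by eventually_elim simp
  ultimately have "(%j. fc L h k - c k) ~> 0" by (rule Lim_transform_eventually)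
  thus ?thesis by (simp add: LIMSEQ_const_iff)
 qed
 thus thesis using h rN(4) that[of h r] unfolding f_def by blast
qed

text \<open>The coefficients of the real and the imaginary part are combinations of those of f at k
  and -k, so the real case applies to both. A function on the torus is multiplied by the indicator
  of the cell to become Borel on the whole space.\<close>

lemma fc_unique:
 assumes L: "L > 0" and f: "tint L f" and zero: "!!k. k : wave_vectors L ==> fc L f k = 0"
 shows "AE x in torus L. f x = 0"
proof -
 have mi: "tint L (%x. mode k x * f x)" for k by (rule integrable_mode_mult[OF f])
 have ci: "tint L (%x. mode k x * cnj (f x))" for k
  by (rule integrable_mode_mult) (use f in simp)
 have zc: "fc L (%x. cnj (f x)) k = 0" if "k : wave_vectors L" for k
 proof -
  have "fc L (%x. cnj (f x)) k = (LINT x|torus L. cnj (mode (- k) x * f x))"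
  unfolding fc_def by (simp add: cnj_mode)
  also have "... = cnj (fc L f (- k))" unfolding fc_def by (rule integral_cnj_complex)
  also have "... = 0" using zero[OF wave_vectors_uminus[OF that]] by simp
  finally show ?thesis .
 qed
 have real_case: "AE x in torus L. g x = 0" if gi: "tint L g" and gz: "!!k. k : wave_vectors L ==> fc L (cx g) k = 0" for g :: "real^3 => real"
 proof -
  define g' where "g' x = indicator (cell L) x * g x" for x
  have g'm: "g' : borel_measurable borel" using gi unfolding g'_def by (auto simp: integrable_torus)
  have g'i: "tint L g'"
  using gi by (subst Bochner_Integration.integrable_cong[OF refl, of _ _ g]) (auto simp: g'_def)
  have "fc L (%x. complex_of_real (g' x)) k = fc L (cx g) k" for k
  unfolding fc_def by (intro Bochner_Integration.integral_cong) (auto simp: g'_def)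
  hence "AE x in torus L. g' x = 0" using gz by (intro fc_unique_real[OF L g'm g'i]) auto
  thus ?thesis by (rule AE_mp) (auto simp: g'_def)
 qed
 have "AE x in torus L. Re (f x) = 0"
 proof (rule real_case)
  show "tint L (%x. Re (f x))" using f by simp
  fix k assume k: "k : wave_vectors L"
  have "fc L (%x. complex_of_real (Re (f x))) k = (LINT x|torus L. (mode k x * f x + mode k x * cnj (f x)) / 2)"
  unfolding fc_def by (intro Bochner_Integration.integral_cong) (auto simp: complex_add_cnj[symmetric] ring_distribs complex_eq_iff)
  also have "... = (fc L f k + fc L (%x. cnj (f x)) k) / 2"
  unfolding fc_def using mi ci by simp
  finally show "fc L (%x. complex_of_real (Re (f x))) k = 0" using zero[OF k] zc[OF k] by simp
 qed
 moreover have "AE x in torus L. Im (f x) = 0"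
 proof (rule real_case)
  show "tint L (%x. Im (f x))" using f by simp
  fix k assume k: "k : wave_vectors L"
  have "fc L (%x. complex_of_real (Im (f x))) k = (LINT x|torus L. (mode k x * f x - mode k x * cnj (f x)) / (2 * \<i>))"
  unfolding fc_def
  proof (rule Bochner_Integration.integral_cong[OF refl])
  fix x
  have "f x - cnj (f x) = complex_of_real (Im (f x)) * (2 * \<i>)" by (simp add: complex_eq_iff)
  hence "complex_of_real (Im (f x)) = (f x - cnj (f x)) / (2 * \<i>)"
  by (intro nonzero_eq_divide_eq[THEN iffD2]) auto
  thus "mode k x * complex_of_real (Im (f x)) = (mode k x * f x - mode k x * cnj (f x)) / (2 * \<i>)"
  by (simp only: right_diff_distrib times_divide_eq_right)
  qed
  also have "... = (fc L f k - fc L (%x. cnj (f x)) k) / (2 * \<i>)"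
  unfolding fc_def using mi ci by simp
  finally show "fc L (%x. complex_of_real (Im (f x))) k = 0" using zero[OF k] zc[OF k] by simp
 qed
 ultimately show ?thesis by eventually_elim (simp add: complex_eq_iff)
qed

text \<open>The Riesz-Fischer function with the coefficients of f is f itself by uniqueness, so the
  defect in Bessel's identity tends to 0 along the radii r; monotonicity of the square sums gives
  the full sequence.\<close>

theorem parseval:
 assumes L: "L > 0" and fm: "f : borel_measurable (torus L)" and f: "tint L (%x. (norm (f x))^2)"
 shows "(%n. SUM k:ball_modes L (real n). (norm (fc L f k))^2) ~> L ^ 3 * (LINT x|torus L. (norm (f x))^2)"
proof -
 interpret finite_measure "torus L" by simp
 have Bw: "ball_modes L (real n) <= wave_vectors L" for n by (auto simp: ball_modes_def)
 define s where "s n = (SUM k:ball_modes L (real n). (norm (fc L f k))^2)" for n :: nat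
 have bd: "s n <= L ^ 3 * (LINT x|torus L. (norm (f x))^2)" for n
  unfolding s_def by (rule bessel[OF L _ Bw fm f]) (use L in simp)
 obtain h r where h: "h : borel_measurable (torus L)" "tint L (%x. (norm (h x))^2)"
  "!!k. k : wave_vectors L ==> fc L h k = fc L f k"
  "(%j. LINT x|torus L. (norm (h x - trig_sum L (fc L f) (ball_modes L (real (r j))) x))^2) ~> 0"
  "!!j. j <= r j"
  by (rule riesz_fischer[OF L bd[unfolded s_def]]) (rule that)
 have fi: "tint L f" and hi: "tint L h"
  using integrable_if_square_integrable fm f h by auto
 have mi: "tint L (%x. mode k x * g x)" if "tint L g" for g k
  using that by (rule integrable_mode_mult)
 have "AE x in torus L. f x - h x = 0"
 proof (rule fc_unique[OF L])
  show "tint L (%x. f x - h x)" using fi hi by simp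
  fix k assume k: "k : wave_vectors L"
  have "fc L (%x. f x - h x) k = fc L f k - fc L h k"
  unfolding fc_def right_diff_distrib by (rule Bochner_Integration.integral_diff[OF mi[OF fi] mi[OF hi]])
  thus "fc L (%x. f x - h x) k = 0" using h(3)[OF k] by simp
 qed
 hence "(LINT x|torus L. (norm (h x - trig_sum L (fc L f) (ball_modes L (real (r j))) x))^2)
  = (LINT x|torus L. (norm (f x - trig_sum L (fc L f) (ball_modes L (real (r j))) x))^2)" for j
  using fm h(1) measurable_torus[OF trig_sum_measurable]
  by (intro integral_cong_AE borel_measurable_power borel_measurable_norm borel_measurable_diff) auto
 hence "(%j. (LINT x|torus L. (norm (f x))^2) - s (r j) / L ^ 3) ~> 0"
  using h(4) bessel_identity[OF L finite_ball_modes[OF L] Bw fm f] by (simp add: s_def)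
 hence "(%j. L ^ 3 * ((LINT x|torus L. (norm (f x))^2) - ((LINT x|torus L. (norm (f x))^2) - s (r j) / L ^ 3)))
  ~> L ^ 3 * ((LINT x|torus L. (norm (f x))^2) - 0)" by (intro tendsto_intros)
 hence sr: "(%j. s (r j)) ~> L ^ 3 * (LINT x|torus L. (norm (f x))^2)" using L by simp
 have inc: "s m <= s n" if "m <= n" for m n
  unfolding s_def by (rule sum_mono2[OF finite_ball_modes[OF L]]) (use that in \<open>auto simp: ball_modes_def\<close>)
 have "s ~> L ^ 3 * (LINT x|torus L. (norm (f x))^2)"
 proof (rule increasing_LIMSEQ)
  show "s n <= s (Suc n)" for n by (rule inc) simp
  show "s n <= L ^ 3 * (LINT x|torus L. (norm (f x))^2)" for n by (rule bd)
  fix e :: real assume "0 < e"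
  hence "eventually (%j. s (r j) > L ^ 3 * (LINT x|torus L. (norm (f x))^2) - e) sequentially"
  by (intro order_tendstoD(1)[OF sr]) simp
  then obtain j where "s (r j) > L ^ 3 * (LINT x|torus L. (norm (f x))^2) - e" by (auto simp: eventually_sequentially)
  thus "EX n. L ^ 3 * (LINT x|torus L. (norm (f x))^2) <= s n + e" by (intro exI[of _ "r j"]) simp
 qed
 thus ?thesis unfolding s_def .
qed

section \<open>Smooth periodic functions and weak derivatives\<close>

lemma smooth_add: "smooth f ==> smooth g ==> smooth (%p. f p + g p)"
 by (simp add: smooth_def times_differentiable_add)

lemma smooth_uminus: "smooth f ==> smooth (%p. - f p :: real)"
 using smooth_mult[OF smooth_const[of "-1"]] by simp

lemma smooth_diff: "smooth f ==> smooth g ==> smooth (%p. f p - g p :: real)"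
 using smooth_add[OF _ smooth_uminus] by simp

lemma dirderiv_add:
 "smooth f ==> smooth g ==> dirderiv v (%p. f p + g p) p = dirderiv v f p + dirderiv v g p"
 by (rule dirderiv_eqI[of _ "%v. dirderiv v f p + dirderiv v g p"])
  (intro has_derivative_add differentiable_has_derivative smooth_differentiable)

lemma dirderiv_mult:
 fixes f g :: "'a::real_normed_vector => real"
 shows "smooth f ==> smooth g ==> dirderiv v (%p. f p * g p) p = f p * dirderiv v g p + dirderiv v f p * g p"
 by (rule dirderiv_eqI[of _ "%v. f p * dirderiv v g p + dirderiv v f p * g p"])
  (intro has_derivative_mult differentiable_has_derivative smooth_differentiable)

lemma dirderiv_eq_line:
 assumes "smooth f" "((%s. f (x + s *\<^sub>R v)) has_vector_derivative d) (at 0)"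
 shows "dirderiv v f x = d"
 using vector_derivative_unique_at[OF dirderiv_along_line[OF assms(1), of x v 0 UNIV, simplified] assms(2)] by simp

lemma periodic_dirderiv:
 assumes "smooth f" "space_periodic L f" shows "space_periodic L (dirderiv v f)"
 unfolding space_periodic_def
proof (intro allI)
 fix x :: "real^3" and i
 have "((%s. f (x + axis i L + s *\<^sub>R v)) has_vector_derivative dirderiv v f (x + axis i L)) (at 0)"
  using dirderiv_along_line[OF assms(1), of "x + axis i L" v 0 UNIV] by simp
 moreover have "f (x + axis i L + s *\<^sub>R v) = f (x + s *\<^sub>R v)" for s
  using assms(2)[unfolded space_periodic_def, rule_format, of "x + s *\<^sub>R v" i] by (simp add: add_ac)
 ultimately have "((%s. f (x + s *\<^sub>R v)) has_vector_derivative dirderiv v f (x + axis i L)) (at 0)"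
  by (simp only:)
 thus "dirderiv v f (x + axis i L) = dirderiv v f x"
  by (rule dirderiv_eq_line[OF assms(1), symmetric])
qed

lemma smooth_measurable: "smooth f ==> f : borel_measurable borel"
 for f :: "'a::real_normed_vector => 'b::real_normed_vector"
 by (intro borel_measurable_continuous_onI smooth_continuous)

lemma smooth_bounded_cell:
 assumes "smooth (f :: real^3 => 'b::real_normed_vector)"
 obtains C where "C > 0" "!!x. x : cell L ==> norm (f x) <= C"
proof -
 have "compact (f ` cell L)"
  unfolding cell_def by (intro compact_continuous_image compact_cbox continuous_on_subset[OF smooth_continuous[OF assms]]) auto
 then obtain C where "C > 0" "ALL y:f ` cell L. norm y <= C"
  using compact_imp_bounded bounded_pos by blast
 thus thesis using that[of C] by blast
qed

lemma integrable_mult_smooth: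
 assumes v: "tint L v" and f: "smooth f"
 shows "tint L (%x. v x * f x :: real)"
proof -
 obtain C where C: "C > 0" "!!x. x : cell L ==> norm (f x) <= C" using smooth_bounded_cell[OF f] by blast
 show ?thesis
 proof (rule Bochner_Integration.integrable_bound)
  show "tint L (%x. C * v x)" using v by simp
  show "(%x. v x * f x) : borel_measurable (torus L)"
  using v by (intro borel_measurable_times measurable_torus[OF smooth_measurable[OF f]]) auto
  show "AE x in torus L. norm (v x * f x) <= norm (C * v x)"
  proof (rule AE_I2)
  fix x assume "x : space (torus L)"
  hence "norm (f x) * norm (v x) <= C * norm (v x)" using C(2) by (intro mult_right_mono) auto
  thus "norm (v x * f x) <= norm (C * v x)" using C(1) by (simp add: abs_mult mult.commute)
  qed
 qed
qed

lemma integrable_smooth: "smooth f ==> tint L (f :: real^3 => real)"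
 using integrable_mult_smooth[of L "%_. 1" f] finite_measure.integrable_const[OF finite_measure_torus[of L], of "1::real"] by simp

lemma upd_line: "upd x i s = upd x i 0 + s *\<^sub>R axis i 1"
 by (auto simp: vec_eq_iff axis_def)

lemma line_integral_dirderiv:
 assumes L: "L > 0" and f: "smooth (f :: real^3 => real)" "space_periodic L f"
 shows "(LINT s:{0..L}|lborel. dirderiv (axis i 1) f (upd x i s)) = 0"
proof -
 define p where "p = upd x i 0"
 have line: "upd x i s = p + s *\<^sub>R axis i 1" for s unfolding p_def by (rule upd_line)
 have "(LINT s:{0..L}|lborel. dirderiv (axis i 1) f (upd x i s)) = f (upd x i L) - f (upd x i 0)"
  unfolding set_lebesgue_integral_def
 proof (rule integral_FTC_Icc)
  show "0 <= L" using L by simp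
  show "((%s. f (upd x i s)) has_vector_derivative dirderiv (axis i 1) f (upd x i s)) (at s within {0..L})" for s
  unfolding line by (rule dirderiv_along_line[OF f(1)])
  have "continuous_on {0..L} (%s. p + s *\<^sub>R axis i 1)" by (intro continuous_intros)
  thus "continuous_on {0..L} (%s. dirderiv (axis i 1) f (upd x i s))"
  unfolding line
  by (intro continuous_on_compose2[OF smooth_continuous[OF smooth_dirderiv[OF f(1)]]]) auto
 qed
 also have "upd x i L = upd x i 0 + axis i L" by (auto simp: vec_eq_iff axis_def)
 finally show ?thesis using f(2) by (simp add: space_periodic_def)
qed

lemma integral_dirderiv_zero:
 assumes L: "L > 0" and f: "smooth (f :: real^3 => real)" "space_periodic L f"
 shows "(LINT x|torus L. dirderiv (axis i 1) f x) = 0"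
proof -
 have "complex_of_real L * (LINT x|torus L. complex_of_real (dirderiv (axis i 1) f x))
  = (LINT x|torus L. (LINT s:{0..L}|lborel. complex_of_real (dirderiv (axis i 1) f (upd x i s))))"
  using smooth_measurable[OF smooth_dirderiv[OF f(1)]] integrable_smooth[OF smooth_dirderiv[OF f(1)]]
  by (intro line_average[OF L]) auto
 also have "... = 0"
  unfolding set_integral_complex_of_real line_integral_dirderiv[OF L f] by simp
 finally show ?thesis using L by simp
qed

lemma bounded_linear_inner: "bounded_linear (%x::real^3. k \<bullet> x)"
 by (rule bounded_linear_inner_right)

lemma smooth_cos: "smooth (%x::real^3. cos (k \<bullet> x))" and smooth_sin: "smooth (%x::real^3. sin (k \<bullet> x))"
 by (rule smooth_linear_compose[OF bounded_linear_inner smooth1_cos] smooth_linear_compose[OF bounded_linear_inner smooth1_sin])+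

lemma dirderiv_cos: "dirderiv v (%x::real^3. cos (k \<bullet> x)) x = - (k \<bullet> v) * sin (k \<bullet> x)"
 by (rule dirderiv_eqI[of _ "%v. - (k \<bullet> v) * sin (k \<bullet> x)"]) (auto intro!: derivative_eq_intros)

lemma dirderiv_sin: "dirderiv v (%x::real^3. sin (k \<bullet> x)) x = (k \<bullet> v) * cos (k \<bullet> x)"
 by (rule dirderiv_eqI[of _ "%v. (k \<bullet> v) * cos (k \<bullet> x)"]) (auto intro!: derivative_eq_intros)

lemma mode_eq: "mode k x = complex_of_real (cos (k \<bullet> x)) - \<i> * complex_of_real (sin (k \<bullet> x))"
 by (simp add: mode_def complex_eq_iff exp_minus Re_exp Im_exp)

lemma mode_periodic:
 assumes L: "L > 0" and k: "k : wave_vectors L" shows "mode k (x + axis i L) = mode k x"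
proof -
 obtain z where z: "k $ i / (2 * pi / L) = of_int z" using k by (auto simp: wave_vectors_def elim: Ints_cases)
 hence "k \<bullet> (x + axis i L) = k \<bullet> x + 2 * pi * of_int z"
  using L by (simp add: inner_add_right inner_axis field_simps)
 hence "mode k (x + axis i L) = mode k x * exp (2 * of_int (- z) * of_real pi * \<i>)"
  by (simp add: mode_def exp_add[symmetric] algebra_simps)
 moreover have "exp (2 * of_int (- z) * complex_of_real pi * \<i>) = 1"
  using exp_integer_2pi[of "of_int (- z)"] by (simp add: mult_ac)
 ultimately show ?thesis by (simp only: mult_1_right)
qed

lemma periodic_cos: "L > 0 ==> k : wave_vectors L ==> space_periodic L (%x. cos (k \<bullet> x))"
 and periodic_sin: "L > 0 ==> k : wave_vectors L ==> space_periodic L (%x. sin (k \<bullet> x))"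
 using mode_periodic[of L k] unfolding space_periodic_def mode_eq complex_eq_iff by simp_all

lemma fc_real:
 assumes f: "tint L f"
 shows "fc L (cx f) k
  = complex_of_real (LINT x|torus L. f x * cos (k \<bullet> x)) - \<i> * complex_of_real (LINT x|torus L. f x * sin (k \<bullet> x))"
proof -
 note c = integrable_mult_smooth[OF f smooth_cos[of k]] and s = integrable_mult_smooth[OF f smooth_sin[of k]]
 have "mode k x * complex_of_real (f x) = complex_of_real (f x * cos (k \<bullet> x)) - \<i> * complex_of_real (f x * sin (k \<bullet> x))" for x
  by (simp add: mode_eq algebra_simps)
 thus ?thesis unfolding fc_def
  using c s by (simp only: Bochner_Integration.integral_diff integrable_mult_right integral_mult_right_zero integral_complex_of_real complex_of_real_integrable_eq)
qed

text \<open>The integrand has the modulus of f, so it is not integrable either and the integral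
  takes its default value 0.\<close>

lemma fc_not_integrable:
 assumes "f : borel_measurable (torus L)" "~ tint L f" shows "fc L f k = 0"
proof -
 have "~ tint L (%x. mode k x * f x)"
 proof
  assume "tint L (%x. mode k x * f x)"
  from integrable_mode_mult[OF this, of "- k"] have "tint L f"
  by (simp add: mult.assoc[symmetric] mode_add[symmetric])
  thus False using assms by simp
 qed
 thus ?thesis by (simp add: fc_def not_integrable_integral_eq)
qed

lemma fc_uminus_cnj: "fc L (cx f) (- k) = cnj (fc L (cx f) k)"
 unfolding fc_def integral_cnj_complex[symmetric] by (simp add: cnj_mode)

lemma fc_dirderiv:
 assumes L: "L > 0" and f: "smooth (f :: real^3 => real)" "space_periodic L f" and k: "k : wave_vectors L"
 shows "fc L (%x. complex_of_real (dirderiv (axis i 1) f x)) k = \<i> * of_real (k $ i) * fc L (cx f) k"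
proof -
 have per: "space_periodic L (%x. f x * g x)" if "space_periodic L g" for g using f(2) that by (simp add: space_periodic_def)
 have i: "tint L (%x. g x * h x)" if "smooth g" "smooth h" for g h :: "real^3 => real"
  by (intro integrable_smooth smooth_mult that)
 note d = smooth_dirderiv[OF f(1), of "axis i 1"]
 have "0 = (LINT x|torus L. dirderiv (axis i 1) (%x. f x * cos (k \<bullet> x)) x)"
  by (rule integral_dirderiv_zero[OF L smooth_mult[OF f(1) smooth_cos] per[OF periodic_cos[OF L k]], symmetric])
 also have "... = (LINT x|torus L. - (k $ i) * (f x * sin (k \<bullet> x)) + dirderiv (axis i 1) f x * cos (k \<bullet> x))"
  by (simp add: dirderiv_mult[OF f(1) smooth_cos] dirderiv_cos inner_axis mult_ac)
 also have "... = - (k $ i) * (LINT x|torus L. f x * sin (k \<bullet> x)) + (LINT x|torus L. dirderiv (axis i 1) f x * cos (k \<bullet> x))"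
  by (subst Bochner_Integration.integral_add) (auto intro!: integrable_mult_right i f d smooth_sin smooth_cos simp del: mult_minus_left)
 finally have c: "(LINT x|torus L. dirderiv (axis i 1) f x * cos (k \<bullet> x)) = k $ i * (LINT x|torus L. f x * sin (k \<bullet> x))" by simp
 have "0 = (LINT x|torus L. dirderiv (axis i 1) (%x. f x * sin (k \<bullet> x)) x)"
  by (rule integral_dirderiv_zero[OF L smooth_mult[OF f(1) smooth_sin] per[OF periodic_sin[OF L k]], symmetric])
 also have "... = (LINT x|torus L. k $ i * (f x * cos (k \<bullet> x)) + dirderiv (axis i 1) f x * sin (k \<bullet> x))"
  by (simp add: dirderiv_mult[OF f(1) smooth_sin] dirderiv_sin inner_axis mult_ac)
 also have "... = k $ i * (LINT x|torus L. f x * cos (k \<bullet> x)) + (LINT x|torus L. dirderiv (axis i 1) f x * sin (k \<bullet> x))"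
  by (subst Bochner_Integration.integral_add) (auto intro!: integrable_mult_right i f d smooth_sin smooth_cos)
 finally have s: "(LINT x|torus L. dirderiv (axis i 1) f x * sin (k \<bullet> x)) = - k $ i * (LINT x|torus L. f x * cos (k \<bullet> x))" by simp
 show ?thesis
  unfolding fc_real[OF integrable_smooth[OF d]] fc_real[OF integrable_smooth[OF f(1)]] c s
  by (simp add: complex_eq_iff)
qed

text \<open>One entry of \<open>is_weak_grad\<close> as a relation between scalar functions. Only g
  has to be square integrable; v may fail to be integrable, and then some of the integrals on the
  left take the default value 0.\<close>

definition weak_deriv :: "real => 3 => (real^3 => real) => (real^3 => real) => bool" where
 "weak_deriv L i v g \<longleftrightarrow> square_integrable L g &
  (ALL \<phi> :: real^3 => real. smooth \<phi> & space_periodic L \<phi> -->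
  (LINT x|torus L. v x * dirderiv (axis i 1) \<phi> x) = - (LINT x|torus L. g x * \<phi> x))"

lemma weak_derivD:
 "weak_deriv L i v g ==> smooth \<phi> ==> space_periodic L \<phi> ==>
  (LINT x|torus L. v x * dirderiv (axis i 1) \<phi> x) = - (LINT x|torus L. g x * \<phi> x)"
 by (simp add: weak_deriv_def)

lemma square_integrable_integrable: "square_integrable L g ==> tint L g"
 by (auto simp: square_integrable_def intro: finite_measure.integrable_if_square_integrable)

lemma weak_deriv_integrable: "weak_deriv L i v g ==> tint L g"
 by (simp add: weak_deriv_def square_integrable_integrable)

text \<open>If \<open>v\<close> is not integrable, then all integrals against test functions vanish: adding to an integrable
 \<open>v * dirderiv (axis i 1) \<phi>\<close> a non-integrable one of the same kind gives the junk value 0.\<close>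

lemma weak_deriv_not_integrable:
 assumes L: "L > 0" and vm: "v : borel_measurable (torus L)" and nv: "~ tint L v"
  and w: "weak_deriv L i v g" and ph: "smooth \<phi>" "space_periodic L \<phi>"
 shows "(LINT x|torus L. v x * dirderiv (axis i 1) \<phi> x) = 0"
proof (cases "tint L (%x. v x * dirderiv (axis i 1) \<phi> x)")
 case True
 define k :: "real^3" where "k = axis i (2 * pi / L)"
 have k: "k : wave_vectors L" unfolding wave_vectors_def k_def using L by (auto simp: axis_def)
 have ki: "k $ i ~= 0" using L by (simp add: k_def)
 \<comment> \<open>If all these products were integrable, then so would be v times cos and v times
   sin at one frequency, and |cos| + |sin| >= 1 would make v integrable.\<close>
 have "EX f. smooth f & space_periodic L f & ~ tint L (%x. v x * dirderiv (axis i 1) f x)"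
 proof (rule ccontr)
  assume *: "~ ?thesis"
  have "tint L (%x. v x * dirderiv (axis i 1) (%x. cos (k \<bullet> x)) x)"
  "tint L (%x. v x * dirderiv (axis i 1) (%x. sin (k \<bullet> x)) x)"
  using * smooth_cos[of k] smooth_sin[of k] periodic_cos[OF L k] periodic_sin[OF L k] by blast+
  hence "tint L (%x. (- inverse (k $ i)) * (v x * dirderiv (axis i 1) (%x. cos (k \<bullet> x)) x))"
  "tint L (%x. inverse (k $ i) * (v x * dirderiv (axis i 1) (%x. sin (k \<bullet> x)) x))"
  by (simp_all only: integrable_mult_right)
  hence i: "tint L (%x. v x * sin (k \<bullet> x))" "tint L (%x. v x * cos (k \<bullet> x))"
  using ki by (simp_all add: dirderiv_cos dirderiv_sin inner_axis field_simps)
  have "tint L v"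
  proof (rule Bochner_Integration.integrable_bound)
  show "tint L (%x. \<bar>v x * sin (k \<bullet> x)\<bar> + \<bar>v x * cos (k \<bullet> x)\<bar>)" using i by simp
  show "AE x in torus L. norm (v x) <= norm (\<bar>v x * sin (k \<bullet> x)\<bar> + \<bar>v x * cos (k \<bullet> x)\<bar>)"
  proof (rule AE_I2)
  fix x
  have "1 <= \<bar>sin (k \<bullet> x)\<bar> + \<bar>cos (k \<bullet> x)\<bar>"
  using abs_sin_le_one[of "k \<bullet> x"] abs_cos_le_one[of "k \<bullet> x"] sin_cos_squared_add[of "k \<bullet> x"]
  mult_left_le[of "\<bar>sin (k \<bullet> x)\<bar>" "\<bar>sin (k \<bullet> x)\<bar>"] mult_left_le[of "\<bar>cos (k \<bullet> x)\<bar>" "\<bar>cos (k \<bullet> x)\<bar>"]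
  by (simp add: power2_eq_square)
  hence "\<bar>v x\<bar> * 1 <= \<bar>v x\<bar> * (\<bar>sin (k \<bullet> x)\<bar> + \<bar>cos (k \<bullet> x)\<bar>)" by (intro mult_left_mono) auto
  thus "norm (v x) <= norm (\<bar>v x * sin (k \<bullet> x)\<bar> + \<bar>v x * cos (k \<bullet> x)\<bar>)"
  by (simp add: abs_mult distrib_left)
  qed
  qed (rule vm)
  thus False using nv by simp
 qed
 then obtain f where f: "smooth f" "space_periodic L f" "~ tint L (%x. v x * dirderiv (axis i 1) f x)" by blast
 have gi: "tint L g" by (rule weak_deriv_integrable[OF w])
 have "~ tint L (%x. v x * dirderiv (axis i 1) (%p. \<phi> p + f p) x)"
 proof
  assume "tint L (%x. v x * dirderiv (axis i 1) (%p. \<phi> p + f p) x)"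
  hence "tint L (%x. v x * dirderiv (axis i 1) (%p. \<phi> p + f p) x - v x * dirderiv (axis i 1) \<phi> x)"
  using True by (rule Bochner_Integration.integrable_diff)
  thus False using f by (simp add: dirderiv_add[OF ph(1) f(1)] distrib_left)
 qed
 hence "(LINT x|torus L. g x * (\<phi> x + f x)) = 0"
  using weak_derivD[OF w smooth_add[OF ph(1) f(1)]] ph(2) f(2) by (simp add: not_integrable_integral_eq space_periodic_def)
 moreover have "(LINT x|torus L. g x * f x) = 0"
  using weak_derivD[OF w f(1,2)] f(3) by (simp add: not_integrable_integral_eq)
 moreover have "(LINT x|torus L. g x * (\<phi> x + f x)) = (LINT x|torus L. g x * \<phi> x) + (LINT x|torus L. g x * f x)"
  unfolding distrib_left by (intro Bochner_Integration.integral_add integrable_mult_smooth gi ph f)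
 ultimately show ?thesis using weak_derivD[OF w ph] by simp
qed (simp add: not_integrable_integral_eq)

text \<open>For integrable v this is the weak identity tested with cos and sin. For other v both
  sides are 0, the left one by \<open>weak_deriv_not_integrable\<close> and the right one by the
  default value in \<open>fc\<close>.\<close>

lemma fc_weak_deriv:
 assumes L: "L > 0" and vm: "v : borel_measurable (torus L)" and w: "weak_deriv L i v g" and k: "k : wave_vectors L"
 shows "fc L (cx g) k = \<i> * of_real (k $ i) * fc L (cx v) k"
proof -
 have gi: "tint L g" by (rule weak_deriv_integrable[OF w])
 note c = weak_derivD[OF w smooth_cos periodic_cos[OF L k]] and s = weak_derivD[OF w smooth_sin periodic_sin[OF L k]]
 show ?thesis
 proof (cases "tint L v")
  case True
  have "(LINT x|torus L. g x * cos (k \<bullet> x)) = k $ i * (LINT x|torus L. v x * sin (k \<bullet> x))"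
  using c by (simp add: dirderiv_cos inner_axis mult.left_commute[of _ "k $ i"])
  moreover have "(LINT x|torus L. g x * sin (k \<bullet> x)) = - (k $ i) * (LINT x|torus L. v x * cos (k \<bullet> x))"
  using s by (simp add: dirderiv_sin inner_axis mult.left_commute[of _ "k $ i"])
  ultimately show ?thesis unfolding fc_real[OF gi] fc_real[OF True] by (simp add: complex_eq_iff)
 next
  case False
  have "(LINT x|torus L. g x * cos (k \<bullet> x)) = 0" "(LINT x|torus L. g x * sin (k \<bullet> x)) = 0"
  using c s weak_deriv_not_integrable[OF L vm False w smooth_cos periodic_cos[OF L k]]
  weak_deriv_not_integrable[OF L vm False w smooth_sin periodic_sin[OF L k]] by simp_all
  moreover have "fc L (cx v) k = 0"
  proof (rule fc_not_integrable)
  show "(cx v) : borel_measurable (torus L)" using vm by simp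
  have "tint L (cx v) ==> tint L v"
  using integrable_Re[of "torus L" "%x. complex_of_real (v x)"] by simp
  thus "~ tint L (cx v)" using False by blast
  qed
  ultimately show ?thesis unfolding fc_real[OF gi] by simp
 qed
qed

lemma sum_inverse_squares_bounded:
 assumes "a > 0"
 obtains M where "!!N. (SUM z:{- int N..int N}. 1 / (1 + (a * of_int z)^2)) <= (M::real)" "M >= 0"
proof -
 define f where "f n = 1 / (1 + (a * real n)^2)" for n
 have f0: "f n >= 0" for n by (simp add: f_def add_nonneg_nonneg)
 have "summable f"
 proof (rule summable_comparison_test')
  show "summable (%n. 1 / a^2 * (1 / (real n)^2))"
  by (intro summable_mult) (use inverse_power_summable[of 2, where 'a = real] in \<open>simp add: inverse_eq_divide\<close>)
  show "norm (f n) <= 1 / a^2 * (1 / (real n)^2)" if "n >= 1" for n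
  proof -
  have "(a * real n)^2 <= 1 + (a * real n)^2" "0 < (a * real n)^2" using assms that by auto
  moreover from this have "0 < 1 + (a * real n)^2" by linarith
  ultimately have "1 / (1 + (a * real n)^2) <= 1 / (a * real n)^2"
  by (intro divide_left_mono mult_pos_pos) simp_all
  thus ?thesis using f0[of n] by (simp add: f_def power_mult_distrib)
  qed
 qed
 hence sum: "(SUM n<=N. f n) <= suminf f" for N by (rule sum_le_suminf) (auto simp: f0)
 define g where "g z = 1 / (1 + (a * of_int z)^2)" for z :: int
 have g0: "g z >= 0" for z by (simp add: g_def add_nonneg_nonneg)
 show thesis
 proof (rule that[of "2 * suminf f"])
  fix N
  define A B where "A = int ` {..N}" and "B = (%n. - int n) ` {..N}"
  have "{- int N..int N} <= A \<union> B"
  proof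
  fix z assume "z : {- int N..int N}"
  hence "z = int (nat z) & nat z <= N \<or> z = - int (nat (- z)) & nat (- z) <= N" by auto
  thus "z : A \<union> B" unfolding A_def B_def by blast
  qed
  hence "sum g {- int N..int N} <= sum g (A \<union> B)"
  using g0 by (intro sum_mono2) (auto simp: A_def B_def)
  also have "... <= sum g (A \<union> B) + sum g (A \<inter> B)" using g0 by (simp add: sum_nonneg)
  also have "... = sum g A + sum g B" by (rule sum.union_inter) (auto simp: A_def B_def)
  also have "... = (SUM n<=N. f n) + (SUM n<=N. f n)"
  unfolding A_def B_def by (subst (1 2) sum.reindex) (auto simp: inj_on_def g_def f_def)
  finally show "(SUM z:{- int N..int N}. 1 / (1 + (a * of_int z)^2)) <= 2 * suminf f"
  using sum[of N] by (simp add: g_def)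
 qed (use sum[of 0] f0[of 0] in simp)
qed

lemma ball_modes_subset:
 assumes L: "L > 0"
 obtains N where "ball_modes L R <= (%g. wave L (\<chi> j. g j)) ` (PiE UNIV (%_. {- int N..int N}))"
proof
 show "ball_modes L R <= (%g. wave L (\<chi> j. g j)) ` (PiE UNIV (%_. {- int (nat \<lceil>R * L / (2 * pi)\<rceil>)..int (nat \<lceil>R * L / (2 * pi)\<rceil>)}))"
 proof
  fix k assume k: "k : ball_modes L R"
  then obtain z where z: "k = wave L z" using wave_vectors_eq[OF L] by (auto simp: ball_modes_def)
  have "\<bar>z $ i\<bar> <= int (nat \<lceil>R * L / (2 * pi)\<rceil>)" for i
  proof -
  have "\<bar>k $ i\<bar> <= R" using k component_le_norm_cart[of k i] by (auto simp: ball_modes_def)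
  hence "\<bar>of_int (z $ i)\<bar> <= R * L / (2 * pi)" using L by (simp add: z wave_def abs_mult field_simps)
  hence "of_int \<bar>z $ i\<bar> <= R * L / (2 * pi)" by simp
  thus ?thesis by linarith
  qed
  hence "(%i. z $ i) : PiE UNIV (%_. {- int (nat \<lceil>R * L / (2 * pi)\<rceil>)..int (nat \<lceil>R * L / (2 * pi)\<rceil>)})"
  unfolding PiE_UNIV_domain Pi_iff atLeastAtMost_iff by (metis abs_le_iff minus_le_iff)
  moreover have "k = wave L (\<chi> j. z $ j)" using z by simp
  ultimately show "k : (%g. wave L (\<chi> j. g j)) ` (PiE UNIV (%_. {- int (nat \<lceil>R * L / (2 * pi)\<rceil>)..int (nat \<lceil>R * L / (2 * pi)\<rceil>)}))"
  by blast
 qed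
qed

lemma norm_fc_le: "norm (fc L f k) <= (LINT x|torus L. norm (f x))"
 unfolding fc_def using integral_norm_bound[of "torus L" "%x. mode k x * f x"] by (simp add: norm_mult)

text \<open>Apply \<open>(1 - \<partial>\<^sub>1\<^sup>2)(1 - \<partial>\<^sub>2\<^sup>2)(1 - \<partial>\<^sub>3\<^sup>2)\<close>.\<close>

lemma fc_smooth_summable:
 assumes L: "L > 0" and ph: "smooth (\<phi> :: real^3 => real)" "space_periodic L \<phi>"
 obtains M where "!!R. (SUM k:ball_modes L R. norm (fc L (%x. complex_of_real (\<phi> x)) k)) <= M"
proof -
 define H where "H j f = (%x. f x - dirderiv (axis j 1) (dirderiv (axis j 1) f) x)" for j :: 3 and f :: "real^3 => real"
 have Hs: "smooth (H j f)" "space_periodic L (H j f)" if "smooth f" "space_periodic L f" for j f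
 proof -
  note d = smooth_dirderiv[OF that(1), of "axis j 1"] periodic_dirderiv[OF that, of "axis j 1"]
  note d2 = smooth_dirderiv[OF d(1), of "axis j 1"] periodic_dirderiv[OF d, of "axis j 1"]
  show "smooth (H j f)" unfolding H_def by (rule smooth_diff[OF that(1) d2(1)])
  show "space_periodic L (H j f)" using that(2) d2(2) by (simp add: H_def space_periodic_def)
 qed
 have Hf: "fc L (%x. complex_of_real (H j f x)) k = of_real (1 + (k $ j)^2) * fc L (cx f) k"
  if f: "smooth f" "space_periodic L f" and k: "k : wave_vectors L" for j f k
 proof -
  have d: "smooth (dirderiv (axis j 1) f)" "space_periodic L (dirderiv (axis j 1) f)"
  using f smooth_dirderiv periodic_dirderiv by auto
  have "fc L (%x. complex_of_real (H j f x)) k = fc L (cx f) k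
  - fc L (%x. complex_of_real (dirderiv (axis j 1) (dirderiv (axis j 1) f) x)) k"
  unfolding fc_def H_def of_real_diff right_diff_distrib
  by (intro Bochner_Integration.integral_diff integrable_mode_mult)
  (simp_all only: complex_of_real_integrable_eq integrable_smooth f smooth_dirderiv)
  thus ?thesis unfolding fc_dirderiv[OF L d k] fc_dirderiv[OF L f k]
  by (simp add: algebra_simps power2_eq_square)
 qed
 define \<psi> where "\<psi> = H 1 (H 2 (H 3 \<phi>))"
 define C where "C = (LINT x|torus L. norm (complex_of_real (\<psi> x)))"
 \<comment> \<open>Each operator multiplies the coefficient at k by \<open>1 + (k $ j)^2\<close>,
   and the coefficients of the resulting function are bounded by its L1 norm. The product of the
   three inverse factors is summable over the lattice.\<close>
 have fb: "norm (fc L (%x. complex_of_real (\<phi> x)) k) <= C * (PROD j:UNIV. 1 / (1 + (k $ j)^2))" if k: "k : wave_vectors L" for k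
 proof -
  have pos: "1 + (k $ j)^2 > 0" for j by (simp add: add_pos_nonneg)
  have prod3: "(PROD j:UNIV. 1 + (k $ j)^2) = (1 + (k $ 1)^2) * ((1 + (k $ 2)^2) * (1 + (k $ 3)^2))"
  unfolding UNIV_3 by simp
  have "fc L (%x. complex_of_real (\<psi> x)) k = of_real (PROD j:UNIV. 1 + (k $ j)^2) * fc L (%x. complex_of_real (\<phi> x)) k"
  unfolding \<psi>_def Hf[OF Hs[OF Hs[OF ph]] k] Hf[OF Hs[OF ph] k] Hf[OF ph k]
  prod3 of_real_mult mult.assoc ..
  moreover define P where "P = (PROD j:UNIV. 1 + (k $ j)^2)"
  moreover have P: "P > 0" unfolding P_def using pos by (intro prod_pos) auto
  ultimately have "norm (fc L (%x. complex_of_real (\<psi> x)) k) = P * norm (fc L (%x. complex_of_real (\<phi> x)) k)"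
  by (simp only: norm_mult norm_of_real abs_of_pos)
  moreover have "norm (fc L (%x. complex_of_real (\<psi> x)) k) <= C" unfolding C_def by (rule norm_fc_le)
  ultimately have "norm (fc L (%x. complex_of_real (\<phi> x)) k) <= C * (1 / P)"
  using P by (simp add: field_simps)
  thus ?thesis unfolding P_def by (simp add: prod_dividef)
 qed
 have C0: "C >= 0" by (simp add: C_def)
 obtain M where M: "!!N. (SUM z:{- int N..int N}. 1 / (1 + (2 * pi / L * of_int z)^2)) <= M" "M >= 0"
  using sum_inverse_squares_bounded[of "2 * pi / L"] L by auto
 show thesis
 proof (rule that[of "C * M ^ 3"])
  fix R
  obtain N where N: "ball_modes L R <= (%g. wave L (\<chi> j. g j)) ` (PiE UNIV (%_. {- int N..int N}))"
  using ball_modes_subset[OF L] by blast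
  let ?S = "PiE (UNIV :: 3 set) (%_. {- int N..int N})"
  have fin: "finite ?S" by (intro finite_PiE) auto
  have inj: "inj_on (%g. wave L (\<chi> j. g j)) ?S"
  proof (rule inj_onI)
  fix g h :: "3 => int" assume "wave L (\<chi> j. g j) = wave L (\<chi> j. h j)"
  hence "(\<chi> j. g j) = (\<chi> j. h j)" by (rule injD[OF inj_wave[OF L]])
  thus "g = h" by (simp add: vec_eq_iff fun_eq_iff)
  qed
  have "(SUM k:ball_modes L R. norm (fc L (%x. complex_of_real (\<phi> x)) k)) <= (SUM k:ball_modes L R. C * (PROD j:UNIV. 1 / (1 + (k $ j)^2)))"
  by (intro sum_mono fb) (auto simp: ball_modes_def)
  also have "... <= (SUM k:(%g. wave L (\<chi> j. g j)) ` ?S. C * (PROD j:UNIV. 1 / (1 + (k $ j)^2)))"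
  using N C0 by (intro sum_mono2 finite_imageI fin) (auto intro!: mult_nonneg_nonneg prod_nonneg add_nonneg_nonneg)
  also have "... = C * (SUM g:?S. PROD j:UNIV. 1 / (1 + (2 * pi / L * of_int (g j))^2))"
  by (subst sum.reindex[OF inj]) (simp add: sum_distrib_left wave_def)
  also have "(SUM g:?S. PROD j:UNIV. 1 / (1 + (2 * pi / L * of_int (g j))^2)) = (PROD j:(UNIV::3 set). SUM z:{- int N..int N}. 1 / (1 + (2 * pi / L * of_int z)^2))"
  by (rule prod_sum_PiE[symmetric]) auto
  also have "C * ... <= C * M ^ 3"
  unfolding prod_constant card_num1 using M(1)[of N] C0
  by (intro mult_left_mono) (auto intro!: power_mono sum_nonneg add_nonneg_nonneg)
  finally show "(SUM k:ball_modes L R. norm (fc L (%x. complex_of_real (\<phi> x)) k)) <= C * M ^ 3" .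
 qed
qed

lemma trig_sum_pairing:
 assumes f: "tint L f"
 shows "tint L (%x. trig_sum L c B x * f x)"
  and "(LINT x|torus L. trig_sum L c B x * f x) = (SUM k:B. c k * fc L f (- k)) / of_real (L ^ 3)"
proof -
 have e: "trig_sum L c B x * f x = (SUM k:B. c k / of_real (L ^ 3) * (mode (- k) x * f x))" for x
  unfolding trig_sum_def sum_divide_distrib sum_distrib_right by (intro sum.cong refl) simp
 have fi: "tint L (%x. c k / of_real (L ^ 3) * (mode (- k) x * f x))" for k
  by (rule integrable_mult_right[OF integrable_mode_mult[OF f]])
 show "tint L (%x. trig_sum L c B x * f x)"
  unfolding e by (rule Bochner_Integration.integrable_sum[OF fi])
 show "(LINT x|torus L. trig_sum L c B x * f x) = (SUM k:B. c k * fc L f (- k)) / of_real (L ^ 3)"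
  unfolding e Bochner_Integration.integral_sum[OF fi] integral_mult_right_zero fc_def sum_divide_distrib
  by (intro sum.cong refl) simp
qed

text \<open>Here f is merely integrable, so convergence in L2 of the Fourier series of \<phi> does
  not suffice. Its partial sums are bounded uniformly, by summability of the coefficients, and
  converge almost everywhere along a subsequence, so dominated convergence applies. Starting from a
  given q allows two such subsequences to be nested.\<close>

lemma fourier_pairing:
 assumes L: "L > 0" and f: "tint L f"
  and ph: "smooth (\<phi> :: real^3 => real)" "space_periodic L \<phi>" and q: "strict_mono (q :: nat => nat)"
 obtains r :: "nat => nat" where "strict_mono r"
  "(%n. (SUM k:ball_modes L (real (q (r n))). fc L (%x. complex_of_real (\<phi> x)) k * fc L f (- k)) / of_real (L ^ 3))
  ~> (LINT x|torus L. complex_of_real (\<phi> x) * f x)"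
proof -
 interpret finite_measure "torus L" by simp
 define F where "F x = complex_of_real (\<phi> x)" for x
 define T where "T n = trig_sum L (fc L F) (ball_modes L (real (q n)))" for n
 define V where "V = measure (torus L) (space (torus L))"
 have Fm: "F : borel_measurable (torus L)"
  unfolding F_def using measurable_torus[OF smooth_measurable[OF ph(1)]] by simp
 have Fsq: "tint L (%x. (norm (F x))^2)"
  using integrable_smooth[OF smooth_mult[OF ph(1) ph(1)]] by (simp add: F_def power2_eq_square)
 have Tm: "T n : borel_measurable (torus L)" for n unfolding T_def by (intro measurable_torus) simp
 have Tsq: "tint L (%x. (norm (T n x))^2)" for n unfolding T_def by (rule trig_sum_sq_integrable)
 have Bw: "ball_modes L R <= wave_vectors L" for R by (auto simp: ball_modes_def)
 note pars = LIMSEQ_subseq_LIMSEQ[OF parseval[OF L Fm Fsq] q, unfolded o_def]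
 have "(%n. (LINT x|torus L. (norm (F x))^2) - (SUM k:ball_modes L (real (q n)). (norm (fc L F k))^2) / L ^ 3)
  ~> (LINT x|torus L. (norm (F x))^2) - L ^ 3 * (LINT x|torus L. (norm (F x))^2) / L ^ 3"
  using L by (intro tendsto_intros pars) auto
 hence l2: "(%n. LINT x|torus L. (norm (F x - T n x))^2) ~> 0"
  using L unfolding T_def bessel_identity[OF L finite_ball_modes[OF L] Bw Fm Fsq] by simp
 have di: "tint L (%x. F x - T n x)" for n
  using integrable_if_square_integrable[OF Fm Fsq] integrable_if_square_integrable[OF Tm Tsq] by simp
 have "(%n. LINT x|torus L. norm (F x - T n x)) ~> 0"
 proof (rule Lim_null_comparison)
  show "eventually (%n. norm (LINT x|torus L. norm (F x - T n x)) <= sqrt (V * (LINT x|torus L. (norm (F x - T n x))^2))) sequentially"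
  proof (intro always_eventually allI)
  fix n
  have "(LINT x|torus L. norm (F x - T n x))^2 <= V * (LINT x|torus L. (norm (F x - T n x))^2)"
  unfolding V_def by (intro L1_le_L2 integrable_sq_diff Fm Fsq Tm Tsq borel_measurable_diff)
  thus "norm (LINT x|torus L. norm (F x - T n x)) <= sqrt (V * (LINT x|torus L. (norm (F x - T n x))^2))"
  by (simp add: real_le_rsqrt)
  qed
  have "(%n. sqrt (V * (LINT x|torus L. (norm (F x - T n x))^2))) ~> sqrt (V * 0)"
  by (intro tendsto_intros l2)
  thus "(%n. sqrt (V * (LINT x|torus L. (norm (F x - T n x))^2))) ~> 0" by simp
 qed
 from tendsto_L1_AE_subseq[OF di this]
 obtain r :: "nat => nat" where r: "strict_mono r" "AE x in torus L. (%n. F x - T (r n) x) ~> 0" by blast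
 obtain M where M: "!!R. (SUM k:ball_modes L R. norm (fc L F k)) <= M"
  using fc_smooth_summable[OF L ph] unfolding F_def by blast
 have "(%n. LINT x|torus L. T (r n) x * f x) ~> (LINT x|torus L. F x * f x)"
 proof (rule integral_dominated_convergence[where w = "%x. M / L ^ 3 * norm (f x)"])
  show "(%x. F x * f x) : borel_measurable (torus L)" "(%x. T (r n) x * f x) : borel_measurable (torus L)" for n
  using f by (auto intro!: borel_measurable_times Fm Tm)
  show "tint L (%x. M / L ^ 3 * norm (f x))" using f by simp
  show "AE x in torus L. (%n. T (r n) x * f x) ~> F x * f x"
  using r(2)
  proof eventually_elim
  case (elim x)
  have "(%n. (F x - (F x - T (r n) x)) * f x) ~> (F x - 0) * f x" by (intro tendsto_intros elim)
  thus ?case by simp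
  qed
  show "AE x in torus L. norm (T (r n) x * f x) <= M / L ^ 3 * norm (f x)" for n
  proof (rule AE_I2)
  fix x
  have "norm (T (r n) x) <= (SUM k:ball_modes L (real (q (r n))). norm (fc L F k)) / \<bar>L ^ 3\<bar>"
  unfolding T_def by (rule trig_sum_bounded)
  also have "... <= M / L ^ 3" using M[of "real (q (r n))"] L by (simp add: divide_right_mono)
  finally show "norm (T (r n) x * f x) <= M / L ^ 3 * norm (f x)"
  unfolding norm_mult by (rule mult_right_mono) simp
  qed
 qed
 thus thesis using that[OF r(1)] unfolding T_def trig_sum_pairing(2)[OF f] F_def by blast
qed

text \<open>In terms of Fourier coefficients, existence is a countable combination of conditions on
  finite sums, hence measurable in a parameter; this is why the bound C is a natural number. Bessel
  gives one direction, Riesz-Fischer constructs the derivative in the other.\<close>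

lemma weak_deriv_iff_integrable:
 assumes L: "L > 0" and v: "tint L v"
 shows "(EX g. weak_deriv L i v g) \<longleftrightarrow>
  (EX C::nat. ALL n::nat. (SUM k:ball_modes L (real n). (norm (\<i> * of_real (k $ i) * fc L (cx v) k))^2) <= real C)"
proof
 assume "EX g. weak_deriv L i v g"
 then obtain g where g: "weak_deriv L i v g" by blast
 define G where "G x = complex_of_real (g x)" for x
 have Gm: "G : borel_measurable (torus L)"
 proof -
  have "g : borel_measurable (torus L)" using g by (simp add: weak_deriv_def square_integrable_def)
  thus ?thesis unfolding G_def[abs_def] by measurable
 qed
 have Gsq: "tint L (%x. (norm (G x))^2)"
  using g by (simp add: weak_deriv_def square_integrable_def G_def)
 obtain C :: nat where C: "L ^ 3 * (LINT x|torus L. (norm (G x))^2) <= real C" using real_arch_simple by blast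
 have "(SUM k:ball_modes L (real n). (norm (\<i> * of_real (k $ i) * fc L (cx v) k))^2) <= real C" for n
 proof -
  have "(SUM k:ball_modes L (real n). (norm (\<i> * of_real (k $ i) * fc L (cx v) k))^2)
  = (SUM k:ball_modes L (real n). (norm (fc L G k))^2)"
  unfolding G_def using fc_weak_deriv[OF L _ g] v by (intro sum.cong refl) (auto simp: ball_modes_def)
  also have "... <= L ^ 3 * (LINT x|torus L. (norm (G x))^2)"
  by (rule bessel[OF L finite_ball_modes[OF L] _ Gm Gsq]) (auto simp: ball_modes_def)
  finally show ?thesis using C by linarith
 qed
 thus "EX C::nat. ALL n::nat. (SUM k:ball_modes L (real n). (norm (\<i> * of_real (k $ i) * fc L (cx v) k))^2) <= real C" by blast
next
 define V where "V x = complex_of_real (v x)" for x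
 have Vi: "tint L V" unfolding V_def[abs_def] using v by simp
 define c where "c k = \<i> * of_real (k $ i) * fc L V k" for k
 assume "EX C::nat. ALL n::nat. (SUM k:ball_modes L (real n). (norm (\<i> * of_real (k $ i) * fc L (cx v) k))^2) <= real C"
 then obtain C :: nat where C: "!!n::nat. (SUM k:ball_modes L (real n). (norm (c k))^2) <= real C"
  unfolding c_def V_def by blast
 obtain h r where hm: "h : borel_measurable (torus L)" and hsq: "tint L (%x. (norm (h x))^2)"
  and hc: "!!k. k : wave_vectors L ==> fc L h k = c k"
  and "(%j. LINT x|torus L. (norm (h x - trig_sum L c (ball_modes L (real (r j))) x))^2) ~> 0" "!!j. j <= r j"
  by (rule riesz_fischer[OF L C]) (rule that)
 define g where "g x = Re (h x)" for x
 have gm: "g : borel_measurable (torus L)" unfolding g_def using hm by measurable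
 have gsq: "tint L (%x. (norm (g x))^2)"
 proof (rule Bochner_Integration.integrable_bound[OF hsq])
  show "(%x. (norm (g x))^2) : borel_measurable (torus L)" using gm by measurable
  show "AE x in torus L. norm ((norm (g x))^2) <= norm ((norm (h x))^2)"
  by (intro AE_I2) (simp add: g_def cmod_power2)
 qed
 have g2: "square_integrable L g" using gm gsq by (simp add: square_integrable_def)
 define G where "G x = complex_of_real (g x)" for x
 have hi: "tint L h"
  using finite_measure.integrable_if_square_integrable[OF finite_measure_torus hm hsq] .
 have Gi: "tint L G" unfolding G_def[abs_def] using square_integrable_integrable[OF g2] by simp
 \<comment> \<open>The candidate coefficients have the symmetry of a real function, so the real part
   of h has the same coefficients as h.\<close>
 have ccnj: "cnj (c (- k)) = c k" for k
  unfolding c_def V_def by (simp add: fc_uminus_cnj)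
 have gc: "fc L G k = c k" if k: "k : wave_vectors L" for k
 proof -
  have "fc L G k = (LINT x|torus L. (mode k x * h x + cnj (mode (- k) x * h x)) / 2)"
  unfolding fc_def
  proof (rule Bochner_Integration.integral_cong[OF refl])
  fix x
  have "G x = (h x + cnj (h x)) / 2" by (simp add: G_def g_def complex_add_cnj)
  thus "mode k x * G x = (mode k x * h x + cnj (mode (- k) x * h x)) / 2"
  by (simp only: complex_cnj_mult cnj_mode minus_minus distrib_left times_divide_eq_right)
  qed
  also have "... = (fc L h k + cnj (fc L h (- k))) / 2"
  unfolding fc_def integral_cnj_complex[symmetric] integral_divide_zero
  using integrable_mode_mult[OF hi]
  by (subst Bochner_Integration.integral_add) (auto intro: integrable_bounded_linear[OF bounded_linear_cnj] simp del: complex_cnj_mult)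
  also have "... = c k" unfolding hc[OF k] hc[OF wave_vectors_uminus[OF k]] ccnj by simp
  finally show ?thesis .
 qed
 have "weak_deriv L i v g"
  unfolding weak_deriv_def
 proof (intro conjI allI impI g2)
  fix \<phi> :: "real^3 => real" assume "smooth \<phi> & space_periodic L \<phi>"
  hence ph: "smooth \<phi>" "space_periodic L \<phi>" by auto
  obtain r where r: "strict_mono r"
  "(%n. (SUM k:ball_modes L (real (r n)). fc L (%x. complex_of_real (\<phi> x)) k * fc L G (- k)) / of_real (L ^ 3))
  ~> (LINT x|torus L. complex_of_real (\<phi> x) * G x)"
  by (rule fourier_pairing[OF L Gi ph, of "%n. n"]) (auto simp: strict_mono_def)
  obtain s where s: "strict_mono s"
  "(%n. (SUM k:ball_modes L (real (r (s n))). fc L (%x. complex_of_real (dirderiv (axis i 1) \<phi> x)) k * fc L V (- k)) / of_real (L ^ 3))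
  ~> (LINT x|torus L. complex_of_real (dirderiv (axis i 1) \<phi> x) * V x)"
  using fourier_pairing[OF L Vi smooth_dirderiv[OF ph(1)] periodic_dirderiv[OF ph] r(1)] by blast
  have eq: "fc L (%x. complex_of_real (dirderiv (axis i 1) \<phi> x)) k * fc L V (- k) = - (fc L (%x. complex_of_real (\<phi> x)) k * fc L G (- k))"
  if "k : ball_modes L R" for k R
  using that fc_dirderiv[OF L ph] gc[OF wave_vectors_uminus] by (simp add: ball_modes_def c_def mult_ac)
  have "(%n. - ((SUM k:ball_modes L (real (r (s n))). fc L (%x. complex_of_real (\<phi> x)) k * fc L G (- k)) / of_real (L ^ 3)))
  ~> - (LINT x|torus L. complex_of_real (\<phi> x) * G x)"
  using tendsto_minus[OF LIMSEQ_subseq_LIMSEQ[OF r(2) s(1)]] by (simp add: o_def)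
  moreover have "- ((SUM k:ball_modes L R. fc L (%x. complex_of_real (\<phi> x)) k * fc L G (- k)) / of_real (L ^ 3))
  = (SUM k:ball_modes L R. fc L (%x. complex_of_real (dirderiv (axis i 1) \<phi> x)) k * fc L V (- k)) / of_real (L ^ 3)" for R
  using eq[of _ R] by (simp add: sum_negf)
  ultimately have "(LINT x|torus L. complex_of_real (dirderiv (axis i 1) \<phi> x) * V x) = - (LINT x|torus L. complex_of_real (\<phi> x) * G x)"
  using LIMSEQ_unique[OF s(2)] by simp
  hence "complex_of_real (LINT x|torus L. dirderiv (axis i 1) \<phi> x * v x) = complex_of_real (- (LINT x|torus L. \<phi> x * g x))"
  unfolding V_def G_def of_real_mult[symmetric] integral_complex_of_real of_real_minus .
  thus "(LINT x|torus L. v x * dirderiv (axis i 1) \<phi> x) = - (LINT x|torus L. g x * \<phi> x)"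
  unfolding of_real_eq_iff by (simp add: mult.commute)
 qed
 thus "EX g. weak_deriv L i v g" by blast
qed

section \<open>Test functions adapted to boxes\<close>

text \<open>By \<open>cos_arc\<close> the argument of \<open>bump\<close> is positive, within a
  period, exactly on (a, b); so these are smooth periodic functions that tend to the indicator of
  (a, b) as n grows.\<close>

definition arcb :: "real => real => real => nat => real => real" where
 "arcb L a b n x = bump (real n * (cos (2 * pi * (x - (a + b) / 2) / L) - cos (pi * (b - a) / L)))"

lemma smooth1_arcb: "smooth1 (arcb L a b n)"
proof -
 have e: "arcb L a b n = (%x. bump (real n * (cos (2 * pi / L * x + - (2 * pi / L * ((a + b) / 2))) - cos (pi * (b - a) / L))))"
  by (rule ext) (simp add: arcb_def diff_divide_distrib right_diff_distrib)
 show ?thesis unfolding e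
  by (rule smooth1_compose[OF smooth1_bump] smooth1_mult smooth1_const smooth1_diff
  smooth1_compose[OF smooth1_cos] smooth1_add smooth1_id)+
qed

lemma arcb_periodic: "L > 0 ==> arcb L a b n (x + L) = arcb L a b n x"
proof -
 assume L: "L > 0"
 have "2 * pi * (x + L - (a + b) / 2) / L = 2 * pi * (x - (a + b) / 2) / L + 2 * pi"
  using L by (simp add: field_simps)
 thus ?thesis by (simp only: arcb_def cos_periodic)
qed

lemma arcb_nonneg: "0 <= arcb L a b n x" and arcb_le_1: "arcb L a b n x <= 1"
 by (simp_all add: arcb_def bump_nonneg bump_le_1)

lemma arcb_limit:
 assumes "L > 0" "0 <= a" "a < b" "b <= L" "0 < x" "x < L"
 shows "(%n. arcb L a b n x) ~> indicator {a<..<b} x"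
 unfolding arcb_def
 using bump_limit[of "cos (2 * pi * (x - (a + b) / 2) / L) - cos (pi * (b - a) / L)"] cos_arc[of L a b x] assms
 by (cases "a < x & x < b") (auto simp: indicator_def)

lemma arcb_support:
 assumes "L > 0" "0 <= a" "a < b" "b <= L" "0 < x" "x < L" "x ~: {a<..<b}"
 shows "arcb L a b n x = 0"
proof -
 have "~ 0 < cos (2 * pi * (x - (a + b) / 2) / L) - cos (pi * (b - a) / L)"
  using cos_arc[of L a b x] assms by auto
 hence "~ 0 < real n * (cos (2 * pi * (x - (a + b) / 2) / L) - cos (pi * (b - a) / L))"
  by (simp add: zero_less_mult_iff)
 thus ?thesis by (simp add: arcb_def bump_eq)
qed

lemma arcb_measurable [measurable]: "arcb L a b n : borel_measurable borel"
 by (intro borel_measurable_continuous_onI smooth1_imp_continuous smooth1_arcb)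

definition arc_mass :: "real => real => real => nat => real" where
 "arc_mass L a b n = (LINT s:{0..L}|lborel. arcb L a b n s)"

lemma arc_mass_bounds:
 assumes L: "L > 0" shows "0 <= arc_mass L a b n" "arc_mass L a b n <= L"
proof -
 show "0 <= arc_mass L a b n"
  unfolding arc_mass_def set_lebesgue_integral_def by (intro integral_nonneg_AE AE_I2) (simp add: arcb_nonneg)
 have "arc_mass L a b n <= (LINT s:{0..L}|lborel. 1)"
  unfolding arc_mass_def
 proof (rule set_integral_mono)
  show "set_integrable lborel {0..L} (arcb L a b n)"
  by (intro borel_integrable_atLeastAtMost' continuous_on_subset[OF smooth1_imp_continuous[OF smooth1_arcb]]) auto
  show "set_integrable lborel {0..L} (%_. 1 :: real)" by (intro borel_integrable_atLeastAtMost') auto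
 qed (rule arcb_le_1)
 also have "(LINT s:{0..L}|lborel. 1) = L" using L by (simp add: set_lebesgue_integral_def)
 finally show "arc_mass L a b n <= L" .
qed

lemma arc_mass_limit:
 assumes "L > 0" "0 <= a" "a < b" "b <= L"
 shows "(%n. arc_mass L a b n) ~> b - a"
proof -
 have "(%n. LINT s|lborel. indicator {0..L} s *\<^sub>R arcb L a b n s) ~> (LINT s|lborel. indicator {a<..<b} s)"
 proof (rule integral_dominated_convergence[where w = "indicator {0..L}"])
  have "AE s in lborel. s ~= 0 & s ~= L" using AE_lborel_singleton[of 0] AE_lborel_singleton[of L] by eventually_elim simp
  thus "AE s in lborel. (%n. indicator {0..L} s *\<^sub>R arcb L a b n s) ~> indicator {a<..<b} s"
  proof eventually_elim
  case (elim s)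
  show ?case
  proof (cases "0 <= s & s <= L")
  case True
  thus ?thesis using arcb_limit[OF assms, of s] elim by simp
  qed (use assms in \<open>auto simp: indicator_def\<close>)
  qed
  show "AE s in lborel. norm (indicator {0..L} s *\<^sub>R arcb L a b n s) <= indicator {0..L} s" for n
  by (intro AE_I2) (simp add: indicator_def arcb_nonneg arcb_le_1)
  show "integrable lborel (indicator {0..L} :: real => real)"
  by (intro integrable_real_indicator) (auto simp: emeasure_lborel_Icc_eq)
 qed auto
 thus ?thesis using assms by (simp add: arc_mass_def set_lebesgue_integral_def)
qed

definition box_bump :: "real => real^3 => real^3 => nat => real^3 => real" where
 "box_bump L a b n x = (PROD j:UNIV. arcb L (a $ j) (b $ j) n (x $ j))"

lemma box_bump_measurable [measurable]: "box_bump L a b n : borel_measurable borel"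
proof -
 have "(%x :: real^3. arcb L (a $ j) (b $ j) n (x $ j)) : borel_measurable borel" for j
  by (rule measurable_compose[OF nth_measurable arcb_measurable])
 thus ?thesis unfolding box_bump_def[abs_def] by (intro borel_measurable_prod)
qed

lemma box_bump_nonneg: "0 <= box_bump L a b n x" and box_bump_le_1: "box_bump L a b n x <= 1"
 by (auto simp: box_bump_def arcb_nonneg arcb_le_1 intro!: prod_nonneg prod_le_1)

definition sub_box :: "real => real^3 => real^3 => bool" where
 "sub_box L a b \<longleftrightarrow> (ALL j. 0 <= a $ j & a $ j < b $ j & b $ j <= L)"

lemma box_bump_limit:
 assumes L: "L > 0" and ab: "sub_box L a b" and x: "!!j. 0 < x $ j & x $ j < L"
 shows "(%n. box_bump L a b n x) ~> indicator (box a b) x"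
proof -
 have "(%n. box_bump L a b n x) ~> (PROD j:UNIV. indicator {a $ j<..<b $ j} (x $ j))"
  unfolding box_bump_def using ab x by (intro tendsto_prod arcb_limit[OF L]) (auto simp: sub_box_def)
 also have "(PROD j:UNIV. indicator {a $ j<..<b $ j} (x $ j)) = (indicator (box a b) x :: real)"
  by (auto simp: indicator_def mem_box_cart intro!: prod.neutral)
 finally show ?thesis .
qed

lemma box_bump_le_indicator:
 assumes L: "L > 0" and ab: "sub_box L a b" and x: "!!j. 0 < x $ j & x $ j < L"
 shows "box_bump L a b n x <= indicator (box a b) x"
proof (cases "x : box a b")
 case False
 then obtain j where "x $ j ~: {a $ j<..<b $ j}" by (auto simp: mem_box_cart)
 hence "arcb L (a $ j) (b $ j) n (x $ j) = 0" using ab x by (intro arcb_support[OF L]) (auto simp: sub_box_def)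
 hence "box_bump L a b n x = 0" unfolding box_bump_def by (intro prod_zero) auto
 thus ?thesis by simp
qed (simp add: box_bump_le_1)

text \<open>The increment of an antiderivative over a period is constant and equals the integral of
  f over a period, which is 0.\<close>

lemma periodic_antiderivative:
 assumes L: "L > 0" and f: "smooth1 f" "!!x. f (x + L) = f x" and z: "(LINT s:{0..L}|lborel. f s) = 0"
 obtains B where "!!x. (B has_real_derivative f x) (at x)" "smooth1 B" "!!x. B (x + L) = B x"
proof -
 obtain B where B: "!!x. (B has_real_derivative f x) (at x)"
  using ex_antiderivative[OF smooth1_imp_continuous[OF f(1)]] by blast
 have "((%x. B (x + L) - B x) has_real_derivative 0) (at x)" for x
 proof -
  have "((%x. B (x + L)) has_real_derivative f (x + L)) (at x)"
  using B[of "x + L"] by (subst (asm) DERIV_shift) simp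
  from DERIV_diff[OF this B[of x]] show ?thesis by (simp add: f(2))
 qed
 hence "ALL x. B (x + L) - B x = B (0 + L) - B 0"
  using DERIV_isconst_all[of "%x. B (x + L) - B x"] by blast
 moreover have "B L - B 0 = (LINT s:{0..L}|lborel. f s)"
  unfolding set_lebesgue_integral_def
  by (rule integral_FTC_Icc[symmetric])
  (use L B in \<open>auto intro: continuous_on_subset[OF smooth1_imp_continuous[OF f(1)]] has_vector_derivative_at_within
  simp: has_real_derivative_iff_has_vector_derivative\<close>)
 ultimately have "B (x + L) = B x" for x using z by (metis add_0 eq_iff_diff_eq_0)
 with B show thesis using that smooth1_antiderivative[OF B f(1)] by blast
qed

lemma upd_self: "upd x i (x $ i) = x"
 by (simp add: vec_eq_iff)

text \<open>Two box bumps that differ only in direction i are each weighted with the mass of the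
  other, so that their difference has mean zero along lines in direction i and is the derivative of
  a periodic function.\<close>

lemma box_bump_dirderiv:
 assumes L: "L > 0"
 obtains \<phi> where "smooth \<phi>" "space_periodic L \<phi>"
  "!!x. dirderiv (axis i 1) \<phi> x = arc_mass L a' b' n * box_bump L a b n x
  - arc_mass L (a $ i) (b $ i) n * box_bump L (upd a i a') (upd b i b') n x"
proof -
 define m m' where "m = arc_mass L (a $ i) (b $ i) n" and "m' = arc_mass L a' b' n"
 define f where "f s = m' * arcb L (a $ i) (b $ i) n s - m * arcb L a' b' n s" for s
 have fs: "smooth1 f" unfolding f_def by (intro smooth1_diff smooth1_mult smooth1_const smooth1_arcb)
 have fp: "f (x + L) = f x" for x by (simp add: f_def arcb_periodic[OF L])
 have si: "set_integrable lborel {0..L} (arcb L a b n)" for a b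
  by (intro borel_integrable_atLeastAtMost' continuous_on_subset[OF smooth1_imp_continuous[OF smooth1_arcb]]) auto
 have "(LINT s:{0..L}|lborel. f s) = m' * m - m * m'"
  unfolding f_def using si by (simp add: set_integral_diff m_def m'_def arc_mass_def)
 hence z: "(LINT s:{0..L}|lborel. f s) = 0" by simp
 obtain B where B: "!!x. (B has_real_derivative f x) (at x)" "smooth1 B" "!!x. B (x + L) = B x"
  using periodic_antiderivative[OF L fs fp z] by blast
 define Q where "Q x = (PROD j:UNIV - {i}. arcb L (a $ j) (b $ j) n (x $ j))" for x :: "real^3"
 define \<phi> where "\<phi> x = B (x $ i) * Q x" for x :: "real^3"
 have nth: "bounded_linear (%x :: real^3. x $ j)" for j by (rule bounded_linear_vec_nth)
 have s: "smooth \<phi>"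
  unfolding \<phi>_def Q_def
  by (intro smooth_mult smooth_linear_compose[OF nth B(2)] smooth_prod smooth_linear_compose[OF nth smooth1_arcb]) auto
 show thesis
 proof (rule that[OF s])
  show "space_periodic L \<phi>"
  unfolding space_periodic_def
  proof (intro allI)
  fix x :: "real^3" and k
  have "B ((x + axis k L) $ i) = B (x $ i)" by (cases "k = i") (auto simp: axis_def B(3))
  moreover have "Q (x + axis k L) = Q x"
  unfolding Q_def by (intro prod.cong refl) (auto simp: axis_def arcb_periodic[OF L])
  ultimately show "\<phi> (x + axis k L) = \<phi> x" by (simp add: \<phi>_def)
  qed
  fix x :: "real^3"
  have "((%s. B (x $ i + s) * Q x) has_real_derivative f (x $ i + 0) * Q x) (at 0)"
  proof (rule DERIV_cmult_right)
  show "((%s. B (x $ i + s)) has_real_derivative f (x $ i + 0)) (at 0)"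
  using B(1)[of "x $ i + 0"] DERIV_shift[of B "f (x $ i + 0)" 0 "x $ i"] by (simp add: add.commute)
  qed
  moreover have "\<phi> (x + s *\<^sub>R axis i 1) = B (x $ i + s) * Q x" for s
  unfolding \<phi>_def Q_def by (auto simp: axis_def intro!: arg_cong2[where f = "(*)"] prod.cong)
  ultimately have "dirderiv (axis i 1) \<phi> x = f (x $ i) * Q x"
  by (intro dirderiv_eq_line[OF s]) (simp add: has_real_derivative_iff_has_vector_derivative)
  moreover have "box_bump L a b n x = arcb L (a $ i) (b $ i) n (x $ i) * Q x"
  unfolding box_bump_def Q_def by (rule prod.remove) auto
  moreover have "box_bump L (upd a i a') (upd b i b') n x = arcb L a' b' n (x $ i) * Q x"
  unfolding box_bump_def Q_def by (subst prod.remove[of _ i]) (auto intro!: prod.cong)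
  ultimately show "dirderiv (axis i 1) \<phi> x = arc_mass L a' b' n * box_bump L a b n x
  - arc_mass L (a $ i) (b $ i) n * box_bump L (upd a i a') (upd b i b') n x"
  by (simp add: f_def m_def m'_def left_diff_distrib mult.assoc)
 qed
qed

section \<open>Weak derivatives of non-integrable functions\<close>

definition rvec :: "(3 => rat) => real^3" where
 "rvec q = (\<chi> j. of_rat (q j))"

text \<open>The derivatives from \<open>box_bump_dirderiv\<close> for rational boxes, tested against
  v. These are countably many equations for integrals, hence a measurable condition when v depends
  measurably on a parameter.\<close>

definition box_conditions :: "real => 3 => (real^3 => real) => bool" where
 "box_conditions L i v \<longleftrightarrow> (ALL q r q' r' n. (LINT x|torus L. v x * (arc_mass L (of_rat q') (of_rat r') n * box_bump L (rvec q) (rvec r) n x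
  - arc_mass L (rvec q $ i) (rvec r $ i) n * box_bump L (upd (rvec q) i (of_rat q')) (upd (rvec r) i (of_rat r')) n x)) = 0)"

lemma rvec_ex: "(!!j. a $ j : \<rat>) ==> EX q. a = rvec q"
proof -
 assume "!!j. a $ j : \<rat>"
 hence "ALL j. EX q. a $ j = of_rat q" by (auto simp: Rats_def)
 then obtain q where "!!j. a $ j = of_rat (q j)" by metis
 thus ?thesis by (intro exI[of _ q]) (simp add: rvec_def vec_eq_iff)
qed

lemma AE_torus_interior: "AE x in torus L. ALL j. 0 < x $ j & x $ j < L"
 using AE_interior[of L] unfolding AE_torus
proof eventually_elim
 case (elim x)
 thus ?case by (auto simp: mem_cell order_less_le)
qed

text \<open>Letting n grow in \<open>box_conditions\<close> replaces bumps by indicators and masses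
  by side lengths: v has the same average over two boxes that differ only in direction i.
  Integrability on both boxes provides the dominating function.\<close>

lemma box_averages:
 assumes L: "L > 0" and F: "box_conditions L i v"
  and rat: "!!j. a $ j : \<rat> & b $ j : \<rat>" "a' : \<rat>" "b' : \<rat>"
  and ab: "sub_box L a b" "sub_box L (upd a i a') (upd b i b')"
  and vm: "v : borel_measurable borel"
  and int: "tint L (%x. indicator (box a b) x * v x)"
  "tint L (%x. indicator (box (upd a i a') (upd b i b')) x * v x)"
 shows "(b' - a') * (LINT x|torus L. indicator (box a b) x * v x)
  = (b $ i - a $ i) * (LINT x|torus L. indicator (box (upd a i a') (upd b i b')) x * v x)"
proof -
 define c d where "c = upd a i a'" and "d = upd b i b'"
 note ab = ab[folded c_def d_def] and int = int[folded c_def d_def]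
 have ab': "0 <= a'" "a' < b'" "b' <= L" using ab(2) by (auto simp: sub_box_def c_def d_def dest: spec[of _ i])
 have abi: "0 <= a $ i" "a $ i < b $ i" "b $ i <= L" using ab(1) by (auto simp: sub_box_def)
 define g where "g n x = arc_mass L a' b' n * box_bump L a b n x - arc_mass L (a $ i) (b $ i) n * box_bump L c d n x" for n x
 obtain q r where "a = rvec q" "b = rvec r" using rvec_ex[of a] rvec_ex[of b] rat(1) by blast
 moreover obtain q' r' where "a' = of_rat q'" "b' = of_rat r'" using rat(2,3) by (auto simp: Rats_def)
 ultimately have g0: "(LINT x|torus L. v x * g n x) = 0" for n
  using F unfolding box_conditions_def g_def c_def d_def by simp
 have gm: "g n : borel_measurable borel" for n unfolding g_def by measurable
 have "(%n. LINT x|torus L. v x * g n x) ~> (LINT x|torus L. (b' - a') * (indicator (box a b) x * v x) - (b $ i - a $ i) * (indicator (box c d) x * v x))"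
 proof (rule integral_dominated_convergence[where w = "%x. L * norm (indicator (box a b) x * v x) + L * norm (indicator (box c d) x * v x)"])
  show "(%x. v x * g n x) : borel_measurable (torus L)" for n
  by (intro measurable_torus borel_measurable_times vm gm)
  show "(%x. (b' - a') * (indicator (box a b) x * v x) - (b $ i - a $ i) * (indicator (box c d) x * v x)) : borel_measurable (torus L)"
  using int by auto
  show "tint L (%x. L * norm (indicator (box a b) x * v x) + L * norm (indicator (box c d) x * v x))"
  using int by (intro Bochner_Integration.integrable_add integrable_mult_right integrable_norm)
  show "AE x in torus L. (%n. v x * g n x) ~> (b' - a') * (indicator (box a b) x * v x) - (b $ i - a $ i) * (indicator (box c d) x * v x)"
  using AE_torus_interior
  proof eventually_elim
  case (elim x)
  have "(%n. v x * g n x) ~> v x * ((b' - a') * indicator (box a b) x - (b $ i - a $ i) * indicator (box c d) x)"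
  unfolding g_def using elim
  by (intro tendsto_intros arc_mass_limit[OF L ab'] arc_mass_limit[OF L abi] box_bump_limit[OF L ab(1)] box_bump_limit[OF L ab(2)]) auto
  thus ?case by (simp add: algebra_simps)
  qed
  show "AE x in torus L. norm (v x * g n x) <= L * norm (indicator (box a b) x * v x) + L * norm (indicator (box c d) x * v x)" for n
  using AE_torus_interior
  proof eventually_elim
  case (elim x)
  have "\<bar>g n x\<bar> <= arc_mass L a' b' n * box_bump L a b n x + arc_mass L (a $ i) (b $ i) n * box_bump L c d n x"
  unfolding g_def using mult_nonneg_nonneg[OF arc_mass_bounds(1)[OF L] box_bump_nonneg, of a' b' n L a b n x]
  mult_nonneg_nonneg[OF arc_mass_bounds(1)[OF L] box_bump_nonneg, of "a $ i" "b $ i" n L c d n x] by linarith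
  also have "... <= L * indicator (box a b) x + L * indicator (box c d) x"
  using elim L by (intro add_mono mult_mono arc_mass_bounds[OF L] box_bump_le_indicator[OF L ab(1)] box_bump_le_indicator[OF L ab(2)] box_bump_nonneg) auto
  finally have "\<bar>v x\<bar> * \<bar>g n x\<bar> <= \<bar>v x\<bar> * (L * indicator (box a b) x + L * indicator (box c d) x)"
  by (intro mult_left_mono) auto
  thus ?case by (simp add: abs_mult algebra_simps)
  qed
 qed
 hence "(LINT x|torus L. (b' - a') * (indicator (box a b) x * v x) - (b $ i - a $ i) * (indicator (box c d) x * v x)) = 0"
  unfolding g0 by (simp add: LIMSEQ_const_iff)
 thus ?thesis using int by (simp add: c_def d_def)
qed

lemma integral_indicator_box_torus:
 fixes v :: "real^3 => real"
 assumes "sub_box L a b"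
 shows "(LINT x|torus L. indicator (box a b) x * v x) = (LINT x|lborel. indicator (box a b) x * v x)"
  "tint L (%x. indicator (box a b) x * v x) \<longleftrightarrow> integrable lborel (%x. indicator (box a b) x * v x)"
proof -
 have "box a b <= cell L"
 proof
  fix x assume x: "x : box a b"
  have "0 <= x $ j & x $ j <= L" for j
  using x assms[unfolded sub_box_def, rule_format, of j] by (auto simp: mem_box_cart dest: spec[of _ j])
  thus "x : cell L" by (simp add: mem_cell)
 qed
 hence "(%x. indicator (cell L) x *\<^sub>R (indicator (box a b) x * v x)) = (%x. indicator (box a b) x * v x)"
  by (auto simp: indicator_def fun_eq_iff)
 thus "(LINT x|torus L. indicator (box a b) x * v x) = (LINT x|lborel. indicator (box a b) x * v x)"
  "tint L (%x. indicator (box a b) x * v x) \<longleftrightarrow> integrable lborel (%x. indicator (box a b) x * v x)"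
  unfolding integral_torus integrable_torus by simp_all
qed

text \<open>Equality of averages, rewritten with an independent height s as second variable;
  \<open>coord_swap\<close> brings the integral over the other box to the same domain.\<close>

lemma box_difference_integral:
 fixes v :: "real^3 => real"
 assumes L: "L > 0" and F: "box_conditions L i v"
  and rat: "!!j. a $ j : \<rat> & b $ j : \<rat>" "a' : \<rat>" "b' : \<rat>"
  and ab: "sub_box L a b" "sub_box L (upd a i a') (upd b i b')"
  and vm: "v : borel_measurable borel"
  and int: "tint L (%x. indicator (box a b) x * v x)"
  "tint L (%x. indicator (box (upd a i a') (upd b i b')) x * v x)"
 shows "integrable lborel (%p. indicator (box a b) (fst p) * indicator {a'<..<b'} (snd p) * (v (fst p) - v (upd (fst p) i (snd p))))"
  and "(LINT p|lborel. indicator (box a b) (fst p) * indicator {a'<..<b'} (snd p) * (v (fst p) - v (upd (fst p) i (snd p)))) = 0"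
proof -
 define c d where "c = upd a i a'" and "d = upd b i b'"
 note ab = ab[folded c_def d_def] and int' = int[folded c_def d_def]
 have ab': "a' < b'" using ab(2) by (auto simp: sub_box_def c_def d_def dest: spec[of _ i])
 have abi: "a $ i < b $ i" using ab(1) by (auto simp: sub_box_def)
 have ih: "integrable lborel (indicator {s<..<t} :: real => real)" for s t
  using emeasure_bounded_finite[OF bounded_box[of s t]] unfolding box_real by (intro integrable_real_indicator) auto
 have i1: "integrable lborel (%x. indicator (box a b) x * v x)" and i2: "integrable lborel (%x. indicator (box c d) x * v x)"
  using int' integral_indicator_box_torus(2)[OF ab(1)] integral_indicator_box_torus(2)[OF ab(2)] by auto
 define g h where "g p = (indicator (box a b) (fst p) * v (fst p)) * indicator {a'<..<b'} (snd p)"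
  and "h p = (indicator (box c d) (fst p) * v (fst p)) * indicator {a $ i<..<b $ i} (snd p)" for p :: "(real^3) \<times> real"
 have g: "integrable lborel g" "(LINT p|lborel. g p) = (LINT x|lborel. indicator (box a b) x * v x) * (b' - a')"
  unfolding g_def using integrable_lborel_prod_mult[OF i1 ih, of a' b'] ab' by simp_all
 have h: "integrable lborel h" "(LINT p|lborel. h p) = (LINT x|lborel. indicator (box c d) x * v x) * (b $ i - a $ i)"
  unfolding h_def using integrable_lborel_prod_mult[OF i2 ih, of "a $ i" "b $ i"] abi by simp_all
 have hm: "h : borel_measurable borel" using h(1) by auto
 have e: "indicator (box a b) (fst p) * indicator {a'<..<b'} (snd p) * (v (fst p) - v (upd (fst p) i (snd p))) = g p - h (coord_swap i p)" for p
 proof -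
  have "fst p : box a b & snd p : {a'<..<b'} \<longleftrightarrow> upd (fst p) i (snd p) : box c d & fst p $ i : {a $ i<..<b $ i}"
  proof -
  have split: "(ALL j. P j) \<longleftrightarrow> P i & (ALL j. j ~= i --> P j)" for P by metis
  show ?thesis unfolding mem_box_cart by (subst (1 2) split) (auto simp: c_def d_def)
  qed
  thus ?thesis by (auto simp: g_def h_def coord_swap_def indicator_def)
 qed
 have hs: "integrable lborel (%p. h (coord_swap i p))" "(LINT p|lborel. h (coord_swap i p)) = (LINT p|lborel. h p)"
  using integral_coord_swap[OF hm, of i] h(1) by auto
 show "integrable lborel (%p. indicator (box a b) (fst p) * indicator {a'<..<b'} (snd p) * (v (fst p) - v (upd (fst p) i (snd p))))"
  unfolding e using g(1) hs(1) by simp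
 have "(LINT p|lborel. g p - h (coord_swap i p)) = (LINT p|lborel. g p) - (LINT p|lborel. h p)"
  using g(1) hs by simp
 also have "... = 0"
  using box_averages[OF L F rat ab[unfolded c_def d_def] vm int]
  unfolding g(2) h(2) c_def[symmetric] d_def[symmetric] integral_indicator_box_torus(1)[OF ab(1)] integral_indicator_box_torus(1)[OF ab(2)]
  by (simp add: mult.commute)
 finally show "(LINT p|lborel. indicator (box a b) (fst p) * indicator {a'<..<b'} (snd p) * (v (fst p) - v (upd (fst p) i (snd p)))) = 0"
  unfolding e .
qed

text \<open>Intersecting with a rational box in R^3 x R leaves a pair of boxes of the same kind, so
  the difference of v at the two points integrates to 0 over every rational box.\<close>

lemma AE_constant_along_lines_box:
 fixes v :: "real^3 => real"
 assumes L: "L > 0" and F: "box_conditions L i v"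
  and rat: "!!j. A $ j : \<rat> & B $ j : \<rat>" "A' : \<rat>" "B' : \<rat>"
  and AB: "sub_box L A B" "sub_box L (upd A i A') (upd B i B')"
  and vm: "v : borel_measurable borel"
  and int: "tint L (%x. indicator (box A B) x * v x)"
  "tint L (%x. indicator (box (upd A i A') (upd B i B')) x * v x)"
 shows "AE p in lborel. fst p : box A B --> snd p : {A'<..<B'} --> v (fst p) = v (upd (fst p) i (snd p))"
proof -
 define f where "f p = indicator (box A B) (fst p) * indicator {A'<..<B'} (snd p) * (v (fst p) - v (upd (fst p) i (snd p)))" for p
 have "AE p in lborel. f p = 0"
 proof (rule AE_zero_if_box_integrals_zero)
  show "integrable lborel f" unfolding f_def by (rule box_difference_integral[OF L F rat AB vm int])
  fix l u :: "(real^3) \<times> real"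
  assume lu: "!!k. k : Basis ==> l \<bullet> k : \<rat> & u \<bullet> k : \<rat>"
  have lu1: "fst l $ j : \<rat> & fst u $ j : \<rat>" for j
  using lu[of "(axis j 1, 0)"] by (auto simp: Basis_prod_def inner_prod_def inner_axis axis_in_Basis_iff)
  have lu2: "snd l : \<rat> & snd u : \<rat>"
  using lu[of "(0, 1)"] by (auto simp: Basis_prod_def inner_prod_def)
  define a b where "a = (\<chi> j. max (A $ j) (fst l $ j))" and "b = (\<chi> j. min (B $ j) (fst u $ j))"
  define a' b' where "a' = max A' (snd l)" and "b' = min B' (snd u)"
  have rt: "a $ j : \<rat> & b $ j : \<rat>" "a' : \<rat>" "b' : \<rat>" for j
  using rat lu1 lu2 by (auto simp: a_def b_def a'_def b'_def max_def min_def)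
  have e: "indicator (box l u) p * f p = indicator (box a b) (fst p) * indicator {a'<..<b'} (snd p) * (v (fst p) - v (upd (fst p) i (snd p)))" for p
  by (auto simp: f_def box_prod_eq[of l u] a_def b_def a'_def b'_def mem_box_cart indicator_def mem_Times_iff)
  show "(LINT p|lborel. indicator (box l u) p * f p) = 0"
  proof (cases "(ALL j. a $ j < b $ j) & a' < b'")
  case True
  have s1: "sub_box L a b"
  using True AB(1) unfolding sub_box_def by (simp add: a_def b_def le_max_iff_disj min_le_iff_disj)
  have s2: "sub_box L (upd a i a') (upd b i b')"
  proof -
  have "0 <= A'" "B' <= L" using AB(2) unfolding sub_box_def by (auto dest: spec[of _ i])
  hence "0 <= a'" "b' <= L" by (auto simp: a'_def b'_def le_max_iff_disj min_le_iff_disj)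
  thus ?thesis using True s1 unfolding sub_box_def by auto
  qed
  have sub: "box a b <= box A B" "box (upd a i a') (upd b i b') <= box (upd A i A') (upd B i B')"
  by (auto simp: subset_eq mem_box_cart a_def b_def a'_def b'_def split: if_splits)
  have restrict: "tint L (%x. indicator S x * v x)" if "tint L (%x. indicator S' x * v x)" "S <= S'" "S : sets borel" for S S' :: "(real^3) set"
  proof (rule Bochner_Integration.integrable_bound[OF that(1)])
  show "(%x. indicator S x * v x) : borel_measurable (torus L)"
  using that(3) vm by (intro measurable_torus borel_measurable_times) auto
  qed (use that(2) in \<open>auto simp: indicator_def\<close>)
  show ?thesis unfolding e
  by (rule box_difference_integral(2)[OF L F rt s1 s2 vm restrict[OF int(1) sub(1)] restrict[OF int(2) sub(2)]]) auto
  next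
  case False
  hence "indicator (box a b) (fst p) * indicator {a'<..<b'} (snd p) * (v (fst p) - v (upd (fst p) i (snd p))) = 0" for p :: "(real^3) \<times> real"
  proof -
  have "!!j. fst p : box a b ==> a $ j < b $ j" by (meson mem_box_cart less_trans)
  thus ?thesis using False by (auto simp: indicator_def)
  qed
  thus ?thesis unfolding e by (intro integral_eq_zero_AE AE_I2)
  qed
 qed
 thus ?thesis by eventually_elim (auto simp: f_def)
qed

lemma AE_inner_Basis_neq:
 assumes "b : Basis" shows "AE x in lborel. (x :: 'a::euclidean_space) \<bullet> b ~= y"
proof -
 have "negligible {x :: 'a. x \<bullet> b = y}" by (rule negligible_standard_hyperplane[OF assms])
 hence "{x :: 'a. x \<bullet> b = y} : null_sets lebesgue" by (simp add: negligible_iff_null_sets)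
 moreover have "{x :: 'a. x \<bullet> b = y} : sets borel" by measurable
 ultimately have "{x :: 'a. x \<bullet> b = y} : null_sets lborel" by (simp add: null_sets_def)
 thus ?thesis by (rule AE_I') auto
qed

text \<open>Near a point where \<psi> is nonzero, v is integrable, because v * \<psi> is integrable
  and \<psi> is bounded away from 0. Countably many pairs of rational boxes cover all pairs of such
  points, so the exceptional sets add up to a null set.\<close>

lemma AE_constant_along_lines:
 fixes v :: "real^3 => real"
 assumes L: "L > 0" and F: "box_conditions L i v" and vm: "v : borel_measurable borel"
  and \<psi>: "continuous_on UNIV \<psi>" and int: "tint L (%x. v x * \<psi> x)"
 shows "AE p in lborel. (ALL j. 0 < fst p $ j & fst p $ j < L) --> 0 < snd p --> snd p < L -->
  \<psi> (fst p) ~= 0 --> \<psi> (upd (fst p) i (snd p)) ~= 0 --> v (fst p) = v (upd (fst p) i (snd p))"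
proof -
 define good where "good a b \<longleftrightarrow> sub_box L a b & tint L (%x. indicator (box a b) x * v x)" for a b
 have "AE p in lborel. ALL q r q' r'. good (rvec q) (rvec r) --> good (upd (rvec q) i (of_rat q')) (upd (rvec r) i (of_rat r')) -->
  fst p : box (rvec q) (rvec r) --> snd p : {of_rat q'<..<of_rat r'} --> v (fst p) = v (upd (fst p) i (snd p))"
  unfolding AE_all_countable
 proof (intro allI)
  fix q r q' r'
  show "AE p in lborel. good (rvec q) (rvec r) --> good (upd (rvec q) i (of_rat q')) (upd (rvec r) i (of_rat r')) -->
  fst p : box (rvec q) (rvec r) --> snd p : {of_rat q'<..<of_rat r'} --> v (fst p) = v (upd (fst p) i (snd p))"
  proof (cases "good (rvec q) (rvec r) & good (upd (rvec q) i (of_rat q')) (upd (rvec r) i (of_rat r'))")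
  case True
  hence g: "sub_box L (rvec q) (rvec r)" "sub_box L (upd (rvec q) i (of_rat q')) (upd (rvec r) i (of_rat r'))"
  "tint L (%x. indicator (box (rvec q) (rvec r)) x * v x)"
  "tint L (%x. indicator (box (upd (rvec q) i (of_rat q')) (upd (rvec r) i (of_rat r'))) x * v x)"
  by (auto simp: good_def)
  have rt: "rvec q $ j : \<rat> & rvec r $ j : \<rat>" "of_rat q' : (\<rat> :: real set)" "of_rat r' : (\<rat> :: real set)" for j
  by (auto simp: rvec_def)
  show ?thesis using AE_constant_along_lines_box[OF L F rt g(1,2) vm g(3,4)] by eventually_elim auto
  qed auto
 qed
 thus ?thesis
 proof eventually_elim
  case (elim p)
  define x s y where "x = fst p" and "s = snd p" and "y = upd (fst p) i (snd p)"
  have near: "EX a b. (ALL j. a $ j : \<rat> & b $ j : \<rat>) & z : box a b & good a b"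
  if z: "!!j. 0 < z $ j & z $ j < L" "\<psi> z ~= 0" for z
  proof -
  have "open (box 0 (\<chi> j. L) \<inter> {w :: real^3. \<bar>\<psi> w\<bar> > \<bar>\<psi> z\<bar> / 2})"
  by (intro open_Int open_box open_Collect_less continuous_intros \<psi>)
  moreover have "z : box 0 (\<chi> j. L) \<inter> {w :: real^3. \<bar>\<psi> w\<bar> > \<bar>\<psi> z\<bar> / 2}"
  using z by (auto simp: mem_box_cart)
  ultimately obtain e where e: "e > 0" "ball z e <= box 0 (\<chi> j. L) \<inter> {w. \<bar>\<psi> w\<bar> > \<bar>\<psi> z\<bar> / 2}"
  by (meson openE)
  obtain a b where ab: "ALL k:Basis. a \<bullet> k : \<rat> & b \<bullet> k : \<rat>" "z : box a b" "box a b <= ball z e"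
  using rational_boxes[OF e(1), of z] by blast
  have rt: "a $ j : \<rat> & b $ j : \<rat>" for j
  using ab(1)[rule_format, of "axis j 1"] by (simp add: inner_axis axis_in_Basis_iff)
  have lt: "a $ j < b $ j" for j using ab(2) by (auto simp: mem_box_cart dest: spec[of _ j])
  have "box a b <= box 0 (\<chi> j. L)" using ab(3) e(2) by blast
  moreover have "ALL k:Basis. a \<bullet> k < b \<bullet> k" using lt by (auto simp: Basis_vec_def inner_axis)
  ultimately have k: "ALL k:Basis. 0 \<bullet> k <= a \<bullet> k & b \<bullet> k <= (\<chi> j. L) \<bullet> k" unfolding subset_box(4) by blast
  have "0 <= a $ j & b $ j <= L" for j
  using k[rule_format, of "axis j 1"] by (simp add: inner_axis axis_in_Basis_iff)
  hence sb: "sub_box L a b" using lt by (auto simp: sub_box_def)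
  have "tint L (%x. indicator (box a b) x * v x)"
  proof (rule Bochner_Integration.integrable_bound)
  show "tint L (%x. 2 / \<bar>\<psi> z\<bar> * (v x * \<psi> x))" using int by (rule integrable_mult_right)
  show "(%x. indicator (box a b) x * v x) : borel_measurable (torus L)"
  using vm by (intro measurable_torus borel_measurable_times) auto
  show "AE x in torus L. norm (indicator (box a b) x * v x) <= norm (2 / \<bar>\<psi> z\<bar> * (v x * \<psi> x))"
  proof (rule AE_I2)
  fix x
  show "norm (indicator (box a b) x * v x) <= norm (2 / \<bar>\<psi> z\<bar> * (v x * \<psi> x))"
  proof (cases "x : box a b")
  case True
  hence "\<bar>\<psi> x\<bar> > \<bar>\<psi> z\<bar> / 2" using ab(3) e(2) by blast
  hence "1 <= 2 / \<bar>\<psi> z\<bar> * \<bar>\<psi> x\<bar>" using z(2) by (simp add: field_simps)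
  hence "\<bar>v x\<bar> * 1 <= \<bar>v x\<bar> * (2 / \<bar>\<psi> z\<bar> * \<bar>\<psi> x\<bar>)" by (intro mult_left_mono) auto
  thus ?thesis using True by (simp add: abs_mult mult_ac)
  qed simp
  qed
  qed
  thus ?thesis using rt ab(2) sb by (auto simp: good_def)
  qed
  show ?case
  proof (intro impI)
  assume as: "ALL j. 0 < fst p $ j & fst p $ j < L" "0 < snd p" "snd p < L" "\<psi> (fst p) ~= 0" "\<psi> (upd (fst p) i (snd p)) ~= 0"
  obtain a b where ab: "!!j. a $ j : \<rat> & b $ j : \<rat>" "x : box a b" "good a b"
  using near[of x] as by (auto simp: x_def)
  have "!!j. 0 < y $ j & y $ j < L" using as by (auto simp: y_def)
  then obtain c d where cd: "!!j. c $ j : \<rat> & d $ j : \<rat>" "y : box c d" "good c d"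
  using near[of y] as by (auto simp: y_def)
  have yj: "y $ j = (if j = i then s else x $ j)" for j by (simp add: y_def x_def s_def)
  have xb: "a $ j < x $ j & x $ j < b $ j" for j using ab(2) by (simp add: mem_box_cart)
  have yb: "c $ j < y $ j & y $ j < d $ j" for j using cd(2) by (simp add: mem_box_cart)
  \<comment> \<open>In the directions other than i both boxes have to be the same, so they are
    intersected there and left apart in direction i.\<close>
  define A B where "A = (\<chi> j. if j = i then a $ j else max (a $ j) (c $ j))"
  and "B = (\<chi> j. if j = i then b $ j else min (b $ j) (d $ j))"
  have subs: "box A B <= box a b" "box (upd A i (c $ i)) (upd B i (d $ i)) <= box c d"
  by (auto simp: subset_eq mem_box_cart A_def B_def split: if_splits)
  have "A $ j < x $ j & x $ j < B $ j" for j using xb[of j] yb[of j] yj[of j] by (auto simp: A_def B_def)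
  hence xA: "x : box A B" by (simp add: mem_box_cart)
  have bounds: "0 <= a $ j & b $ j <= L" "0 <= c $ j & d $ j <= L" for j
  using ab(3) cd(3) by (auto simp: good_def sub_box_def)
  have lt: "A $ j < B $ j" for j using xA by (auto simp: mem_box_cart dest: spec[of _ j])
  have sb: "sub_box L A B" "sub_box L (upd A i (c $ i)) (upd B i (d $ i))"
  proof -
  have l1: "0 <= A $ j & B $ j <= L" for j
  using bounds[of j] by (auto simp: A_def B_def le_max_iff_disj min_le_iff_disj)
  have ci: "c $ i < d $ i" using cd(3) by (simp add: good_def sub_box_def)
  show "sub_box L A B" using lt l1 unfolding sub_box_def by blast
  show "sub_box L (upd A i (c $ i)) (upd B i (d $ i))"
  unfolding sub_box_def using lt l1 bounds(2)[of i] ci by simp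
  qed
  have restrict: "tint L (%x. indicator S x * v x)" if "tint L (%x. indicator S' x * v x)" "S <= S'" "S : sets borel" for S S' :: "(real^3) set"
  proof (rule Bochner_Integration.integrable_bound[OF that(1)])
  show "(%x. indicator S x * v x) : borel_measurable (torus L)"
  using that(3) vm by (intro measurable_torus borel_measurable_times) auto
  qed (use that(2) in \<open>auto simp: indicator_def\<close>)
  have g: "good A B" "good (upd A i (c $ i)) (upd B i (d $ i))"
  using sb restrict[OF _ subs(1)] restrict[OF _ subs(2)] ab(3) cd(3) by (auto simp: good_def)
  have r1: "A $ j : \<rat>" "B $ j : \<rat>" for j
  using ab(1)[of j] cd(1)[of j] by (auto simp: A_def B_def max_def min_def)
  obtain q r where qr: "A = rvec q" "B = rvec r"
  using rvec_ex[of A, OF r1(1)] rvec_ex[of B, OF r1(2)] by blast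
  obtain q' r' where qr': "c $ i = of_rat q'" "d $ i = of_rat r'" using cd(1)[of i] by (auto simp: Rats_def)
  have "snd p : {c $ i<..<d $ i}" using yb[of i] yj[of i] by (simp add: s_def)
  thus "v (fst p) = v (upd (fst p) i (snd p))"
  using elim[rule_format, of q r q' r'] g xA unfolding qr qr' x_def by blast
  qed
 qed
qed

text \<open>A function constant along lines is orthogonal to a derivative along these lines: weight the line through
 \<open>x\<close> with \<open>\<bar>\<psi>\<bar>\<close>, and exchange the two points by \<open>coord_swap\<close>.\<close>

lemma integral_mult_line_mean_zero:
 fixes v :: "real^3 => real"
 assumes L: "L > 0" and F: "box_conditions L i v" and vm [measurable]: "v : borel_measurable borel"
  and \<psi>: "continuous_on UNIV \<psi>" and zero: "!!x. (LINT s:{0..L}|lborel. \<psi> (upd x i s)) = 0"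
  and int: "tint L (%x. v x * \<psi> x)"
 shows "(LINT x|torus L. v x * \<psi> x) = 0"
proof -
 have psm [measurable]: "\<psi> : borel_measurable borel" using \<psi> by (rule borel_measurable_continuous_onI)
 have pu [measurable]: "(%p. \<psi> (upd (fst p) i (snd p))) : borel_measurable (borel \<Otimes>\<^sub>M borel)"
  by (rule measurable_compose[OF upd_measurable psm])
 have cl: "continuous_on S (%s. \<psi> (upd x i s))" for x S
 proof -
  define y where "y = upd x i 0"
  have "upd x i s = y + s *\<^sub>R axis i 1" for s unfolding y_def by (rule upd_line)
  thus ?thesis by (simp only:) (intro continuous_on_compose2[OF \<psi>] continuous_intros, auto)
 qed
 \<comment> \<open>\<open>W x\<close> is the total weight of the line through x in direction i. It
   is constant along the line and positive where \<psi> x is nonzero, so dividing by it writes v *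
   \<psi> as an average over the height s.\<close>
 define k where "k x s = indicator {0..L} s * \<bar>\<psi> (upd x i s)\<bar>" for x s
 define W where "W x = (LINT s|lborel. k x s)" for x
 have ki: "integrable lborel (k x)" for x
  using borel_integrable_atLeastAtMost'[of 0 L "%s. \<bar>\<psi> (upd x i s)\<bar>"] cl[of "{0..L}" x]
  unfolding k_def set_integrable_def by (simp add: continuous_on_rabs)
 have W0: "W x >= 0" for x unfolding W_def by (intro integral_nonneg_AE AE_I2) (simp add: k_def)
 have W_upd: "W (upd x i s) = W x" for x s
 proof -
  have "upd (upd x i s) i r = upd x i r" for r by (simp add: vec_eq_iff)
  thus ?thesis by (simp add: W_def k_def)
 qed
 have W_pos: "W x > 0" if "x : cell L" "\<psi> x ~= 0" for x
 proof (rule ccontr)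
  assume "~ W x > 0"
  hence "W x = 0" using W0[of x] by simp
  hence "(LINT s:{0..L}|lborel. \<bar>\<psi> (upd x i s)\<bar>) = 0" by (simp add: W_def k_def set_lebesgue_integral_def)
  hence "integral {0..L} (%s. \<bar>\<psi> (upd x i s)\<bar>) = 0"
  using set_borel_integral_eq_integral(2)[of "{0..L}" "%s. \<bar>\<psi> (upd x i s)\<bar>"] ki[of x] by (simp add: k_def[abs_def] set_integrable_def)
  hence "ALL s:{0..L}. \<bar>\<psi> (upd x i s)\<bar> = 0"
  using integral_eq_0_iff[of 0 L "%s. \<bar>\<psi> (upd x i s)\<bar>"] cl[of "{0..L}" x] L by (simp add: continuous_on_rabs)
  moreover have "x $ i : {0..L}" using that(1) by (simp add: mem_cell)
  ultimately have "\<psi> (upd x i (x $ i)) = 0" by auto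
  thus False using that(2) by (simp add: upd_self)
 qed
 have sets_eq: "sets (borel \<Otimes>\<^sub>M (lborel :: real measure)) = sets ((borel :: (real^3) measure) \<Otimes>\<^sub>M borel)"
  by (intro sets_pair_measure_cong) auto
 have km: "(%p. k (fst p) (snd p)) : borel_measurable (borel \<Otimes>\<^sub>M borel)"
  unfolding k_def by measurable
 have Wm [measurable]: "W : borel_measurable borel"
  unfolding W_def[abs_def]
 proof (rule lborel.borel_measurable_lebesgue_integral)
  show "case_prod k : borel_measurable (borel \<Otimes>\<^sub>M lborel)"
  using km unfolding measurable_cong_sets[OF sets_eq refl] by (simp add: case_prod_unfold)
 qed
 define h where "h x = indicator (cell L) x * (v x * \<psi> x / W x)" for x
 define g where "g x = indicator (cell L) x * (v x * \<bar>\<psi> x\<bar> / W x)" for x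
 have hm [measurable]: "h : borel_measurable borel" unfolding h_def by measurable
 have gm [measurable]: "g : borel_measurable borel" unfolding g_def by measurable
 have hW: "h x * W x = indicator (cell L) x * (v x * \<psi> x)" for x
  using W_pos[of x] by (cases "\<psi> x = 0") (auto simp: h_def indicator_def)
 define H where "H p = h (fst p) * k (fst p) (snd p)" for p
 define G where "G p = g (fst p) * (indicator {0..L} (snd p) * \<psi> (upd (fst p) i (snd p)))" for p
 have Hm: "H : borel_measurable (borel \<Otimes>\<^sub>M borel)" and Gm: "G : borel_measurable (borel \<Otimes>\<^sub>M borel)"
  unfolding H_def G_def k_def by measurable
 have lsets: "sets ((lborel :: (real^3) measure) \<Otimes>\<^sub>M (lborel :: real measure)) = sets (borel \<Otimes>\<^sub>M borel)"
  by (intro sets_pair_measure_cong) auto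
 have Hi: "integrable (lborel \<Otimes>\<^sub>M lborel) H"
 proof (rule lborel_pair.Fubini_integrable)
  show "H : borel_measurable (lborel \<Otimes>\<^sub>M lborel)" using Hm unfolding measurable_cong_sets[OF lsets refl] .
  have "(LINT s|lborel. norm (H (x, s))) = norm (indicator (cell L) x *\<^sub>R (v x * \<psi> x))" for x
  proof -
  have "(LINT s|lborel. norm (H (x, s))) = (LINT s|lborel. \<bar>h x\<bar> * k x s)"
  by (intro Bochner_Integration.integral_cong refl) (simp add: H_def abs_mult k_def)
  also have "... = \<bar>h x\<bar> * W x" by (simp add: W_def)
  also have "... = \<bar>h x * W x\<bar>" using W0[of x] by (simp add: abs_mult)
  finally show ?thesis by (simp add: hW)
  qed
  thus "integrable lborel (%x. LINT s|lborel. norm (H (x, s)))"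
  using integrable_norm[OF int[unfolded integrable_torus]] by simp
  show "AE x in lborel. integrable lborel (%s. H (x, s))"
  using ki by (simp add: H_def)
 qed
 have Gi: "integrable (lborel \<Otimes>\<^sub>M lborel) G"
 proof (rule Bochner_Integration.integrable_bound[OF Hi])
  show "G : borel_measurable (lborel \<Otimes>\<^sub>M lborel)" using Gm unfolding measurable_cong_sets[OF lsets refl] .
  show "AE p in lborel \<Otimes>\<^sub>M lborel. norm (G p) <= norm (H p)"
  by (rule AE_I2) (simp add: G_def H_def g_def h_def k_def abs_mult)
 qed
 have "(LINT x|torus L. v x * \<psi> x) = (LINT x|lborel. LINT s|lborel. H (x, s))"
 proof -
  have "(LINT s|lborel. H (x, s)) = h x * W x" for x by (simp add: H_def W_def)
  thus ?thesis unfolding integral_torus by (simp add: hW)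
 qed
 also have "... = (LINT p|(lborel \<Otimes>\<^sub>M lborel). H p)" by (rule lborel_pair.integral_fst'[OF Hi])
 also have "... = (LINT p|lborel. H p)" by (simp add: lborel_prod)
 \<comment> \<open>As v agrees at both ends, the swap exchanges the factor \<psi> at one point with
   the weight |\<psi>| at the other. In \<open>G\<close> the inner integral is that of \<psi> along
   the line, which vanishes.\<close>
 also have "... = (LINT p|lborel. G (coord_swap i p))"
 proof (rule integral_cong_AE)
  show "H : borel_measurable lborel" using Hm by (simp add: borel_prod)
  have "G : borel_measurable borel" using Gm by (simp add: borel_prod)
  from measurable_compose[OF coord_swap_measurable this] show "(%p. G (coord_swap i p)) : borel_measurable lborel" by simp
  have AE1: "AE p in lborel. ALL j:(UNIV :: 3 set). fst (p :: (real^3) \<times> real) $ j ~= 0 & fst p $ j ~= L"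
  proof (intro AE_finite_allI)
  fix j :: 3
  have "(axis j 1, 0) : (Basis :: ((real^3) \<times> real) set)" by (auto simp: Basis_prod_def axis_in_Basis_iff)
  from AE_inner_Basis_neq[OF this, of 0] AE_inner_Basis_neq[OF this, of L]
  show "AE p in lborel. fst (p :: (real^3) \<times> real) $ j ~= 0 & fst p $ j ~= L"
  by eventually_elim (simp add: inner_prod_def inner_axis)
  qed simp
  have AE2: "AE p in lborel. snd (p :: (real^3) \<times> real) ~= 0 & snd p ~= L"
  proof -
  have "(0, 1) : (Basis :: ((real^3) \<times> real) set)" by (auto simp: Basis_prod_def)
  from AE_inner_Basis_neq[OF this, of 0] AE_inner_Basis_neq[OF this, of L]
  show ?thesis by eventually_elim (simp add: inner_prod_def)
  qed
  show "AE p in lborel. H p = G (coord_swap i p)"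
  using AE1 AE2 AE_constant_along_lines[OF L F vm \<psi> int]
  proof eventually_elim
  case (elim p)
  obtain x s where p: "p = (x, s)" by (cases p)
  define y where "y = upd x i s"
  have xy: "upd y i (x $ i) = x" by (simp add: y_def vec_eq_iff)
  have Wy: "W y = W x" by (simp add: y_def W_upd)
  show "H p = G (coord_swap i p)"
  proof (cases "x : cell L & s : {0..L}")
  case True
  hence yc: "y : cell L" "x $ i : {0..L}" by (auto simp: y_def mem_cell)
  have HG: "H p = v x * \<psi> x * \<bar>\<psi> y\<bar> / W x" "G (coord_swap i p) = v y * \<bar>\<psi> y\<bar> * \<psi> x / W x"
  using True yc by (simp_all add: p H_def G_def h_def g_def k_def coord_swap_def y_def[symmetric] xy Wy)
  have "ALL j. 0 < x $ j & x $ j < L" "0 < s" "s < L"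
  using True elim by (auto simp: p mem_cell order_less_le)
  hence "\<psi> x ~= 0 ==> \<psi> y ~= 0 ==> v x = v y" using elim by (simp add: p y_def)
  thus ?thesis unfolding HG by (cases "\<psi> x = 0 \<or> \<psi> y = 0") auto
  next
  case False
  have "~ (y : cell L & x $ i : {0..L})"
  proof
  assume *: "y : cell L & x $ i : {0..L}"
  hence yj: "0 <= y $ j & y $ j <= L" for j by (simp add: mem_cell)
  have "0 <= x $ j & x $ j <= L" for j using yj[of j] * by (cases "j = i") (simp_all add: y_def)
  thus False using False yj[of i] by (simp add: mem_cell y_def)
  qed
  hence "indicator (cell L) y * indicator {0..L} (x $ i) = (0::real)" by (auto simp: indicator_def)
  moreover have "indicator (cell L) x * indicator {0..L} s = (0::real)" using False by (auto simp: indicator_def)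
  ultimately show ?thesis by (auto simp: p H_def G_def h_def g_def k_def coord_swap_def y_def[symmetric])
  qed
  qed
 qed
 also have "... = (LINT p|lborel. G p)" using Gm by (intro integral_coord_swap) (simp add: borel_prod)
 also have "... = (LINT p|(lborel \<Otimes>\<^sub>M lborel). G p)" by (simp add: lborel_prod)
 also have "... = (LINT x|lborel. LINT s|lborel. G (x, s))" by (rule lborel_pair.integral_fst'[OF Gi, symmetric])
 also have "... = 0" using zero by (simp add: G_def set_lebesgue_integral_def)
 finally show ?thesis .
qed

text \<open>One direction is \<open>weak_deriv_not_integrable\<close>. In the other, 0 serves as
  weak derivative: every pairing of v with a derivative vanishes, by
  \<open>integral_mult_line_mean_zero\<close> or by default.\<close>

lemma weak_deriv_iff_not_integrable:
 assumes L: "L > 0" and vm: "v : borel_measurable borel" and nv: "~ tint L v"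
 shows "(EX g. weak_deriv L i v g) \<longleftrightarrow> box_conditions L i v"
proof
 assume "EX g. weak_deriv L i v g"
 then obtain g where g: "weak_deriv L i v g" by blast
 show "box_conditions L i v"
  unfolding box_conditions_def
 proof (intro allI)
  fix q r q' r' n
  obtain \<phi> where \<phi>: "smooth \<phi>" "space_periodic L \<phi>"
  "!!x. dirderiv (axis i 1) \<phi> x = arc_mass L (of_rat q') (of_rat r') n * box_bump L (rvec q) (rvec r) n x
  - arc_mass L (rvec q $ i) (rvec r $ i) n * box_bump L (upd (rvec q) i (of_rat q')) (upd (rvec r) i (of_rat r')) n x"
  using box_bump_dirderiv[OF L] by blast
  show "(LINT x|torus L. v x * (arc_mass L (of_rat q') (of_rat r') n * box_bump L (rvec q) (rvec r) n x
  - arc_mass L (rvec q $ i) (rvec r $ i) n * box_bump L (upd (rvec q) i (of_rat q')) (upd (rvec r) i (of_rat r')) n x)) = 0"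
  using weak_deriv_not_integrable[OF L measurable_torus[OF vm] nv g \<phi>(1,2)] unfolding \<phi>(3) .
 qed
next
 assume F: "box_conditions L i v"
 have "weak_deriv L i v (%_. 0)"
  unfolding weak_deriv_def
 proof (intro conjI allI impI)
  show "square_integrable L (%_. 0 :: real)" by (simp add: square_integrable_def)
  fix \<phi> :: "real^3 => real" assume \<phi>: "smooth \<phi> & space_periodic L \<phi>"
  have "(LINT x|torus L. v x * dirderiv (axis i 1) \<phi> x) = 0"
  proof (cases "tint L (%x. v x * dirderiv (axis i 1) \<phi> x)")
  case True
  show ?thesis
  by (rule integral_mult_line_mean_zero[OF L F vm _ _ True])
  (use \<phi> L in \<open>auto intro: line_integral_dirderiv smooth_continuous smooth_dirderiv\<close>)
  qed (simp add: not_integrable_integral_eq)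
  thus "(LINT x|torus L. v x * dirderiv (axis i 1) \<phi> x) = - (LINT x|torus L. 0 * \<phi> x)" by simp
 qed
 thus "EX g. weak_deriv L i v g" by blast
qed

section \<open>Measurability of the set of times with a weak derivative\<close>

lemma measurable_pair_torus:
 assumes "f : borel_measurable (borel \<Otimes>\<^sub>M (borel :: (real^3) measure))"
 shows "f : borel_measurable (borel \<Otimes>\<^sub>M torus L)"
proof -
 have "(%x. x) : torus L \<rightarrow>\<^sub>M borel" by (rule measurable_torus) simp
 hence "(%p. (fst p, snd p)) : borel \<Otimes>\<^sub>M torus L \<rightarrow>\<^sub>M borel \<Otimes>\<^sub>M borel"
  by (intro measurable_Pair measurable_fst measurable_compose[OF measurable_snd])
 from measurable_compose[OF this assms] show ?thesis by simp
qed

lemma sigma_finite_torus: "sigma_finite_measure (torus L)"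
 by (rule finite_measure.axioms(1)[OF finite_measure_torus])

lemma measurable_torus_integral:
 fixes f :: "real => real^3 => 'b::{banach, second_countable_topology}"
 assumes "(%p. f (fst p) (snd p)) : borel_measurable (borel \<Otimes>\<^sub>M borel)"
 shows "(%t. LINT x|torus L. f t x) : borel_measurable borel"
  and "{t. tint L (f t)} : sets borel"
proof -
 have m: "case_prod f : borel_measurable (borel \<Otimes>\<^sub>M torus L)"
  using measurable_pair_torus[OF assms] by (simp add: case_prod_unfold)
 show "(%t. LINT x|torus L. f t x) : borel_measurable borel"
  by (rule sigma_finite_measure.borel_measurable_lebesgue_integral[OF sigma_finite_torus m])
 have "Measurable.pred borel (%t. tint L (f t))"
  by (rule sigma_finite_measure.borel_measurable_lebesgue_integrable[OF sigma_finite_torus m])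
 thus "{t. tint L (f t)} : sets borel" by (simp add: pred_def)
qed

text \<open>Both cases, integrable or not, have a countable criterion built from integrals that are
  measurable in t.\<close>

lemma sets_exists_weak_deriv:
 fixes w :: "real => real^3 => real"
 assumes L: "L > 0" and wm [measurable]: "(%p. w (fst p) (snd p)) : borel_measurable (borel \<Otimes>\<^sub>M borel)"
 shows "{t. EX g. weak_deriv L i (w t) g} : sets borel"
proof -
 have wt: "w t : borel_measurable borel" for t
  using measurable_compose[OF measurable_Pair1' wm, of t] by simp
 have [measurable]: "(%t. fc L (%x. complex_of_real (w t x)) k) : borel_measurable borel" for k
  unfolding fc_def by (rule measurable_torus_integral) measurable
 have [measurable]: "(%t. LINT x|torus L. w t x * (c * box_bump L a b n x - d * box_bump L a' b' n x)) : borel_measurable borel" for a b a' b' n c d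
  by (rule measurable_torus_integral) measurable
 have [measurable]: "Measurable.pred borel (%t. tint L (w t))"
  using measurable_torus_integral(2)[OF wm] by (simp add: pred_def)
 have "{t. EX g. weak_deriv L i (w t) g} = {t\<in>space borel. (tint L (w t) &
  (EX C::nat. ALL n::nat. (SUM k:ball_modes L (real n). (norm (\<i> * of_real (k $ i) * fc L (%x. complex_of_real (w t x)) k))^2) <= real C))
  \<or> (~ tint L (w t) & box_conditions L i (w t))}"
 proof -
  have "(EX g. weak_deriv L i (w t) g) \<longleftrightarrow> (tint L (w t) &
  (EX C::nat. ALL n::nat. (SUM k:ball_modes L (real n). (norm (\<i> * of_real (k $ i) * fc L (%x. complex_of_real (w t x)) k))^2) <= real C))
  \<or> (~ tint L (w t) & box_conditions L i (w t))" for t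
  by (cases "tint L (w t)")
  (simp_all only: weak_deriv_iff_integrable[OF L] weak_deriv_iff_not_integrable[OF L wt] simp_thms not_False_eq_True)
  thus ?thesis by (simp only: space_borel UNIV_I simp_thms)
 qed
 also have "... : sets borel"
  unfolding box_conditions_def by measurable
 finally show ?thesis .
qed

section \<open>Spectral identities for vector fields\<close>

lemma norm_sq_vec: "(norm (x :: 'a::real_normed_vector ^ 'n))^2 = (SUM i:UNIV. (norm (x $ i))^2)"
 by (simp add: norm_vec_def L2_set_def sum_nonneg)

lemma L2_norm_sq: "(L2_norm L f)^2 = (LINT x|torus L. (norm (f x))^2)"
 by (simp add: L2_norm_def)

lemma vec_nth_borel: "f : borel_measurable M ==> (%x. f x $ j) : borel_measurable M"
 for f :: "'c => 'b::euclidean_space ^ 'n"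
 by (rule measurable_compose[where g = "%v. v $ j"]) (auto intro!: borel_measurable_continuous_onI continuous_intros)

lemma square_integrable_nth:
 fixes f :: "real^3 => 'b::euclidean_space ^ 'n"
 assumes "square_integrable L f" shows "square_integrable L (%x. f x $ j)"
proof -
 have m: "(%x. f x $ j) : borel_measurable (torus L)"
  using assms by (intro vec_nth_borel) (simp add: square_integrable_def)
 have "tint L (%x. (norm (f x $ j))^2)"
 proof (rule Bochner_Integration.integrable_bound)
  show "tint L (%x. (norm (f x))^2)" using assms by (simp add: square_integrable_def)
  show "(%x. (norm (f x $ j))^2) : borel_measurable (torus L)" using m by measurable
  show "AE x in torus L. norm ((norm (f x $ j))^2) <= norm ((norm (f x))^2)"
  by (intro AE_I2) (simp add: power_mono Finite_Cartesian_Product.norm_nth_le)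
 qed
 with m show ?thesis by (simp add: square_integrable_def)
qed

lemma L2_norm_vec:
 fixes f :: "real^3 => 'b::euclidean_space ^ 'n"
 assumes "square_integrable L f"
 shows "(L2_norm L f)^2 = (SUM j:UNIV. (L2_norm L (%x. f x $ j))^2)"
 unfolding L2_norm_sq norm_sq_vec
 using square_integrable_nth[OF assms] by (intro Bochner_Integration.integral_sum) (simp add: square_integrable_def)

lemma square_integrable_vecI:
 fixes f :: "real^3 => real ^ 3 ^ 3"
 assumes "!!i j. square_integrable L (%x. f x $ i $ j)"
 shows "square_integrable L f"
proof -
 have "f : borel_measurable (torus L)"
  using assms by (subst borel_measurable_euclidean_space) (auto simp: Basis_vec_def inner_axis square_integrable_def)
 moreover have "tint L (%x. (norm (f x))^2)"
  unfolding norm_sq_vec using assms by (intro Bochner_Integration.integrable_sum) (auto simp: square_integrable_def)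
 ultimately show ?thesis by (simp add: square_integrable_def)
qed

lemma parseval_real:
 fixes f :: "real^3 => real"
 assumes L: "L > 0" and f: "square_integrable L f"
 shows "(%n. SUM k:ball_modes L (real n). (norm (fc L (cx f) k))^2) ~> L ^ 3 * (L2_norm L f)^2"
proof -
 have "f : borel_measurable (torus L)" using f by (simp add: square_integrable_def)
 hence "(cx f) : borel_measurable (torus L)" by measurable
 from parseval[OF L this] show ?thesis using f by (simp add: square_integrable_def L2_norm_sq)
qed

lemma norm_fourier_sq: "(norm (fourier L f k))^2 = (SUM j:UNIV. (norm (fc L (%x. complex_of_real (f x $ j)) k))^2)"
 by (simp add: norm_sq_vec fourier_nth)

lemma parseval_field:
 fixes f :: "real^3 => real^3"
 assumes L: "L > 0" and f: "square_integrable L f"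
 shows "(%n. SUM k:ball_modes L (real n). (norm (fourier L f k))^2) ~> L ^ 3 * (L2_norm L f)^2"
 unfolding norm_fourier_sq L2_norm_vec[OF f] sum_distrib_left
 by (subst sum.swap) (intro tendsto_sum parseval_real[OF L] square_integrable_nth f)

lemma parseval_matrix:
 fixes F :: "real^3 => real^3^3"
 assumes L: "L > 0" and F: "square_integrable L F"
 shows "(%n. SUM k:ball_modes L (real n). SUM i:UNIV. SUM j:UNIV. (norm (fc L (%x. complex_of_real (F x $ i $ j)) k))^2)
  ~> L ^ 3 * (L2_norm L F)^2"
proof -
 have "(%n. SUM i:UNIV. SUM j:UNIV. SUM k:ball_modes L (real n). (norm (fc L (%x. complex_of_real (F x $ i $ j)) k))^2)
  ~> (SUM i:UNIV. SUM j:UNIV. L ^ 3 * (L2_norm L (%x. F x $ i $ j))^2)"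
  by (intro tendsto_sum parseval_real[OF L] square_integrable_nth F)
 moreover have "(SUM i:UNIV. SUM j:UNIV. L ^ 3 * (L2_norm L (%x. F x $ i $ j))^2) = L ^ 3 * (L2_norm L F)^2"
  unfolding L2_norm_vec[OF F] L2_norm_vec[OF square_integrable_nth[OF F]] sum_distrib_left ..
 moreover have "(SUM i:UNIV. SUM j:UNIV. SUM k:B. g k i j) = (SUM k:B. SUM i:UNIV. SUM j:UNIV. g k i j)"
  for B :: "(real^3) set" and g :: "real^3 => 3 => 3 => real"
  by (subst (2) sum.swap, subst sum.swap) (rule refl)
 ultimately show ?thesis by simp
qed

lemma is_weak_grad_iff:
 "is_weak_grad L f G \<longleftrightarrow> square_integrable L G & (ALL i j. weak_deriv L i (%x. f x $ j) (%x. G x $ i $ j))"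
 unfolding is_weak_grad_def weak_deriv_def using square_integrable_nth[OF square_integrable_nth] by blast

lemma ex_weak_grad_iff:
 "(EX G. is_weak_grad L f G) \<longleftrightarrow> (ALL i j. EX g. weak_deriv L i (%x. f x $ j) g)"
proof
 assume "ALL i j. EX g. weak_deriv L i (%x. f x $ j) g"
 then obtain g where g: "!!i j. weak_deriv L i (%x. f x $ j) (g i j)" by metis
 have "is_weak_grad L f (%x. \<chi> i j. g i j x)"
  unfolding is_weak_grad_iff using g by (auto intro!: square_integrable_vecI simp: weak_deriv_def)
 thus "EX G. is_weak_grad L f G" by blast
qed (auto simp: is_weak_grad_iff)

lemma fc_weak_grad:
 assumes L: "L > 0" and f: "f : borel_measurable (torus L)" and G: "is_weak_grad L f G" and k: "k : wave_vectors L"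
 shows "fc L (%x. complex_of_real (G x $ i $ j)) k = \<i> * of_real (k $ i) * fourier L f k $ j"
 unfolding fourier_nth
 by (rule fc_weak_deriv[OF L vec_nth_borel[OF f] _ k]) (use G in \<open>simp add: is_weak_grad_iff\<close>)

text \<open>The norm depends only on the Fourier coefficients of f, hence not on the choice behind
  \<open>weak_grad\<close>, and it inherits measurability in time from them.\<close>

lemma weak_grad_spectral:
 assumes L: "L > 0" and f: "f : borel_measurable (torus L)" and G: "is_weak_grad L f G"
 shows "(%n. SUM k:ball_modes L (real n). (norm k)^2 * (norm (fourier L f k))^2) ~> L ^ 3 * (L2_norm L G)^2"
proof -
 have "(SUM i:UNIV. SUM j:UNIV. (norm (fc L (%x. complex_of_real (G x $ i $ j)) k))^2) = (norm k)^2 * (norm (fourier L f k))^2"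
  if "k : ball_modes L R" for k R
  using that fc_weak_grad[OF L f G]
  by (simp add: ball_modes_def norm_mult power_mult_distrib norm_sq_vec sum_product)
 thus ?thesis using parseval_matrix[OF L, of G] G by (simp add: is_weak_grad_iff)
qed

lemma weak_grad_is_weak_grad: "is_weak_grad L f G ==> is_weak_grad L f (weak_grad L f)"
 using someI[of "is_weak_grad L f" G] by (simp add: weak_grad_def)

lemma curl_square_integrable:
 assumes "square_integrable L G" shows "square_integrable L (%x. \<chi> i j. (G x :: real^3^3) $ i $ j - G x $ j $ i)"
proof (rule square_integrable_vecI)
 fix i j
 have c: "square_integrable L (%x. G x $ i $ j)" for i j
  by (rule square_integrable_nth[OF square_integrable_nth[OF assms]])
 thus "square_integrable L (%x. (\<chi> i j. G x $ i $ j - G x $ j $ i) $ i $ j)"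
  using integrable_sq_diff(1)[of "%x. G x $ i $ j" "torus L" "%x. G x $ j $ i"]
  by (auto simp: square_integrable_def intro: borel_measurable_diff)
qed

lemma vorticity_spectral:
 assumes L: "L > 0" and f: "f : borel_measurable (torus L)" and G: "is_weak_grad L f (weak_grad L f)"
 shows "(%n. SUM k:ball_modes L (real n). SUM i:UNIV. SUM j:UNIV.
  (norm (of_real (k $ i) * fourier L f k $ j - of_real (k $ j) * fourier L f k $ i))^2) ~> L ^ 3 * (L2_norm L (vorticity L f))^2"
proof -
 define G where "G = weak_grad L f"
 have G': "is_weak_grad L f G" using G by (simp add: G_def)
 hence G2: "square_integrable L G" by (simp add: is_weak_grad_iff)
 have Gi: "tint L (%x. complex_of_real (G x $ i $ j))" for i j
  using square_integrable_integrable[OF square_integrable_nth[OF square_integrable_nth[OF G2]]] by simp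
 have "norm (fc L (%x. complex_of_real (vorticity L f x $ i $ j)) k) = norm (of_real (k $ i) * fourier L f k $ j - of_real (k $ j) * fourier L f k $ i)"
  if k: "k : ball_modes L R" for k R i j
 proof -
  have "fc L (%x. complex_of_real (vorticity L f x $ i $ j)) k = fc L (%x. complex_of_real (G x $ i $ j)) k - fc L (%x. complex_of_real (G x $ j $ i)) k"
  unfolding fc_def vorticity_def G_def[symmetric] vec_lambda_beta of_real_diff right_diff_distrib
  by (intro Bochner_Integration.integral_diff integrable_mode_mult Gi)
  also have "... = \<i> * (of_real (k $ i) * fourier L f k $ j - of_real (k $ j) * fourier L f k $ i)"
  using k fc_weak_grad[OF L f G'] by (simp add: ball_modes_def algebra_simps)
  finally show ?thesis by (simp add: norm_mult)
 qed
 moreover have "square_integrable L (vorticity L f)"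
  using curl_square_integrable[OF G2] unfolding vorticity_def[abs_def] G_def .
 ultimately show ?thesis using parseval_matrix[OF L, of "vorticity L f"] by simp
qed

lemma lagrange_identity:
 fixes k p :: "3 => real"
 shows "(SUM i:UNIV. SUM j:UNIV. (k i * p j - k j * p i)^2) = 2 * (SUM i:UNIV. (k i)^2) * (SUM j:UNIV. (p j)^2) - 2 * (SUM i:UNIV. k i * p i)^2"
 unfolding sum_3 by (simp add: power2_eq_square algebra_simps)

text \<open>Lagrange's identity for the real and the imaginary part of a; the subtracted term is the
  product of k with a, which is 0.\<close>

lemma curl_of_div_free:
 fixes a :: "complex^3" and k :: "real^3"
 assumes "(SUM i:UNIV. of_real (k $ i) * a $ i) = 0"
 shows "(SUM i:UNIV. SUM j:UNIV. (norm (of_real (k $ i) * a $ j - of_real (k $ j) * a $ i))^2) = 2 * ((norm k)^2 * (norm a)^2)"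
proof -
 have re: "(SUM i:UNIV. k $ i * Re (a $ i)) = 0" and im: "(SUM i:UNIV. k $ i * Im (a $ i)) = 0"
  using arg_cong[OF assms, of Re] arg_cong[OF assms, of Im] by simp_all
 have "(SUM i:UNIV. SUM j:UNIV. (norm (of_real (k $ i) * a $ j - of_real (k $ j) * a $ i))^2)
  = (SUM i:UNIV. SUM j:UNIV. (k $ i * Re (a $ j) - k $ j * Re (a $ i))^2) + (SUM i:UNIV. SUM j:UNIV. (k $ i * Im (a $ j) - k $ j * Im (a $ i))^2)"
  unfolding cmod_power2 sum.distrib[symmetric] by simp
 also have "... = 2 * (SUM i:UNIV. (k $ i)^2) * ((SUM j:UNIV. (Re (a $ j))^2) + (SUM j:UNIV. (Im (a $ j))^2))"
  unfolding lagrange_identity re im by (simp add: algebra_simps)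
 also have "... = 2 * ((norm k)^2 * (norm a)^2)"
  unfolding norm_sq_vec cmod_power2 sum.distrib by (simp add: mult.assoc)
 finally show ?thesis .
qed

lemma fourier_div_free:
 assumes L: "L > 0" and f: "square_integrable L f" and div: "weakly_div_free L f" and k: "k : wave_vectors L"
 shows "(SUM i:UNIV. of_real (k $ i) * fourier L f k $ i) = 0"
proof -
 have fi: "tint L (%x. f x $ i)" for i by (rule square_integrable_integrable[OF square_integrable_nth[OF f]])
 have "0 = (LINT x|torus L. (SUM i:UNIV. f x $ i * dirderiv (axis i 1) (%x. cos (k \<bullet> x)) x))"
  using div smooth_cos periodic_cos[OF L k] by (simp add: weakly_div_free_def)
 also have "... = (LINT x|torus L. (SUM i:UNIV. - (k $ i) * (f x $ i * sin (k \<bullet> x))))"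
  by (simp add: dirderiv_cos inner_axis mult_ac)
 also have "... = (SUM i:UNIV. - (k $ i) * (LINT x|torus L. f x $ i * sin (k \<bullet> x)))"
  using integrable_mult_right[OF integrable_mult_smooth[OF fi smooth_sin]]
  by (subst Bochner_Integration.integral_sum) (auto simp del: mult_minus_left)
 finally have s: "(SUM i:UNIV. k $ i * (LINT x|torus L. f x $ i * sin (k \<bullet> x))) = 0" by (simp add: sum_negf)
 have "0 = (LINT x|torus L. (SUM i:UNIV. f x $ i * dirderiv (axis i 1) (%x. sin (k \<bullet> x)) x))"
  using div smooth_sin periodic_sin[OF L k] by (simp add: weakly_div_free_def)
 also have "... = (LINT x|torus L. (SUM i:UNIV. k $ i * (f x $ i * cos (k \<bullet> x))))"
  by (simp add: dirderiv_sin inner_axis mult_ac)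
 also have "... = (SUM i:UNIV. k $ i * (LINT x|torus L. f x $ i * cos (k \<bullet> x)))"
  using integrable_mult_right[OF integrable_mult_smooth[OF fi smooth_cos]]
  by (subst Bochner_Integration.integral_sum) auto
 finally have c: "(SUM i:UNIV. k $ i * (LINT x|torus L. f x $ i * cos (k \<bullet> x))) = 0" by simp
 have "(SUM i:UNIV. of_real (k $ i) * fourier L f k $ i)
  = of_real (SUM i:UNIV. k $ i * (LINT x|torus L. f x $ i * cos (k \<bullet> x))) - \<i> * of_real (SUM i:UNIV. k $ i * (LINT x|torus L. f x $ i * sin (k \<bullet> x)))"
  unfolding fourier_nth fc_real[OF fi] by (simp add: right_diff_distrib sum_subtractf sum_distrib_left mult_ac)
 thus ?thesis unfolding s c by simp
qed

lemma vorticity_norm_div_free: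
 assumes L: "L > 0" and f: "square_integrable L f" and div: "weakly_div_free L f" and G: "is_weak_grad L f (weak_grad L f)"
 shows "(L2_norm L (vorticity L f))^2 = 2 * (L2_norm L (weak_grad L f))^2"
proof -
 have fm: "f : borel_measurable (torus L)" using f by (simp add: square_integrable_def)
 have "(%n. SUM k:ball_modes L (real n). 2 * ((norm k)^2 * (norm (fourier L f k))^2)) ~> L ^ 3 * (L2_norm L (vorticity L f))^2"
 proof -
  have "(SUM i:UNIV. SUM j:UNIV. (norm (of_real (k $ i) * fourier L f k $ j - of_real (k $ j) * fourier L f k $ i))^2) = 2 * ((norm k)^2 * (norm (fourier L f k))^2)"
  if "k : ball_modes L R" for k R
  by (rule curl_of_div_free[OF fourier_div_free[OF L f div]]) (use that in \<open>simp add: ball_modes_def\<close>)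
  thus ?thesis using vorticity_spectral[OF L fm G] by simp
 qed
 moreover have "(%n. SUM k:ball_modes L (real n). 2 * ((norm k)^2 * (norm (fourier L f k))^2)) ~> 2 * (L ^ 3 * (L2_norm L (weak_grad L f))^2)"
  unfolding sum_distrib_left[symmetric] by (intro tendsto_mult tendsto_const weak_grad_spectral[OF L fm G])
 ultimately show ?thesis using LIMSEQ_unique L by fastforce
qed

lemma weak_grad_norm_unique:
 assumes L: "L > 0" and f: "f : borel_measurable (torus L)" and G: "is_weak_grad L f G"
 shows "(L2_norm L G)^2 = (L2_norm L (weak_grad L f))^2"
 using LIMSEQ_unique[OF weak_grad_spectral[OF L f G] weak_grad_spectral[OF L f weak_grad_is_weak_grad[OF G]]] L by simp

text \<open>The triangle inequality is applied to the vector-valued integral, so that no factor for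
  the three components is lost in the estimate of the low modes.\<close>

lemma norm_fourier_le_L1:
 fixes f :: "real^3 => real^3"
 assumes f: "square_integrable L f"
 shows "norm (fourier L f k) <= L1_norm L f"
proof -
 have fi: "tint L f" using f by (auto simp: square_integrable_def intro: finite_measure.integrable_if_square_integrable)
 define F where "F x = (\<chi> j. mode k x * complex_of_real (f x $ j))" for x
 have nF: "norm (F x) = norm (f x)" for x
  unfolding norm_vec_def F_def by (simp add: norm_mult)
 have Fc: "tint L (%x. F x $ j)" for j
  unfolding F_def vec_lambda_beta
  by (rule integrable_mode_mult) (use square_integrable_integrable[OF square_integrable_nth[OF f]] in simp)
 have Fm: "F : borel_measurable (torus L)"
  using borel_measurable_integrable[OF Fc]
  by (subst borel_measurable_euclidean_space) (auto simp: Basis_vec_def inner_axis intro: borel_measurable_inner)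
 have "tint L (%x. norm (F x))" unfolding nF by (rule integrable_norm[OF fi])
 hence Fi: "tint L F" by (rule integrable_norm_cancel[OF _ Fm])
 have "fourier L f k = (LINT x|torus L. F x)"
 proof (subst vec_eq_iff, intro allI)
  fix j
  have "(LINT x|torus L. F x) $ j = (LINT x|torus L. F x $ j)"
  by (rule integral_bounded_linear[OF bounded_linear_vec_nth Fi, symmetric])
  thus "fourier L f k $ j = (LINT x|torus L. F x) $ j" by (simp add: fourier_nth fc_def F_def)
 qed
 thus ?thesis using integral_norm_bound[of "torus L" F] by (simp add: nF L1_norm_def)
qed

lemma L1_norm_sq_le:
 fixes f :: "real^3 => real^3"
 assumes "L > 0" "square_integrable L f"
 shows "(L1_norm L f)^2 <= L ^ 3 * (L2_norm L f)^2"
 using finite_measure.L1_le_L2[OF finite_measure_torus, of f L] assms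
 by (simp add: L1_norm_def L2_norm_sq square_integrable_def measure_torus)

section \<open>Measurability in time\<close>

locale measurable_field =
 fixes L :: real and U :: "real => real^3 => real^3"
 assumes L: "L > 0" and Um [measurable]: "(%p. U (fst p) (snd p)) : borel_measurable (borel \<Otimes>\<^sub>M borel)"
begin

lemma Ut: "U t : borel_measurable borel"
 using measurable_compose[OF measurable_Pair1' Um, of t] by simp

lemma Ut_torus: "U t : borel_measurable (torus L)"
 by (rule measurable_torus[OF Ut])

lemma Uj: "(%p. U (fst p) (snd p) $ j) : borel_measurable (borel \<Otimes>\<^sub>M borel)"
 by (rule vec_nth_borel[OF Um])

lemma fourier_nth_measurable [measurable]: "(%t. fourier L (U t) k $ j) : borel_measurable borel"
 unfolding fourier_nth fc_def using Uj[of j] by (intro measurable_torus_integral) measurable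

lemma norm_fourier_measurable [measurable]: "(%t. (norm (fourier L (U t) k))^2) : borel_measurable borel"
 unfolding norm_sq_vec by measurable

lemma L2_measurable [measurable]: "(%t. (L2_norm L (U t))^2) : borel_measurable borel"
 unfolding L2_norm_sq by (rule measurable_torus_integral) measurable

lemma L1_measurable [measurable]: "(%t. L1_norm L (U t)) : borel_measurable borel"
 unfolding L1_norm_def by (rule measurable_torus_integral) measurable

lemma mean_measurable [measurable]: "(%t. LINT x|torus L. U t x $ j) : borel_measurable borel"
 by (rule measurable_torus_integral[OF Uj])

definition gradient_times :: "real set" where
 "gradient_times = {t. EX G. is_weak_grad L (U t) G}"

lemma gradient_times_measurable [measurable]: "gradient_times : sets borel"
proof -
 have "gradient_times = (\<Inter>i\<in>UNIV. \<Inter>j\<in>UNIV. {t. EX g. weak_deriv L i (%x. U t x $ j) g})"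
  unfolding gradient_times_def ex_weak_grad_iff by auto
 also have "... : sets borel"
  using sets_exists_weak_deriv[OF L Uj] by (intro sets.finite_INT) auto
 finally show ?thesis .
qed

text \<open>At such times the choice is made from a constantly false predicate; its value is
  arbitrary but the same function at all of them, so measurability in time survives.\<close>

lemma weak_grad_undefined: "t ~: gradient_times ==> weak_grad L (U t) = (SOME G. False)"
proof -
 assume "t ~: gradient_times"
 hence "is_weak_grad L (U t) = (%G. False)" by (auto simp: gradient_times_def)
 thus ?thesis by (simp add: weak_grad_def)
qed

lemma weak_grad_norm_measurable [measurable]: "(%t. (L2_norm L (weak_grad L (U t)))^2) : borel_measurable borel"
proof -
 have "(L2_norm L (weak_grad L (U t)))^2 = (if t : gradient_times
  then lim (%n. SUM k:ball_modes L (real n). (norm k)^2 * (norm (fourier L (U t) k))^2) / L ^ 3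
  else (L2_norm L (SOME G :: real^3 => real^3^3. False))\<^sup>2)" for t
 proof (cases "t : gradient_times")
  case True
  then obtain G where G: "is_weak_grad L (U t) G" by (auto simp: gradient_times_def)
  have "lim (%n. SUM k:ball_modes L (real n). (norm k)^2 * (norm (fourier L (U t) k))^2) = L ^ 3 * (L2_norm L (weak_grad L (U t)))^2"
  by (rule limI[OF weak_grad_spectral[OF L Ut_torus weak_grad_is_weak_grad[OF G]]])
  thus ?thesis using True L by simp
 qed (simp add: weak_grad_undefined)
 moreover have "(%t. if t : gradient_times
  then lim (%n. SUM k:ball_modes L (real n). (norm k)^2 * (norm (fourier L (U t) k))^2) / L ^ 3
  else (L2_norm L (SOME G :: real^3 => real^3^3. False))\<^sup>2) : borel_measurable borel"
  by measurable
 ultimately show ?thesis by simp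
qed

lemma vorticity_norm_measurable [measurable]: "(%t. (L2_norm L (vorticity L (U t)))^2) : borel_measurable borel"
proof -
 define c where "c = (L2_norm L (%x. \<chi> i j. (SOME G :: real^3 => real^3^3. False) x $ i $ j - (SOME G :: real^3 => real^3^3. False) x $ j $ i :: real^3^3))^2"
 have "(L2_norm L (vorticity L (U t)))^2 = (if t : gradient_times
  then lim (%n. SUM k:ball_modes L (real n). SUM i:UNIV. SUM j:UNIV.
  (norm (of_real (k $ i) * fourier L (U t) k $ j - of_real (k $ j) * fourier L (U t) k $ i))^2) / L ^ 3
  else c)" for t
 proof (cases "t : gradient_times")
  case True
  then obtain G where G: "is_weak_grad L (U t) G" by (auto simp: gradient_times_def)
  from limI[OF vorticity_spectral[OF L Ut_torus weak_grad_is_weak_grad[OF G]]] show ?thesis using True L by simp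
 qed (simp add: weak_grad_undefined vorticity_def[abs_def] c_def)
 moreover have "(%t. if t : gradient_times
  then lim (%n. SUM k:ball_modes L (real n). SUM i:UNIV. SUM j:UNIV.
  (norm (of_real (k $ i) * fourier L (U t) k $ j - of_real (k $ j) * fourier L (U t) k $ i))^2) / L ^ 3
  else c) : borel_measurable borel"
  by measurable
 ultimately show ?thesis by simp
qed

end

lemma AE_lborel_ex:
 assumes "AE t in lborel. P t" "(a::real) < b"
 obtains t where "a < t" "t < b" "P t"
proof (rule ccontr)
 assume "~ thesis"
 hence no: "~ P t" if "a < t" "t < b" for t using that \<open>!!t. a < t ==> t < b ==> P t ==> thesis\<close> by blast
 obtain N where N: "{x : space lborel. ~ P x} <= N" "emeasure lborel N = 0" "N : sets lborel"
  using AE_E[OF assms(1)] by blast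
 have "{a<..<b} <= N" using N(1) no by auto
 hence "emeasure lborel {a<..<b} <= 0" using emeasure_mono[of "{a<..<b}" N lborel] N by simp
 thus False using assms(2) by simp
qed

locale leray_flow =
 fixes L \<nu> T0 T1 :: real and u :: "real => real^3 => real^3"
 assumes L0: "L > 0" and nu: "\<nu> > 0" and T0: "0 <= T0" and T01: "T0 < T1"
  and sol: "leray_solution L \<nu> T0 u" and mean0: "(LINT x|torus L. rho L *\<^sub>R u T0 x) = 0"
begin

text \<open>\<open>leray_space\<close> gives measurability for t >= 0 only; extension by 0 makes the
  field Borel on the whole time axis.\<close>

definition U :: "real => real^3 => real^3" where
 "U t x = indicator {0..} t *\<^sub>R u t x"

lemma U_eq: "t >= 0 ==> U t = u t"
 by (simp add: U_def fun_eq_iff)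

lemma leray: "leray_space L u"
 using sol by (simp add: leray_solution_def)

lemma U_measurable: "(%p. U (fst p) (snd p)) : borel_measurable (borel \<Otimes>\<^sub>M borel)"
proof -
 have "(%(t, x). u t x) : borel_measurable (restrict_space borel ({0..} \<times> UNIV))"
  using leray by (simp add: leray_space_def)
 moreover have "({0..} :: real set) \<times> (UNIV :: (real^3) set) : sets borel"
  by (intro borel_closed closed_Times) auto
 ultimately have "(%p. indicator ({0..} \<times> UNIV) p *\<^sub>R (case p of (t, x) => u t x)) : borel_measurable borel"
  by (subst (asm) borel_measurable_restrict_space_iff) auto
 also have "(%p. indicator ({0..} \<times> UNIV) p *\<^sub>R (case p of (t, x) => u t x)) = (%p. U (fst p) (snd p))"
  by (auto simp: U_def indicator_def fun_eq_iff split: prod.split)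
 finally show ?thesis by (simp add: borel_prod)
qed

sublocale measurable_field L U
 by unfold_locales (use L0 U_measurable in auto)

definition M where "M = (SOME M. M >= 0 & (AE t in lborel. t >= 0 --> square_integrable L (U t) & L2_norm L (U t) <= M))"

lemma M0: "M >= 0" and AE_field: "AE t in lborel. t >= 0 --> square_integrable L (U t) & L2_norm L (U t) <= M"
proof -
 obtain M' where M': "AE t in lborel. t >= 0 --> square_integrable L (u t) & L2_norm L (u t) <= M'"
  using leray by (auto simp: leray_space_def)
 have "AE t in lborel. t >= 0 --> square_integrable L (U t) & L2_norm L (U t) <= max 0 M'"
  using M' by eventually_elim (auto simp: U_eq)
 hence "max 0 M' >= 0 & (AE t in lborel. t >= 0 --> square_integrable L (U t) & L2_norm L (U t) <= max 0 M')" by simp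
 from someI[of "%M. M >= 0 & (AE t in lborel. t >= 0 --> square_integrable L (U t) & L2_norm L (U t) <= M)", OF this]
 show "M >= 0" "AE t in lborel. t >= 0 --> square_integrable L (U t) & L2_norm L (U t) <= M"
  unfolding M_def by auto
qed

lemma L2_norm_nonneg: "L2_norm L f >= 0"
 by (simp add: L2_norm_def)

definition N where "N t = (L2_norm L (U t))^2"
definition E where "E t = (L2_norm L (weak_grad L (U t)))^2"

lemma N_measurable [measurable]: "N : borel_measurable borel"
 unfolding N_def[abs_def] by (rule L2_measurable)

lemma E_measurable [measurable]: "E : borel_measurable borel"
 unfolding E_def[abs_def] by (rule weak_grad_norm_measurable)

lemma N_nonneg: "N t >= 0" and E_nonneg: "E t >= 0"
 by (auto simp: N_def E_def)

lemma AE_N: "AE t in lborel. t >= 0 --> N t <= M^2"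
 using AE_field by eventually_elim (auto simp: N_def L2_norm_nonneg intro!: power_mono)

lemma integrable_if_AE_bounded:
 fixes f :: "real => real"
 assumes [measurable]: "f : borel_measurable borel" and b: "AE t in lborel. t >= 0 --> \<bar>f t\<bar> <= C" and "0 <= a"
 shows "set_integrable lborel {a..b} f"
 unfolding set_integrable_def
proof (rule Bochner_Integration.integrable_bound)
 show "integrable lborel (%t. indicator {a..b} t *\<^sub>R C)"
  by (intro integrable_scaleR_left integrable_real_indicator) (auto simp: emeasure_lborel_Icc_eq)
 show "AE t in lborel. norm (indicator {a..b} t *\<^sub>R f t) <= norm (indicator {a..b} t *\<^sub>R C)"
  using b by eventually_elim (use assms(3) in \<open>auto simp: indicator_def\<close>)
qed measurable

lemma N_integrable: "0 <= a ==> set_integrable lborel {a..b} N"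
 using AE_N by (intro integrable_if_AE_bounded[where C = "M^2"]) (auto simp: N_nonneg)

lemma AE_grad: "AE t in lborel. t >= 0 --> is_weak_grad L (U t) (weak_grad L (U t))"
proof -
 obtain G where "AE t in lborel. t >= 0 --> is_weak_grad L (u t) (G t)" using leray by (auto simp: leray_space_def)
 thus ?thesis by eventually_elim (auto simp: U_eq intro: weak_grad_is_weak_grad)
qed

text \<open>The gradient G in \<open>leray_space\<close> need not be the one chosen by
  \<open>weak_grad\<close>, but both have the same norm at almost every time.\<close>

lemma E_integrable_half_line: "set_integrable lborel {0..} E"
proof -
 obtain G where G: "AE t in lborel. t >= 0 --> is_weak_grad L (u t) (G t)"
  "set_integrable lborel ({0..} \<times> cell L) (%(t, x). (norm (G t x))^2)" using leray by (auto simp: leray_space_def)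
 define f where "f p = indicator ({0..} \<times> cell L) p *\<^sub>R (case p of (t, x) => (norm (G t x))\<^sup>2)" for p
 have "integrable (lborel \<Otimes>\<^sub>M lborel) f"
  using G(2) unfolding set_integrable_def f_def[abs_def] by (simp add: lborel_prod)
 hence i: "integrable lborel (%t. LINT x|lborel. f (t, x))" by (rule lborel_pair.integrable_fst')
 have e: "(LINT x|lborel. f (t, x)) = indicator {0..} t * (L2_norm L (G t))^2" for t
 proof -
  have "f (t, x) = indicator {0..} t * (indicator (cell L) x *\<^sub>R (norm (G t x))\<^sup>2)" for x
  by (simp add: f_def indicator_def)
  thus ?thesis by (simp add: L2_norm_sq integral_torus)
 qed
 have "AE t in lborel. (LINT x|lborel. f (t, x)) = indicator {0..} t *\<^sub>R E t"
  using G(1)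
 proof eventually_elim
  case (elim t)
  show ?case
  proof (cases "t >= 0")
  case True
  hence "is_weak_grad L (U t) (G t)" using elim by (simp add: U_eq)
  from weak_grad_norm_unique[OF L Ut_torus this] show ?thesis using True by (simp add: e E_def)
  qed (simp add: e)
 qed
 thus ?thesis unfolding set_integrable_def
  by (rule integrable_cong_AE_imp[OF i, rotated]) measurable
qed

lemma E_integrable: "0 <= a ==> set_integrable lborel {a..b} E"
 by (rule set_integrable_subset[OF E_integrable_half_line]) auto

lemma square_integrable_initial: "square_integrable L (U T0)"
 using sol T0 by (simp add: leray_solution_def U_eq)

section \<open>Conservation of momentum\<close>

definition momentum where "momentum j t = (LINT x|torus L. U t x $ j)"

lemma momentum_measurable [measurable]: "momentum j : borel_measurable borel"
 unfolding momentum_def[abs_def] by (rule mean_measurable)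

lemma momentum_bound: "square_integrable L (U t) ==> L2_norm L (U t) <= M ==>
  (LINT x|torus L. \<bar>U t x $ j\<bar>) <= sqrt (L ^ 3) * M"
proof -
 assume s: "square_integrable L (U t)" and b: "L2_norm L (U t) <= M"
 have "(LINT x|torus L. \<bar>U t x $ j\<bar>)^2 <= L ^ 3 * (LINT x|torus L. (norm (U t x $ j))^2)"
  using finite_measure.L1_le_L2[OF finite_measure_torus, of "%x. U t x $ j" L] square_integrable_nth[OF s, of j] L
  by (simp add: square_integrable_def measure_torus)
 also have "... <= L ^ 3 * (LINT x|torus L. (norm (U t x))^2)"
  using square_integrable_nth[OF s, of j] s L
  by (intro mult_left_mono integral_mono power_mono Finite_Cartesian_Product.norm_nth_le) (auto simp: square_integrable_def)
 also have "... <= L ^ 3 * M^2"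
  unfolding L2_norm_sq[symmetric] using b L by (intro mult_left_mono power_mono L2_norm_nonneg) auto
 also have "... = (sqrt (L ^ 3) * M)^2" using L by (simp add: power_mult_distrib)
 finally show ?thesis by (rule power2_le_imp_le) (use M0 L in simp)
qed

lemma momentum_fubini:
 assumes [measurable]: "g : borel_measurable borel" and g: "!!t. \<bar>g t\<bar> <= C * indicator {T0..b} t" and C: "C >= 0"
 shows "(LINT p|lborel. g (fst p) * (indicator (cell L) (snd p) * U (fst p) (snd p) $ j)) = (LINT t|lborel. g t * momentum j t)"
  and "integrable lborel (%t. g t * momentum j t)"
proof -
 define h where "h p = g (fst p) * (indicator (cell L) (snd p) * U (fst p) (snd p) $ j)" for p
 have lsets: "sets ((lborel :: real measure) \<Otimes>\<^sub>M (lborel :: (real^3) measure)) = sets (borel \<Otimes>\<^sub>M borel)"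
  by (intro sets_pair_measure_cong) auto
 have [measurable]: "(%p. U (fst p) (snd p) $ j) : borel_measurable (borel \<Otimes>\<^sub>M borel)" by (rule Uj)
 have hm: "h : borel_measurable (borel \<Otimes>\<^sub>M borel)" unfolding h_def by measurable
 have g0: "g t = 0" if "t < 0" for t using g[of t] that T0 by (auto simp: indicator_def)
 have inner: "(LINT x|lborel. norm (h (t, x))) = \<bar>g t\<bar> * (LINT x|torus L. \<bar>U t x $ j\<bar>)" for t
 proof -
  have "norm (h (t, x)) = \<bar>g t\<bar> * (indicator (cell L) x *\<^sub>R \<bar>U t x $ j\<bar>)" for x
  by (simp add: h_def abs_mult)
  thus ?thesis by (simp add: integral_torus)
 qed
 have i: "integrable (lborel \<Otimes>\<^sub>M lborel) h"
 proof (rule lborel_pair.Fubini_integrable)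
  show "h : borel_measurable (lborel \<Otimes>\<^sub>M lborel)" using hm unfolding measurable_cong_sets[OF lsets refl] .
  show "integrable lborel (%t. LINT x|lborel. norm (h (t, x)))"
  proof (rule Bochner_Integration.integrable_bound)
  show "integrable lborel (%t. C * (sqrt (L ^ 3) * M) * indicator {T0..b} t)"
  by (intro integrable_mult_right integrable_real_indicator) (auto simp: emeasure_lborel_Icc_eq)
  have "(%t. LINT x|torus L. \<bar>U t x $ j\<bar>) : borel_measurable borel"
  by (rule measurable_torus_integral) measurable
  thus "(%t. LINT x|lborel. norm (h (t, x))) : borel_measurable lborel"
  unfolding inner by measurable
  show "AE t in lborel. norm (LINT x|lborel. norm (h (t, x))) <= norm (C * (sqrt (L ^ 3) * M) * indicator {T0..b} t)"
  using AE_field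
  proof eventually_elim
  case (elim t)
  show ?case
  proof (cases "t >= 0")
  case True
  hence "\<bar>g t\<bar> * (LINT x|torus L. \<bar>U t x $ j\<bar>) <= (C * indicator {T0..b} t) * (sqrt (L ^ 3) * M)"
  using elim g[of t] momentum_bound[of t j] C by (intro mult_mono) auto
  thus ?thesis unfolding inner using M0 L C by (simp add: abs_mult mult_ac)
  next
  case False
  thus ?thesis unfolding inner using M0 L C by (simp add: g0)
  qed
  qed
  qed
  show "AE t in lborel. integrable lborel (%x. h (t, x))"
  using AE_field
  proof eventually_elim
  case (elim t)
  show ?case
  proof (cases "t >= 0")
  case True
  hence "tint L (%x. U t x $ j)"
  using elim by (intro square_integrable_integrable square_integrable_nth) auto
  thus ?thesis unfolding h_def integrable_torus by simp
  qed (simp add: h_def g0)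
  qed
 qed
 have e: "(LINT x|lborel. h (t, x)) = g t * momentum j t" for t
  by (simp add: h_def momentum_def integral_torus)
 have "(LINT t|lborel. LINT x|lborel. h (t, x)) = (LINT p|(lborel \<Otimes>\<^sub>M lborel). h p)"
  by (rule lborel_pair.integral_fst'[OF i])
 thus "(LINT p|lborel. g (fst p) * (indicator (cell L) (snd p) * U (fst p) (snd p) $ j)) = (LINT t|lborel. g t * momentum j t)"
  unfolding e by (simp add: h_def[abs_def] lborel_prod)
 show "integrable lborel (%t. g t * momentum j t)" using lborel_pair.integrable_fst'[OF i] unfolding e .
qed

lemma initial_momentum: "(LINT x|torus L. u T0 x $ j) = 0"
proof -
 have i: "tint L (u T0)"
  using square_integrable_initial T0
  by (auto simp: square_integrable_def U_eq intro: finite_measure.integrable_if_square_integrable)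
 have "rho L *\<^sub>R (LINT x|torus L. u T0 x) = 0" using mean0 by simp
 hence "(LINT x|torus L. u T0 x) = 0" using L by (simp add: rho_def)
 moreover have "(LINT x|torus L. u T0 x $ j) = (LINT x|torus L. u T0 x) $ j"
  by (rule integral_bounded_linear[OF bounded_linear_vec_nth i])
 ultimately show ?thesis by simp
qed

text \<open>The weak formulation is tested with \<open>\<eta>(t) e\<^sub>j\<close>, where \<open>\<eta>'\<close> is a bump in \<open>(\<alpha>, \<beta>)\<close> minus a
 translate of it into the past of \<open>T0\<close>.\<close>

lemma momentum_test:
 assumes \<alpha>: "T0 <= \<alpha>" "\<alpha> < \<beta>"
 shows "(LINT t|lborel. (bump (real n * (t - \<alpha>)) * bump (real n * (\<beta> - t))) * momentum j t) = 0"
proof -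
 define b where "b t = bump (real n * (t - \<alpha>)) * bump (real n * (\<beta> - t))" for t
 have b0: "b t = 0" if "t <= \<alpha> \<or> \<beta> <= t" for t
 proof -
  have "real n * (t - \<alpha>) <= 0 \<or> real n * (\<beta> - t) <= 0" using that by (auto intro: mult_nonneg_nonpos)
  thus ?thesis by (auto simp: b_def bump_eq)
 qed
 have b01: "0 <= b t" "b t <= 1" for t by (auto simp: b_def bump_nonneg bump_le_1 intro!: mult_le_one)
 have lin: "smooth1 (%t. c * (t - d))" "smooth1 (%t. c * (d - t))" for c d
  by (intro smooth1_mult smooth1_const smooth1_diff smooth1_id)+
 have bs: "smooth1 b" unfolding b_def by (intro smooth1_mult smooth1_compose[OF smooth1_bump] lin)
 obtain P where P: "!!t. (P has_real_derivative b t) (at t)" using ex_antiderivative[OF smooth1_imp_continuous[OF bs]] by blast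
 have Ps: "smooth1 P" by (rule smooth1_antiderivative[OF P bs])
 have Pconst: "P t = P s" if "s < t" "!!z. s < z ==> z < t ==> b z = 0" for s t
  using MVT2[OF that(1) P] that(2) by auto
 \<comment> \<open>With this shift the translated bump lives before T0 - 1, where the weak
   formulation does not look. The two bumps cancel in mean, so \<eta> has compact support.\<close>
 define s where "s = \<beta> - T0 + 1"
 define \<eta> where "\<eta> t = P t - P (t + s)" for t
 define \<eta>' where "\<eta>' t = b t - b (t + s)" for t
 have \<eta>s: "smooth1 \<eta>" unfolding \<eta>_def by (intro smooth1_diff Ps smooth1_compose[OF Ps] smooth1_add smooth1_id smooth1_const)
 have \<eta>d: "(\<eta> has_real_derivative \<eta>' t) (at t)" for t
 proof -
  have "((%t. P (t + s)) has_real_derivative b (t + s)) (at t)" using P[of "t + s"] by (simp add: DERIV_shift)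
  from DERIV_diff[OF P[of t] this] show ?thesis by (simp add: \<eta>_def[abs_def] \<eta>'_def)
 qed
 define \<phi> where "\<phi> p = \<eta> (fst p) *\<^sub>R axis j (1::real)" for p :: "real \<times> (real^3)"
 have d: "dirderiv v \<phi> p = (fst v * \<eta>' (fst p)) *\<^sub>R axis j 1" for v p
 proof (rule dirderiv_eqI)
  have "((%p. \<eta> (fst p)) has_derivative (%v. fst v * \<eta>' (fst p))) (at p)"
  by (rule DERIV_compose_FDERIV[OF \<eta>d bounded_linear_imp_has_derivative[OF bounded_linear_fst]])
  from has_derivative_scaleR_left[OF this]
  show "(\<phi> has_derivative (%v. (fst v * \<eta>' (fst p)) *\<^sub>R axis j 1)) (at p)" unfolding \<phi>_def[abs_def] .
 qed
 have d0: "dirderiv (0, w) \<phi> = (%_. 0)" for w by (simp add: d fun_eq_iff)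
 have d00: "dirderiv v (%_ :: real \<times> (real^3). 0 :: real^3) p = 0" for v p
  by (rule dirderiv_eqI[of _ "%_. 0"]) (rule has_derivative_const)
 have "ns_test_field L \<phi>"
  unfolding ns_test_field_def
 proof (intro conjI)
  show "smooth \<phi>" unfolding \<phi>_def
  by (rule smooth_scaleR[OF smooth_linear_compose[OF bounded_linear_fst \<eta>s]])
  show "ALL t. space_periodic L (%x. \<phi> (t, x))" by (simp add: space_periodic_def \<phi>_def)
  show "ALL p. (SUM i:UNIV. dirderiv (0, axis i 1) \<phi> p $ i) = 0" by (simp add: d0)
  have "\<eta> t = 0" if "t >= \<beta>" for t
  proof -
  have "P (t + s) = P t" using \<alpha> that by (intro Pconst) (auto simp: s_def intro: b0)
  thus ?thesis by (simp add: \<eta>_def)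
  qed
  moreover have "\<eta> t = 0" if "t <= \<alpha> - s" for t
  proof -
  have "P (t + s) = P t" using \<alpha> that by (intro Pconst) (auto simp: s_def intro: b0)
  thus ?thesis by (simp add: \<eta>_def)
  qed
  ultimately have "\<eta> t = 0" if "\<bar>t\<bar> >= \<bar>\<beta>\<bar> + \<bar>\<alpha> - s\<bar>" for t
  using that by (cases "t >= \<beta>") auto
  thus "EX b. ALL t x. b <= \<bar>t\<bar> --> \<phi> (t, x) = 0" by (intro exI[of _ "\<bar>\<beta>\<bar> + \<bar>\<alpha> - s\<bar>"]) (auto simp: \<phi>_def)
 qed
 moreover have "ns_weak_form L \<nu> T0 u" using sol by (simp add: leray_solution_def)
 ultimately have weak: "(LINT p:({T0..} \<times> cell L)|lborel. (case p of (t, x) =>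
  u t x \<bullet> dirderiv (1, 0) \<phi> (t, x)
  + \<nu> * (u t x \<bullet> (SUM i:UNIV. dirderiv (0, axis i 1) (dirderiv (0, axis i 1) \<phi>) (t, x)))
  + u t x \<bullet> dirderiv (0, u t x) \<phi> (t, x)))
  + (LINT x|torus L. u T0 x \<bullet> \<phi> (T0, x)) = 0"
  by (simp add: ns_weak_form_def)
 have "(LINT x|torus L. u T0 x \<bullet> \<phi> (T0, x)) = 0"
  using initial_momentum by (simp add: \<phi>_def inner_axis)
 hence "(LINT p:({T0..} \<times> cell L)|lborel. (case p of (t, x) => \<eta>' t * u t x $ j)) = 0"
  using weak by (simp add: d0 d00 d inner_axis)
 moreover have "(LINT p:({T0..} \<times> cell L)|lborel. (case p of (t, x) => \<eta>' t * u t x $ j))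
  = (LINT p|lborel. b (fst p) * (indicator (cell L) (snd p) * U (fst p) (snd p) $ j))"
  unfolding set_lebesgue_integral_def
 proof (intro Bochner_Integration.integral_cong refl)
  fix p :: "real \<times> (real^3)"
  obtain t x where p: "p = (t, x)" by (cases p)
  have "b (t + s) = 0" if "t >= T0" using that by (intro b0) (auto simp: s_def)
  moreover have "b t = 0" if "t < T0" using that \<alpha> by (intro b0) auto
  ultimately show "indicator ({T0..} \<times> cell L) p *\<^sub>R (case p of (t, x) => \<eta>' t * u t x $ j)
  = b (fst p) * (indicator (cell L) (snd p) * U (fst p) (snd p) $ j)"
  using T0 by (cases "t >= T0") (auto simp: p \<eta>'_def indicator_def U_eq)
 qed
 moreover have "b : borel_measurable borel" by (intro borel_measurable_continuous_onI smooth1_imp_continuous bs)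
 moreover have "\<bar>b t\<bar> <= 1 * indicator {T0..\<beta>} t" for t
  using b0[of t] b01[of t] \<alpha> by (auto simp: indicator_def)
 ultimately show ?thesis using momentum_fubini(1)[of b 1 \<beta> j] unfolding b_def[symmetric] by simp
qed

lemma momentum_interval:
 assumes \<alpha>: "T0 <= \<alpha>" "\<alpha> < \<beta>"
 shows "(LINT t|lborel. indicator {\<alpha><..<\<beta>} t * momentum j t) = 0"
proof -
 define b where "b n t = bump (real n * (t - \<alpha>)) * bump (real n * (\<beta> - t))" for n t
 have bm [measurable]: "b n : borel_measurable borel" for n
 proof -
  have "smooth1 (b n)" unfolding b_def
  by (intro smooth1_mult smooth1_compose[OF smooth1_bump] smooth1_const smooth1_diff smooth1_id)
  thus ?thesis by (intro borel_measurable_continuous_onI smooth1_imp_continuous)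
 qed
 have "(%n. LINT t|lborel. b n t * momentum j t) ~> (LINT t|lborel. indicator {\<alpha><..<\<beta>} t * momentum j t)"
 proof (rule integral_dominated_convergence[where w = "%t. norm (indicator {\<alpha><..<\<beta>} t * momentum j t)"])
  have "\<bar>indicator {\<alpha><..<\<beta>} t :: real\<bar> <= 1 * indicator {T0..\<beta>} t" for t :: real using \<alpha> by (auto simp: indicator_def)
  thus "integrable lborel (%t. norm (indicator {\<alpha><..<\<beta>} t * momentum j t))"
  by (intro integrable_norm momentum_fubini(2)[where C = 1 and b = \<beta>]) auto
  show "AE t in lborel. (%n. b n t * momentum j t) ~> indicator {\<alpha><..<\<beta>} t * momentum j t"
  proof (rule AE_I2)
  fix t
  have "(%n. b n t * momentum j t) ~> (if t - \<alpha> > 0 then 1 else 0) * (if \<beta> - t > 0 then 1 else 0) * momentum j t"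
  unfolding b_def by (intro tendsto_mult tendsto_const bump_limit)
  moreover have "(if t - \<alpha> > 0 then 1 else 0) * (if \<beta> - t > 0 then 1 else 0) * momentum j t = indicator {\<alpha><..<\<beta>} t * momentum j t"
  by (auto simp: indicator_def)
  ultimately show "(%n. b n t * momentum j t) ~> indicator {\<alpha><..<\<beta>} t * momentum j t" by (simp only:)
  qed
  show "AE t in lborel. norm (b n t * momentum j t) <= norm (indicator {\<alpha><..<\<beta>} t * momentum j t)" for n
  proof (rule AE_I2)
  fix t
  have "\<bar>b n t\<bar> <= indicator {\<alpha><..<\<beta>} t"
  proof (cases "t : {\<alpha><..<\<beta>}")
  case False
  hence "real n * (t - \<alpha>) <= 0 \<or> real n * (\<beta> - t) <= 0" by (auto intro: mult_nonneg_nonpos)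
  thus ?thesis using False by (auto simp: b_def bump_eq)
  qed (simp add: b_def abs_mult bump_nonneg bump_le_1 mult_le_one)
  hence "\<bar>b n t\<bar> * \<bar>momentum j t\<bar> <= indicator {\<alpha><..<\<beta>} t * \<bar>momentum j t\<bar>" by (rule mult_right_mono) simp
  thus "norm (b n t * momentum j t) <= norm (indicator {\<alpha><..<\<beta>} t * momentum j t)" by (simp add: abs_mult)
  qed
 qed measurable
 thus ?thesis using momentum_test[OF \<alpha>] by (simp add: b_def LIMSEQ_const_iff)
qed

lemma AE_momentum: "AE t in lborel. T0 < t --> t < T1 --> momentum j t = 0"
proof -
 have "AE t in lborel. indicator {T0<..<T1} t * momentum j t = 0"
 proof (rule AE_zero_if_box_integrals_zero)
  have "\<bar>indicator {T0<..<T1} t :: real\<bar> <= 1 * indicator {T0..T1} t" for t :: real by (auto simp: indicator_def)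
  thus "integrable lborel (%t. indicator {T0<..<T1} t * momentum j t)"
  by (intro momentum_fubini(2)[where C = 1 and b = T1]) auto
  fix a b :: real
  have e: "indicator (box a b) t * (indicator {T0<..<T1} t * momentum j t) = indicator {max a T0<..<min b T1} t * momentum j t" for t
  by (auto simp: indicator_def)
  show "(LINT t|lborel. indicator (box a b) t * (indicator {T0<..<T1} t * momentum j t)) = 0"
  unfolding e by (cases "max a T0 < min b T1") (auto intro: momentum_interval)
 qed
 thus ?thesis by eventually_elim auto
qed

lemma AE_fourier_zero: "AE t in lborel. T0 < t --> t < T1 --> fourier L (U t) 0 = 0"
proof -
 have "AE t in lborel. ALL j:UNIV. T0 < t --> t < T1 --> momentum j t = 0"
  by (intro AE_finite_allI AE_momentum) auto
 thus ?thesis using AE_field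
 proof eventually_elim
  case (elim t)
  show ?case
  proof (intro impI)
  assume t: "T0 < t" "t < T1"
  hence "tint L (%x. U t x $ j)" for j
  using elim T0 by (intro square_integrable_integrable square_integrable_nth) auto
  thus "fourier L (U t) 0 = 0"
  using elim t by (simp add: vec_eq_iff fourier_nth fc_real momentum_def)
  qed
 qed
qed

lemma AE_vorticity: "AE t in lborel. T0 < t --> (L2_norm L (vorticity L (U t)))\<^sup>2 = 2 * E t"
proof -
 have "AE t in lborel. T0 < t --> weakly_div_free L (u t)" using sol by (simp add: leray_solution_def)
 thus ?thesis using AE_field AE_grad
  by eventually_elim (use T0 in \<open>auto simp: E_def U_eq intro!: vorticity_norm_div_free[OF L]\<close>)
qed

end

section \<open>From the mean spectrum to mean energy and mean dissipation\<close>

lemma sum_over_norms: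
 fixes f :: "real^3 => real"
 assumes L: "L > 0" and f0: "f 0 = 0"
 shows "(SUM k:ball_modes L R. c (norm k) * f k)
  = (SUM K:{K : Sigma_star L. K <= R}. c K * (\<Sum>k | k : wave_vectors L & norm k = K. f k))"
proof -
 let ?B = "ball_modes L R - {0}"
 have fin: "finite ?B" using L by simp
 have img: "norm ` ?B = {K : Sigma_star L. K <= R}"
  by (auto simp: ball_modes_def Sigma_star_def Sigma_set_def)
 \<comment> \<open>The mode 0 has no shell in \<open>Sigma_star\<close>; it drops out because f 0 =
   0.\<close>
 have "(SUM k:ball_modes L R. c (norm k) * f k) = (SUM k:?B. c (norm k) * f k)"
  by (rule sum.mono_neutral_right) (use L f0 in auto)
 also have "... = (SUM K:norm ` ?B. \<Sum>k | k : ?B & norm k = K. c (norm k) * f k)"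
  by (rule sum.image_gen[OF fin])
 also have "... = (SUM K:{K : Sigma_star L. K <= R}. c K * (\<Sum>k | k : wave_vectors L & norm k = K. f k))"
  unfolding img
 proof (rule sum.cong[OF refl])
  fix K assume K: "K : {K : Sigma_star L. K <= R}"
  hence "{k. k : ?B & norm k = K} = {k. k : wave_vectors L & norm k = K}"
  by (auto simp: ball_modes_def Sigma_star_def)
  thus "(\<Sum>k | k : ?B & norm k = K. c (norm k) * f k) = c K * (\<Sum>k | k : wave_vectors L & norm k = K. f k)"
  by (simp add: sum_distrib_left)
 qed
 finally show ?thesis .
qed

lemma finite_Sigma_star_le: "L > 0 ==> finite {K : Sigma_star L. K <= R}"
proof -
 assume L: "L > 0"
 have "{K : Sigma_star L. K <= R} <= norm ` ball_modes L R" by (auto simp: Sigma_star_def Sigma_set_def ball_modes_def)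
 thus ?thesis by (rule finite_subset[OF _ finite_imageI[OF finite_ball_modes[OF L]]])
qed

lemma Sigma_star_pos: "K : Sigma_star L ==> K > 0"
 by (auto simp: Sigma_star_def Sigma_set_def)

text \<open>The mass that \<open>spectral_measure\<close> gives to the frequency K.\<close>

definition shell_weight :: "real => real => real" where
 "shell_weight L K = (2 * pi / L) * (2 * pi / (K * L))"

lemma spectral_integral:
 "(LINT K:A|spectral_measure L. f K) = (LINT K|count_space (Sigma_star L). indicator A K * (shell_weight L K * f K))"
 if L: "L > 0" for f :: "real => real"
proof -
 have "(LINT K:A|spectral_measure L. f K) = (LINT K|density (count_space (Sigma_star L)) (%K. ennreal (shell_weight L K)). indicator A K *\<^sub>R f K)"
  by (simp add: set_lebesgue_integral_def spectral_measure_def point_measure_def shell_weight_def)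
 also have "... = (LINT K|count_space (Sigma_star L). shell_weight L K *\<^sub>R (indicator A K *\<^sub>R f K))"
  by (rule integral_density) (use L in \<open>auto simp: AE_count_space shell_weight_def dest: Sigma_star_pos intro!: divide_nonneg_nonneg mult_nonneg_nonneg\<close>)
 finally show ?thesis by (simp add: mult_ac)
qed

lemma spectral_integral_interval:
 fixes f :: "real => real"
 assumes L: "L > 0"
 shows "(LINT K:{a..b}|spectral_measure L. f K) = (SUM K:Sigma_star L \<inter> {a..b}. shell_weight L K * f K)"
proof -
 define h where "h K = indicator {a..b} K * (shell_weight L K * f K)" for K
 have fin: "finite (Sigma_star L \<inter> {a..b})"
  by (rule finite_subset[OF _ finite_Sigma_star_le[OF L, of b]]) auto
 have sub: "{K : Sigma_star L. h K ~= 0} <= Sigma_star L \<inter> {a..b}" by (auto simp: h_def indicator_def split: if_splits)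
 have "(LINT K|count_space (Sigma_star L). h K) = (\<Sum>K | K : Sigma_star L & h K ~= 0. h K)"
  by (rule lebesgue_integral_count_space_finite_support[OF finite_subset[OF sub fin]])
 also have "... = (SUM K:Sigma_star L \<inter> {a..b}. h K)"
  by (rule sum.mono_neutral_left[OF fin sub]) auto
 also have "... = (SUM K:Sigma_star L \<inter> {a..b}. shell_weight L K * f K)"
  by (intro sum.cong refl) (simp add: h_def)
 finally show ?thesis unfolding spectral_integral[OF L] h_def .
qed

text \<open>A limit over balls is not yet a Lebesgue integral over all shells; nonnegativity and
  monotone convergence identify the two and exclude the default value 0.\<close>

lemma spectral_integral_UNIV:
 fixes f :: "real => real"
 assumes L: "L > 0" and f: "!!K. K : Sigma_star L ==> f K >= 0"
  and lim: "(%n. SUM K:(shells L n). shell_weight L K * f K) ~> l"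
 shows "(LINT K:UNIV|spectral_measure L. f K) = l"
proof -
 define h where "h K = shell_weight L K * f K" for K
 have h0: "h K >= 0" if "K : Sigma_star L" for K
  using f[OF that] Sigma_star_pos[OF that] L by (auto simp: h_def shell_weight_def)
 define g where "g n K = ennreal (indicator {..real n} K * h K)" for n K
 have gi: "(\<integral>\<^sup>+K. g n K \<partial>count_space (Sigma_star L)) = ennreal (SUM K:(shells L n). h K)" for n
 proof -
  have fin: "finite (shells L n)" by (rule finite_Sigma_star_le[OF L])
  have "(\<integral>\<^sup>+K. g n K \<partial>count_space (Sigma_star L)) = (\<integral>\<^sup>+K. g n K * indicator (shells L n) K \<partial>count_space (Sigma_star L))"
  by (intro nn_integral_cong) (auto simp: g_def indicator_def)
  also have "... = (\<integral>\<^sup>+K. g n K \<partial>count_space (shells L n))"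
  by (subst nn_integral_restrict_space[symmetric]) (auto simp: restrict_count_space Int_absorb1 Int_def intro!: nn_integral_count_space_eq)
  also have "... = (SUM K:(shells L n). g n K)" by (rule nn_integral_count_space_finite[OF fin])
  also have "... = (SUM K:(shells L n). ennreal (h K))" by (intro sum.cong refl) (auto simp: g_def)
  also have "... = ennreal (SUM K:(shells L n). h K)" using h0 by (intro sum_ennreal) auto
  finally show ?thesis .
 qed
 have s0: "(SUM K:(shells L n). h K) >= 0" for n using h0 by (intro sum_nonneg) auto
 have lim': "(%n. SUM K:(shells L n). h K) ~> l" using lim by (simp add: h_def)
 have l0: "l >= 0" by (rule LIMSEQ_le_const[OF lim']) (use s0 in auto)
 have inc: "incseq (%n. \<integral>\<^sup>+K. g n K \<partial>count_space (Sigma_star L))"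
 proof (rule incseq_SucI)
  show "(\<integral>\<^sup>+K. g n K \<partial>count_space (Sigma_star L)) <= (\<integral>\<^sup>+K. g (Suc n) K \<partial>count_space (Sigma_star L))" for n
  by (intro nn_integral_mono) (auto simp: g_def indicator_def h0 intro!: ennreal_leI)
 qed
 have "(\<integral>\<^sup>+K. ennreal (h K) \<partial>count_space (Sigma_star L)) = (\<integral>\<^sup>+K. (SUP n. g n K) \<partial>count_space (Sigma_star L))"
 proof (rule nn_integral_cong)
  fix K assume K: "K : space (count_space (Sigma_star L))"
  obtain n :: nat where n: "K <= real n" using real_arch_simple by blast
  show "ennreal (h K) = (SUP n. g n K)"
  proof (rule antisym)
  have "ennreal (h K) = g n K" using n by (simp add: g_def)
  thus "ennreal (h K) <= (SUP n. g n K)" by (metis SUP_upper UNIV_I)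
  show "(SUP n. g n K) <= ennreal (h K)"
  using h0[of K] K by (intro SUP_least) (auto simp: g_def indicator_def)
  qed
 qed
 also have "... = (SUP n. \<integral>\<^sup>+K. g n K \<partial>count_space (Sigma_star L))"
 proof (rule nn_integral_monotone_convergence_SUP_AE)
  show "AE K in count_space (Sigma_star L). g n K <= g (Suc n) K" for n
  by (auto simp: AE_count_space g_def indicator_def h0 intro!: ennreal_leI)
 qed simp
 also have "... = ennreal l"
  by (rule LIMSEQ_unique[OF LIMSEQ_SUP[OF inc]]) (use tendsto_ennrealI[OF lim'] in \<open>simp add: gi\<close>)
 finally have "(\<integral>\<^sup>+K. ennreal (h K) \<partial>count_space (Sigma_star L)) = ennreal l" .
 hence "(LINT K|count_space (Sigma_star L). h K) = l"
  using l0 h0 by (subst integral_eq_nn_integral) (auto simp: AE_count_space)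
 thus ?thesis unfolding spectral_integral[OF L] by (simp add: h_def)
qed

context leray_flow
begin

lemma time_avg_U: "(!!t. t >= 0 ==> f t = g t) ==> time_avg T0 T1 f = time_avg T0 T1 g"
 unfolding time_avg_def using T0 by (intro arg_cong2[where f = "(/)"] set_lebesgue_integral_cong refl) auto

lemma time_avg_mult: "time_avg T0 T1 (%t. c * f t) = c * time_avg T0 T1 f"
 unfolding time_avg_def by simp

lemma time_avg_cong_AE:
 assumes [measurable]: "f : borel_measurable borel" "g : borel_measurable borel"
  and "AE t in lborel. T0 < t --> t < T1 --> f t = g t"
 shows "time_avg T0 T1 f = time_avg T0 T1 g"
proof -
 have "(LINT t:{T0..T1}|lborel. f t) = (LINT t:{T0..T1}|lborel. g t)"
  unfolding set_lebesgue_integral_def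
 proof (rule integral_cong_AE)
  show "AE t in lborel. indicator {T0..T1} t *\<^sub>R f t = indicator {T0..T1} t *\<^sub>R g t"
  using assms(3) AE_lborel_singleton[of T0] AE_lborel_singleton[of T1]
  by eventually_elim (auto simp: indicator_def)
 qed measurable
 thus ?thesis by (simp add: time_avg_def)
qed

lemma time_avg_mono_AE:
 assumes "set_integrable lborel {T0..T1} f" "set_integrable lborel {T0..T1} g"
  and "AE t in lborel. T0 < t --> t < T1 --> f t <= g t"
 shows "time_avg T0 T1 f <= time_avg T0 T1 g"
proof -
 have "(LINT t:{T0..T1}|lborel. f t) <= (LINT t:{T0..T1}|lborel. g t)"
  unfolding set_lebesgue_integral_def
 proof (rule integral_mono_AE)
  show "AE t in lborel. indicator {T0..T1} t *\<^sub>R f t <= indicator {T0..T1} t *\<^sub>R g t"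
  using assms(3) AE_lborel_singleton[of T0] AE_lborel_singleton[of T1]
  by eventually_elim (auto simp: indicator_def)
 qed (use assms in \<open>auto simp: set_integrable_def\<close>)
 thus ?thesis using T01 by (simp add: time_avg_def divide_right_mono)
qed

lemma time_avg_nonneg: "(!!t. f t >= 0) ==> time_avg T0 T1 f >= 0"
 unfolding time_avg_def set_lebesgue_integral_def using T01 by (intro divide_nonneg_nonneg integral_nonneg_AE AE_I2) auto

definition mode_energy :: "real^3 => real" where
 "mode_energy k = time_avg T0 T1 (%t. (norm (fourier L (U t) k))^2)"

lemma L1_sq_bound: "AE t in lborel. t >= 0 --> (norm (fourier L (U t) k))\<^sup>2 <= (L1_norm L (U t))^2 & (L1_norm L (U t))\<^sup>2 <= L ^ 3 * M^2"
 using AE_field AE_N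
proof eventually_elim
 case (elim t)
 show ?case
 proof (intro impI conjI)
  assume t: "t >= 0"
  hence s: "square_integrable L (U t)" using elim by simp
  show "(norm (fourier L (U t) k))^2 <= (L1_norm L (U t))^2"
  by (intro power_mono norm_fourier_le_L1 s) auto
  have "(L1_norm L (U t))^2 <= L ^ 3 * N t" using L1_norm_sq_le[OF L s] by (simp add: N_def)
  also have "... <= L ^ 3 * M^2" using elim t L by (intro mult_left_mono) auto
  finally show "(L1_norm L (U t))^2 <= L ^ 3 * M^2" .
 qed
qed

lemma L1_sq_integrable: "set_integrable lborel {T0..T1} (%t. (L1_norm L (U t))^2)"
proof (rule integrable_if_AE_bounded[OF _ _ T0])
 show "AE t in lborel. t >= 0 --> \<bar>(L1_norm L (U t))\<^sup>2\<bar> <= L ^ 3 * M^2"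
  using L1_sq_bound by eventually_elim auto
qed measurable

lemma fourier_integrable: "set_integrable lborel {T0..T1} (%t. (norm (fourier L (U t) k))^2)"
proof (rule integrable_if_AE_bounded[OF norm_fourier_measurable _ T0])
 show "AE t in lborel. t >= 0 --> \<bar>(norm (fourier L (U t) k))\<^sup>2\<bar> <= L ^ 3 * M^2"
  using L1_sq_bound[of k] by eventually_elim auto
qed

lemma mode_energy_nonneg: "mode_energy k >= 0"
 unfolding mode_energy_def by (rule time_avg_nonneg) simp

lemma mode_energy_zero: "mode_energy 0 = 0"
proof -
 have "mode_energy 0 = time_avg T0 T1 (%t. 0)"
  unfolding mode_energy_def
 proof (rule time_avg_cong_AE[OF norm_fourier_measurable])
  show "AE t in lborel. T0 < t --> t < T1 --> (norm (fourier L (U t) 0))\<^sup>2 = 0"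
  using AE_fourier_zero by eventually_elim auto
 qed simp
 thus ?thesis by (simp add: time_avg_def)
qed

lemma mode_energy_le: "mode_energy k <= time_avg T0 T1 (%t. (L1_norm L (U t))^2)"
 unfolding mode_energy_def
proof (rule time_avg_mono_AE[OF fourier_integrable L1_sq_integrable])
 show "AE t in lborel. T0 < t --> t < T1 --> (norm (fourier L (U t) k))\<^sup>2 <= (L1_norm L (U t))^2"
  using L1_sq_bound[of k] by eventually_elim (use T0 in auto)
qed

lemma time_avg_sum_modes:
 "time_avg T0 T1 (%t. SUM k:B. c k * (norm (fourier L (U t) k))^2) = (SUM k:B. c k * mode_energy k)"
proof -
 have "(LINT t:{T0..T1}|lborel. SUM k:B. c k * (norm (fourier L (U t) k))^2)
  = (SUM k:B. LINT t|lborel. c k * (indicator {T0..T1} t *\<^sub>R (norm (fourier L (U t) k))\<^sup>2))"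
  unfolding set_lebesgue_integral_def scaleR_sum_right
  using fourier_integrable unfolding set_integrable_def
  by (subst Bochner_Integration.integral_sum[symmetric]) (auto intro!: integrable_mult_right simp: mult.left_commute)
 thus ?thesis
  by (simp add: time_avg_def mode_energy_def set_lebesgue_integral_def sum_divide_distrib)
qed

text \<open>With nonnegative weights the partial sums increase to H, which therefore dominates
  them.\<close>

lemma mode_energy_limit:
 assumes c: "!!k. c k >= 0" and H: "set_integrable lborel {T0..T1} H"
  and lim: "AE t in lborel. t >= 0 --> (%n. SUM k:ball_modes L (real n). c k * (norm (fourier L (U t) k))^2) ~> H t"
 shows "(%n. SUM k:ball_modes L (real n). c k * mode_energy k) ~> time_avg T0 T1 H"
proof -
 define F where "F n t = (SUM k:ball_modes L (real n). c k * (norm (fourier L (U t) k))^2)" for n t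
 have Fm [measurable]: "F n : borel_measurable borel" for n unfolding F_def by measurable
 have inc: "incseq (%n. F n t)" for t
  unfolding F_def incseq_def
  by (intro allI impI sum_mono2) (use L c in \<open>auto simp: ball_modes_def intro: finite_ball_modes[OF L, unfolded ball_modes_def]\<close>)
 have F0: "F n t >= 0" for n t unfolding F_def by (intro sum_nonneg mult_nonneg_nonneg c) auto
 have "(%n. LINT t|lborel. indicator {T0..T1} t *\<^sub>R F n t) ~> (LINT t|lborel. indicator {T0..T1} t *\<^sub>R H t)"
 proof (rule integral_dominated_convergence[where w = "%t. indicator {T0..T1} t *\<^sub>R H t"])
  show "integrable lborel (%t. indicator {T0..T1} t *\<^sub>R H t)" using H by (simp add: set_integrable_def)
  thus "(%t. indicator {T0..T1} t *\<^sub>R H t) : borel_measurable lborel" by (rule borel_measurable_integrable)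
  show "AE t in lborel. (%n. indicator {T0..T1} t *\<^sub>R F n t) ~> indicator {T0..T1} t *\<^sub>R H t"
  using lim by eventually_elim (use T0 in \<open>auto simp: F_def indicator_def\<close>)
  show "AE t in lborel. norm (indicator {T0..T1} t *\<^sub>R F n t) <= indicator {T0..T1} t *\<^sub>R H t" for n
  using lim
  proof eventually_elim
  case (elim t)
  show ?case
  proof (cases "t : {T0..T1}")
  case True
  hence "(%n. F n t) ~> H t" using elim T0 by (simp add: F_def)
  hence "F n t <= H t" by (rule incseq_le[OF inc])
  thus ?thesis using True F0[of n t] by simp
  qed simp
  qed
 qed measurable
 hence "(%n. time_avg T0 T1 (F n)) ~> time_avg T0 T1 H"
  unfolding time_avg_def set_lebesgue_integral_def using T01 by (intro tendsto_divide tendsto_const) auto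
 thus ?thesis unfolding F_def time_avg_sum_modes .
qed

abbreviation S :: "real => real" where "S \<equiv> mean_spectrum L T0 T1 u"
abbreviation "mean_energy \<equiv> time_avg T0 T1 (energy L u)"
abbreviation "mean_diss \<equiv> time_avg T0 T1 (dissipation L \<nu> u)"

text \<open>The factor 1/K of the weight cancels the K in \<open>spectrum\<close>, and the powers of
  2 pi cancel, so that every mode counts with the same factor rho / L^3, whatever its shell.\<close>

lemma shell_weight_spectrum:
 assumes "K : Sigma_star L"
 shows "shell_weight L K * S K = rho L / L ^ 3 * (\<Sum>k | k : wave_vectors L & norm k = K. mode_energy k)"
proof -
 have K: "K > 0" using assms by (rule Sigma_star_pos)
 have "S K = time_avg T0 T1 (%t. (1 / (2 * pi)^2 * rho L * (K / L)) * (\<Sum>k | k : wave_vectors L & norm k = K. 1 * (norm (fourier L (U t) k))^2))"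
  unfolding mean_spectrum_def by (rule time_avg_U) (simp add: spectrum_def U_eq)
 also have "... = (1 / (2 * pi)^2 * rho L * (K / L)) * (\<Sum>k | k : wave_vectors L & norm k = K. 1 * mode_energy k)"
  unfolding time_avg_mult time_avg_sum_modes ..
 finally show ?thesis using K L by (simp add: shell_weight_def power2_eq_square power3_eq_cube)
qed

lemma S_nonneg: "K : Sigma_star L ==> S K >= 0"
proof -
 assume K: "K : Sigma_star L"
 have "shell_weight L K * S K >= 0"
  unfolding shell_weight_spectrum[OF K] using L by (intro mult_nonneg_nonneg sum_nonneg mode_energy_nonneg) (auto simp: rho_def)
 moreover have "shell_weight L K > 0" using Sigma_star_pos[OF K] L by (simp add: shell_weight_def)
 ultimately show ?thesis by (simp add: zero_le_mult_iff)
qed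

text \<open>Groups Parseval's sums over modes into sums over shells. The case c = 1 gives the energy
  and c = K^2 the enstrophy; \<open>mode_energy_zero\<close> is what allows the mode 0 to be left
  out.\<close>

lemma spectrum_limit:
 assumes c: "!!K. c K >= 0" and H: "set_integrable lborel {T0..T1} H"
  and lim: "AE t in lborel. t >= 0 --> (%n. SUM k:ball_modes L (real n). c (norm k) * (norm (fourier L (U t) k))^2) ~> L ^ 3 * H t"
 shows "(%n. SUM K:(shells L n). shell_weight L K * (c K * S K)) ~> rho L * time_avg T0 T1 H"
proof -
 have "(%n. rho L / L ^ 3 * (SUM k:ball_modes L (real n). c (norm k) * mode_energy k)) ~> rho L / L ^ 3 * time_avg T0 T1 (%t. L ^ 3 * H t)"
  by (intro tendsto_mult tendsto_const mode_energy_limit set_integrable_mult_right H lim) (use c in auto)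
 moreover have "rho L / L ^ 3 * time_avg T0 T1 (%t. L ^ 3 * H t) = rho L * time_avg T0 T1 H"
  unfolding time_avg_mult using L by simp
 moreover have "rho L / L ^ 3 * (SUM k:ball_modes L R. c (norm k) * mode_energy k) = (SUM K:{K : Sigma_star L. K <= R}. shell_weight L K * (c K * S K))" for R
  unfolding sum_over_norms[where f = mode_energy, OF L mode_energy_zero]
 proof (subst sum_distrib_left, rule sum.cong[OF refl])
  fix K assume "K : {K : Sigma_star L. K <= R}"
  thus "rho L / L ^ 3 * (c K * (\<Sum>k | k : wave_vectors L & norm k = K. mode_energy k)) = shell_weight L K * (c K * S K)"
  using shell_weight_spectrum[of K] by (simp add: mult.left_commute[of _ "c K"])
 qed
 ultimately show ?thesis by simp
qed

lemma mean_energy_eq: "mean_energy = rho L * time_avg T0 T1 N"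
proof -
 have "mean_energy = time_avg T0 T1 (%t. rho L * N t)"
  by (rule time_avg_U) (simp add: energy_def N_def U_eq)
 thus ?thesis by (simp only: time_avg_mult)
qed

lemma mean_diss_eq: "mean_diss = 2 * \<nu> * (rho L * time_avg T0 T1 E)"
proof -
 have "mean_diss = time_avg T0 T1 (%t. (2 * rho L * \<nu>) * E t)"
  by (rule time_avg_U) (simp add: dissipation_def E_def U_eq)
 thus ?thesis by (simp add: time_avg_mult)
qed

lemma energy_spectrum_limit:
 "(%n. SUM K:(shells L n). shell_weight L K * S K) ~> mean_energy"
proof -
 have "(%n. SUM K:(shells L n). shell_weight L K * (1 * S K)) ~> rho L * time_avg T0 T1 N"
 proof (rule spectrum_limit[where c = "%_. 1" and H = N, OF _ N_integrable[OF T0]])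
  show "AE t in lborel. t >= 0 --> (%n. SUM k:ball_modes L (real n). 1 * (norm (fourier L (U t) k))^2) ~> L ^ 3 * N t"
  using AE_field by eventually_elim (use parseval_field[OF L] in \<open>auto simp: N_def\<close>)
 qed simp
 thus ?thesis by (simp add: mean_energy_eq)
qed

lemma enstrophy_spectrum_limit:
 "(%n. SUM K:(shells L n). shell_weight L K * (K^2 * S K)) ~> mean_diss / (2 * \<nu>)"
proof -
 have "(%n. SUM K:(shells L n). shell_weight L K * (K^2 * S K)) ~> rho L * time_avg T0 T1 E"
 proof (rule spectrum_limit[where c = "%K. K^2" and H = E, OF _ E_integrable[OF T0]])
  show "AE t in lborel. t >= 0 --> (%n. SUM k:ball_modes L (real n). (norm k)^2 * (norm (fourier L (U t) k))^2) ~> L ^ 3 * E t"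
  using AE_grad by eventually_elim (use weak_grad_spectral[OF L Ut_torus] in \<open>auto simp: E_def\<close>)
 qed simp
 thus ?thesis using nu by (simp add: mean_diss_eq)
qed

lemma enstrophy_UNIV: "enstrophy_on L T0 T1 u UNIV = mean_diss / (2 * \<nu>)"
 unfolding enstrophy_on_def
 by (rule spectral_integral_UNIV[OF L _ enstrophy_spectrum_limit]) (auto intro!: mult_nonneg_nonneg S_nonneg)

lemma enstrophy_interval:
 "enstrophy_on L T0 T1 u {a..b} = (SUM K:Sigma_star L \<inter> {a..b}. shell_weight L K * (K^2 * S K))"
 unfolding enstrophy_on_def by (rule spectral_integral_interval[OF L])

lemma energy_inequality: "AE t in lborel. t > T0 --> energy L u t <= energy L u T0 - (LINT \<tau>:{T0..t}|lborel. dissipation L \<nu> u \<tau>)"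
 using sol unfolding leray_solution_def Let_def by blast

lemma diss_integral: "(LINT \<tau>:{T0..t}|lborel. dissipation L \<nu> u \<tau>) = 2 * rho L * \<nu> * (LINT \<tau>:{T0..t}|lborel. E \<tau>)"
proof -
 have "(LINT \<tau>:{T0..t}|lborel. dissipation L \<nu> u \<tau>) = (LINT \<tau>:{T0..t}|lborel. (2 * rho L * \<nu>) * E \<tau>)"
  by (rule set_lebesgue_integral_cong) (use T0 in \<open>auto simp: dissipation_def E_def U_eq\<close>)
 thus ?thesis by simp
qed

lemma rho_pos: "rho L > 0" using L by (simp add: rho_def)

lemma energy_nonneg: "energy L u t >= 0" using rho_pos by (simp add: energy_def)

lemma E_integral_nonneg: "(LINT \<tau>:{T0..t}|lborel. E \<tau>) >= 0"
 unfolding set_lebesgue_integral_def by (intro integral_nonneg_AE AE_I2) (simp add: E_nonneg)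

lemma mean_energy_le: "mean_energy <= energy L u T0"
proof -
 have "time_avg T0 T1 (%t. rho L * N t) <= time_avg T0 T1 (%t. energy L u T0)"
 proof (rule time_avg_mono_AE)
  show "set_integrable lborel {T0..T1} (%t. rho L * N t)" by (intro set_integrable_mult_right N_integrable T0)
  show "set_integrable lborel {T0..T1} (%t. energy L u T0)" by (intro borel_integrable_atLeastAtMost') auto
  show "AE t in lborel. T0 < t --> t < T1 --> rho L * N t <= energy L u T0"
  using energy_inequality
  proof eventually_elim
  case (elim t)
  have "0 <= 2 * rho L * \<nu> * (LINT \<tau>:{T0..t}|lborel. E \<tau>)" using rho_pos nu E_integral_nonneg[of t] by simp
  moreover have "rho L * N t = energy L u t" if "T0 < t" using that T0 by (simp add: energy_def N_def U_eq)
  ultimately show ?case using elim unfolding diss_integral by linarith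
  qed
 qed
 also have "time_avg T0 T1 (%t. energy L u T0) = energy L u T0"
  using T01 by (simp add: time_avg_def set_lebesgue_integral_def)
 finally show ?thesis by (simp add: mean_energy_eq time_avg_mult)
qed

lemma mean_diss_le: "(T1 - T0) * mean_diss <= energy L u T0"
proof -
 \<comment> \<open>The energy inequality holds at almost every time, perhaps not at T1 itself. A
   slightly later time serves, since the dissipated energy only grows and the remaining energy is
   nonnegative.\<close>
 obtain t where t: "T1 < t" "t < T1 + 1" "t > T0 --> energy L u t <= energy L u T0 - (LINT \<tau>:{T0..t}|lborel. dissipation L \<nu> u \<tau>)"
  by (rule AE_lborel_ex[OF energy_inequality, of T1 "T1 + 1"]) auto
 have "(LINT \<tau>:{T0..T1}|lborel. E \<tau>) <= (LINT \<tau>:{T0..t}|lborel. E \<tau>)"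
  unfolding set_lebesgue_integral_def
  using E_integrable[OF T0, of T1] E_integrable[OF T0, of t] t(1) unfolding set_integrable_def
  by (intro integral_mono) (auto simp: indicator_def E_nonneg)
 hence "2 * rho L * \<nu> * (LINT \<tau>:{T0..T1}|lborel. E \<tau>) <= 2 * rho L * \<nu> * (LINT \<tau>:{T0..t}|lborel. E \<tau>)"
  using rho_pos nu by (intro mult_left_mono) auto
 moreover have "(T1 - T0) * mean_diss = 2 * rho L * \<nu> * (LINT \<tau>:{T0..T1}|lborel. E \<tau>)"
  unfolding mean_diss_eq unfolding time_avg_def using T01 by simp
 ultimately show ?thesis using t T01 energy_nonneg[of t] by (simp add: diss_integral)
qed

text \<open>For divergence-free fields the squared norm of the vorticity is twice that of the
  gradient, and \<open>dissipation\<close> carries the same factor 2 together with \<nu> and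
  \<open>rho L\<close>.\<close>

lemma vorticity_integral:
 "(LINT t:{T0..T1}|lborel. (L2_norm L (vorticity L (u t)))^2) = (T1 - T0) * mean_diss / (\<nu> * rho L)"
proof -
 have "time_avg T0 T1 (%t. (L2_norm L (vorticity L (u t)))^2) = time_avg T0 T1 (%t. (L2_norm L (vorticity L (U t)))^2)"
  by (rule time_avg_U) (simp add: U_eq)
 also have "... = time_avg T0 T1 (%t. 2 * E t)"
 proof (rule time_avg_cong_AE[OF vorticity_norm_measurable])
  show "AE t in lborel. T0 < t --> t < T1 --> (L2_norm L (vorticity L (U t)))\<^sup>2 = 2 * E t"
  using AE_vorticity by eventually_elim auto
 qed measurable
 finally have "(LINT t:{T0..T1}|lborel. (L2_norm L (vorticity L (u t)))^2) = (T1 - T0) * (2 * time_avg T0 T1 E)"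
  unfolding time_avg_mult using T01 by (simp add: time_avg_def[of _ _ "%t. (L2_norm L (vorticity L (u t)))^2"] field_simps)
 thus ?thesis using nu rho_pos by (simp add: mean_diss_eq)
qed

lemma time_scale_eq:
 "time_scale L \<nu> T0 T1 u Kp = (K41_alpha L \<nu> T0 T1 u Kp) ^ 3 * \<nu> * (T1 - T0) * mean_diss / (energy L u T0)^2"
proof -
 have "(energy L u T0)^2 = (rho L)^2 * (L2_norm L (u T0)) ^ 4" by (simp add: energy_def power_mult_distrib flip: power_mult)
 thus ?thesis
  unfolding time_scale_def vorticity_integral using nu rho_pos
  by (simp add: power2_eq_square)
qed

text \<open>Each Fourier coefficient is bounded by the L1 norm, and \<open>Vol\<close> is the ratio
  that converts the mean squared L1 norm into mean energy.\<close>

lemma low_mode_bound: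
 assumes K: "K : Sigma_star L" and pos: "mean_energy > 0"
 shows "shell_weight L K * S K <= real (card {k : wave_vectors L. norm k = K}) * (Vol L T0 T1 u / L ^ 3) * mean_energy"
proof -
 define V where "V = time_avg T0 T1 (%t. (L1_norm L (U t))^2)"
 have "Vol L T0 T1 u = V / time_avg T0 T1 N"
  unfolding Vol_def V_def by (intro arg_cong2[where f = "(/)"] time_avg_U) (auto simp: N_def U_eq)
 moreover have "time_avg T0 T1 N > 0" using pos rho_pos by (simp add: mean_energy_eq zero_less_mult_iff)
 ultimately have V: "V = Vol L T0 T1 u * time_avg T0 T1 N" by simp
 have "(\<Sum>k | k : wave_vectors L & norm k = K. mode_energy k) <= real (card {k : wave_vectors L. norm k = K}) * V"
  using sum_bounded_above[of "{k. k : wave_vectors L & norm k = K}" mode_energy V] mode_energy_le by (simp add: V_def)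
 hence "rho L / L ^ 3 * (\<Sum>k | k : wave_vectors L & norm k = K. mode_energy k) <= rho L / L ^ 3 * (real (card {k : wave_vectors L. norm k = K}) * V)"
  using rho_pos L by (intro mult_left_mono) auto
 thus ?thesis unfolding shell_weight_spectrum[OF K] V mean_energy_eq by (simp add: mult_ac)
qed

end

section \<open>Sums over the norms of lattice vectors\<close>

definition three_square_sums :: "nat set" where
 "three_square_sums = {n. n >= 1 & (EX z::int^3. int n = (SUM i:UNIV. (z $ i)^2))}"

lemma three_square_sums_mod_4:
 assumes "n mod 4 = 1 \<or> n mod 4 = 2" shows "n : three_square_sums"
proof -
 obtain x y z :: int where "int n = x^2 + y^2 + z^2" using three_squares[OF assms] by blast
 hence "int n = (SUM i:UNIV. ((\<chi> i::3. if i = 1 then x else if i = 2 then y else z) $ i)^2)"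
  by (simp add: sum_3)
 moreover have "n >= 1" using assms by (cases n) auto
 ultimately show ?thesis unfolding three_square_sums_def by blast
qed

lemma Sigma_star_eq:
 assumes L: "L > 0" shows "Sigma_star L = (%n. 2 * pi / L * sqrt (real n)) ` three_square_sums"
proof (intro equalityI subsetI)
 fix K assume "K : Sigma_star L"
 then obtain z where z: "K = norm (wave L z)" "K ~= 0"
  using wave_vectors_eq[OF L] by (auto simp: Sigma_star_def Sigma_set_def)
 define n where "n = nat (SUM i:UNIV. (z $ i)^2)"
 have n: "int n = (SUM i:UNIV. (z $ i)^2)" by (simp add: n_def sum_nonneg)
 have K: "K = 2 * pi / L * sqrt (real n)"
  unfolding z(1) norm_wave[OF L] n[symmetric] by simp
 hence "n ~= 0" using z(2) by auto
 hence "n : three_square_sums" using n by (auto simp: three_square_sums_def)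
 thus "K : (%n. 2 * pi / L * sqrt (real n)) ` three_square_sums" using K by blast
next
 fix K assume "K : (%n. 2 * pi / L * sqrt (real n)) ` three_square_sums"
 then obtain n z where n: "K = 2 * pi / L * sqrt (real n)" "n >= 1" "int n = (SUM i:UNIV. ((z :: int^3) $ i)^2)"
  by (auto simp: three_square_sums_def)
 have "K = norm (wave L z)" unfolding norm_wave[OF L] n(3)[symmetric] by (simp add: n(1))
 moreover have "K ~= 0" using n(1,2) L by simp
 ultimately show "K : Sigma_star L" using wave_vectors_eq[OF L] by (auto simp: Sigma_star_def Sigma_set_def)
qed

text \<open>Mean value theorem for z powr (2/3), whose derivative is monotone: this compares sums of
  z powr (-1/3) with an integral.\<close>

lemma powr_two_thirds_bounds:
 fixes x y :: real assumes "0 < x" "x < y"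
 shows "(y - x) * y powr (-1/3) <= 3/2 * (y powr (2/3) - x powr (2/3))"
  "3/2 * (y powr (2/3) - x powr (2/3)) <= (y - x) * x powr (-1/3)"
proof -
 have "EX z. x < z & z < y & y powr (2/3) - x powr (2/3) = (y - x) * (2/3 * z powr (-1/3))"
  by (rule MVT2[OF assms(2)]) (use assms in \<open>auto intro!: derivative_eq_intros simp: powr_diff\<close>)
 then obtain z where z: "x < z" "z < y" "y powr (2/3) - x powr (2/3) = (y - x) * (2/3 * z powr (-1/3))" by blast
 have "y powr (-1/3) <= z powr (-1/3)" "z powr (-1/3) <= x powr (-1/3)"
  using z assms by (auto intro!: powr_mono2')
 thus "(y - x) * y powr (-1/3) <= 3/2 * (y powr (2/3) - x powr (2/3))"
  "3/2 * (y powr (2/3) - x powr (2/3)) <= (y - x) * x powr (-1/3)"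
  unfolding z(3) using assms by (auto intro: mult_left_mono)
qed

lemma powr_minus_third_bounds:
 fixes x y :: real assumes "0 < x" "x < y"
 shows "(y - x) * y powr (-4/3) <= 3 * (x powr (-1/3) - y powr (-1/3))"
  "3 * (x powr (-1/3) - y powr (-1/3)) <= (y - x) * x powr (-4/3)"
proof -
 have "EX z. x < z & z < y & y powr (-1/3) - x powr (-1/3) = (y - x) * (-1/3 * z powr (-4/3))"
  by (rule MVT2[OF assms(2)]) (use assms in \<open>auto intro!: derivative_eq_intros simp: powr_diff\<close>)
 then obtain z where z: "x < z" "z < y" "y powr (-1/3) - x powr (-1/3) = (y - x) * (-1/3 * z powr (-4/3))" by blast
 have e: "3 * (x powr (-1/3) - y powr (-1/3)) = (y - x) * z powr (-4/3)"
 proof -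
  have "3 * (x powr (-1/3) - y powr (-1/3)) = - 3 * (y powr (-1/3) - x powr (-1/3))" by simp
  also have "... = (y - x) * z powr (-4/3)" unfolding z(3) by simp
  finally show ?thesis .
 qed
 have "y powr (-4/3) <= z powr (-4/3)" "z powr (-4/3) <= x powr (-4/3)"
  using z assms by (auto intro!: powr_mono2')
 thus "(y - x) * y powr (-4/3) <= 3 * (x powr (-1/3) - y powr (-1/3))"
  "3 * (x powr (-1/3) - y powr (-1/3)) <= (y - x) * x powr (-4/3)"
  unfolding e using assms by (auto intro: mult_left_mono)
qed

lemma sum_powr_minus_third_le: "(SUM n:{1..N}. real n powr (-1/3)) <= 3/2 * real N powr (2/3)"
proof (induction N)
 case (Suc N)
 have "real (Suc N) powr (-1/3) <= 3/2 * (real (Suc N) powr (2/3) - real N powr (2/3))"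
  using powr_two_thirds_bounds(1)[of "real N" "real (Suc N)"] by (cases "N = 0") auto
 thus ?case using Suc.IH by simp
qed simp

lemma sum_powr_minus_four_thirds_le:
 assumes "1 <= m" shows "(SUM n:{m..N}. real n powr (-4/3)) <= real m powr (-4/3) + 3 * real m powr (-1/3)"
proof -
 have "(SUM n:{m..m + k}. real n powr (-4/3)) <= real m powr (-4/3) + 3 * (real m powr (-1/3) - real (m + k) powr (-1/3))" for k
 proof (induction k)
  case (Suc k)
  have "real (Suc (m + k)) powr (-4/3) <= 3 * (real (m + k) powr (-1/3) - real (Suc (m + k)) powr (-1/3))"
  using powr_minus_third_bounds(1)[of "real (m + k)" "real (Suc (m + k))"] assms by simp
  moreover have "(SUM n:{m..m + Suc k}. real n powr (-4/3)) = (SUM n:{m..m + k}. real n powr (-4/3)) + real (Suc (m + k)) powr (-4/3)"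
  by (simp add: sum.cl_ivl_Suc)
  ultimately show ?case using Suc.IH by simp
 qed simp
 from this[of "N - m"] show ?thesis
 proof (cases "m <= N")
  case True
  have "(SUM n:{m..N}. real n powr (-4/3)) <= real m powr (-4/3) + 3 * (real m powr (-1/3) - real N powr (-1/3))"
  using \<open>!!k. (SUM n:{m..m + k}. real n powr (-4/3)) <= _ k\<close>[of "N - m"] True by simp
  also have "... <= real m powr (-4/3) + 3 * real m powr (-1/3)" by simp
  finally show ?thesis .
 qed simp
qed

text \<open>Only the residues 1 and 2 modulo 4 are used below: pairs \<open>4 j + 1\<close>, \<open>4 j + 2\<close>.\<close>

lemma sum_pairs_le:
 fixes f :: "nat => real"
 assumes f: "!!n. f n >= 0" and sub: "!!j. a <= j ==> j < b ==> 4 * j + 1 : X & 4 * j + 2 : X" and X: "finite X"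
 shows "(SUM j:{a..<b}. f (4 * j + 1) + f (4 * j + 2)) <= sum f X"
proof -
 let ?A = "(%j. 4 * j + 1) ` {a..<b}" and ?B = "(%j. 4 * j + 2) ` {a..<b}"
 have "(SUM j:{a..<b}. f (4 * j + 1) + f (4 * j + 2)) = sum f ?A + sum f ?B"
  unfolding sum.distrib by (subst (1 2) sum.reindex) (auto simp: inj_on_def)
 also have "... = sum f (?A \<union> ?B)"
  by (rule sum.union_disjoint[symmetric]) (auto, presburger)
 also have "... <= sum f X" using sub f X by (intro sum_mono2) auto
 finally show ?thesis .
qed

text \<open>Each block of four integers contributes two terms, half of the full sum, so the factor
  3/2 of the integral becomes 3/4. The shift by 4 is the price of rounding to whole blocks.\<close>

lemma sum_minus_third_ge:
 assumes m: "1 <= m" "m <= N"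
 shows "3/4 * (real N powr (2/3) - (real m + 4) powr (2/3)) <= (SUM n:three_square_sums \<inter> {m..N}. real n powr (-1/3))"
proof -
 \<comment> \<open>The rounding is such that the first pair starts at m or later and the last one
   ends at N or earlier.\<close>
 define a b where "a = (m + 2) div 4" and "b = (N + 2) div 4"
 have ab: "a <= b" using m unfolding a_def b_def by (intro div_le_mono) auto
 define f where "f j = (real (4 * j + 2)) powr (2/3)" for j
 have "3/4 * (f b - f a) = (SUM j:{a..<b}. 3/4 * (f (Suc j) - f j))"
  unfolding sum_distrib_left[symmetric] sum_Suc_diff'[OF ab] ..
 also have "... <= (SUM j:{a..<b}. real (4 * j + 1) powr (-1/3) + real (4 * j + 2) powr (-1/3))"
 proof (rule sum_mono)
  fix j
  have "3/2 * (f (Suc j) - f j) <= 4 * real (4 * j + 2) powr (-1/3)"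
  using powr_two_thirds_bounds(2)[of "real (4 * j + 2)" "real (4 * Suc j + 2)"] by (simp add: f_def)
  moreover have "real (4 * j + 2) powr (-1/3) <= real (4 * j + 1) powr (-1/3)" by (intro powr_mono2') auto
  ultimately show "3/4 * (f (Suc j) - f j) <= real (4 * j + 1) powr (-1/3) + real (4 * j + 2) powr (-1/3)" by simp
 qed
 also have "... <= (SUM n:three_square_sums \<inter> {m..N}. real n powr (-1/3))"
 proof (rule sum_pairs_le)
  fix j assume j: "a <= j" "j < b"
  hence "m <= 4 * j + 1" "4 * j + 2 <= N" unfolding a_def b_def by linarith+
  thus "4 * j + 1 : three_square_sums \<inter> {m..N} & 4 * j + 2 : three_square_sums \<inter> {m..N}"
  by (auto intro!: three_square_sums_mod_4) presburger+
 qed auto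
 finally have "3/4 * (f b - f a) <= (SUM n:three_square_sums \<inter> {m..N}. real n powr (-1/3))" .
 moreover have "real N powr (2/3) <= f b"
 proof -
  have "N <= 4 * b + 2" unfolding b_def by linarith
  thus ?thesis unfolding f_def by (intro powr_mono2) auto
 qed
 moreover have "f a <= (real m + 4) powr (2/3)"
 proof -
  have "4 * a + 2 <= m + 4" unfolding a_def by linarith
  hence "real (4 * a + 2) <= real m + 4" by linarith
  thus ?thesis unfolding f_def by (intro powr_mono2) auto
 qed
 ultimately show ?thesis by simp
qed

text \<open>The term n = m is kept exactly: for small m it is a sizeable part of the sum, and the
  telescoped bound alone would be too small for \<open>b_lower\<close>.\<close>

lemma sum_minus_four_thirds_ge:
 assumes m: "m : three_square_sums" "m <= N"
 shows "real m powr (-4/3) + 3/2 * ((real m + 5) powr (-1/3) - real N powr (-1/3))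
  <= (SUM n:three_square_sums \<inter> {m..N}. real n powr (-4/3))"
proof -
 have m1: "m >= 1" using m by (simp add: three_square_sums_def)
 define a b where "a = (m + 3) div 4" and "b = (N + 2) div 4"
 define X where "X = three_square_sums \<inter> {m<..N}"
 have "3/2 * ((real m + 5) powr (-1/3) - real N powr (-1/3)) <= (SUM n:X. real n powr (-4/3))"
 proof (cases "a <= b")
  case ab: True
  define f where "f j = (real (4 * j + 2)) powr (-1/3)" for j
  have "3/2 * (f a - f b) = (SUM j:{a..<b}. - (3/2) * (f (Suc j) - f j))"
  unfolding sum_distrib_left[symmetric] sum_Suc_diff'[OF ab] by (simp only: mult_minus_left mult_minus_right[symmetric] minus_diff_eq)
  also have "... <= (SUM j:{a..<b}. real (4 * j + 1) powr (-4/3) + real (4 * j + 2) powr (-4/3))"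
  proof (rule sum_mono)
  fix j
  have "3 * (f j - f (Suc j)) <= 4 * real (4 * j + 2) powr (-4/3)"
  using powr_minus_third_bounds(2)[of "real (4 * j + 2)" "real (4 * Suc j + 2)"] by (simp add: f_def)
  moreover have "real (4 * j + 2) powr (-4/3) <= real (4 * j + 1) powr (-4/3)" by (intro powr_mono2') auto
  moreover have "- (3/2) * (f (Suc j) - f j) = 1/2 * (3 * (f j - f (Suc j)))" by (simp add: field_simps)
  ultimately show "- (3/2) * (f (Suc j) - f j) <= real (4 * j + 1) powr (-4/3) + real (4 * j + 2) powr (-4/3)" by linarith
  qed
  also have "... <= (SUM n:X. real n powr (-4/3))"
  proof (rule sum_pairs_le)
  fix j assume j: "a <= j" "j < b"
  hence "m < 4 * j + 1" "4 * j + 2 <= N" unfolding a_def b_def by linarith+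
  thus "4 * j + 1 : X & 4 * j + 2 : X"
  unfolding X_def by (auto intro!: three_square_sums_mod_4) presburger+
  qed (auto simp: X_def)
  finally have "3/2 * (f a - f b) <= (SUM n:X. real n powr (-4/3))" .
  moreover have "f b <= real N powr (-1/3)"
  proof -
  have "N <= 4 * b + 2" unfolding b_def by linarith
  thus ?thesis unfolding f_def using m1 m(2) by (intro powr_mono2') auto
  qed
  moreover have "(real m + 5) powr (-1/3) <= f a"
  proof -
  have "4 * a + 2 <= m + 5" unfolding a_def by linarith
  hence "real (4 * a + 2) <= real m + 5" by linarith
  thus ?thesis unfolding f_def by (intro powr_mono2') auto
  qed
  ultimately show ?thesis by simp
 next
  case False
  hence "N <= m" unfolding a_def b_def by linarith
  hence "(real m + 5) powr (-1/3) <= real N powr (-1/3)" using m1 m(2) by (intro powr_mono2') auto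
  moreover have "(SUM n:X. real n powr (-4/3)) >= 0" by (intro sum_nonneg) auto
  ultimately show ?thesis by simp
 qed
 moreover have "three_square_sums \<inter> {m..N} = insert m X" using m by (auto simp: X_def)
 ultimately show ?thesis by (simp add: X_def)
qed

text \<open>A crude bound that also covers intervals too short for whole blocks; there the last
  term, at N itself, is enough.\<close>

lemma sum_minus_third_ge_length:
 assumes m: "1 <= m" "m <= N" and N: "N : three_square_sums"
 shows "(real N - real m) / (8 * real N) <= (SUM n:three_square_sums \<inter> {m..N}. real n powr (-1/3))"
proof (cases "N - m < 8")
 case True
 have "(real N - real m) / (8 * real N) <= 1 / real N"
  using True m by (simp add: divide_le_eq)
 also have "... <= real N powr (-1/3)"
  using m powr_mono[of "-1" "-1/3" "real N"] by (simp add: powr_minus_divide)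
 also have "... <= (SUM n:three_square_sums \<inter> {m..N}. real n powr (-1/3))"
  using N m by (intro member_le_sum) auto
 finally show ?thesis .
next
 case False
 define a b where "a = (m + 2) div 4" and "b = (N + 2) div 4"
 have ab: "a <= b" using m unfolding a_def b_def by (intro div_le_mono) auto
 have l: "real N - real m <= 8 * (real b - real a)"
 proof -
  have "N <= m + 8 * (b - a)" using False m unfolding a_def b_def by linarith
  thus ?thesis using ab by (simp add: of_nat_diff)
 qed
 have "(real N - real m) / (8 * real N) <= (real b - real a) * (1 / real N)"
 proof -
  have "(real N - real m) / (8 * real N) <= (8 * (real b - real a)) / (8 * real N)" using l by (intro divide_right_mono) auto
  also have "... = (real b - real a) / real N" by (rule mult_divide_mult_cancel_left) simp
  finally show ?thesis by simp
 qed
 also have "... <= (SUM j:{a..<b}. real (4 * j + 1) powr (-1/3) + real (4 * j + 2) powr (-1/3))"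
 proof -
  have "(SUM j:{a..<b}. 1 / real N) <= (SUM j:{a..<b}. real (4 * j + 1) powr (-1/3) + real (4 * j + 2) powr (-1/3))"
  proof (rule sum_mono)
  fix j assume j: "j : {a..<b}"
  hence "4 * j + 2 <= N" unfolding b_def by auto
  hence "real N powr (-1/3) <= real (4 * j + 2) powr (-1/3)" by (intro powr_mono2') auto
  moreover have "1 / real N <= real N powr (-1/3)"
  using m powr_mono[of "-1" "-1/3" "real N"] by (simp add: powr_minus_divide)
  moreover have "0 <= real (4 * j + 1) powr (-1/3)" by simp
  ultimately show "1 / real N <= real (4 * j + 1) powr (-1/3) + real (4 * j + 2) powr (-1/3)" by linarith
  qed
  thus ?thesis using ab by (simp add: of_nat_diff)
 qed
 also have "... <= (SUM n:three_square_sums \<inter> {m..N}. real n powr (-1/3))"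
 proof (rule sum_pairs_le)
  fix j assume j: "a <= j" "j < b"
  hence "m <= 4 * j + 1" "4 * j + 2 <= N" unfolding a_def b_def by linarith+
  thus "4 * j + 1 : three_square_sums \<inter> {m..N} & 4 * j + 2 : three_square_sums \<inter> {m..N}"
  by (auto intro!: three_square_sums_mod_4) presburger+
 qed auto
 finally show ?thesis .
qed

lemma cube_root_ge: "0 <= c ==> c ^ 3 <= y ==> c <= y powr (1/3)" for c y :: real
proof (cases "c = 0")
 case False
 assume c: "0 <= c" "c ^ 3 <= y"
 hence "y > 0" using False by (smt (verit) zero_less_power)
 have "c = root 3 (c ^ 3)" using c by (simp add: real_root_power_cancel)
 also have "... <= root 3 y" using c by simp
 also have "... = y powr (1/3)" using root_powr_inverse[of 3 y] \<open>y > 0\<close> by simp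
 finally show ?thesis .
qed simp

text \<open>Fractional powers become integer powers of the cube root, so that the later estimates
  reduce to algebra with polynomials.\<close>

lemma cube_powr:
 fixes z :: real assumes "z > 0"
 defines "r \<equiv> z powr (1/3)"
 shows "r > 0" "r ^ 3 = z" "z powr (2/3) = r^2" "z powr (-1/3) = 1 / r" "z powr (-2/3) = 1 / r^2"
  "z powr (-4/3) = 1 / r ^ 4" "z powr (4/3) = r ^ 4"
proof -
 show r: "r > 0" using assms by simp
 have p: "z powr (of_nat n / 3) = r ^ n" for n
  using assms by (simp add: r_def powr_power)
 show "r ^ 3 = z" "z powr (2/3) = r^2" "z powr (4/3) = r ^ 4"
  using p[of 3] p[of 2] p[of 4] assms by simp_all
 have m: "z powr (- (of_nat n / 3)) = 1 / r ^ n" for n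
  unfolding powr_minus p by (simp add: inverse_eq_divide)
 show "z powr (-1/3) = 1 / r" "z powr (-2/3) = 1 / r^2" "z powr (-4/3) = 1 / r ^ 4"
  using m[of 1] m[of 2] m[of 4] by simp_all
qed

text \<open>The integer vectors lie in a cube with at most 2 sqrt m + 1 <= 3 sqrt m points on a
  side, whence 27.\<close>

lemma card_ball_modes_le:
 assumes L: "L > 0" and R: "R = 2 * pi / L * sqrt (real m)" and m: "m >= 1"
 shows "real (card (ball_modes L R)) <= 27 * sqrt (real m) ^ 3"
proof -
 define N where "N = \<lfloor>sqrt (real m)\<rfloor>"
 have N0: "N >= 0" by (simp add: N_def)
 have "ball_modes L R <= (%g. wave L (\<chi> j. g j)) ` (PiE UNIV (%_. {- N..N}))"
 proof
  fix k assume k: "k : ball_modes L R"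
  then obtain z where z: "k = wave L z" using wave_vectors_eq[OF L] by (auto simp: ball_modes_def)
  have "- N <= z $ i & z $ i <= N" for i
  proof -
  have "\<bar>k $ i\<bar> <= R" using k component_le_norm_cart[of k i] by (auto simp: ball_modes_def)
  hence "2 * pi / L * \<bar>of_int (z $ i)\<bar> <= 2 * pi / L * sqrt (real m)"
  using L by (simp add: z wave_def abs_mult R)
  hence "\<bar>of_int (z $ i)\<bar> <= sqrt (real m)" using L by (subst (asm) mult_le_cancel_left_pos) auto
  hence "of_int \<bar>z $ i\<bar> <= sqrt (real m)" by simp
  hence "\<bar>z $ i\<bar> <= N" unfolding N_def by (simp only: le_floor_iff)
  thus ?thesis by linarith
  qed
  hence "(%i. z $ i) : PiE UNIV (%_. {- N..N})" by (auto simp: PiE_UNIV_domain)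
  moreover have "k = wave L (\<chi> j. z $ j)" using z by simp
  ultimately show "k : (%g. wave L (\<chi> j. g j)) ` (PiE UNIV (%_. {- N..N}))" by blast
 qed
 hence "card (ball_modes L R) <= card ((%g. wave L (\<chi> j. g j)) ` (PiE (UNIV :: 3 set) (%_. {- N..N})))"
  by (intro card_mono finite_imageI finite_PiE) auto
 also have "... <= card (PiE (UNIV :: 3 set) (%_. {- N..N}))"
  by (intro card_image_le finite_PiE) auto
 also have "... = nat (2 * N + 1) ^ 3" by (subst card_PiE) auto
 finally have "real (card (ball_modes L R)) <= real (nat (2 * N + 1) ^ 3)" by (rule of_nat_mono)
 also have "... = (2 * of_int N + 1) ^ 3" using N0 by simp
 also have "... <= (3 * sqrt (real m)) ^ 3"
 proof (rule power_mono)
  have "of_int N <= sqrt (real m)" "1 <= sqrt (real m)" using m by (auto simp: N_def)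
  thus "2 * of_int N + 1 <= 3 * sqrt (real m)" by linarith
 qed (use N0 in simp)
 finally show ?thesis by (simp add: power_mult_distrib)
qed

lemma cancel_common_factor:
 fixes g al X a Y Z N :: real
 assumes "Y ~= 0"
 shows "3 * (g * (Y * al * X * a)) / (Y * Z * N) = g * al * X / Z * (3 * a / N)"
proof -
 have "3 * (g * (Y * al * X * a)) / (Y * Z * N) = (Y * (3 * (g * (al * (X * a))))) / (Y * (Z * N))"
  by (simp only: mult_ac)
 also have "... = 3 * (g * (al * (X * a))) / (Z * N)"
  using assms by (rule mult_divide_mult_cancel_left)
 also have "... = g * al * X / Z * (3 * a / N)" by (simp only: times_divide_times_eq mult_ac)
 finally show ?thesis .
qed

section \<open>Estimates on the inertial range\<close>

locale k41_flow = leray_flow +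
 fixes c Km Kp :: real
 assumes k41: "K41_function L T0 T1 c u" and inertial: "inertial_range L T0 T1 c u Km Kp"
  and pos: "ALL K:Sigma_star L \<inter> {Km..Kp}. S K > 0"
begin

lemma Km: "Km : Sigma_star L" and Kp: "Kp : Sigma_star L" and Kmp: "Km < Kp"
 using inertial by (auto simp: inertial_range_def)

lemma Km0: "Km > 0" and Kp0: "Kp > 0"
 using Km Kp by (auto dest: Sigma_star_pos)

abbreviation "Z \<equiv> Sigma_star L \<inter> {Km..Kp}"

lemma finite_Z: "finite Z"
 by (rule finite_subset[OF _ finite_Sigma_star_le[OF L, of Kp]]) auto

lemma KpZ: "Kp : Z" and KmZ: "Km : Z" using Km Kp Kmp by auto

definition \<gamma> where "\<gamma> = slope_defect L T0 T1 u Km Kp"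
definition Re where "Re = reynolds Km Kp"
text \<open>Equals (Kp / Km)^\<gamma>, the largest deviation from a pure -5/3 law that slopes within
  \<gamma> can accumulate over the whole range; it tends to 1 together with Re^\<gamma>.\<close>

definition g where "g = (Re powr \<gamma>) powr (3/4)"

lemma slope_step:
 assumes "consecutive L K K'" "Km <= K" "K' <= Kp"
 shows "\<bar>ln (S K' / S K) / ln (K' / K) + 5/3\<bar> <= \<gamma>"
proof -
 let ?D = "{\<bar>ln (S K' / S K) / ln (K' / K) + 5/3\<bar> | K K'. consecutive L K K' & Km <= K & K' <= Kp}"
 have "?D <= (%(K, K'). \<bar>ln (S K' / S K) / ln (K' / K) + 5/3\<bar>) ` (Z \<times> Z)"
 proof
  fix d assume "d : ?D"
  then obtain K K' where d: "d = \<bar>ln (S K' / S K) / ln (K' / K) + 5/3\<bar>" "consecutive L K K'" "Km <= K" "K' <= Kp" by blast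
  hence "(K, K') : Z \<times> Z" using Km0 by (auto simp: consecutive_def Sigma_star_def)
  thus "d : (%(K, K'). \<bar>ln (S K' / S K) / ln (K' / K) + 5/3\<bar>) ` (Z \<times> Z)" using d(1) by force
 qed
 hence "finite ?D" using finite_Z finite_subset by blast
 thus ?thesis unfolding \<gamma>_def slope_defect_def by (rule Max_ge) (use assms in blast)
qed

lemma next_frequency:
 assumes "K : Z" "K < Kp"
 obtains K' where "K' : Z" "K < K'" "consecutive L K K'"
proof -
 define A where "A = {K' : Z. K < K'}"
 have A: "finite A" "A ~= {}"
 proof -
  show "finite A" unfolding A_def by (rule finite_subset[OF _ finite_Z]) auto
  show "A ~= {}" using KpZ assms by (auto simp: A_def)
 qed
 define K' where "K' = Min A"
 have K': "K' : A" "!!K''. K'' : A ==> K' <= K''" using Min_in[OF A] Min_le[OF A(1)] by (auto simp: K'_def)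
 have "Sigma_set L \<inter> {K<..<K'} = {}"
 proof (rule ccontr)
  assume "Sigma_set L \<inter> {K<..<K'} ~= {}"
  then obtain K'' where K'': "K'' : Sigma_set L" "K < K''" "K'' < K'" by auto
  hence "K'' : A" using assms K'(1) Km0 by (auto simp: A_def Sigma_star_def)
  thus False using K'(2) K''(3) by fastforce
 qed
 hence "consecutive L K K'" using K'(1) assms(1) by (auto simp: consecutive_def A_def Sigma_star_def)
 thus thesis using that[of K'] K'(1) by (auto simp: A_def)
qed

lemma gamma_nonneg: "\<gamma> >= 0"
proof -
 obtain K' where K': "K' : Z" "Km < K'" "consecutive L Km K'" using next_frequency[OF KmZ Kmp] by blast
 from slope_step[OF K'(3)] K'(1) show ?thesis by auto
qed

text \<open>The steps from K up to Kp telescope, each deviating by at most \<gamma> times its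
  logarithmic length. The anchor is Kp because \<alpha> is defined there.\<close>

lemma slope:
 assumes "K : Z"
 shows "\<bar>ln (S K) - ln (S Kp) + 5/3 * (ln K - ln Kp)\<bar> <= \<gamma> * (ln Kp - ln K)"
 using assms
proof (induction "card {K' : Z. K < K'}" arbitrary: K rule: less_induct)
 case less
 show ?case
 proof (cases "K = Kp")
  case False
  hence "K < Kp" using less.prems by auto
  then obtain K' where K': "K' : Z" "K < K'" "consecutive L K K'" using next_frequency[OF less.prems] by blast
  have "card {K'' : Z. K' < K''} < card {K'' : Z. K < K''}"
  proof (rule psubset_card_mono)
  show "finite {K'' : Z. K < K''}" by (rule finite_subset[OF _ finite_Z]) auto
  have "K' : {K'' : Z. K < K''}" "K' ~: {K'' : Z. K' < K''}" using K' by auto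
  moreover have "{K'' : Z. K' < K''} <= {K'' : Z. K < K''}" using K' by auto
  ultimately show "{K'' : Z. K' < K''} \<subset> {K'' : Z. K < K''}" by blast
  qed
  from less.hyps[OF this K'(1)] have IH: "\<bar>ln (S K') - ln (S Kp) + 5/3 * (ln K' - ln Kp)\<bar> <= \<gamma> * (ln Kp - ln K')" .
  have K0: "K > 0" "K' > 0" and S0: "S K > 0" "S K' > 0" using less.prems K'(1) Km0 pos by auto
  define d where "d = ln K' - ln K"
  define e where "e = ln (S K') - ln (S K)"
  have d0: "d > 0" using K0 K'(2) by (simp add: d_def)
  have "\<bar>e / d + 5/3\<bar> <= \<gamma>"
  using slope_step[OF K'(3)] less.prems K'(1) K0 S0 by (simp add: ln_div d_def e_def)
  hence "\<bar>e / d + 5/3\<bar> * d <= \<gamma> * d" using d0 by (intro mult_right_mono) auto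
  moreover have "\<bar>e / d + 5/3\<bar> * d = \<bar>(e / d + 5/3) * d\<bar>" using d0 by (simp add: abs_mult)
  moreover have "(e / d + 5/3) * d = e + 5/3 * d" using d0 by (simp add: field_simps)
  ultimately have st: "\<bar>e + 5/3 * d\<bar> <= \<gamma> * d" by simp
  have "ln (S K) - ln (S Kp) + 5/3 * (ln K - ln Kp) = (ln (S K') - ln (S Kp) + 5/3 * (ln K' - ln Kp)) - (e + 5/3 * d)"
  unfolding e_def d_def by (simp add: right_diff_distrib diff_divide_distrib)
  moreover have "\<gamma> * (ln Kp - ln K) = \<gamma> * (ln Kp - ln K') + \<gamma> * d" by (simp add: d_def algebra_simps)
  ultimately show ?thesis using IH st by linarith
 qed simp
qed

lemma Re_pos: "Re > 1"
 unfolding Re_def reynolds_def using Km0 Kmp by (intro gr_one_powr) auto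

lemma g_eq: "g = exp (\<gamma> * (ln Kp - ln Km))"
proof -
 have "ln Re = 4/3 * (ln Kp - ln Km)" unfolding Re_def reynolds_def using Km0 Kp0 by (simp add: ln_powr ln_div)
 thus ?thesis unfolding g_def using Re_pos by (simp add: powr_def)
qed

lemma g_pos: "g > 0" by (simp add: g_eq)

abbreviation "\<epsilon> \<equiv> mean_diss"
text \<open>Cube root of the mean dissipation, so that the power 2/3 in \<open>K41_alpha\<close>
  becomes a square.\<close>

definition x where "x = mean_diss powr (1/3)"
definition \<alpha> where "\<alpha> = K41_alpha L \<nu> T0 T1 u Kp"

lemma weight_pos: "K : Sigma_star L ==> shell_weight L K > 0"
 using L by (auto simp: shell_weight_def dest: Sigma_star_pos)

lemma partial_sum_le_limit:
 assumes "!!K. K : Sigma_star L ==> f K >= 0" "(%n. SUM K:(shells L n). f K) ~> l"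
  and A: "finite A" "A <= Sigma_star L"
 shows "sum f A <= (l :: real)"
proof -
 have inc: "incseq (%n. SUM K:(shells L n). f K)"
  unfolding incseq_def using assms(1) by (intro allI impI sum_mono2 finite_Sigma_star_le[OF L]) auto
 obtain n :: nat where n: "!!K. K : A ==> K <= real n"
 proof (cases "A = {}")
  case False
  obtain n :: nat where "Max A <= real n" using real_arch_simple by blast
  thus thesis using that[of n] A(1) Max_ge[OF A(1)] by (meson order.trans)
 qed auto
 have "sum f A <= (SUM K:(shells L n). f K)"
  using n A assms(1) by (intro sum_mono2 finite_Sigma_star_le[OF L]) auto
 also have "... <= l" by (rule incseq_le[OF inc assms(2)])
 finally show ?thesis .
qed

lemma enstrophy_sum_le: "finite A ==> A <= Sigma_star L ==> (SUM K:A. shell_weight L K * (K^2 * S K)) <= \<epsilon> / (2 * \<nu>)"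
 by (rule partial_sum_le_limit[OF _ enstrophy_spectrum_limit])
  (auto intro!: mult_nonneg_nonneg S_nonneg less_imp_le[OF weight_pos])

lemma energy_sum_le: "finite A ==> A <= Sigma_star L ==> (SUM K:A. shell_weight L K * S K) <= mean_energy"
 by (rule partial_sum_le_limit[OF _ energy_spectrum_limit])
  (auto intro!: mult_nonneg_nonneg S_nonneg less_imp_le[OF weight_pos])

lemma diss_pos: "\<epsilon> > 0"
proof -
 have "0 < shell_weight L Kp * (Kp^2 * S Kp)" using weight_pos[OF Kp] Kp0 pos KpZ by simp
 also have "... <= \<epsilon> / (2 * \<nu>)" using enstrophy_sum_le[of "{Kp}"] Kp by simp
 finally show ?thesis using nu by (simp add: zero_less_divide_iff)
qed

lemma mean_energy_pos: "mean_energy > 0"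
proof -
 have "0 < shell_weight L Kp * S Kp" using weight_pos[OF Kp] pos KpZ by simp
 also have "... <= mean_energy" using energy_sum_le[of "{Kp}"] Kp by simp
 finally show ?thesis .
qed

lemma x_pos: "x > 0" and x_cubed: "x ^ 3 = \<epsilon>" and x_squared: "\<epsilon> powr (2/3) = x^2"
 using cube_powr[OF diss_pos] by (auto simp: x_def)

lemma alpha_pos: "\<alpha> > 0"
 unfolding \<alpha>_def K41_alpha_def using pos KpZ diss_pos Kp0 by simp

lemma S_Kp: "S Kp = \<alpha> * x^2 * Kp powr (-5/3)"
 using x_pos Kp0 by (simp add: \<alpha>_def K41_alpha_def x_squared)

lemma S_bounds:
 assumes K: "K : Z"
 shows "S K <= g * (\<alpha> * x^2 * K powr (-5/3))" "\<alpha> * x^2 * K powr (-5/3) <= g * S K"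
proof -
 have K0: "K > 0" and S0: "S K > 0" "S Kp > 0" using K KpZ Km0 pos by auto
 have l: "ln (\<alpha> * x^2 * K powr (-5/3)) = ln (S Kp) - 5/3 * (ln K - ln Kp)"
  unfolding S_Kp using alpha_pos x_pos K0 Kp0 by (simp add: ln_mult ln_powr) (simp add: field_simps)
 have "\<gamma> * (ln Kp - ln K) <= \<gamma> * (ln Kp - ln Km)"
  using gamma_nonneg K Km0 K0 by (intro mult_left_mono) auto
 hence "\<bar>ln (S K) - ln (\<alpha> * x^2 * K powr (-5/3))\<bar> <= ln g"
  using slope[OF K] unfolding l g_eq ln_exp by linarith
 hence b: "ln (S K) <= ln (g * (\<alpha> * x^2 * K powr (-5/3)))" "ln (\<alpha> * x^2 * K powr (-5/3)) <= ln (g * S K)"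
  using g_pos alpha_pos x_pos K0 S0 by (simp_all add: ln_mult_pos abs_le_iff)
 show "S K <= g * (\<alpha> * x^2 * K powr (-5/3))" "\<alpha> * x^2 * K powr (-5/3) <= g * S K"
  using b g_pos alpha_pos x_pos K0 S0 by simp_all
qed

definition \<kappa> where "\<kappa> = 2 * pi / L"
definition y where "y = \<kappa> powr (1/3)"

lemma kappa_pos: "\<kappa> > 0" using L by (simp add: \<kappa>_def)
lemma y_pos: "y > 0" using kappa_pos by (simp add: y_def)
lemma y_cubed: "y ^ 3 = \<kappa>" using cube_powr(2)[OF kappa_pos] by (simp add: y_def)

definition m where "m = (SOME m. m : three_square_sums & Km = \<kappa> * sqrt (real m))"
definition Np where "Np = (SOME n. n : three_square_sums & Kp = \<kappa> * sqrt (real n))"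

lemma m: "m : three_square_sums" "Km = \<kappa> * sqrt (real m)"
proof -
 have "EX m. m : three_square_sums & Km = \<kappa> * sqrt (real m)" using Km unfolding Sigma_star_eq[OF L] \<kappa>_def by blast
 from someI_ex[OF this] show "m : three_square_sums" "Km = \<kappa> * sqrt (real m)" by (auto simp: m_def)
qed

lemma Np: "Np : three_square_sums" "Kp = \<kappa> * sqrt (real Np)"
proof -
 have "EX n. n : three_square_sums & Kp = \<kappa> * sqrt (real n)" using Kp unfolding Sigma_star_eq[OF L] \<kappa>_def by blast
 from someI_ex[OF this] show "Np : three_square_sums" "Kp = \<kappa> * sqrt (real Np)" by (auto simp: Np_def)
qed

lemma m1: "1 <= m" and mN: "m < Np"
proof -
 show "1 <= m" using m(1) by (simp add: three_square_sums_def)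
 have "\<kappa> * sqrt (real m) < \<kappa> * sqrt (real Np)" using Kmp unfolding m(2)[symmetric] Np(2)[symmetric] .
 thus "m < Np" using kappa_pos by simp
qed

abbreviation "X \<equiv> three_square_sums \<inter> {m..Np}"

lemma Z_eq: "Z = (%n. \<kappa> * sqrt (real n)) ` X"
proof -
 have le: "\<kappa> * sqrt (real i) <= \<kappa> * sqrt (real j) \<longleftrightarrow> i <= j" for i j
  using kappa_pos by simp
 have iff: "\<kappa> * sqrt (real n) : {Km..Kp} \<longleftrightarrow> n : {m..Np}" for n
  unfolding atLeastAtMost_iff by (subst m(2), subst Np(2)) (simp only: le)
 have img: "f ` S \<inter> B = f ` {n : S. f n : B}" for f :: "nat => real" and S B by auto
 have "Sigma_star L = (%n. \<kappa> * sqrt (real n)) ` three_square_sums"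
  unfolding \<kappa>_def by (rule Sigma_star_eq[OF L])
 hence "Z = (%n. \<kappa> * sqrt (real n)) ` {n : three_square_sums. n : {m..Np}}"
  by (simp only: img iff)
 thus ?thesis by (simp only: Int_def)
qed

lemma sum_Z: "(SUM K:Z. f K) = (SUM n:X. f (\<kappa> * sqrt (real n)))"
 unfolding Z_eq using kappa_pos by (subst sum.reindex) (auto simp: inj_on_def)

definition a where "a = (SUM n:X. real n powr (-1/3))"
definition b where "b = (SUM n:X. real n powr (-4/3))"

text \<open>The weight brings K^(-1). With the -5/3 law and K^2 this combines to K^(-2/3), that is
  n^(-1/3) up to constants; without K^2 to K^(-8/3), that is n^(-4/3).\<close>

lemma weight_powr:
 assumes "n : X"
 defines "K \<equiv> \<kappa> * sqrt (real n)"
 shows "shell_weight L K * (K^2 * (\<alpha> * x^2 * K powr (-5/3))) = y ^ 4 * \<alpha> * x^2 * real n powr (-1/3)"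
  and "shell_weight L K * (\<alpha> * x^2 * K powr (-5/3)) = \<alpha> * x^2 / y^2 * real n powr (-4/3)"
proof -
 have n0: "real n > 0" using assms m1 by auto
 hence K0: "K > 0" using kappa_pos by (simp add: K_def)
 have w: "shell_weight L K = \<kappa>\<^sup>2 / K" by (simp add: shell_weight_def \<kappa>_def power2_eq_square)
 define r s where "r = real n powr (1/3)" and "s = K powr (1/3)"
 note rn = cube_powr[OF n0, folded r_def] and sK = cube_powr[OF K0, folded s_def]
 have Kp53: "K powr (-5/3) = 1 / s ^ 5"
 proof -
  have e: "(-5/3 :: real) = -1 + -2/3" by simp
  have "K powr (-5/3) = K powr (-1) * K powr (-2/3)" unfolding e by (rule powr_add)
  also have "... = 1 / s ^ 3 * (1 / s^2)" using K0 sK by (simp add: powr_minus_divide)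
  also have "... = 1 / s ^ 5" by (simp add: power_add[symmetric])
  finally show ?thesis .
 qed
 have s2: "s^2 = y^2 * r"
 proof -
  have "(s^2) ^ 3 = K^2" using sK(2) by (metis power_mult mult.commute)
  also have "... = \<kappa>\<^sup>2 * real n" by (simp add: K_def power_mult_distrib)
  also have "... = (y ^ 3)^2 * r ^ 3" by (simp only: y_cubed rn(2))
  also have "... = (y^2 * r) ^ 3" by (simp add: power_mult_distrib flip: power_mult)
  finally show ?thesis by (rule power_eq_imp_eq_base) (use sK(1) rn(1) y_pos in simp_all)
 qed
 have "shell_weight L K * (K^2 * (\<alpha> * x^2 * K powr (-5/3))) = \<kappa>\<^sup>2 * (\<alpha> * x^2) * (K / s ^ 5)"
  unfolding w Kp53 using K0 by (simp add: power2_eq_square)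
 also have "K / s ^ 5 = 1 / s^2"
  unfolding sK(2)[symmetric] using sK(1) by (simp add: field_simps power_add[symmetric])
 also have "\<kappa>\<^sup>2 * (\<alpha> * x^2) * (1 / s^2) = y ^ 4 * \<alpha> * x^2 * (1 / r)"
  unfolding s2 y_cubed[symmetric] using y_pos rn(1) by (simp add: field_simps flip: power_mult power_add)
 finally show "shell_weight L K * (K^2 * (\<alpha> * x^2 * K powr (-5/3))) = y ^ 4 * \<alpha> * x^2 * real n powr (-1/3)"
  unfolding rn(4) .
 have "shell_weight L K * (\<alpha> * x^2 * K powr (-5/3)) = \<kappa>\<^sup>2 * (\<alpha> * x^2) * (1 / (K * s ^ 5))"
  unfolding w Kp53 by simp
 also have "K * s ^ 5 = (s^2) ^ 4"
  unfolding sK(2)[symmetric] by (simp flip: power_add power_mult)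
 also have "\<kappa>\<^sup>2 * (\<alpha> * x^2) * (1 / (s^2) ^ 4) = \<alpha> * x^2 / y^2 * (1 / r ^ 4)"
  unfolding s2 y_cubed[symmetric] using y_pos rn(1) by (simp add: field_simps power_mult_distrib flip: power_mult power_add)
 finally show "shell_weight L K * (\<alpha> * x^2 * K powr (-5/3)) = \<alpha> * x^2 / y^2 * real n powr (-4/3)"
  unfolding rn(6) .
qed

lemma enstrophy_Z_bounds:
 "(SUM K:Z. shell_weight L K * (K^2 * S K)) <= g * (y ^ 4 * \<alpha> * x^2 * a)"
 "y ^ 4 * \<alpha> * x^2 * a <= g * (SUM K:Z. shell_weight L K * (K^2 * S K))"
proof -
 have e: "(SUM K:Z. shell_weight L K * (K^2 * (\<alpha> * x^2 * K powr (-5/3)))) = y ^ 4 * \<alpha> * x^2 * a"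
  unfolding sum_Z a_def sum_distrib_left by (intro sum.cong refl weight_powr(1))
 have w0: "shell_weight L K >= 0" if "K : Z" for K using weight_pos[of K] that by simp
 have "(SUM K:Z. shell_weight L K * (K^2 * S K)) <= (SUM K:Z. g * (shell_weight L K * (K^2 * (\<alpha> * x^2 * K powr (-5/3)))))"
 proof (rule sum_mono)
  fix K assume K: "K : Z"
  have "shell_weight L K * K^2 * S K <= shell_weight L K * K^2 * (g * (\<alpha> * x^2 * K powr (-5/3)))"
  using S_bounds(1)[OF K] w0[OF K] by (intro mult_left_mono) auto
  thus "shell_weight L K * (K^2 * S K) <= g * (shell_weight L K * (K^2 * (\<alpha> * x^2 * K powr (-5/3))))" by (simp add: mult_ac)
 qed
 thus "(SUM K:Z. shell_weight L K * (K^2 * S K)) <= g * (y ^ 4 * \<alpha> * x^2 * a)" by (simp only: e sum_distrib_left[symmetric])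
 have "(SUM K:Z. shell_weight L K * (K^2 * (\<alpha> * x^2 * K powr (-5/3)))) <= (SUM K:Z. g * (shell_weight L K * (K^2 * S K)))"
 proof (rule sum_mono)
  fix K assume K: "K : Z"
  have "shell_weight L K * K^2 * (\<alpha> * x^2 * K powr (-5/3)) <= shell_weight L K * K^2 * (g * S K)"
  using S_bounds(2)[OF K] w0[OF K] by (intro mult_left_mono) auto
  thus "shell_weight L K * (K^2 * (\<alpha> * x^2 * K powr (-5/3))) <= g * (shell_weight L K * (K^2 * S K))" by (simp add: mult_ac)
 qed
 thus "y ^ 4 * \<alpha> * x^2 * a <= g * (SUM K:Z. shell_weight L K * (K^2 * S K))" by (simp only: e sum_distrib_left[symmetric])
qed

lemma energy_Z_bounds:
 "(SUM K:Z. shell_weight L K * S K) <= g * (\<alpha> * x^2 / y^2 * b)"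
 "\<alpha> * x^2 / y^2 * b <= g * (SUM K:Z. shell_weight L K * S K)"
proof -
 have e: "(SUM K:Z. shell_weight L K * (\<alpha> * x^2 * K powr (-5/3))) = \<alpha> * x^2 / y^2 * b"
  unfolding sum_Z b_def sum_distrib_left by (intro sum.cong refl weight_powr(2))
 have w0: "shell_weight L K >= 0" if "K : Z" for K using weight_pos[of K] that by simp
 have "(SUM K:Z. shell_weight L K * S K) <= (SUM K:Z. g * (shell_weight L K * (\<alpha> * x^2 * K powr (-5/3))))"
 proof (rule sum_mono)
  fix K assume K: "K : Z"
  have "shell_weight L K * S K <= shell_weight L K * (g * (\<alpha> * x^2 * K powr (-5/3)))"
  using S_bounds(1)[OF K] w0[OF K] by (intro mult_left_mono)
  thus "shell_weight L K * S K <= g * (shell_weight L K * (\<alpha> * x^2 * K powr (-5/3)))" by (simp add: mult_ac)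
 qed
 thus "(SUM K:Z. shell_weight L K * S K) <= g * (\<alpha> * x^2 / y^2 * b)" by (simp only: e sum_distrib_left[symmetric])
 have "(SUM K:Z. shell_weight L K * (\<alpha> * x^2 * K powr (-5/3))) <= (SUM K:Z. g * (shell_weight L K * S K))"
 proof (rule sum_mono)
  fix K assume K: "K : Z"
  have "shell_weight L K * (\<alpha> * x^2 * K powr (-5/3)) <= shell_weight L K * (g * S K)"
  using S_bounds(2)[OF K] w0[OF K] by (intro mult_left_mono)
  thus "shell_weight L K * (\<alpha> * x^2 * K powr (-5/3)) <= g * (shell_weight L K * S K)" by (simp add: mult_ac)
 qed
 thus "\<alpha> * x^2 / y^2 * b <= g * (SUM K:Z. shell_weight L K * S K)" by (simp only: e sum_distrib_left[symmetric])
qed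

lemma diss_upper: "\<epsilon> / (2 * \<nu>) <= 3 * (SUM K:Z. shell_weight L K * (K^2 * S K))"
proof -
 have "\<epsilon> / (2 * \<nu>) <= (1 + c) * (SUM K:Z. shell_weight L K * (K^2 * S K))"
  using inertial unfolding inertial_range_def enstrophy_UNIV enstrophy_interval by blast
 also have "... <= 3 * (SUM K:Z. shell_weight L K * (K^2 * S K))"
  using k41 by (intro mult_right_mono sum_nonneg mult_nonneg_nonneg S_nonneg less_imp_le[OF weight_pos]) (auto simp: K41_function_def)
 finally show ?thesis .
qed

lemma a_pos: "a > 0"
proof -
 have "0 < real m powr (-1/3)" using m1 by simp
 also have "... <= a" unfolding a_def using m mN by (intro member_le_sum) auto
 finally show ?thesis .
qed

text \<open>The dissipation is x^3, while the law on the inertial range gives a multiple of x^2 for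
  its part of it; dividing by x^2 leaves a bound on x itself. The same mechanism yields
  \<open>x_upper\<close>.\<close>

lemma x_lower: "2 * \<nu> * \<alpha> * a * y ^ 4 <= g * x"
proof -
 have "y ^ 4 * \<alpha> * x^2 * a <= g * (\<epsilon> / (2 * \<nu>))"
  using order_trans[OF enstrophy_Z_bounds(2) mult_left_mono[OF enstrophy_sum_le[OF finite_Z] less_imp_le[OF g_pos]]] by simp
 also have "... = x^2 * (g * x / (2 * \<nu>))" unfolding x_cubed[symmetric] by (simp add: power2_eq_square power3_eq_cube)
 finally have "x^2 * (y ^ 4 * \<alpha> * a) <= x^2 * (g * x / (2 * \<nu>))" by (simp add: mult_ac)
 hence "y ^ 4 * \<alpha> * a <= g * x / (2 * \<nu>)" using x_pos by (subst (asm) mult_le_cancel_left_pos) auto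
 thus ?thesis using nu by (simp add: field_simps)
qed

lemma x_upper: "x <= 6 * \<nu> * g * \<alpha> * a * y ^ 4"
proof -
 have "x^2 * (x / (2 * \<nu>)) = x ^ 3 / (2 * \<nu>)" by (simp add: power2_eq_square power3_eq_cube)
 also have "... <= 3 * (g * (y ^ 4 * \<alpha> * x^2 * a))"
  using diss_upper enstrophy_Z_bounds(1) unfolding x_cubed by linarith
 also have "... = x^2 * (3 * g * y ^ 4 * \<alpha> * a)" by (simp only: mult_ac)
 finally have "x^2 * (x / (2 * \<nu>)) <= x^2 * (3 * g * y ^ 4 * \<alpha> * a)" .
 hence "x / (2 * \<nu>) <= 3 * g * y ^ 4 * \<alpha> * a" using x_pos by (subst (asm) mult_le_cancel_left_pos) auto
 thus ?thesis using nu by (simp add: field_simps)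
qed

lemma energy_lower: "\<alpha> * x^2 / y^2 * b <= g * mean_energy"
 using order_trans[OF energy_Z_bounds(2) mult_left_mono[OF energy_sum_le[OF finite_Z] less_imp_le[OF g_pos]]] by simp

text \<open>If \<open>Vol\<close> is large, Km is the smallest frequency and no shell lies below it.
  Otherwise V * Km^3 <= 1; at most 27 m^(3/2) modes carry a share of at most V / L^3 of the mean
  energy each, and Km = 2 pi sqrt m / L turns the product into 27 / (2 pi)^3.\<close>

lemma low_modes: "(SUM K:{K : Sigma_star L. K < Km}. shell_weight L K * S K) <= 27 / (8 * pi ^ 3) * mean_energy"
proof (cases "Vol L T0 T1 u / vol_torus L >= 1 / (2 * pi) ^ 3")
 case True
 hence "Km = \<kappa>" using inertial by (simp add: inertial_range_def \<kappa>_def)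
 moreover have "\<kappa> <= K" if "K : Sigma_star L" for K
  using that kappa_pos unfolding Sigma_star_eq[OF L] \<kappa>_def[symmetric] by (auto simp: three_square_sums_def)
 ultimately have e: "{K : Sigma_star L. K < Km} = {}" by fastforce
 show ?thesis unfolding e using mean_energy_pos by simp
next
 case False
 hence KV: "Km <= Vol L T0 T1 u powr (-1/3)" using inertial by (simp add: inertial_range_def)
 define V where "V = Vol L T0 T1 u"
 have V0: "V >= 0" unfolding V_def Vol_def by (intro divide_nonneg_nonneg time_avg_nonneg) auto
 \<comment> \<open>A vanishing V would force Km <= 0, because 0 powr (-1/3) is 0.\<close>
 hence Vp: "V > 0" using KV Km0 by (cases "V = 0") (auto simp: V_def)
 have "Km ^ 3 <= (V powr (-1/3)) ^ 3" using KV Km0 unfolding V_def[symmetric] by (intro power_mono) auto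
 also have "... = 1 / V" using cube_powr[OF Vp] by (simp add: power_divide)
 finally have VK: "V * Km ^ 3 <= 1" using Vp by (simp add: field_simps)
 define A where "A = {K : Sigma_star L. K < Km}"
 have finA: "finite A" unfolding A_def by (rule finite_subset[OF _ finite_Sigma_star_le[OF L, of Km]]) auto
 have cards: "(SUM K:A. real (card {k : wave_vectors L. norm k = K})) <= real (card (ball_modes L Km))"
 proof -
  have fin: "finite {k : wave_vectors L. norm k = K}" for K
  by (rule finite_subset[OF _ finite_ball_modes[OF L, of K]]) (auto simp: ball_modes_def)
  have "(SUM K:A. card {k : wave_vectors L. norm k = K}) = card (\<Union>K\<in>A. {k : wave_vectors L. norm k = K})"
  using finA fin by (intro card_UN_disjoint[symmetric]) auto
  also have "... <= card (ball_modes L Km)" by (intro card_mono finite_ball_modes L) (auto simp: A_def ball_modes_def)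
  finally have "real (SUM K:A. card {k : wave_vectors L. norm k = K}) <= real (card (ball_modes L Km))"
  by (rule of_nat_mono)
  thus ?thesis by (simp only: of_nat_sum)
 qed
 have "(SUM K:A. shell_weight L K * S K) <= (SUM K:A. real (card {k : wave_vectors L. norm k = K}) * (V / L ^ 3) * mean_energy)"
  unfolding V_def by (intro sum_mono low_mode_bound mean_energy_pos) (simp add: A_def)
 also have "... = (SUM K:A. real (card {k : wave_vectors L. norm k = K})) * (V / L ^ 3 * mean_energy)"
  unfolding sum_distrib_right by (simp only: mult.assoc)
 also have "... <= (27 * sqrt (real m) ^ 3) * (V / L ^ 3 * mean_energy)"
  using cards card_ball_modes_le[OF L m(2)[unfolded \<kappa>_def] m1] V0 L mean_energy_pos by (intro mult_right_mono) auto
 also have "... <= 27 / (8 * pi ^ 3) * mean_energy"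
 proof -
  define s where "s = sqrt (real m)"
  have s0: "s > 0" using m1 by (simp add: s_def)
  have "Km = 2 * pi * s / L" using m(2) unfolding \<kappa>_def s_def[symmetric] by (rule trans) simp
  hence "V * Km ^ 3 = V * s ^ 3 / L ^ 3 * (8 * pi ^ 3)" by (simp add: power_mult_distrib power_divide)
  hence "V * s ^ 3 / L ^ 3 * (8 * pi ^ 3) <= 1" using VK by simp
  hence "V * s ^ 3 / L ^ 3 <= 1 / (8 * pi ^ 3)" by (subst pos_le_divide_eq) auto
  hence "27 * mean_energy * (V * s ^ 3 / L ^ 3) <= 27 * mean_energy * (1 / (8 * pi ^ 3))"
  using mean_energy_pos by (intro mult_left_mono) auto
  thus ?thesis unfolding s_def[symmetric] by (simp add: mult_ac)
 qed
 finally show ?thesis unfolding A_def .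
qed

text \<open>Three ranges of frequencies: below Km by \<open>low_modes\<close>, on the inertial range
  by the power law, and above Kp by the dissipation divided by Kp^2. The last one, by way of
  \<open>diss_upper\<close>, gives the term 3 a / Np.\<close>

lemma energy_upper: "mean_energy * (1 - 27 / (8 * pi ^ 3)) <= g * \<alpha> * x^2 / y^2 * (b + 3 * a / real Np)"
proof -
 define low where "low = (SUM K:{K : Sigma_star L. K < Km}. shell_weight L K * S K)"
 have w: "shell_weight L K * S K >= 0" if "K : Sigma_star L" for K
  using weight_pos[OF that] S_nonneg[OF that] by simp
 have "mean_energy <= low + g * (\<alpha> * x^2 / y^2 * b) + \<epsilon> / (2 * \<nu>) / Kp^2"
 proof (rule LIMSEQ_le_const2[OF energy_spectrum_limit], intro exI allI impI)
  fix n :: nat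
  define A where "A = {K : Sigma_star L. K < Km}"
  define B where "B = {K : Sigma_star L. Kp < K & K <= real n}"
  have fin: "finite A" "finite B"
  proof -
  show "finite A" unfolding A_def by (rule finite_subset[OF _ finite_Sigma_star_le[OF L, of Km]]) auto
  show "finite B" unfolding B_def by (rule finite_subset[OF _ finite_Sigma_star_le[OF L, of "real n"]]) auto
  qed
  have "(SUM K:(shells L n). shell_weight L K * S K) <= (SUM K:A \<union> Z \<union> B. shell_weight L K * S K)"
  using w fin finite_Z by (intro sum_mono2) (auto simp: A_def B_def)
  also have "... = (SUM K:A. shell_weight L K * S K) + (SUM K:Z. shell_weight L K * S K) + (SUM K:B. shell_weight L K * S K)"
  using fin finite_Z Kmp by (subst sum.union_disjoint; (subst sum.union_disjoint)?) (auto simp: A_def B_def)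
  also have "(SUM K:B. shell_weight L K * S K) <= (SUM K:B. shell_weight L K * (K^2 * S K) / Kp^2)"
  proof (rule sum_mono)
  fix K assume K: "K : B"
  hence "Kp^2 <= K^2" using Kp0 by (intro power_mono) (auto simp: B_def)
  hence "(shell_weight L K * S K) * Kp^2 <= (shell_weight L K * S K) * K^2"
  using w[of K] K by (intro mult_left_mono) (auto simp: B_def)
  thus "shell_weight L K * S K <= shell_weight L K * (K^2 * S K) / Kp^2" using Kp0 by (simp add: pos_le_divide_eq mult_ac)
  qed
  also have "(SUM K:B. shell_weight L K * (K^2 * S K) / Kp^2) <= \<epsilon> / (2 * \<nu>) / Kp^2"
  unfolding sum_divide_distrib[symmetric] by (intro divide_right_mono enstrophy_sum_le fin) (auto simp: B_def)
  finally show "(SUM K:(shells L n). shell_weight L K * S K) <= low + g * (\<alpha> * x^2 / y^2 * b) + \<epsilon> / (2 * \<nu>) / Kp^2"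
  using energy_Z_bounds(1) by (simp add: low_def A_def)
 qed
 moreover have "low <= 27 / (8 * pi ^ 3) * mean_energy" unfolding low_def by (rule low_modes)
 moreover have "\<epsilon> / (2 * \<nu>) / Kp^2 <= g * \<alpha> * x^2 / y^2 * (3 * a / real Np)"
 proof -
  have "\<epsilon> / (2 * \<nu>) <= 3 * (g * (y ^ 4 * \<alpha> * x^2 * a))" using diss_upper enstrophy_Z_bounds(1) by linarith
  hence "\<epsilon> / (2 * \<nu>) / Kp^2 <= 3 * (g * (y ^ 4 * \<alpha> * x^2 * a)) / Kp^2" by (intro divide_right_mono) auto
  also have kp: "Kp^2 = y ^ 6 * real Np"
  proof -
  have "Kp^2 = (\<kappa> * sqrt (real Np))^2" by (rule arg_cong[OF Np(2)])
  also have "... = (y ^ 3)^2 * real Np" unfolding y_cubed by (simp add: power_mult_distrib)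
  finally show ?thesis by (simp flip: power_mult)
  qed
  also have "3 * (g * (y ^ 4 * \<alpha> * x^2 * a)) / (y ^ 6 * real Np) = g * \<alpha> * x^2 / y^2 * (3 * a / real Np)"
  proof -
  have six: "y ^ 6 = y ^ 4 * y^2" by (simp flip: power_add)
  have nz: "y ^ 4 ~= 0" using y_pos by simp
  show ?thesis unfolding six by (rule cancel_common_factor[OF nz])
  qed
  finally show ?thesis unfolding kp .
 qed
 ultimately have "mean_energy - 27 / (8 * pi ^ 3) * mean_energy <= g * (\<alpha> * x^2 / y^2 * b) + g * \<alpha> * x^2 / y^2 * (3 * a / real Np)" by linarith
 thus ?thesis by (simp add: algebra_simps add_divide_distrib)
qed

end

section \<open>Explicit constants\<close>

lemma pi_cubed_ge: "27 / (8 * pi ^ 3) <= 1 / 8"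
proof -
 have "(3::real) ^ 3 <= pi ^ 3" using pi_gt3 by (intro power_mono) auto
 thus ?thesis by (simp add: divide_le_eq)
qed

context k41_flow
begin

definition p where "p = real m powr (1/3)"
definition q where "q = real Np powr (1/3)"

lemma real_m_pos: "real m > 0" and real_Np_pos: "real Np > 0"
 using m1 mN by auto

lemmas p_powr = cube_powr[OF real_m_pos, folded p_def]
lemmas q_powr = cube_powr[OF real_Np_pos, folded q_def]

lemma p_ge_1: "p >= 1" unfolding p_def using m1 by (intro ge_one_powr_ge_zero) auto

lemma p_less_q: "p < q" unfolding p_def q_def using mN by (intro powr_less_mono2) auto

lemma Re_eq: "Re = q^2 / p^2"
proof -
 have "Kp / Km = (\<kappa> * sqrt (real Np)) / (\<kappa> * sqrt (real m))" by (rule arg_cong2[where f = "(/)", OF Np(2) m(2)])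
 hence "Kp / Km = sqrt (real Np) / sqrt (real m)" using kappa_pos by simp
 hence "Re = sqrt (real Np) powr (4/3) / sqrt (real m) powr (4/3)"
  unfolding Re_def reynolds_def by (simp add: powr_divide)
 moreover have "sqrt (real k) powr (4/3) = real k powr (2/3)" for k
  by (simp add: powr_half_sqrt[symmetric] powr_powr)
 ultimately show ?thesis by (simp add: p_powr(3) q_powr(3))
qed

lemma a_upper: "a <= 3/2 * q^2"
proof -
 have "a <= (SUM n:{1..Np}. real n powr (-1/3))" unfolding a_def using m1 by (intro sum_mono2) auto
 thus ?thesis using sum_powr_minus_third_le[of Np] unfolding q_powr(3) by linarith
qed

lemma b_upper: "b <= 4 / p"
proof -
 have "b <= (SUM n:{m..Np}. real n powr (-4/3))" unfolding b_def by (intro sum_mono2) auto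
 also have "... <= 1 / p ^ 4 + 3 * (1 / p)"
  using sum_powr_minus_four_thirds_le[OF m1, of Np] unfolding p_powr(4,6) .
 also have "1 / p ^ 4 <= 1 / p" using p_ge_1 self_le_power[of p 4] by (intro divide_left_mono) auto
 finally show ?thesis by simp
qed

text \<open>Re >= 400 means p^2 <= q^2 / 400, so the boundary term (m + 4)^(2/3) <= 5^(2/3) p^2 <= 3
  p^2 costs less than q^2 / 100, and 3/4 falls to no less than 7/10.\<close>

lemma a_lower: "Re >= 400 ==> 7/10 * q^2 <= a"
proof -
 assume R: "Re >= 400"
 define r :: real where "r = 5 powr (1/3)"
 note r = cube_powr[of 5, folded r_def]
 have "(r^2) ^ 3 = (r ^ 3)^2" by (simp flip: power_mult)
 hence "(r^2) ^ Suc 2 <= 3 ^ Suc 2" using r(2) by simp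
 hence r3: "r^2 <= 3" by (rule power_le_imp_le_base) simp
 define w where "w = (real m + 4) powr (2/3)"
 have "w <= (5 * real m) powr (2/3)" unfolding w_def using m1 by (intro powr_mono2) auto
 also have "... = r^2 * p^2" using r(3) p_powr(3) by (simp add: powr_mult)
 also have "... <= 3 * p^2" using r3 by (intro mult_right_mono) auto
 finally have "w <= 3 * p^2" .
 moreover have "3/4 * (q^2 - w) <= a"
  using sum_minus_third_ge[OF m1 less_imp_le[OF mN]] unfolding a_def[symmetric] w_def[symmetric] q_powr(3) .
 moreover have "400 * p^2 <= q^2" using R p_powr(1) unfolding Re_eq by (simp add: pos_le_divide_eq)
 moreover have "0 <= q^2" by simp
 ultimately show ?thesis unfolding right_diff_distrib by linarith
qed

text \<open>As 400 = 20^2, the loss p / q is at most 1/20, and 47/40 - 3/40 = 11/10. The rest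
  depends on m alone: it is checked value by value for m < 5, and from m = 5 on h is at least the
  cube root of 1/2, which exceeds 79/100.\<close>

lemma b_lower: "Re >= 400 ==> 11/10 <= b * p"
proof -
 assume R: "Re >= 400"
 define h where "h = (real m / (real m + 5)) powr (1/3)"
 have "1 / p ^ 4 + 3/2 * ((real m + 5) powr (-1/3) - 1 / q) <= b"
  using sum_minus_four_thirds_ge[OF m(1) less_imp_le[OF mN]] unfolding b_def p_powr(6) q_powr(4) .
 hence le: "(1 / p ^ 4 + 3/2 * ((real m + 5) powr (-1/3) - 1 / q)) * p <= b * p"
  using p_powr(1) by (intro mult_right_mono) auto
 have eq: "(1 / p ^ 4 + 3/2 * ((real m + 5) powr (-1/3) - 1 / q)) * p = 1 / real m + 3/2 * (h - p / q)"
 proof -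
  have "1 / p ^ 4 * p = 1 / real m"
  unfolding p_powr(2)[symmetric] using p_powr(1) by (simp add: field_simps eval_nat_numeral)
  moreover have "(real m + 5) powr (-1/3) * p = h"
  unfolding h_def p_def by (simp add: powr_divide powr_minus_divide)
  ultimately show ?thesis by (simp add: algebra_simps)
 qed
 have "1 / real m + 3/2 * (h - p / q) <= b * p" using le unfolding eq .
 moreover have "p / q <= 1 / 20"
 proof -
  have "20^2 * p^2 <= q^2" using R p_powr(1) unfolding Re_eq by (simp add: pos_le_divide_eq)
  hence "(20 * p)^2 <= q^2" by (simp add: power_mult_distrib)
  hence "20 * p <= q" using q_powr(1) by (rule power2_le_imp_le[OF _ less_imp_le])
  thus ?thesis using q_powr(1) by (simp add: field_simps)
 qed
 moreover have "47/40 <= 1 / real m + 3/2 * h"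
 proof -
  have root: "c <= h" if "0 <= c" "c ^ 3 <= real m / (real m + 5)" for c
  unfolding h_def using that by (rule cube_root_ge)
  consider "m = 1" | "m = 2" | "m = 3" | "m = 4" | "m >= 5" using m1 by linarith
  thus ?thesis
  proof cases
  case 1
  thus ?thesis using root[of "1/2"] by (simp add: power3_eq_cube)
  next
  case 2
  thus ?thesis using root[of "13/20"] by (simp add: power3_eq_cube)
  next
  case 3
  thus ?thesis using root[of "7/10"] by (simp add: power3_eq_cube)
  next
  case 4
  thus ?thesis using root[of "3/4"] by (simp add: power3_eq_cube)
  next
  case 5
  have "(79/100 :: real) ^ 3 <= 1 / 2" by (simp add: power3_eq_cube)
  also have "1 / 2 <= real m / (real m + 5)" using 5 by (simp add: field_simps)
  finally have "79/100 <= h" by (intro root) auto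
  moreover have "0 <= 1 / real m" by simp
  ultimately show ?thesis by linarith
  qed
 qed
 ultimately show ?thesis unfolding right_diff_distrib by linarith
qed

definition E0 where "E0 = energy L u T0"
definition D where "D = T1 - T0"
definition T where "T = time_scale L \<nu> T0 T1 u Kp"

lemma E0_pos: "E0 > 0" and mean_energy_le_E0: "mean_energy <= E0"
 using mean_energy_pos mean_energy_le unfolding E0_def by linarith+

lemma D_pos: "D > 0" using T01 by (simp add: D_def)

lemma T_eq: "T = \<alpha> ^ 3 * \<nu> * D * x ^ 3 / E0^2"
 unfolding T_def time_scale_eq \<alpha>_def D_def E0_def x_cubed ..

lemma T_pos: "T > 0"
 unfolding T_eq using alpha_pos nu D_pos x_pos E0_pos by simp

text \<open>Inserting \<open>T_eq\<close> cancels both the initial energy and the duration; the mean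
  energy relative to x^2 and x itself remain.\<close>

lemma ratio_eq: "(mean_energy / E0)^2 * (D / (Re * T)) = (mean_energy / x^2)^2 * x / (Re * \<alpha> ^ 3 * \<nu>)"
 unfolding T_eq using alpha_pos nu D_pos x_pos E0_pos Re_pos
 by (simp add: field_simps eval_nat_numeral)

text \<open>The bounds 4 / p on the inertial range and (9/2) / q above it add up to (17/2) / p, and
  absorbing the low modes costs a factor 8/7. With x bounded by \<open>x_upper\<close> the constant
  is 9 (68/7)^2, about 849 and thus below 864.\<close>

lemma ratio_upper: "(mean_energy / E0)^2 * (D / (Re * T)) <= 864 * g ^ 3"
proof -
 have q0: "q > 0" and p0: "p > 0" using q_powr(1) p_powr(1) .
 have "3 * a / real Np <= 3 * (3/2 * q^2) / real Np" using a_upper real_Np_pos by (intro divide_right_mono) auto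
 also have "... = 9/2 / q" unfolding q_powr(2)[symmetric] using q0 by (simp add: field_simps eval_nat_numeral)
 also have "... <= 9/2 / p" using p_less_q p0 by (intro divide_left_mono) auto
 finally have s: "b + 3 * a / real Np <= 17/2 / p" using b_upper by simp
 have "mean_energy * (7/8) <= mean_energy * (1 - 27 / (8 * pi ^ 3))"
  using pi_cubed_ge mean_energy_pos by (intro mult_left_mono) auto
 also have "... <= g * \<alpha> * x^2 / y^2 * (17/2 / p)"
  using g_pos alpha_pos by (intro order_trans[OF energy_upper mult_left_mono[OF s]]) auto
 finally have "8/7 * (mean_energy * (7/8)) <= 8/7 * (g * \<alpha> * x^2 / y^2 * (17/2 / p))" by (intro mult_left_mono) auto
 also have "... = (68/7 * g * \<alpha> / (y^2 * p)) * x^2" using p0 y_pos by (simp add: field_simps)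
 finally have "mean_energy <= (68/7 * g * \<alpha> / (y^2 * p)) * x^2" by simp
 hence "mean_energy / x^2 <= 68/7 * g * \<alpha> / (y^2 * p)" using x_pos by (simp add: pos_divide_le_eq)
 hence e: "(mean_energy / x^2)^2 <= (68/7 * g * \<alpha> / (y^2 * p))^2"
  using mean_energy_pos by (intro power_mono) auto
 have xb: "x <= 9 * \<nu> * g * \<alpha> * q^2 * y ^ 4"
 proof -
  have "6 * \<nu> * g * \<alpha> * a * y ^ 4 <= 6 * \<nu> * g * \<alpha> * (3/2 * q^2) * y ^ 4"
  using a_upper nu g_pos alpha_pos y_pos by (intro mult_right_mono mult_left_mono) auto
  from order_trans[OF x_upper this] show ?thesis by (simp add: mult_ac)
 qed
 have "(mean_energy / x^2)^2 * x / (Re * \<alpha> ^ 3 * \<nu>)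
  <= (68/7 * g * \<alpha> / (y^2 * p))^2 * (9 * \<nu> * g * \<alpha> * q^2 * y ^ 4) / (Re * \<alpha> ^ 3 * \<nu>)"
  using e xb x_pos Re_pos alpha_pos nu by (intro divide_right_mono mult_mono) auto
 also have "... = (68/7)^2 * 9 * g ^ 3"
  unfolding Re_eq using q0 p0 alpha_pos nu y_pos by (simp add: field_simps eval_nat_numeral)
 also have "... <= 864 * g ^ 3" using g_pos by (intro mult_right_mono) (auto simp: power2_eq_square)
 finally show ?thesis unfolding ratio_eq .
qed

text \<open>Both factors in \<open>ratio_eq\<close> are bounded below by the inertial range alone;
  the powers of \<alpha>, \<nu> and y cancel, and Re = q^2 / p^2 normalises a and b.\<close>

lemma ratio_lower: "2 * (a / q^2) * (b * p)^2 / g ^ 3 <= (mean_energy / E0)^2 * (D / (Re * T))"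
proof -
 have q0: "q > 0" and p0: "p > 0" using q_powr(1) p_powr(1) .
 have b0: "b >= 0" unfolding b_def by (intro sum_nonneg) auto
 have "\<alpha> * b / (g * y^2) * x^2 <= mean_energy"
  using energy_lower g_pos y_pos by (simp add: field_simps)
 hence "\<alpha> * b / (g * y^2) <= mean_energy / x^2" using x_pos by (simp add: pos_le_divide_eq)
 hence e: "(\<alpha> * b / (g * y^2))^2 <= (mean_energy / x^2)^2"
  using alpha_pos b0 g_pos by (intro power_mono) auto
 have xb: "2 * \<nu> * \<alpha> * a * y ^ 4 / g <= x" using x_lower g_pos by (simp add: pos_divide_le_eq mult.commute)
 have "2 * (a / q^2) * (b * p)^2 / g ^ 3 = (\<alpha> * b / (g * y^2))^2 * (2 * \<nu> * \<alpha> * a * y ^ 4 / g) / (Re * \<alpha> ^ 3 * \<nu>)"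
  unfolding Re_eq using q0 p0 alpha_pos nu y_pos g_pos by (simp add: field_simps eval_nat_numeral)
 also have "... <= (mean_energy / x^2)^2 * x / (Re * \<alpha> ^ 3 * \<nu>)"
  using e xb a_pos Re_pos alpha_pos nu y_pos g_pos by (intro divide_right_mono mult_mono) auto
 finally show ?thesis unfolding ratio_eq .
qed

text \<open>No more energy is dissipated than was there initially: D x^3 <= E0. This bounds D * Re *
  T by Re * \<alpha>^3 * \<nu> / x^3, and \<open>x_lower\<close> finishes. The number 3375/16384
  converts 1 / (8 (2 pi)^4) = 1 / (128 pi^4) into the constant of the statement; C stays open
  because small and large Re need different factors.\<close>

lemma duration_upper:
 assumes C: "Re * g ^ 3 * (3375 / 16384) <= C * a ^ 3"
 shows "D <= 128 * C / (3375 * pi ^ 4) * (1 / (Re * T)) * (vol_torus L powr (4/3) / \<nu>\<^sup>2)"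
proof -
 have vol: "vol_torus L powr (4/3) = L ^ 4"
 proof -
  have "L ^ 3 > 0" using L by simp
  note r = cube_powr[OF this]
  have "(L ^ 3) powr (1/3) = L" using r(1,2) L by (metis less_imp_le power_eq_iff_eq_base zero_less_numeral)
  thus ?thesis using r(7) by (simp add: vol_torus_def)
 qed
 have Dx: "D * x ^ 3 <= E0" using mean_diss_le by (simp add: D_def E0_def x_cubed)
 have "D * (Re * T) = Re * \<alpha> ^ 3 * \<nu> * ((D * x ^ 3)^2 / E0^2) / x ^ 3"
  unfolding T_eq using x_pos by (simp add: field_simps eval_nat_numeral)
 also have "... <= Re * \<alpha> ^ 3 * \<nu> * 1 / x ^ 3"
 proof -
  have "(D * x ^ 3)^2 <= E0^2" using Dx D_pos x_pos by (intro power_mono) auto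
  hence "(D * x ^ 3)^2 / E0^2 <= 1" using E0_pos by simp
  thus ?thesis using Re_pos alpha_pos nu x_pos by (intro divide_right_mono mult_left_mono) auto
 qed
 also have "... <= Re * \<alpha> ^ 3 * \<nu> * 1 / (2 * \<nu> * \<alpha> * a * y ^ 4 / g) ^ 3"
 proof -
  have l: "0 < 2 * \<nu> * \<alpha> * a * y ^ 4 / g" using nu alpha_pos a_pos y_pos g_pos by simp
  have "2 * \<nu> * \<alpha> * a * y ^ 4 / g <= x" using x_lower g_pos by (simp add: pos_divide_le_eq mult.commute)
  hence "(2 * \<nu> * \<alpha> * a * y ^ 4 / g) ^ 3 <= x ^ 3" using l by (intro power_mono) auto
  thus ?thesis using l x_pos Re_pos alpha_pos nu by (intro divide_left_mono) auto
 qed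
 also have "... = Re * g ^ 3 / (8 * \<nu>\<^sup>2 * a ^ 3 * (y ^ 3) ^ 4)"
  using nu alpha_pos a_pos y_pos g_pos by (simp add: field_simps eval_nat_numeral)
 also have "... = 128 / (3375 * pi ^ 4) * (L ^ 4 / \<nu>\<^sup>2) * (Re * g ^ 3 * (3375 / 16384) / a ^ 3)"
  unfolding y_cubed \<kappa>_def using nu a_pos L by (simp add: field_simps power_divide power_mult_distrib)
 also have "... <= 128 / (3375 * pi ^ 4) * (L ^ 4 / \<nu>\<^sup>2) * C"
  using C a_pos by (intro mult_left_mono) (auto simp: pos_divide_le_eq)
 finally have "D * (Re * T) <= 128 / (3375 * pi ^ 4) * (L ^ 4 / \<nu>\<^sup>2) * C" .
 moreover have "Re * T > 0" using Re_pos T_pos by simp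
 ultimately have "D <= 128 / (3375 * pi ^ 4) * (L ^ 4 / \<nu>\<^sup>2) * C / (Re * T)" by (simp only: pos_le_divide_eq)
 thus ?thesis unfolding vol by (simp add: mult_ac)
qed

text \<open>Re^(-3/2) = m / Np expresses the crude bound through Re alone, as the factors in the
  theorem may not depend on m and Np.\<close>

lemma a_ge_general: "(1 - Re powr (-3/2)) / 8 <= a"
proof -
 have "Re powr (-3/2) = real m / real Np"
 proof -
  have "Re = (q / p) powr 2" using q_powr(1) p_powr(1) by (simp add: Re_eq power_divide)
  hence "Re powr (-3/2) = (q / p) powr (-3)" by (simp add: powr_powr)
  also have "... = p ^ 3 / q ^ 3" using q_powr(1) p_powr(1) by (simp add: powr_minus_divide power_divide)
  finally show ?thesis by (simp only: p_powr(2) q_powr(2))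
 qed
 hence e: "(1 - Re powr (-3/2)) / 8 = (real Np - real m) / (8 * real Np)"
  using real_Np_pos by (simp only: diff_divide_distrib) simp
 show ?thesis unfolding e a_def by (rule sum_minus_third_ge_length[OF m1 less_imp_le[OF mN] Np(1)])
qed

lemma Re_rpowr_less_1: "Re powr (-3/2) < 1"
 using powr_less_mono[of "-3/2" 0 Re] Re_pos by simp

lemma g_cubed: "(Re powr \<gamma>) powr (9/4) = g ^ 3"
 unfolding g_def using Re_pos by (simp add: powr_power)

text \<open>The number 2 (7/10) (121/100) / 1.016 is just above 3375/2048, and the threshold 1.005
  keeps g^3 below 1.016.\<close>

lemma low_constant:
 assumes "Re >= 400" "Re powr \<gamma> <= 1.005"
 shows "3375 / 2048 <= 2 * (a / q^2) * (b * p)^2 / g ^ 3"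
proof -
 have q0: "q > 0" by (rule q_powr(1))
 have "g ^ 3 <= (1.005 :: real) powr (9/4)"
  unfolding g_cubed[symmetric] using assms Re_pos by (intro powr_mono2) auto
 also have "... <= 1.005 powr 3" by (intro powr_mono) auto
 also have "... <= 1.016" by (simp add: power3_eq_cube)
 finally have g3: "g ^ 3 <= 1.016" .
 have "7/10 <= a / q^2" using a_lower[OF assms(1)] q0 by (simp add: pos_le_divide_eq)
 moreover have "(11/10)^2 <= (b * p)^2" using b_lower[OF assms(1)] by (intro power_mono) auto
 ultimately have "2 * (7/10) * (11/10)^2 <= 2 * (a / q^2) * (b * p)^2"
  by (intro mult_mono) (use less_imp_le[OF a_pos] in auto)
 hence "2 * (7/10) * (11/10)^2 / 1.016 <= 2 * (a / q^2) * (b * p)^2 / g ^ 3"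
  using g3 g_pos less_imp_le[OF a_pos] by (intro frac_le mult_nonneg_nonneg divide_nonneg_nonneg) auto
 thus ?thesis by (simp add: power2_eq_square)
qed

text \<open>By \<open>a_lower\<close> the sum a is comparable to q^2 >= Re, so its cube exceeds Re
  with room to spare and g^3 alone is enough as a factor.\<close>

lemma large_Re_constant:
 assumes "Re >= 400" shows "Re * g ^ 3 * (3375 / 16384) <= g ^ 3 * a ^ 3"
proof -
 have q1: "1 <= q" using p_ge_1 p_less_q by simp
 have "Re <= q^2" unfolding Re_eq using p_ge_1 q_powr(1) by (simp add: divide_le_eq power_mono[of 1 p 2, simplified])
 also have "... <= (q^2) ^ 3" using q1 by (intro self_le_power) auto
 finally have "Re * (3375 / 16384) <= (7/10) ^ 3 * (q^2) ^ 3" using Re_pos by (simp add: power3_eq_cube)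
 also have "... = (7/10 * q^2) ^ 3" by (simp only: power_mult_distrib)
 also have "... <= a ^ 3" using a_lower[OF assms] by (intro power_mono) auto
 finally have "g ^ 3 * (Re * (3375 / 16384)) <= g ^ 3 * a ^ 3" using g_pos by (intro mult_left_mono) auto
 thus ?thesis by (simp add: mult_ac)
qed

text \<open>The factor (8 / (1 - Re^(-3/2)))^3 cancels the crude lower bound on a^3. It blows up as
  Re tends to 1, but it is a function of Re and serves only for Re < 400.\<close>

lemma small_Re_constant:
 "Re * g ^ 3 * (3375 / 16384) <= g ^ 3 * (3375 / 16384 * Re * (8 / (1 - Re powr (-3/2))) ^ 3) * a ^ 3"
proof -
 define t where "t = 1 - Re powr (-3/2)"
 have t: "t > 0" using Re_rpowr_less_1 by (simp add: t_def)
 have "t / 8 <= a" unfolding t_def by (rule a_ge_general)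
 hence "1 <= 8 / t * a" using t by (simp add: field_simps)
 hence "1 <= (8 / t * a) ^ 3" by (rule one_le_power)
 hence "1 <= (8 / t) ^ 3 * a ^ 3" by (simp only: power_mult_distrib)
 hence "(Re * g ^ 3 * (3375 / 16384)) * 1 <= (Re * g ^ 3 * (3375 / 16384)) * ((8 / t) ^ 3 * a ^ 3)"
  using Re_pos g_pos by (intro mult_left_mono) auto
 thus ?thesis by (simp only: t_def mult_1_right mult_ac)
qed

end

section \<open>The asymptotic regime and the conclusion\<close>

lemma asymptotic_regime_powr: "((%(R, g). R powr g) \<longlongrightarrow> 1) asymptotic_regime"
 unfolding asymptotic_regime_def by (rule filterlim_mono[OF filterlim_filtercomap order_refl inf_le2])

lemma asymptotic_regime_large: "eventually (%(R, g). C <= R) asymptotic_regime"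
proof -
 have "eventually (%p. C <= fst p) (filtercomap fst at_top :: (real \<times> real) filter)"
  by (intro eventually_filtercomapI eventually_ge_at_top)
 thus ?thesis unfolding asymptotic_regime_def
  by (rule filter_leD[OF inf_le1, THEN eventually_mono]) auto
qed

theorem theorem15:
  shows "\<exists>C1 C2 C3 C4 :: real \<Rightarrow> real \<Rightarrow> real.
    (\<forall>C\<in>{C1, C2, C3, C4}. ((\<lambda>(R, g). C R g) \<longlongrightarrow> 1) asymptotic_regime) \<and>
    (\<forall>(L::real) (\<nu>::real) (T0::real) (T1::real) (c::real) (u :: real \<Rightarrow> real^3 \<Rightarrow> real^3)
      (Km::real) (Kp::real) (Re::real) (\<gamma>::real) (T::real).
      L > 0 \<and> \<nu> > 0 \<and> 0 \<le> T0 \<and> T0 < T1 \<and>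
      K41_function L T0 T1 c u \<and>
      inertial_range L T0 T1 c u Km Kp \<and>
      (\<forall>K \<in> Sigma_star L \<inter> {Km..Kp}. mean_spectrum L T0 T1 u K > 0) \<and>
      Re = reynolds Km Kp \<and>
      \<gamma> = slope_defect L T0 T1 u Km Kp \<and>
      T = time_scale L \<nu> T0 T1 u Kp \<and>
      leray_solution L \<nu> T0 u \<and>
      (LINT x|torus L. rho L *\<^sub>R u T0 x) = 0
      \<longrightarrow>
        3375 / 2048 * C1 Re \<gamma> * Re * T \<le> T1 - T0 \<and>
        T1 - T0 \<le> 128 * C2 Re \<gamma> / (3375 * pi ^ 4) * (1 / (Re * T))
                     * (vol_torus L powr (4/3) / \<nu>\<^sup>2) \<and>
        (let Cn = shell_ratio ((L * Km / (2 * pi))\<^sup>2) in Cn < 1 \<longrightarrow>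
           3375 / 2048 * C3 Re \<gamma>
             \<le> (time_avg T0 T1 (energy L u) / energy L u T0)\<^sup>2 * ((T1 - T0) / (Re * T)) \<and>
           (time_avg T0 T1 (energy L u) / energy L u T0)\<^sup>2 * ((T1 - T0) / (Re * T))
             \<le> 864 * C4 Re \<gamma> / (1 - Cn)\<^sup>2))"
proof -
 \<comment> \<open>Outside of the regime the value 0 makes the lower bounds trivial, as the bounded
   quantities are nonnegative. The same function serves as \<open>C3\<close>.\<close>
 define C1 where "C1 R g = (if R >= 400 & R powr g <= 1.005 then 1 else 0 :: real)" for R g :: real
 \<comment> \<open>9/4 = 3 * 3/4, so this is the cube of the deviation \<open>g\<close>.\<close>
 define C4 where "C4 R g = (R powr g) powr (9/4)" for R g :: real
 \<comment> \<open>Agrees with \<open>C4\<close> from Re = 400 on, which decides the limit; below,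
   the extra factor keeps the upper bound valid.\<close>
 define C2 where "C2 R g = C4 R g * (if R >= 400 then 1 else 3375 / 16384 * R * (8 / (1 - R powr (-3/2))) ^ 3)" for R g :: real
 have lim4: "((%(R, g). C4 R g) \<longlongrightarrow> 1) asymptotic_regime"
  using tendsto_powr[OF asymptotic_regime_powr tendsto_const, of "9/4"] by (simp add: C4_def case_prod_unfold)
 have lim2: "((%(R, g). C2 R g) \<longlongrightarrow> 1) asymptotic_regime"
 proof (rule Lim_transform_eventually[OF lim4])
  show "eventually (%p. (case p of (R, g) => C4 R g) = (case p of (R, g) => C2 R g)) asymptotic_regime"
  using asymptotic_regime_large[of 400] by eventually_elim (auto simp: C2_def)
 qed
 have lim1: "((%(R, g). C1 R g) \<longlongrightarrow> 1) asymptotic_regime"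
 proof (rule tendsto_eventually)
  have "eventually (%p. (case p of (R, g) => R powr g) < 1.005) asymptotic_regime"
  by (rule order_tendstoD(2)[OF asymptotic_regime_powr]) simp
  thus "eventually (%p. (case p of (R, g) => C1 R g) = 1) asymptotic_regime"
  using asymptotic_regime_large[of 400] by eventually_elim (auto simp: C1_def)
 qed
 show ?thesis
 proof (rule exI[of _ C1], rule exI[of _ C2], rule exI[of _ C1], rule exI[of _ C4], intro conjI allI impI)
  show "ALL C:{C1, C2, C1, C4}. ((%(R, g). C R g) \<longlongrightarrow> 1) asymptotic_regime" using lim1 lim2 lim4 by simp
 next
  fix L \<nu> T0 T1 c :: real and u :: "real => real^3 => real^3" and Km Kp Re \<gamma> T :: real
  assume as: "L > 0 & \<nu> > 0 & 0 <= T0 & T0 < T1 &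
  K41_function L T0 T1 c u &
  inertial_range L T0 T1 c u Km Kp &
  (ALL K:Sigma_star L \<inter> {Km..Kp}. mean_spectrum L T0 T1 u K > 0) &
  Re = reynolds Km Kp &
  \<gamma> = slope_defect L T0 T1 u Km Kp &
  T = time_scale L \<nu> T0 T1 u Kp &
  leray_solution L \<nu> T0 u &
  (LINT x|torus L. rho L *\<^sub>R u T0 x) = 0"
  interpret F: k41_flow L \<nu> T0 T1 u c Km Kp
  using as by unfold_locales auto
  have eqs: "Re = F.Re" "\<gamma> = F.\<gamma>" "T = F.T" "T1 - T0 = F.D" "energy L u T0 = F.E0"
  using as by (auto simp: F.Re_def F.\<gamma>_def F.T_def F.D_def F.E0_def)
  let ?R = "(time_avg T0 T1 (energy L u) / F.E0)^2 * (F.D / (F.Re * F.T))"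
  have RT: "F.Re * F.T > 0" using F.Re_pos F.T_pos by simp
  have R0: "0 <= ?R" using RT F.D_pos by simp
  have low: "3375 / 2048 * C1 F.Re F.\<gamma> <= ?R"
  proof (cases "F.Re >= 400 & F.Re powr F.\<gamma> <= 1.005")
  case True
  thus ?thesis using order_trans[OF F.low_constant F.ratio_lower] by (simp add: C1_def)
  next
  case False
  hence "C1 F.Re F.\<gamma> = 0" by (auto simp: C1_def)
  thus ?thesis using R0 by simp
  qed
  have C4: "C4 F.Re F.\<gamma> = F.g ^ 3" by (simp add: C4_def F.g_cubed)
  show "3375 / 2048 * C1 Re \<gamma> * Re * T <= T1 - T0"
  proof -
  \<comment> \<open>The mean energy is at most the initial energy, so the lower bound on the
    duration follows from the lower bound on the ratio.\<close>
  have "(time_avg T0 T1 (energy L u) / F.E0)^2 <= 1"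
  using F.mean_energy_pos F.mean_energy_le_E0 F.E0_pos by (intro power_le_one) auto
  hence "?R <= 1 * (F.D / (F.Re * F.T))" using RT F.D_pos by (intro mult_right_mono) auto
  from order_trans[OF low this] have "3375 / 2048 * C1 F.Re F.\<gamma> <= F.D / (F.Re * F.T)" by (simp only: mult_1_left)
  hence "3375 / 2048 * C1 F.Re F.\<gamma> * (F.Re * F.T) <= F.D" using RT by (simp only: pos_le_divide_eq)
  thus ?thesis unfolding eqs by (simp only: mult.assoc)
  qed
  show "T1 - T0 <= 128 * C2 Re \<gamma> / (3375 * pi ^ 4) * (1 / (Re * T)) * (vol_torus L powr (4/3) / \<nu>\<^sup>2)"
  unfolding eqs
  proof (rule F.duration_upper)
  show "F.Re * F.g ^ 3 * (3375 / 16384) <= C2 F.Re F.\<gamma> * F.a ^ 3"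
  proof (cases "F.Re >= 400")
  case True
  thus ?thesis using F.large_Re_constant by (simp only: C2_def C4 if_True mult_1_right)
  next
  case False
  thus ?thesis using F.small_Re_constant by (simp only: C2_def C4 if_False)
  qed
  qed
  show "let Cn = shell_ratio ((L * Km / (2 * pi))^2) in Cn < 1 -->
  3375 / 2048 * C1 Re \<gamma>
  <= (time_avg T0 T1 (energy L u) / energy L u T0)^2 * ((T1 - T0) / (Re * T)) &
  (time_avg T0 T1 (energy L u) / energy L u T0)\<^sup>2 * ((T1 - T0) / (Re * T))
  <= 864 * C4 Re \<gamma> / (1 - Cn)^2"
  unfolding Let_def eqs
  proof (intro impI conjI low)
  define Cn where "Cn = shell_ratio ((L * Km / (2 * pi))^2)"
  assume "shell_ratio ((L * Km / (2 * pi))^2) < 1"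
  hence Cn: "0 <= Cn" "Cn < 1" by (auto simp: Cn_def shell_ratio_def)
  \<comment> \<open>Dividing by a number in (0, 1] only enlarges the bound from
    \<open>ratio_upper\<close>.\<close>
  hence "(1 - Cn)^2 <= 1" "0 < (1 - Cn)^2" by (auto intro: power_le_one)
  hence "864 * F.g ^ 3 <= 864 * F.g ^ 3 / (1 - Cn)^2"
  using F.g_pos by (simp add: pos_le_divide_eq mult_left_le)
  thus "?R <= 864 * C4 F.Re F.\<gamma> / (1 - shell_ratio ((L * Km / (2 * pi))^2))^2"
  using F.ratio_upper unfolding C4 Cn_def by linarith
  qed
 qed
qed

end
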